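(* For $n\ge2$, $\gamma>0$ and $r\in(0,\infty)$, let $Z_0$ be the zero cell of the Poisson hyperplane process in $\mathbb{R}^n$ with intensity $\gamma$ and distance exponent $r$. Let $r=an$ with fixed $a\in(0,\infty)$, let $k\in\mathbb{N}$, and put \[ B(a)= \frac{2\pi e(a+1)^{\frac{a+1}{a}}}{a}. \] Then there are constants $c,C>0$, depending on $a$ and $k$ but not on $n$ or $\gamma$, such that for all $n\ge 2$ and $\gamma>0$ \[ c \,\gamma^{-\frac{k}{a}}\, n^{\frac{k}{a}-\frac{k}{2}} \left(\frac{B(a)}{n}\right)^{\frac{kn}{2}} \leq \mathbb{E}[V_n(Z_0)^k] \leq C \,\gamma^{-\frac{k}{a}}\, n^{\frac{k}{a}-\frac{k}{2}} \left(\frac{B(a)}{n}\right)^{\frac{kn}{2}}, \] and there are constants $c,C>0$, depending on $a$ but not on $n$ or $\gamma$, such that for all $n\ge 2$ and $\gamma>0$ \[ c \left[\frac{4(a+1)^{a+1}}{(a+2)^{a+2}}\right]^{\frac{n}{2}} \gamma^{-\frac{2}{a}}\, n^{\frac{2}{a}-\frac{3}{2}} \left(\frac{B(a)}{n}\right)^{n} \leq \operatorname{Var}[V_n(Z_0)] \leq C \left[\frac{4(a+1)^{a+1}}{(a+2)^{a+2}}\right]^{\frac{n}{2}} \gamma^{-\frac{2}{a}}\, n^{\frac{2}{a}-\frac{3}{2}} \left(\frac{B(a)}{n}\right)^{n}. \] Hence, if the intensity $\gamma$ is constant and $r=an$, then $\mathbb{E}[V_n(Z_0)^k]$ and $\operatorname{Var}[V_n(Z_0)]$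 converge to zero as $n\to\infty$.
   Context: $V_n$ denotes $n$-dimensional volume, $S^{n-1}$ the unit sphere of $\mathbb{R}^n$, $\mathcal{H}^{n-1}$ the $(n-1)$-dimensional Hausdorff measure, $\kappa_n=\pi^{n/2}/\Gamma(\frac n2+1)$ the volume of the unit ball of $\mathbb{R}^n$. For $u\in S^{n-1}$, $t\ge 0$ let $H(u,t)=\{x\in\mathbb{R}^n:\langle x,u\rangle=t\}$. $A(n,n-1)$ is the space of affine hyperplanes of $\mathbb{R}^n$ with its standard topology and Borel $\sigma$-algebra. The Poisson hyperplane process $X$ in $\mathbb{R}^n$ with intensity $\gamma>0$ and distance exponent $r>0$ is the Poisson point process on $A(n,n-1)$ whose intensity measure $\Theta(\cdot)=\mathbb{E}X(\cdot)$ is \[ \Theta(\cdot)=\frac{2\gamma}{n\kappa_n}\int_{S^{n-1}}\int_0^\infty \mathbf{1}\{H(u,t)\in\cdot\}\,t^{r-1}\,dt\,\mathcal{H}^{n-1}(du). \] The zero cell is $Z_0=\bigcap_{H\in X}H^-$, where $H^-$ is the (almost surely unique) closed half-space bounded by $H$ that contains the origin. In the formula for $B(a)$, $e$ is Euler's number. *)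

theory Defs
  imports "HOL-Probability.Probability"
begin

section \<open>Euclidean space of variable dimension\<close>

text \<open>
  The dimension \<open>n\<close> is quantified inside the statement, so \<open>\<real>\<^sup>n\<close> is the carrier of the product
  \<open>\<Pi>\<^sub>M i\<in>{..<n}. lborel\<close>, i.e. the set of extensional functions on \<open>{..<n}\<close>.
\<close>

definition euclid :: "nat \<Rightarrow> (nat \<Rightarrow> real) set" where
  "euclid n = {..<n} \<rightarrow>\<^sub>E UNIV"

definition euclid_origin :: "nat \<Rightarrow> nat \<Rightarrow> real" where
  "euclid_origin n = (\<lambda>i\<in>{..<n}. 0)"

definition euclid_inner :: "nat \<Rightarrow> (nat \<Rightarrow> real) \<Rightarrow> (nat \<Rightarrow> real) \<Rightarrow> real" where
  "euclid_inner n x y = (\<Sum>i<n. x i * y i)"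

definition euclid_dist :: "nat \<Rightarrow> (nat \<Rightarrow> real) \<Rightarrow> (nat \<Rightarrow> real) \<Rightarrow> real" where
  "euclid_dist n x y = L2_set (\<lambda>i. x i - y i) {..<n}"

definition euclid_sphere :: "nat \<Rightarrow> (nat \<Rightarrow> real) set" where
  "euclid_sphere n = {u \<in> euclid n. L2_set u {..<n} = 1}"

definition euclid_topology :: "nat \<Rightarrow> (nat \<Rightarrow> real) topology" where
  "euclid_topology n = product_topology (\<lambda>_. euclideanreal) {..<n}"

definition euclid_lborel :: "nat \<Rightarrow> (nat \<Rightarrow> real) measure" where
  "euclid_lborel n = (\<Pi>\<^sub>M i\<in>{..<n}. lborel)"


section \<open>Hausdorff measure\<close>

definition euclid_ediam :: "nat \<Rightarrow> (nat \<Rightarrow> real) set \<Rightarrow> ennreal" where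
  "euclid_ediam n A = (SUP x\<in>A. SUP y\<in>A. ennreal (euclid_dist n x y))"

text \<open>
  The factor \<open>unit_ball_vol s / 2 ^ s\<close> is the usual normalisation, for which the
  \<open>n\<close>-dimensional Hausdorff measure on \<open>\<real>\<^sup>n\<close> is Lebesgue measure. The case distinction makes the
  empty set contribute nothing also for \<open>s = 0\<close>.
\<close>

definition hausdorff_premeasure ::
    "nat \<Rightarrow> nat \<Rightarrow> ennreal \<Rightarrow> (nat \<Rightarrow> real) set \<Rightarrow> ennreal" where
  "hausdorff_premeasure n s \<delta> A =
    (INF U \<in> {U :: nat \<Rightarrow> (nat \<Rightarrow> real) set.
        A \<subseteq> (\<Union>i. U i) \<and> (\<forall>i. U i \<subseteq> euclid n \<and> euclid_ediam n (U i) \<le> \<delta>)}.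
      \<Sum>i. if U i = {} then 0
          else ennreal (unit_ball_vol (real s) / 2 ^ s) * euclid_ediam n (U i) ^ s)"

definition hausdorff_outer :: "nat \<Rightarrow> nat \<Rightarrow> (nat \<Rightarrow> real) set \<Rightarrow> ennreal" where
  "hausdorff_outer n s A = (SUP \<delta>\<in>{0<..}. hausdorff_premeasure n s \<delta> A)"

definition hausdorff_measure :: "nat \<Rightarrow> nat \<Rightarrow> (nat \<Rightarrow> real) measure" where
  "hausdorff_measure n s =
    measure_of (euclid n) (sets (\<Pi>\<^sub>M i\<in>{..<n}. borel)) (hausdorff_outer n s)"


section \<open>The space of affine hyperplanes\<close>

definition hyperplane :: "nat \<Rightarrow> (nat \<Rightarrow> real) \<Rightarrow> real \<Rightarrow> (nat \<Rightarrow> real) set" where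
  "hyperplane n u t = {x \<in> euclid n. euclid_inner n x u = t}"

definition hyperplanes :: "nat \<Rightarrow> (nat \<Rightarrow> real) set set" where
  "hyperplanes n = {hyperplane n u t | u t. u \<in> euclid_sphere n}"

text \<open>
  The finest topology for which \<open>(u, t) \<mapsto> hyperplane n u t\<close> is continuous on
  \<open>S\<^sup>n\<^sup>-\<^sup>1 \<times> \<real>\<close>.
\<close>

definition hyperplane_topology :: "nat \<Rightarrow> (nat \<Rightarrow> real) set topology" where
  "hyperplane_topology n = topology (\<lambda>U. U \<subseteq> hyperplanes n \<and>
    openin (prod_topology (subtopology (euclid_topology n) (euclid_sphere n)) euclideanreal)
      {(u, t). u \<in> euclid_sphere n \<and> hyperplane n u t \<in> U})"

lemma openin_hyperplane_topology:
  "openin (hyperplane_topology n) U \<longleftrightarrow> U \<subseteq> hyperplanes n \<and>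
    openin (prod_topology (subtopology (euclid_topology n) (euclid_sphere n)) euclideanreal)
      {(u, t). u \<in> euclid_sphere n \<and> hyperplane n u t \<in> U}"
proof -
  let ?P = "prod_topology (subtopology (euclid_topology n) (euclid_sphere n)) euclideanreal"
  let ?V = "\<lambda>U. {(u, t). u \<in> euclid_sphere n \<and> hyperplane n u t \<in> U}"
  have "istopology (\<lambda>U. U \<subseteq> hyperplanes n \<and> openin ?P (?V U))"
    unfolding istopology_def
  proof (intro conjI allI impI)
    fix S T
    assume S: "S \<subseteq> hyperplanes n \<and> openin ?P (?V S)" and T: "T \<subseteq> hyperplanes n \<and> openin ?P (?V T)"
    show "S \<inter> T \<subseteq> hyperplanes n" using S by blast
    have "?V (S \<inter> T) = ?V S \<inter> ?V T" by auto
    then show "openin ?P (?V (S \<inter> T))" using S T by (simp add: openin_Int)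
  next
    fix K :: "(nat \<Rightarrow> real) set set set"
    assume K: "\<forall>S\<in>K. S \<subseteq> hyperplanes n \<and> openin ?P (?V S)"
    show "\<Union> K \<subseteq> hyperplanes n" using K by blast
    have "?V (\<Union> K) = (\<Union>S\<in>K. ?V S)" by auto
    then show "openin ?P (?V (\<Union> K))" using K by (auto intro!: openin_Union)
  qed
  then show ?thesis
    unfolding hyperplane_topology_def by (simp add: topology_inverse')
qed

definition topology_borel :: "'a topology \<Rightarrow> 'a measure" where
  "topology_borel T = sigma (topspace T) {U. openin T U}"


section \<open>Poisson point processes\<close>

text \<open>
  A point process is identified with its random locally finite set of points; the random counting
  measure is \<open>A \<mapsto> point_count X A \<omega>\<close>.
\<close>

definition point_count :: "('w \<Rightarrow> 'a set) \<Rightarrow> 'a set \<Rightarrow> 'w \<Rightarrow> ennreal" where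
  "point_count X A \<omega> = emeasure (count_space UNIV) (X \<omega> \<inter> A)"

definition point_process :: "'w measure \<Rightarrow> 'a topology \<Rightarrow> ('w \<Rightarrow> 'a set) \<Rightarrow> bool" where
  "point_process M T X \<longleftrightarrow>
    prob_space M \<and>
    (\<forall>\<omega>\<in>space M. X \<omega> \<subseteq> topspace T \<and> (\<forall>C. compactin T C \<longrightarrow> finite (X \<omega> \<inter> C))) \<and>
    (\<forall>A\<in>sets (topology_borel T). point_count X A \<in> borel_measurable M)"

definition poisson_process ::
    "'w measure \<Rightarrow> 'a topology \<Rightarrow> 'a measure \<Rightarrow> ('w \<Rightarrow> 'a set) \<Rightarrow> bool" where
  "poisson_process M T \<Theta> X \<longleftrightarrow>
    point_process M T X \<and>
    (\<forall>A\<in>sets (topology_borel T). emeasure \<Theta> A < \<infinity> \<longrightarrow>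
      (\<forall>k::nat. measure M {\<omega>\<in>space M. point_count X A \<omega> = of_nat k} =
        exp (- measure \<Theta> A) * measure \<Theta> A ^ k / fact k)) \<and>
    (\<forall>(I::nat set) A. finite I \<and> A ` I \<subseteq> sets (topology_borel T) \<and> disjoint_family_on A I \<longrightarrow>
      prob_space.indep_vars M (\<lambda>_. borel) (\<lambda>i. point_count X (A i)) I)"


section \<open>The Poisson hyperplane process and its zero cell\<close>

definition hyperplane_intensity :: "nat \<Rightarrow> real \<Rightarrow> real \<Rightarrow> (nat \<Rightarrow> real) set measure" where
  "hyperplane_intensity n \<gamma> r =
    measure_of (hyperplanes n) (sets (topology_borel (hyperplane_topology n)))
      (\<lambda>A. ennreal (2 * \<gamma> / (real n * unit_ball_vol (real n))) *
        (\<integral>\<^sup>+u\<in>euclid_sphere n.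
          (\<integral>\<^sup>+t\<in>{0..}. indicator A (hyperplane n u t) * ennreal (t powr (r - 1)) \<partial>lborel)
        \<partial>hausdorff_measure n (n - 1)))"

definition poisson_hyperplane_process ::
    "'w measure \<Rightarrow> nat \<Rightarrow> real \<Rightarrow> real \<Rightarrow> ('w \<Rightarrow> (nat \<Rightarrow> real) set set) \<Rightarrow> bool" where
  "poisson_hyperplane_process M n \<gamma> r X \<longleftrightarrow>
    poisson_process M (hyperplane_topology n) (hyperplane_intensity n \<gamma> r) X"

definition closed_halfspaces :: "nat \<Rightarrow> (nat \<Rightarrow> real) set \<Rightarrow> (nat \<Rightarrow> real) set set" where
  "closed_halfspaces n H =
    {{x \<in> euclid n. euclid_inner n x u \<le> t} | u t. u \<in> euclid_sphere n \<and> H = hyperplane n u t}"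

text \<open>
  A hyperplane through the origin bounds two closed half-spaces containing the origin. On this null
  event both of them enter the intersection; elsewhere there is exactly one for each hyperplane.
\<close>

definition zero_cell :: "nat \<Rightarrow> (nat \<Rightarrow> real) set set \<Rightarrow> (nat \<Rightarrow> real) set" where
  "zero_cell n \<H> =
    euclid n \<inter> \<Inter> {h. \<exists>H\<in>\<H>. h \<in> closed_halfspaces n H \<and> euclid_origin n \<in> h}"

text \<open>Moments are taken in \<open>[0, \<infinity>]\<close>, so that their finiteness is not presupposed.\<close>

definition zero_cell_moment ::
    "'w measure \<Rightarrow> nat \<Rightarrow> ('w \<Rightarrow> (nat \<Rightarrow> real) set set) \<Rightarrow> nat \<Rightarrow> ennreal" where
  "zero_cell_moment M n X k = (\<integral>\<^sup>+\<omega>. emeasure (euclid_lborel n) (zero_cell n (X \<omega>)) ^ k \<partial>M)"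

definition zero_cell_variance ::
    "'w measure \<Rightarrow> nat \<Rightarrow> ('w \<Rightarrow> (nat \<Rightarrow> real) set set) \<Rightarrow> real" where
  "zero_cell_variance M n X =
    prob_space.variance M (\<lambda>\<omega>. measure (euclid_lborel n) (zero_cell n (X \<omega>)))"

text \<open>The constant \<open>B(a)\<close>; \<open>exp 1\<close> is Euler's number.\<close>

definition B_const :: "real \<Rightarrow> real" where
  "B_const a = 2 * pi * exp 1 * (a + 1) powr ((a + 1) / a) / a"

end

theory Submission
  imports Defs
begin

text \<open>
  A point \<open>x\<close> lies in the zero cell iff no hyperplane of the process separates it from the origin. Hence
  \<open>P(x \<in> Z) = exp (- \<Phi> x)\<close> with \<open>\<Phi> x = q |x|\<^sup>r\<close> by rotation invariance, and
  \<open>P(x, y \<in> Z) = exp (- \<Phi> x - \<Phi> y + meet x y)\<close>, where \<open>meet x y\<close> is the intensity of the hyperplanes separating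
  both points from the origin. Jensen's inequality bounds the \<open>k\<close>-th moment of the volume from below by
  \<open>(\<integral> exp (- \<Phi>))\<^sup>k\<close> and from above by \<open>(\<integral> exp (- \<Phi> / k))\<^sup>k\<close>; for \<open>r = a n\<close> these agree up to
  \<open>k\<close> to the power \<open>k / a\<close>. The variance is the double integral of
  \<open>exp (- \<Phi> x - \<Phi> y) (exp (meet x y) - 1)\<close>. Because \<open>meet x y \<le> min (\<Phi> x) (\<Phi> y)\<close>, it lies between the integrals of
  \<open>meet x y exp (- \<Phi> x - \<Phi> y)\<close> and \<open>meet x y exp (- max (\<Phi> x) (\<Phi> y))\<close>, which both reduce to the integral of
  \<open>(min x\<^sub>n y\<^sub>n)\<^sup>r\<close> over pairs of points with \<open>x\<^sub>n, y\<^sub>n > 0\<close> of the unit ball, a Beta function up to constants.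

  Only the total mass of the sphere under its Hausdorff measure, up to constants independent of \<open>n\<close>, is needed, and
  rotation invariance replaces integration over the sphere by integration over the ball. The lower bound for the mass
  uses the isodiametric inequality (by Steiner symmetrization) for truncated cones over the covering sets,
  the upper bound uses that suitably averaged caps cover the sphere efficiently.
\<close>

subsection \<open>Lebesgue measure and reflections\<close>

text \<open>After scaling, \<open>q\<close> enters the moments only through powers whose exponents
  depend on \<open>n / r\<close>, which is \<open>1 / a\<close> for \<open>r = a * n\<close>. A
  bounded factor in \<open>q\<close> thus costs a bounded factor in the result, whereas a factor
  exponential in \<open>n\<close> would survive in the final order. This decides how much may be
  lost. For the area of the sphere, comparing a covering set of diameter \<open>d\<close> with a
  ball of radius \<open>d\<close>, or covering by a maximal separated set, costs about
  \<open>2 ^ n\<close>; hence the sharp isodiametric inequality for the lower bound and the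
  averaging for the upper one. The variance tolerates crude steps for the same reason: keeping only
  the points with \<open>\<Phi> \<le> 1\<close> below, and all levels of \<open>\<Phi>\<close>
  above, gives the same expression up to \<open>exp (- 2)\<close> and a Gamma value at
  \<open>2 / a + 2\<close>. The remaining integrals are expressed by Gamma functions and compared by
  Stirling's formula for large \<open>n\<close>; in the finitely many smaller dimensions positivity
  and finiteness are enough.\<close>

abbreviation nrm :: "nat \<Rightarrow> (nat \<Rightarrow> real) \<Rightarrow> real" where
  "nrm n x \<equiv> L2_set x {..<n}"

abbreviation ip :: "nat \<Rightarrow> (nat \<Rightarrow> real) \<Rightarrow> (nat \<Rightarrow> real) \<Rightarrow> real" where
  "ip \<equiv> euclid_inner"

interpretation lborel_PiM: product_sigma_finite "\<lambda>_::nat. lborel :: real measure"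
  by standard

lemma space_euclid_lborel [simp]: "space (euclid_lborel n) = euclid n"
  by (simp add: euclid_lborel_def euclid_def space_PiM)

lemma sets_euclid_lborel [measurable_cong]:
  "sets (euclid_lborel n) = sets (\<Pi>\<^sub>M i\<in>{..<n}. borel)"
  unfolding euclid_lborel_def by (rule sets_PiM_cong) auto

lemma sigma_finite_euclid_lborel: "sigma_finite_measure (euclid_lborel n)"
  unfolding euclid_lborel_def by (rule lborel_PiM.sigma_finite) simp

interpretation euclid_lborel: sigma_finite_measure "euclid_lborel n" for n
  by (rule sigma_finite_euclid_lborel)

interpretation euclid_lborel_pair: pair_sigma_finite "euclid_lborel n" "euclid_lborel m" for n m
  by standard

lemma measurable_PiM_coordinate:
  "(\<lambda>x. x i) \<in> borel_measurable (\<Pi>\<^sub>M i\<in>{..<n}. borel :: real measure)"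
proof (cases "i < n")
  case False
  then show ?thesis
    by (subst measurable_cong[where g="\<lambda>_. undefined"]) (auto simp: space_PiM PiE_def extensional_def)
qed auto

lemma measurable_coordinate [measurable]: "(\<lambda>x. x i) \<in> borel_measurable (euclid_lborel n)"
  using measurable_PiM_coordinate by (simp cong: measurable_cong_sets add: sets_euclid_lborel)

lemma measurable_into_euclid:
  assumes "\<And>i. i < n \<Longrightarrow> (\<lambda>x. f x i) \<in> borel_measurable M" "\<And>x. x \<in> space M \<Longrightarrow> f x \<in> euclid n"
  shows "f \<in> measurable M (euclid_lborel n)"
proof -
  have "(\<lambda>x. \<lambda>i\<in>{..<n}. f x i) \<in> measurable M (\<Pi>\<^sub>M i\<in>{..<n}. borel)"
    using assms(1) by (intro measurable_restrict) auto
  also have "?this \<longleftrightarrow> f \<in> measurable M (\<Pi>\<^sub>M i\<in>{..<n}. borel)"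
    using assms(2) by (intro measurable_cong) (auto simp: euclid_def fun_eq_iff PiE_def extensional_def)
  finally show ?thesis by (simp cong: measurable_cong_sets add: sets_euclid_lborel)
qed

lemma measurable_nrm [measurable (raw)]:
  assumes "\<And>i. i < n \<Longrightarrow> (\<lambda>x. f x i) \<in> borel_measurable M"
  shows "(\<lambda>x. nrm n (f x)) \<in> borel_measurable M"
proof -
  have [measurable]: "(\<lambda>x. \<Sum>i<n. (f x i)\<^sup>2) \<in> borel_measurable M"
    using assms by (intro borel_measurable_sum borel_measurable_power) auto
  show ?thesis unfolding L2_set_def by measurable
qed

lemma measurable_ip [measurable (raw)]:
  assumes "\<And>i. i < n \<Longrightarrow> (\<lambda>x. f x i) \<in> borel_measurable M" "\<And>i. i < n \<Longrightarrow> (\<lambda>x. g x i) \<in> borel_measurable M"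
  shows "(\<lambda>x. ip n (f x) (g x)) \<in> borel_measurable M"
  unfolding euclid_inner_def using assms by (intro borel_measurable_sum borel_measurable_times) auto

lemma restrict_in_euclid [simp]: "restrict f {..<n} \<in> euclid n"
  by (auto simp: euclid_def)

lemma euclid_eqI: "x \<in> euclid n \<Longrightarrow> y \<in> euclid n \<Longrightarrow> (\<And>i. i < n \<Longrightarrow> x i = y i) \<Longrightarrow> x = y"
  by (auto simp: euclid_def intro: PiE_ext)

lemma ip_restrict [simp]:
  "ip n (restrict x {..<n}) y = ip n x y" "ip n x (restrict y {..<n}) = ip n x y"
  by (simp_all add: euclid_inner_def)

lemma nrm_restrict [simp]: "nrm n (restrict x {..<n}) = nrm n x"
  by (simp add: L2_set_def)

lemma nrm_power2: "(nrm n x)\<^sup>2 = ip n x x"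
  unfolding L2_set_def euclid_inner_def
  by (subst real_sqrt_pow2) (auto intro: sum_nonneg simp: power2_eq_square)

lemma ip_commute: "ip n x y = ip n y x"
  by (simp add: euclid_inner_def mult.commute)

lemma ip_linear:
  "ip n (\<lambda>i. c * x i + d * y i) z = c * ip n x z + d * ip n y z"
  "ip n z (\<lambda>i. c * x i + d * y i) = c * ip n z x + d * ip n z y"
  by (simp_all add: euclid_inner_def sum_distrib_left algebra_simps sum.distrib)

lemma ip_diff:
  "ip n (\<lambda>i. x i - y i) z = ip n x z - ip n y z"
  "ip n z (\<lambda>i. x i - y i) = ip n z x - ip n z y"
  by (simp_all add: euclid_inner_def algebra_simps sum_subtractf)

lemma ip_scale [simp]:
  "ip n (\<lambda>i. c * x i) z = c * ip n x z" "ip n z (\<lambda>i. c * x i) = c * ip n z x"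
  by (simp_all add: euclid_inner_def sum_distrib_left algebra_simps)

lemma nrm_scale: "nrm n (\<lambda>i. c * x i) = \<bar>c\<bar> * nrm n x"
  by (simp add: L2_set_def power_mult_distrib sum_distrib_left[symmetric] real_sqrt_mult)

lemma nrm_minus_commute: fixes x y :: "nat \<Rightarrow> real" shows "nrm n (\<lambda>i. x i - y i) = nrm n (\<lambda>i. y i - x i)"
  by (simp add: L2_set_def power2_commute)

lemma nrm_triangle: "nrm n (\<lambda>i. x i - z i) \<le> nrm n (\<lambda>i. x i - y i) + nrm n (\<lambda>i. y i - z i)"
  using L2_set_triangle_ineq[of "\<lambda>i. x i - y i" "\<lambda>i. y i - z i" "{..<n}"] by simp

lemma abs_coord_le_nrm: "i < n \<Longrightarrow> \<bar>x i\<bar> \<le> nrm n x"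
  using member_le_L2_set[of "{..<n}" i "\<lambda>i. \<bar>x i\<bar>"] by (simp add: L2_set_def)

lemma abs_ip_le: "\<bar>ip n x y\<bar> \<le> nrm n x * nrm n y"
proof -
  have "\<bar>ip n x y\<bar> \<le> (\<Sum>i<n. \<bar>x i\<bar> * \<bar>y i\<bar>)"
    unfolding euclid_inner_def by (rule order_trans[OF sum_abs]) (simp add: abs_mult)
  also have "\<dots> \<le> nrm n x * nrm n y" by (rule L2_set_mult_ineq)
  finally show ?thesis .
qed

lemma nrm_diff_power2: "(nrm n (\<lambda>i. x i - y i))\<^sup>2 = (nrm n x)\<^sup>2 - 2 * ip n x y + (nrm n y)\<^sup>2"
  by (simp add: nrm_power2 ip_diff ip_commute)

text \<open>A product measure is determined by its values on boxes, and on a box the claim splits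
  into one-dimensional affine substitutions, each contributing a factor
  \<open>\<bar>s\<bar>\<close>.\<close>

lemma nn_integral_euclid_affine:
  assumes s: "s \<noteq> 0" and f [measurable]: "f \<in> borel_measurable (euclid_lborel n)"
  shows "(\<integral>\<^sup>+x. f x \<partial>euclid_lborel n) =
    ennreal (\<bar>s\<bar> ^ n) * (\<integral>\<^sup>+x. f (\<lambda>i\<in>{..<n}. z i + s * x i) \<partial>euclid_lborel n)"
proof -
  let ?T = "\<lambda>x. \<lambda>i\<in>{..<n}. z i + s * x i :: real"
  let ?D = "density (distr (euclid_lborel n) (euclid_lborel n) ?T) (\<lambda>_. ennreal (\<bar>s\<bar> ^ n))"
  have T [measurable]: "?T \<in> measurable (euclid_lborel n) (euclid_lborel n)"
    by measurable
  have "?D = Pi\<^sub>M {..<n} (\<lambda>_. lborel)"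
  proof (rule lborel_PiM.PiM_eqI)
    show "sets ?D = sets (\<Pi>\<^sub>M i\<in>{..<n}. lborel)" by (simp add: euclid_lborel_def)
    fix A :: "nat \<Rightarrow> real set" assume A: "\<And>i. i \<in> {..<n} \<Longrightarrow> A i \<in> sets lborel"
    have PA: "Pi\<^sub>E {..<n} A \<in> sets (euclid_lborel n)"
      unfolding euclid_lborel_def using A by (intro sets_PiM_I_finite) auto
    have vim: "?T -` Pi\<^sub>E {..<n} A \<inter> space (euclid_lborel n) = Pi\<^sub>E {..<n} (\<lambda>i. (\<lambda>x. z i + s * x) -` A i)"
      by (auto simp: euclid_def PiE_def Pi_def extensional_def)
    have vA: "(\<lambda>x. z i + s * x) -` A i \<in> sets lborel" if "i < n" for i
    proof -
      have "(\<lambda>x. z i + s * x) \<in> borel_measurable borel" by measurable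
      from measurable_sets[OF this, of "A i"] A that show ?thesis by simp
    qed
    have 1: "emeasure lborel (A i) = ennreal \<bar>s\<bar> * emeasure lborel ((\<lambda>x. z i + s * x) -` A i)" if "i < n" for i
    proof -
      have [measurable]: "A i \<in> sets borel" using A that by auto
      have "emeasure lborel (A i) = (\<integral>\<^sup>+x. indicator (A i) x \<partial>lborel)" by simp
      also have "\<dots> = ennreal \<bar>s\<bar> * (\<integral>\<^sup>+x. indicator (A i) (z i + s * x) \<partial>lborel)"
        by (rule nn_integral_real_affine[OF _ s]) measurable
      also have "(\<integral>\<^sup>+x. indicator (A i) (z i + s * x) \<partial>lborel) = (\<integral>\<^sup>+x. indicator ((\<lambda>x. z i + s * x) -` A i) x \<partial>lborel)"
        by (intro nn_integral_cong) (auto simp: indicator_def)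
      also have "\<dots> = emeasure lborel ((\<lambda>x. z i + s * x) -` A i)" using vA[OF that] by simp
      finally show ?thesis .
    qed
    have "emeasure ?D (Pi\<^sub>E {..<n} A) = ennreal (\<bar>s\<bar> ^ n) * emeasure (distr (euclid_lborel n) (euclid_lborel n) ?T) (Pi\<^sub>E {..<n} A)"
      using PA by (subst emeasure_density_const) auto
    also have "\<dots> = ennreal (\<bar>s\<bar> ^ n) * emeasure (euclid_lborel n) (Pi\<^sub>E {..<n} (\<lambda>i. (\<lambda>x. z i + s * x) -` A i))"
      by (subst emeasure_distr[OF T PA]) (simp only: vim)
    also have "emeasure (euclid_lborel n) (Pi\<^sub>E {..<n} (\<lambda>i. (\<lambda>x. z i + s * x) -` A i)) =
        (\<Prod>i<n. emeasure lborel ((\<lambda>x. z i + s * x) -` A i))"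
      unfolding euclid_lborel_def using vA by (subst lborel_PiM.emeasure_PiM) auto
    also have "ennreal (\<bar>s\<bar> ^ n) * \<dots> = (\<Prod>i<n. ennreal \<bar>s\<bar> * emeasure lborel ((\<lambda>x. z i + s * x) -` A i))"
      by (simp add: prod.distrib ennreal_power)
    also have "\<dots> = (\<Prod>i<n. emeasure lborel (A i))" by (intro prod.cong) (auto simp: 1)
    finally show "emeasure ?D (Pi\<^sub>E {..<n} A) = (\<Prod>i<n. emeasure lborel (A i))" .
  qed simp
  then have D: "euclid_lborel n = ?D" by (simp add: euclid_lborel_def)
  show ?thesis
    by (subst D) (simp add: nn_integral_density nn_integral_distr nn_integral_cmult)
qed

lemma nn_integral_euclid_translate:
  assumes "f \<in> borel_measurable (euclid_lborel n)"
  shows "(\<integral>\<^sup>+x. f (\<lambda>i\<in>{..<n}. x i + z i) \<partial>euclid_lborel n) = (\<integral>\<^sup>+x. f x \<partial>euclid_lborel n)"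
  using nn_integral_euclid_affine[of 1 f n z] assms by (simp add: add.commute)

lemma emeasure_euclid_ball:
  assumes "r \<ge> 0"
  shows "emeasure (euclid_lborel n) {x \<in> euclid n. nrm n x \<le> r} = ennreal (unit_ball_vol (real n) * r ^ n)"
proof (cases "r = 0")
  case False
  have "emeasure (Pi\<^sub>M {..<n} (\<lambda>_. lborel)) ({f. sqrt (\<Sum>i\<in>{..<n}. (f i)\<^sup>2) \<le> r} \<inter> space (Pi\<^sub>M {..<n} (\<lambda>_. lborel))) =
     ennreal (unit_ball_vol (real n) * r ^ n)"
    using emeasure_cball_aux[of "{..<n}" r] assms False by simp
  also have "{f. sqrt (\<Sum>i\<in>{..<n}. (f i)\<^sup>2) \<le> r} \<inter> space (Pi\<^sub>M {..<n} (\<lambda>_. lborel)) = {x \<in> euclid n. nrm n x \<le> r}"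
    by (auto simp: L2_set_def euclid_def space_PiM)
  finally show ?thesis by (simp add: euclid_lborel_def)
next
  case True
  have eq: "{x \<in> euclid n. nrm n x \<le> r} = Pi\<^sub>E {..<n} (\<lambda>_. {0})"
  proof -
    have "nrm n x \<le> 0 \<longleftrightarrow> (\<forall>i<n. x i = 0)" for x
      using L2_set_eq_0_iff[of "{..<n}" x] L2_set_nonneg[of x "{..<n}"] by (auto simp: order_antisym_conv)
    then show ?thesis using True by (auto simp: euclid_def PiE_iff fun_eq_iff extensional_def)
  qed
  \<comment> \<open>For \<open>n = 0\<close> the space is a single point of measure 1, in agreement
    with \<open>0 ^ 0 = 1\<close>.\<close>
  show ?thesis
    unfolding eq euclid_lborel_def using True
    by (subst lborel_PiM.emeasure_PiM) (auto simp: power_0_left)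
qed

lemma sets_euclid_ball [measurable]: "{x \<in> euclid n. nrm n x \<le> r} \<in> sets (euclid_lborel n)"
proof -
  have "{x \<in> space (euclid_lborel n). nrm n x \<le> r} \<in> sets (euclid_lborel n)" by measurable
  then show ?thesis by simp
qed

lemma emeasure_euclid_ball_finite: "emeasure (euclid_lborel n) {x \<in> euclid n. nrm n x \<le> r} < \<infinity>"
proof -
  have "emeasure (euclid_lborel n) {x \<in> euclid n. nrm n x \<le> r} \<le> emeasure (euclid_lborel n) {x \<in> euclid n. nrm n x \<le> \<bar>r\<bar>}"
    by (rule emeasure_mono) auto
  also have "\<dots> < \<infinity>" by (simp add: emeasure_euclid_ball)
  finally show ?thesis .
qed

section \<open>Reflections in hyperplanes through the origin\<close>

definition hrefl :: "nat \<Rightarrow> (nat \<Rightarrow> real) \<Rightarrow> (nat \<Rightarrow> real) \<Rightarrow> (nat \<Rightarrow> real)" where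
  "hrefl n w x = (\<lambda>i\<in>{..<n}. x i - 2 * ip n x w / ip n w w * w i)"

lemma refl_in_euclid [simp]: "hrefl n w x \<in> euclid n"
  by (simp add: hrefl_def)

lemma ip_self_eq_0: "ip n w w = 0 \<longleftrightarrow> (\<forall>i<n. w i = 0)"
  unfolding euclid_inner_def by (subst sum_nonneg_eq_0_iff) auto

text \<open>By the convention \<open>x / 0 = 0\<close> the map \<open>hrefl n w\<close> is the
  identity on \<open>euclid n\<close> when \<open>w\<close> vanishes on the first \<open>n\<close>
  coordinates. This lemma lets the reflection rules cover that degenerate case, which occurs in
  \<open>refl_maps\<close> for \<open>u = v\<close>.\<close>

lemma ip_0: "ip n w w = 0 \<Longrightarrow> ip n x w = 0"
  by (simp only: ip_self_eq_0) (simp add: euclid_inner_def)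

lemma ip_refl: "ip n (hrefl n w x) y = ip n x y - 2 * ip n x w / ip n w w * ip n y w"
  unfolding hrefl_def using ip_linear(1)[of n 1 x "- (2 * ip n x w / ip n w w)" w y]
  by (simp add: ip_commute[of n w y])

lemma ip_refl_right: "ip n y (hrefl n w x) = ip n y x - 2 * ip n x w / ip n w w * ip n y w"
  using ip_refl[of n w x y] by (simp only: ip_commute[of n "hrefl n w x" y] ip_commute[of n x y])

lemma ip_refl_refl: "ip n (hrefl n w x) (hrefl n w y) = ip n x y"
proof (cases "ip n w w = 0")
  case True
  then show ?thesis by (simp only: ip_refl ip_refl_right) (simp add: True ip_0)
next
  case False
  have "ip n (hrefl n w y) w = - ip n y w" using False by (simp add: ip_refl)
  then show ?thesis unfolding ip_refl[of n w x] by (simp add: ip_refl_right)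
qed

lemma refl_refl: "x \<in> euclid n \<Longrightarrow> hrefl n w (hrefl n w x) = x"
proof (rule euclid_eqI[where n=n], simp_all)
  fix i assume "x \<in> euclid n" "i < n"
  show "hrefl n w (hrefl n w x) i = x i"
  proof (cases "ip n w w = 0")
    case False
    have "hrefl n w (hrefl n w x) i = x i - 2 * ip n x w / ip n w w * w i - 2 * ip n (hrefl n w x) w / ip n w w * w i"
      using \<open>i < n\<close> by (simp add: hrefl_def)
    then show ?thesis using False by (simp add: ip_refl field_simps)
  qed (use \<open>i < n\<close> in \<open>auto simp: hrefl_def\<close>)
qed

lemma nrm_refl [simp]: "nrm n (hrefl n w x) = nrm n x"
  by (rule power2_eq_imp_eq) (auto simp: nrm_power2 ip_refl_refl)

lemma ip_refl_swap: "ip n (hrefl n w x) y = ip n x (hrefl n w y)"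
  by (simp add: ip_refl ip_refl_right)

lemma nrm_refl_diff: "nrm n (\<lambda>i. hrefl n w x i - hrefl n w y i) = nrm n (\<lambda>i. x i - y i)"
  by (rule power2_eq_imp_eq) (auto simp: nrm_diff_power2 ip_refl_refl)

lemma nrm_refl_diff_swap:
  assumes "x \<in> euclid n"
  shows "nrm n (\<lambda>i. hrefl n w x i - y i) = nrm n (\<lambda>i. x i - hrefl n w y i)"
  by (rule power2_eq_imp_eq) (auto simp: nrm_diff_power2 ip_refl_swap)

text \<open>The reflection is the one in the perpendicular bisector of \<open>u\<close> and
  \<open>v\<close>. Such reflections act transitively on the sphere, so invariance under them serves
  as rotation invariance throughout.\<close>

lemma refl_maps:
  assumes u: "u \<in> euclid_sphere n" and v: "v \<in> euclid_sphere n"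
  shows "hrefl n (\<lambda>i. u i - v i) u = v"
proof (rule euclid_eqI[where n=n])
  fix i assume i: "i < n"
  let ?w = "\<lambda>i. u i - v i"
  have uu: "ip n u u = 1" and vv: "ip n v v = 1"
    using u v by (auto simp: euclid_sphere_def nrm_power2[symmetric])
  have *: "ip n u ?w = 1 - ip n u v" "ip n ?w ?w = 2 * (1 - ip n u v)"
    by (simp_all add: ip_diff uu vv ip_commute[of n v u])
  show "hrefl n ?w u i = v i"
  proof (cases "ip n ?w ?w = 0")
    case True
    then have "u i - v i = 0" using i by (simp only: ip_self_eq_0)
    then show ?thesis using i by (simp add: hrefl_def)
  next
    case False
    then have "2 * ip n u ?w / ip n ?w ?w = 1" unfolding * by auto
    then show ?thesis using i unfolding hrefl_def by simp
  qed
qed (use v in \<open>auto simp: euclid_sphere_def\<close>)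

lemma refl_sphere [simp]: "hrefl n w u \<in> euclid_sphere n \<longleftrightarrow> nrm n u = 1"
  by (auto simp: euclid_sphere_def)

lemma measurable_refl [measurable]: "hrefl n w \<in> measurable (euclid_lborel n) (euclid_lborel n)"
  unfolding hrefl_def by measurable

text \<open>For the unit ball \<open>A\<close> the integral of \<open>indicator A x * indicator B (hrefl x + y)\<close> equals \<open>vol A * vol B\<close>
  if \<open>y\<close> is integrated first. Substituting \<open>x - refl y\<close> for \<open>x\<close> makes it \<open>vol A * vol (hrefl -` B)\<close>.\<close>

lemma distr_refl: "distr (euclid_lborel n) (euclid_lborel n) (hrefl n w) = euclid_lborel n"
proof (rule measure_eqI)
  fix B assume "B \<in> sets (distr (euclid_lborel n) (euclid_lborel n) (hrefl n w))"
  then have B [measurable]: "B \<in> sets (euclid_lborel n)" by simp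
  let ?L = "euclid_lborel n" and ?R = "hrefl n w"
  define A where "A = {x \<in> euclid n. nrm n x \<le> 1}"
  have A [measurable]: "A \<in> sets ?L" by (simp add: A_def)
  let ?add = "\<lambda>x y. \<lambda>i\<in>{..<n}. x i + y i :: real"
  have RA: "indicator A (?add (\<lambda>i. x i) (\<lambda>i. - ?R y i)) = (indicator A (?add y (\<lambda>i. - ?R x i)) :: ennreal)" if "x \<in> euclid n" "y \<in> euclid n" for x y
    using nrm_refl_diff_swap[OF that(1), where w=w and y=y] nrm_minus_commute[where x="?R x" and n=n and y=y]
    by (simp add: A_def indicator_def)
  have lin: "?add (?R (?add x (\<lambda>i. - ?R y i))) y = ?R x" if "x \<in> euclid n" "y \<in> euclid n" for x y
  proof (rule euclid_eqI[where n=n])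
    fix i assume i: "i < n"
    have 1: "ip n (?add x (\<lambda>i. - ?R y i)) w = ip n x w + ip n y w"
      using ip_diff(1)[of n x "?R y" w] by (cases "ip n w w = 0") (simp_all add: ip_refl ip_0)
    show "?add (?R (?add x (\<lambda>i. - ?R y i))) y i = ?R x i"
      using i unfolding hrefl_def 1[unfolded hrefl_def] by (simp add: add_divide_distrib algebra_simps)
  qed auto
  have "(\<integral>\<^sup>+x. \<integral>\<^sup>+y. indicator A x * indicator B (?add (?R x) y) \<partial>?L \<partial>?L) =
     (\<integral>\<^sup>+x. indicator A x * emeasure ?L B \<partial>?L)"
  proof (rule nn_integral_cong)
    fix x assume x: "x \<in> space ?L"
    have "(\<integral>\<^sup>+y. indicator A x * indicator B (?add (?R x) y) \<partial>?L) = indicator A x * (\<integral>\<^sup>+y. indicator B (?add y (?R x)) \<partial>?L)"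
      by (subst nn_integral_cmult) (auto simp: add.commute)
    also have "(\<integral>\<^sup>+y. indicator B (?add y (?R x)) \<partial>?L) = emeasure ?L B"
      by (subst nn_integral_euclid_translate) auto
    finally show "(\<integral>\<^sup>+y. indicator A x * indicator B (?add (?R x) y) \<partial>?L) = indicator A x * emeasure ?L B" .
  qed
  also have "\<dots> = emeasure ?L A * emeasure ?L B" by (simp add: nn_integral_multc)
  finally have 1: "(\<integral>\<^sup>+x. \<integral>\<^sup>+y. indicator A x * indicator B (?add (?R x) y) \<partial>?L \<partial>?L) = emeasure ?L A * emeasure ?L B" .
  have "(\<integral>\<^sup>+x. \<integral>\<^sup>+y. indicator A x * indicator B (?add (?R x) y) \<partial>?L \<partial>?L) =
    (\<integral>\<^sup>+y. \<integral>\<^sup>+x. indicator A x * indicator B (?add (?R x) y) \<partial>?L \<partial>?L)"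
    by (rule euclid_lborel_pair.Fubini'[symmetric]) measurable
  also have "\<dots> = (\<integral>\<^sup>+y. \<integral>\<^sup>+x. indicator A (?add x (\<lambda>i. - ?R y i)) * indicator B (?R x) \<partial>?L \<partial>?L)"
  proof (rule nn_integral_cong)
    fix y assume y: "y \<in> space ?L"
    have "(\<integral>\<^sup>+x. indicator A x * indicator B (?add (?R x) y) \<partial>?L) =
      (\<integral>\<^sup>+x. indicator A (?add x (\<lambda>i. - ?R y i)) * indicator B (?add (?R (?add x (\<lambda>i. - ?R y i))) y) \<partial>?L)"
      by (rule nn_integral_euclid_translate[symmetric]) measurable
    also have "\<dots> = (\<integral>\<^sup>+x. indicator A (?add x (\<lambda>i. - ?R y i)) * indicator B (?R x) \<partial>?L)"
      using y by (intro nn_integral_cong) (simp only: lin space_euclid_lborel)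
    finally show "(\<integral>\<^sup>+x. indicator A x * indicator B (?add (?R x) y) \<partial>?L) = \<dots>" .
  qed
  also have "\<dots> = (\<integral>\<^sup>+x. \<integral>\<^sup>+y. indicator A (?add x (\<lambda>i. - ?R y i)) * indicator B (?R x) \<partial>?L \<partial>?L)"
    by (rule euclid_lborel_pair.Fubini') measurable
  also have "\<dots> = (\<integral>\<^sup>+x. emeasure ?L A * indicator B (?R x) \<partial>?L)"
  proof (rule nn_integral_cong)
    fix x assume x: "x \<in> space ?L"
    have "(\<integral>\<^sup>+y. indicator A (?add x (\<lambda>i. - ?R y i)) * indicator B (?R x) \<partial>?L) =
      (\<integral>\<^sup>+y. indicator A (?add y (\<lambda>i. - ?R x i)) * indicator B (?R x) \<partial>?L)"
      using x by (intro nn_integral_cong arg_cong2[where f="(*)"] RA refl) auto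
    also have "\<dots> = (\<integral>\<^sup>+y. indicator A (?add y (\<lambda>i. - ?R x i)) \<partial>?L) * indicator B (?R x)"
      by (rule nn_integral_multc) measurable
    also have "(\<integral>\<^sup>+y. indicator A (?add y (\<lambda>i. - ?R x i)) \<partial>?L) = emeasure ?L A"
      by (subst nn_integral_euclid_translate) auto
    finally show "(\<integral>\<^sup>+y. indicator A (?add x (\<lambda>i. - ?R y i)) * indicator B (?R x) \<partial>?L) = emeasure ?L A * indicator B (?R x)" .
  qed
  also have "\<dots> = emeasure ?L A * (\<integral>\<^sup>+x. indicator B (?R x) \<partial>?L)"
    by (rule nn_integral_cmult) measurable
  also have "(\<integral>\<^sup>+x. indicator B (?R x) \<partial>?L) = (\<integral>\<^sup>+x. indicator B x \<partial>distr ?L ?L ?R)"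
    by (subst nn_integral_distr) auto
  also have "\<dots> = emeasure (distr ?L ?L ?R) B" by simp
  finally have "emeasure ?L A * emeasure (distr ?L ?L ?R) B = emeasure ?L A * emeasure ?L B"
    unfolding 1 by (rule sym)
  moreover have "emeasure ?L A = ennreal (unit_ball_vol (real n))" by (simp add: A_def emeasure_euclid_ball)
  moreover have "ennreal (unit_ball_vol (real n)) \<noteq> 0" "ennreal (unit_ball_vol (real n)) \<noteq> \<top>"
    using unit_ball_vol_pos[of "real n"] by (simp_all add: ennreal_eq_0_iff not_le)
  ultimately show "emeasure (distr ?L ?L ?R) B = emeasure ?L B"
    by (simp add: ennreal_mult_cancel_left)
qed simp

lemma nn_integral_refl:
  assumes "f \<in> borel_measurable (euclid_lborel n)"
  shows "(\<integral>\<^sup>+x. f (hrefl n w x) \<partial>euclid_lborel n) = (\<integral>\<^sup>+x. f x \<partial>euclid_lborel n)"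
  by (subst (2) distr_refl[symmetric, of n w]) (subst nn_integral_distr, use assms in auto)

lemma nn_integral_euclid_Suc:
  assumes "f \<in> borel_measurable (euclid_lborel (Suc m))"
  shows "(\<integral>\<^sup>+x. f x \<partial>euclid_lborel (Suc m)) = (\<integral>\<^sup>+y. \<integral>\<^sup>+x. f (x(m := y)) \<partial>euclid_lborel m \<partial>lborel)"
  using lborel_PiM.product_nn_integral_insert_rev[of "{..<m}" m f] assms
  by (simp add: euclid_lborel_def lessThan_Suc)

lemma nrm_upd: "nrm (Suc m) (x(m := y)) = sqrt ((nrm m x)\<^sup>2 + y\<^sup>2)"
  by (simp add: L2_set_def lessThan_Suc sum_nonneg add.commute)

subsection \<open>The isodiametric inequality\<close>

definition slice :: "nat \<Rightarrow> (nat \<Rightarrow> real) set \<Rightarrow> (nat \<Rightarrow> real) \<Rightarrow> ennreal" where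
  "slice i A x = (\<integral>\<^sup>+t. indicator A (x(i := t)) \<partial>lborel)"

text \<open>The strict inequality makes every section an open interval centred at 0 with the length
  of the original section. It is empty when that length is 0, which \<open>diam_steiner\<close> uses
  to find points in the original sections.\<close>

definition steiner :: "nat \<Rightarrow> nat \<Rightarrow> (nat \<Rightarrow> real) set \<Rightarrow> (nat \<Rightarrow> real) set" where
  "steiner n i A = {x \<in> euclid n. ennreal (2 * \<bar>x i\<bar>) < slice i A x}"

lemma upd_in_euclid: "i < n \<Longrightarrow> x \<in> euclid n \<Longrightarrow> x(i := t) \<in> euclid n"
  by (auto simp: euclid_def PiE_iff extensional_def)

lemma measurable_upd:
  assumes "i < n"
  shows "(\<lambda>(x, t). x(i := t)) \<in> measurable (euclid_lborel n \<Otimes>\<^sub>M lborel) (euclid_lborel n)"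
proof (rule measurable_into_euclid)
  show "(\<lambda>z. (case z of (x, t) \<Rightarrow> x(i := t)) j) \<in> borel_measurable (euclid_lborel n \<Otimes>\<^sub>M lborel)" for j
    by (cases "j = i") (auto simp: case_prod_beta)
qed (use assms in \<open>auto simp: space_pair_measure upd_in_euclid\<close>)

lemma measurable_upd_line: "i < n \<Longrightarrow> x \<in> euclid n \<Longrightarrow> (\<lambda>t. x(i := t)) \<in> measurable lborel (euclid_lborel n)"
  by (rule measurable_into_euclid) (auto simp: upd_in_euclid)

lemma measurable_slice:
  assumes "i < n" "A \<in> sets (euclid_lborel n)"
  shows "slice i A \<in> borel_measurable (euclid_lborel n)"
proof -
  have "(\<lambda>z. indicator A (case z of (x, t) \<Rightarrow> x(i := t)) :: ennreal) \<in> borel_measurable (euclid_lborel n \<Otimes>\<^sub>M lborel)"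
    using measurable_compose[OF measurable_upd[OF assms(1)], of "indicator A :: _ \<Rightarrow> ennreal" borel] assms(2) by auto
  then show ?thesis
    unfolding slice_def[abs_def] by (intro lborel.borel_measurable_nn_integral) (simp add: case_prod_beta')
qed

lemma slice_emeasure:
  assumes "i < n" "A \<in> sets (euclid_lborel n)" "x \<in> euclid n"
  shows "{t. x(i := t) \<in> A} \<in> sets lborel" "slice i A x = emeasure lborel {t. x(i := t) \<in> A}"
proof -
  show 1: "{t. x(i := t) \<in> A} \<in> sets lborel"
    using measurable_sets[OF measurable_upd_line[OF assms(1,3)] assms(2)] by (simp add: vimage_def)
  have "slice i A x = (\<integral>\<^sup>+t. indicator {t. x(i := t) \<in> A} t \<partial>lborel)"
    unfolding slice_def by (intro nn_integral_cong) (auto simp: indicator_def)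
  then show "slice i A x = emeasure lborel {t. x(i := t) \<in> A}" using 1 by simp
qed

lemma sets_steiner [measurable]:
  assumes "i < n" "A \<in> sets (euclid_lborel n)"
  shows "steiner n i A \<in> sets (euclid_lborel n)"
proof -
  note [measurable] = measurable_slice[OF assms]
  have "{x \<in> space (euclid_lborel n). ennreal (2 * \<bar>x i\<bar>) < slice i A x} \<in> sets (euclid_lborel n)"
    by measurable
  then show ?thesis by (simp add: steiner_def)
qed

lemma emeasure_symmetric_interval: "(\<integral>\<^sup>+t. indicator {t::real. ennreal (2 * \<bar>t\<bar>) < l} t \<partial>lborel) = l"
proof (cases l)
  case (real r)
  have "{t::real. ennreal (2 * \<bar>t\<bar>) < l} = {- (r / 2) <..< r / 2}"
    using real by (auto simp: ennreal_less_iff)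
  then have "(\<integral>\<^sup>+t. indicator {t::real. ennreal (2 * \<bar>t\<bar>) < l} t \<partial>lborel) = emeasure lborel {- (r / 2) <..< r / 2}"
    by simp
  also have "\<dots> = ennreal r" using real by (subst emeasure_lborel_Ioo) auto
  finally show ?thesis using real by simp
next
  case top
  then have "{t::real. ennreal (2 * \<bar>t\<bar>) < l} = UNIV" by auto
  then show ?thesis using top by simp
qed

text \<open>Fubini in the coordinate \<open>i\<close>: only the sections in this direction change,
  and they keep their lengths.\<close>

lemma emeasure_steiner:
  assumes i: "i < n" and A: "A \<in> sets (euclid_lborel n)"
  shows "emeasure (euclid_lborel n) (steiner n i A) = emeasure (euclid_lborel n) A"
proof -
  define J where "J = {..<n} - {i}"
  have n: "{..<n} = insert i J" "i \<notin> J" "finite J" using i by (auto simp: J_def)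
  have L: "euclid_lborel n = Pi\<^sub>M (insert i J) (\<lambda>_. lborel)" by (simp add: euclid_lborel_def n)
  have fub: "emeasure (euclid_lborel n) B = (\<integral>\<^sup>+x. slice i B x \<partial>Pi\<^sub>M J (\<lambda>_. lborel))"
    if "B \<in> sets (euclid_lborel n)" for B
  proof -
    have "emeasure (euclid_lborel n) B = (\<integral>\<^sup>+x. indicator B x \<partial>euclid_lborel n)" using that by simp
    also have "\<dots> = (\<integral>\<^sup>+x. slice i B x \<partial>Pi\<^sub>M J (\<lambda>_. lborel))"
      unfolding L slice_def using that L n by (intro lborel_PiM.product_nn_integral_insert) auto
    finally show ?thesis .
  qed
  have "slice i (steiner n i A) x = slice i A x" if x: "x \<in> space (Pi\<^sub>M J (\<lambda>_. lborel :: real measure))" for x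
  proof -
    have "x(i := t) \<in> euclid n" for t
      using x n by (auto simp: euclid_def space_PiM PiE_iff extensional_def)
    then have "slice i (steiner n i A) x = (\<integral>\<^sup>+t. indicator {t. ennreal (2 * \<bar>t\<bar>) < slice i A x} t \<partial>lborel)"
      unfolding slice_def steiner_def by (intro nn_integral_cong) (simp add: indicator_def)
    then show ?thesis by (simp add: emeasure_symmetric_interval)
  qed
  then show ?thesis
    using fub[OF A] fub[OF sets_steiner[OF i A]] by (simp cong: nn_integral_cong)
qed

text \<open>The set \<open>Q\<close> is confined to \<open>{Sup P - D..Inf P + D}\<close>, of length
  \<open>2 * D - (Sup P - Inf P)\<close>, while \<open>P\<close> has measure at most
  \<open>Sup P - Inf P\<close>; the two extents cancel.\<close>

lemma emeasure_add_le_of_dist_le: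
  fixes P Q :: "real set"
  assumes "P \<in> sets lborel" "Q \<in> sets lborel" and ne: "P \<noteq> {}" "Q \<noteq> {}"
    and D: "\<And>s t. s \<in> P \<Longrightarrow> t \<in> Q \<Longrightarrow> \<bar>s - t\<bar> \<le> D"
  shows "emeasure lborel P + emeasure lborel Q \<le> ennreal (2 * D)"
proof -
  obtain p q where pq: "p \<in> P" "q \<in> Q" using ne by auto
  have st: "s \<le> t + D" "t - D \<le> s" if "s \<in> P" "t \<in> Q" for s t
    using D[OF that] by (auto simp: abs_le_iff)
  have bP: "bdd_above P" "bdd_below P"
    by (rule bdd_aboveI, erule st(1)[OF _ pq(2)]) (rule bdd_belowI, erule st(2)[OF _ pq(2)])
  have P: "P \<subseteq> {Inf P..Sup P}" using bP by (auto intro: cInf_lower cSup_upper)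
  have Q: "Q \<subseteq> {Sup P - D..Inf P + D}"
  proof
    fix t assume t: "t \<in> Q"
    have "Sup P \<le> t + D" using st(1)[OF _ t] ne by (intro cSup_least) auto
    moreover have "t - D \<le> Inf P" using st(2)[OF _ t] ne by (intro cInf_greatest) auto
    ultimately show "t \<in> {Sup P - D..Inf P + D}" by auto
  qed
  have le: "Inf P \<le> Sup P" "Sup P - D \<le> Inf P + D" using P Q pq by auto
  have "emeasure lborel P \<le> emeasure lborel {Inf P..Sup P}" using P by (intro emeasure_mono) auto
  moreover have "emeasure lborel Q \<le> emeasure lborel {Sup P - D..Inf P + D}" using Q by (intro emeasure_mono) auto
  ultimately have "emeasure lborel P + emeasure lborel Q \<le> ennreal (Sup P - Inf P) + ennreal (Inf P + D - (Sup P - D))"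
    using le by (intro add_mono) (auto simp: emeasure_lborel_Icc)
  also have "\<dots> = ennreal (2 * D)" using le by (subst ennreal_plus[symmetric]) auto
  finally show ?thesis .
qed

lemma nrm_diff_upd:
  assumes "i < n"
  shows "(nrm n (\<lambda>j. (x(i := s)) j - (y(i := t)) j))\<^sup>2 = (\<Sum>j\<in>{..<n} - {i}. (x j - y j)\<^sup>2) + (s - t)\<^sup>2"
proof -
  have "(nrm n (\<lambda>j. (x(i := s)) j - (y(i := t)) j))\<^sup>2 = (\<Sum>j<n. ((x(i := s)) j - (y(i := t)) j)\<^sup>2)"
    by (simp add: L2_set_def sum_nonneg)
  also have "\<dots> = (s - t)\<^sup>2 + (\<Sum>j\<in>{..<n} - {i}. ((x(i := s)) j - (y(i := t)) j)\<^sup>2)"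
    using assms by (subst sum.remove[of _ i]) auto
  also have "(\<Sum>j\<in>{..<n} - {i}. ((x(i := s)) j - (y(i := t)) j)\<^sup>2) = (\<Sum>j\<in>{..<n} - {i}. (x j - y j)\<^sup>2)"
    by (intro sum.cong) auto
  finally show ?thesis by simp
qed

text \<open>Let \<open>R\<close> be the squared distance in the coordinates other than
  \<open>i\<close>. Points of the two original sections differ by at most
  \<open>sqrt (D\<^sup>2 - R)\<close>, so the lengths of these sections add up to at most twice
  that. As \<open>\<bar>x i\<bar>\<close> and \<open>\<bar>y i\<bar>\<close> are below half of the
  lengths, the same bound holds for \<open>\<bar>x i - y i\<bar>\<close>.\<close>

lemma diam_steiner:
  assumes i: "i < n" and A: "A \<in> sets (euclid_lborel n)"
    and D: "\<And>x y. x \<in> A \<Longrightarrow> y \<in> A \<Longrightarrow> nrm n (\<lambda>j. x j - y j) \<le> D"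
    and x: "x \<in> steiner n i A" and y: "y \<in> steiner n i A"
  shows "nrm n (\<lambda>j. x j - y j) \<le> D"
proof -
  let ?P = "{t. x(i := t) \<in> A}" and ?Q = "{t. y(i := t) \<in> A}"
  have xy: "x \<in> euclid n" "y \<in> euclid n" using x y by (auto simp: steiner_def)
  note P = slice_emeasure[OF i A xy(1)] and Q = slice_emeasure[OF i A xy(2)]
  have l: "ennreal (2 * \<bar>x i\<bar>) < emeasure lborel ?P" "ennreal (2 * \<bar>y i\<bar>) < emeasure lborel ?Q"
    using x y P Q by (auto simp: steiner_def)
  then have ne: "?P \<noteq> {}" "?Q \<noteq> {}" by (metis emeasure_empty not_less_zero)+
  define R where "R = (\<Sum>j\<in>{..<n} - {i}. (x j - y j)\<^sup>2)"
  have st: "\<bar>s - t\<bar> \<le> sqrt (D\<^sup>2 - R)" if "s \<in> ?P" "t \<in> ?Q" for s t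
  proof -
    have "(nrm n (\<lambda>j. (x(i := s)) j - (y(i := t)) j))\<^sup>2 \<le> D\<^sup>2"
      using D[of "x(i := s)" "y(i := t)"] that by (intro power_mono) (simp_all del: fun_upd_apply)
    then show ?thesis unfolding nrm_diff_upd[OF i] R_def[symmetric] by (intro real_le_rsqrt) simp
  qed
  obtain s t where "s \<in> ?P" "t \<in> ?Q" using ne by auto
  then have D0: "0 \<le> D" using D L2_set_nonneg order_trans by blast
  have "ennreal (2 * \<bar>x i\<bar> + 2 * \<bar>y i\<bar>) = ennreal (2 * \<bar>x i\<bar>) + ennreal (2 * \<bar>y i\<bar>)"
    by (rule ennreal_plus) auto
  also have "\<dots> \<le> emeasure lborel ?P + emeasure lborel ?Q"
    by (intro add_mono less_imp_le[OF l(1)] less_imp_le[OF l(2)])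
  also have "\<dots> \<le> ennreal (2 * sqrt (D\<^sup>2 - R))"
    by (rule emeasure_add_le_of_dist_le[OF P(1) Q(1) ne st])
  finally have "2 * \<bar>x i\<bar> + 2 * \<bar>y i\<bar> \<le> 2 * sqrt (D\<^sup>2 - R)"
    using st[OF \<open>s \<in> ?P\<close> \<open>t \<in> ?Q\<close>] by (subst (asm) ennreal_le_iff) linarith+
  then have "\<bar>x i - y i\<bar> \<le> sqrt (D\<^sup>2 - R)" by linarith
  moreover have "0 \<le> D\<^sup>2 - R" using st[OF \<open>s \<in> ?P\<close> \<open>t \<in> ?Q\<close>] by (metis abs_ge_zero order_trans real_sqrt_ge_0_iff)
  ultimately have "\<bar>x i - y i\<bar>\<^sup>2 \<le> D\<^sup>2 - R" by (metis abs_ge_zero power_mono real_sqrt_pow2)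
  then have "(nrm n (\<lambda>j. (x(i := x i)) j - (y(i := y i)) j))\<^sup>2 \<le> D\<^sup>2"
    unfolding nrm_diff_upd[OF i] R_def[symmetric] by simp
  then have "(nrm n (\<lambda>j. x j - y j))\<^sup>2 \<le> D\<^sup>2" by (simp only: fun_upd_triv)
  then show ?thesis by (rule power2_le_imp_le[OF _ D0])
qed

definition flip_invariant :: "nat \<Rightarrow> (nat \<Rightarrow> real) set \<Rightarrow> bool" where
  "flip_invariant j A \<longleftrightarrow> (\<forall>x. x(j := - x j) \<in> A \<longleftrightarrow> x \<in> A)"

text \<open>Sections in direction \<open>i\<close> depend only on the other coordinates, so a
  symmetry of \<open>A\<close> in another coordinate survives while the symmetry in \<open>i\<close>
  is gained. Symmetrizing along all axes in turn accumulates them.\<close>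

lemma flip_steiner:
  assumes "i < n" "j < n" "flip_invariant j A \<or> j = i"
  shows "flip_invariant j (steiner n i A)"
proof -
  have e: "x(j := - x j) \<in> euclid n \<longleftrightarrow> x \<in> euclid n" for x
    by (metis fun_upd_triv fun_upd_upd upd_in_euclid[OF assms(2)])
  have "slice i A (x(j := - x j)) = slice i A x" for x
  proof (cases "i = j")
    case False
    then have "flip_invariant j A" using assms by auto
    then have "x(i := t, j := - x j) \<in> A \<longleftrightarrow> x(i := t) \<in> A" for t
      using False unfolding flip_invariant_def by (metis fun_upd_other)
    then show ?thesis using False unfolding slice_def by (simp add: fun_upd_twist indicator_def)
  qed (simp add: slice_def)
  then show ?thesis using e by (simp add: flip_invariant_def steiner_def)
qed

lemma exists_symmetrization:
  assumes A: "A \<in> sets (euclid_lborel n)"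
    and D: "\<And>x y. x \<in> A \<Longrightarrow> y \<in> A \<Longrightarrow> nrm n (\<lambda>j. x j - y j) \<le> D" and "k \<le> n"
  shows "\<exists>B\<in>sets (euclid_lborel n). emeasure (euclid_lborel n) B = emeasure (euclid_lborel n) A \<and>
    (\<forall>x\<in>B. \<forall>y\<in>B. nrm n (\<lambda>j. x j - y j) \<le> D) \<and> (\<forall>j<k. flip_invariant j B)"
  using \<open>k \<le> n\<close>
proof (induction k)
  case 0
  then show ?case using A D by auto
next
  case (Suc k)
  then obtain B where B: "B \<in> sets (euclid_lborel n)" "emeasure (euclid_lborel n) B = emeasure (euclid_lborel n) A"
    "\<And>x y. x \<in> B \<Longrightarrow> y \<in> B \<Longrightarrow> nrm n (\<lambda>j. x j - y j) \<le> D" "\<And>j. j < k \<Longrightarrow> flip_invariant j B" by auto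
  have k: "k < n" using Suc by simp
  show ?case
  proof (intro bexI[of _ "steiner n k B"] conjI ballI allI impI)
    fix j assume "j < Suc k"
    then show "flip_invariant j (steiner n k B)" using B(4) k by (intro flip_steiner) (auto simp: less_Suc_eq)
  next
    fix x y assume "x \<in> steiner n k B" "y \<in> steiner n k B"
    then show "nrm n (\<lambda>j. x j - y j) \<le> D" using diam_steiner[OF k B(1,3)] by blast
  next
    show "steiner n k B \<in> sets (euclid_lborel n)" by (rule sets_steiner[OF k B(1)])
    show "emeasure (euclid_lborel n) (steiner n k B) = emeasure (euclid_lborel n) A"
      using emeasure_steiner[OF k B(1)] B(2) by simp
  qed
qed

text \<open>Invariance under all coordinate flips gives central symmetry: with \<open>x\<close> also
  \<open>- x\<close> belongs to the symmetrized set, so \<open>2 * nrm n x \<le> D\<close> and the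
  set lies in a ball of radius \<open>D / 2\<close>.\<close>

lemma isodiametric:
  assumes A: "A \<in> sets (euclid_lborel n)" and "0 \<le> D"
    and D: "\<And>x y. x \<in> A \<Longrightarrow> y \<in> A \<Longrightarrow> nrm n (\<lambda>j. x j - y j) \<le> D"
  shows "emeasure (euclid_lborel n) A \<le> ennreal (unit_ball_vol (real n) * (D / 2) ^ n)"
proof -
  obtain B where B: "B \<in> sets (euclid_lborel n)" "emeasure (euclid_lborel n) B = emeasure (euclid_lborel n) A"
    "\<And>x y. x \<in> B \<Longrightarrow> y \<in> B \<Longrightarrow> nrm n (\<lambda>j. x j - y j) \<le> D" "\<And>j. j < n \<Longrightarrow> flip_invariant j B"
    using exists_symmetrization[OF A D order_refl] by blast
  have "nrm n x \<le> D / 2" if x: "x \<in> B" for x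
  proof -
    have "(\<lambda>i. if i < k then - x i else x i) \<in> B" if "k \<le> n" for k
      using that
    proof (induction k)
      case (Suc k)
      let ?y = "\<lambda>i. if i < k then - x i else x i"
      have "?y \<in> B" using Suc by auto
      moreover have "flip_invariant k B" using B(4) Suc by auto
      then have "?y(k := - ?y k) \<in> B \<longleftrightarrow> ?y \<in> B" unfolding flip_invariant_def by (rule spec)
      ultimately have "?y(k := - ?y k) \<in> B" by (rule iffD2[rotated])
      also have "?y(k := - ?y k) = (\<lambda>i. if i < Suc k then - x i else x i)" by (auto simp: less_Suc_eq)
      finally show ?case .
    qed (use x in simp)
    from B(3)[OF x this[of n]] have "nrm n (\<lambda>i. 2 * x i) \<le> D"
      by (simp add: L2_set_def)
    then show ?thesis by (simp add: nrm_scale)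
  qed
  moreover have "B \<subseteq> euclid n" using sets.sets_into_space[OF B(1)] by simp
  ultimately have "emeasure (euclid_lborel n) B \<le> emeasure (euclid_lborel n) {x \<in> euclid n. nrm n x \<le> D / 2}"
    by (intro emeasure_mono sets_euclid_ball) auto
  also have "\<dots> = ennreal (unit_ball_vol (real n) * (D / 2) ^ n)"
    using \<open>0 \<le> D\<close> by (intro emeasure_euclid_ball) simp
  finally show ?thesis using B(2) by simp
qed

subsection \<open>Hausdorff measure is a measure\<close>

definition covers :: "nat \<Rightarrow> ennreal \<Rightarrow> (nat \<Rightarrow> real) set \<Rightarrow> (nat \<Rightarrow> (nat \<Rightarrow> real) set) set" where
  "covers n \<delta> A = {U. A \<subseteq> (\<Union>i. U i) \<and> (\<forall>i. U i \<subseteq> euclid n \<and> euclid_ediam n (U i) \<le> \<delta>)}"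

definition hweight :: "nat \<Rightarrow> nat \<Rightarrow> (nat \<Rightarrow> real) set \<Rightarrow> ennreal" where
  "hweight n s U = (if U = {} then 0 else ennreal (unit_ball_vol (real s) / 2 ^ s) * euclid_ediam n U ^ s)"

lemma hausdorff_premeasure_eq:
  "hausdorff_premeasure n s \<delta> A = (INF U\<in>covers n \<delta> A. \<Sum>i. hweight n s (U i))"
  by (simp add: hausdorff_premeasure_def covers_def hweight_def)

lemma coversI:
  "A \<subseteq> (\<Union>i. U i) \<Longrightarrow> (\<And>i. U i \<subseteq> euclid n) \<Longrightarrow> (\<And>i. euclid_ediam n (U i) \<le> \<delta>) \<Longrightarrow> U \<in> covers n \<delta> A"
  by (simp add: covers_def)

lemma coversD:
  assumes "U \<in> covers n \<delta> A"
  shows "A \<subseteq> (\<Union>i. U i)" "U i \<subseteq> euclid n" "euclid_ediam n (U i) \<le> \<delta>"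
  using assms unfolding covers_def by blast+

lemma hweight_empty [simp]: "hweight n s {} = 0"
  by (simp add: hweight_def)

lemma euclid_ediam_empty [simp]: "euclid_ediam n {} = 0"
  by (simp add: euclid_ediam_def bot_ennreal)

lemma dist_le_euclid_ediam: "x \<in> U \<Longrightarrow> y \<in> U \<Longrightarrow> ennreal (euclid_dist n x y) \<le> euclid_ediam n U"
  unfolding euclid_ediam_def by (intro SUP_upper2[of x] SUP_upper2[of y]) auto

lemma euclid_ediam_le:
  "(\<And>x y. x \<in> U \<Longrightarrow> y \<in> U \<Longrightarrow> euclid_dist n x y \<le> d) \<Longrightarrow> euclid_ediam n U \<le> ennreal d"
  unfolding euclid_ediam_def by (intro SUP_least ennreal_leI) auto

lemma hausdorff_premeasure_mono: "A \<subseteq> B \<Longrightarrow> hausdorff_premeasure n s \<delta> A \<le> hausdorff_premeasure n s \<delta> B"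
  unfolding hausdorff_premeasure_eq by (rule INF_superset_mono) (auto simp: covers_def)

lemma hausdorff_premeasure_antimono: "\<delta> \<le> \<delta>' \<Longrightarrow> hausdorff_premeasure n s \<delta>' A \<le> hausdorff_premeasure n s \<delta> A"
  unfolding hausdorff_premeasure_eq by (rule INF_superset_mono) (auto simp: covers_def intro: order_trans)

lemma hausdorff_premeasure_le_cover:
  "U \<in> covers n \<delta> A \<Longrightarrow> hausdorff_premeasure n s \<delta> A \<le> (\<Sum>i. hweight n s (U i))"
  unfolding hausdorff_premeasure_eq by (rule INF_lower)

lemma hausdorff_premeasure_empty [simp]: "hausdorff_premeasure n s \<delta> {} = 0"
  using hausdorff_premeasure_le_cover[of "\<lambda>_. {}" n \<delta> "{}" s] by (simp add: covers_def)

lemma hausdorff_premeasure_single: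
  assumes "U \<subseteq> euclid n" "euclid_ediam n U \<le> \<delta>"
  shows "hausdorff_premeasure n s \<delta> U \<le> hweight n s U"
proof -
  have "(\<lambda>i. if i = 0 then U else {}) \<in> covers n \<delta> U" using assms by (auto simp: covers_def)
  then have "hausdorff_premeasure n s \<delta> U \<le> (\<Sum>i. hweight n s (if i = (0::nat) then U else {}))"
    by (rule hausdorff_premeasure_le_cover)
  also have "\<dots> = (\<Sum>i<1. hweight n s (if i = (0::nat) then U else {}))"
    by (rule suminf_finite) auto
  finally show ?thesis by simp
qed

lemma hausdorff_premeasure_subadditive:
  "hausdorff_premeasure n s \<delta> (\<Union>i. A i) \<le> (\<Sum>i. hausdorff_premeasure n s \<delta> (A i))"
proof (rule ennreal_le_epsilon)
  let ?H = "hausdorff_premeasure n s \<delta>"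
  fix e :: real assume fin: "(\<Sum>i. ?H (A i)) < top" and e: "0 < e"
  have "\<exists>U\<in>covers n \<delta> (A i). (\<Sum>j. hweight n s (U j)) < ?H (A i) + ennreal (e * (1 / 2) ^ Suc i)" for i
  proof -
    have "?H (A i) \<le> (\<Sum>i. ?H (A i))"
      using sum_le_suminf[of "\<lambda>i. ?H (A i)" "{i}"] by simp
    then have "?H (A i) < top" using fin by (rule le_less_trans)
    then have fin_i: "?H (A i) \<noteq> \<infinity>" by (simp only: infinity_ennreal_def less_top)
    have "0 < ennreal (e * (1 / 2) ^ Suc i)" using e by simp
    with fin_i have "?H (A i) + 0 < ?H (A i) + ennreal (e * (1 / 2) ^ Suc i)"
      by (rule iffD2[OF ennreal_add_left_cancel_less conjI])
    then have "(INF U\<in>covers n \<delta> (A i). \<Sum>j. hweight n s (U j)) < ?H (A i) + ennreal (e * (1 / 2) ^ Suc i)"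
      unfolding hausdorff_premeasure_eq[symmetric] by (simp only: add_0_right)
    then show ?thesis by (simp only: INF_less_iff)
  qed
  then obtain U where U: "\<And>i. U i \<in> covers n \<delta> (A i)"
    "\<And>i. (\<Sum>j. hweight n s (U i j)) < ?H (A i) + ennreal (e * (1 / 2) ^ Suc i)" by metis
  define V where "V k = (case prod_decode k of (i, j) \<Rightarrow> U i j)" for k
  have "V \<in> covers n \<delta> (\<Union>i. A i)"
  proof -
    have "\<exists>k. x \<in> V k" if x: "x \<in> A i" for i x
    proof -
      obtain j where "x \<in> U i j" using U(1)[of i] x unfolding covers_def by blast
      then have "x \<in> V (prod_encode (i, j))" by (simp add: V_def)
      then show ?thesis ..
    qed
    then have "(\<Union>i. A i) \<subseteq> (\<Union>k. V k)" by blast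
    then show ?thesis by (rule coversI) (simp_all add: V_def coversD[OF U(1)] split: prod.split)
  qed
  then have "?H (\<Union>i. A i) \<le> (\<Sum>k. hweight n s (V k))" by (rule hausdorff_premeasure_le_cover)
  also have "\<dots> = (\<Sum>k. (case prod_decode k of (i, j) \<Rightarrow> hweight n s (U i j)))"
    by (simp add: V_def prod.case_distrib)
  also have "\<dots> = (\<Sum>i. \<Sum>j. hweight n s (U i j))"
    using suminf_ennreal_2dimen[of "\<lambda>i. \<Sum>j. hweight n s (U i j)" "\<lambda>(i, j). hweight n s (U i j)"]
    by (simp add: comp_def)
  also have "\<dots> \<le> (\<Sum>i. ?H (A i) + ennreal (e * (1 / 2) ^ Suc i))"
    using U(2) by (intro suminf_le) (auto intro: less_imp_le)
  also have "\<dots> = (\<Sum>i. ?H (A i)) + (\<Sum>i. ennreal (e * (1 / 2) ^ Suc i))"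
    by (rule suminf_add[symmetric]) auto
  also have "(\<Sum>i. ennreal (e * (1 / 2) ^ Suc i)) = ennreal e"
    using sums_mult[OF power_half_series, of e] e by (intro suminf_ennreal_eq) auto
  finally show "?H (\<Union>i. A i) \<le> (\<Sum>i. ?H (A i)) + ennreal e" .
qed

lemma hausdorff_premeasure_le_outer: "0 < \<delta> \<Longrightarrow> hausdorff_premeasure n s \<delta> A \<le> hausdorff_outer n s A"
  unfolding hausdorff_outer_def by (rule SUP_upper) auto

lemma hausdorff_outer_empty [simp]: "hausdorff_outer n s {} = 0"
proof -
  have "hausdorff_outer n s {} \<le> 0" unfolding hausdorff_outer_def by (rule SUP_least) simp
  then show ?thesis by simp
qed

lemma hausdorff_outer_mono: "A \<subseteq> B \<Longrightarrow> hausdorff_outer n s A \<le> hausdorff_outer n s B"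
  unfolding hausdorff_outer_def by (intro SUP_mono) (auto intro: hausdorff_premeasure_mono)

lemma hausdorff_outer_subadditive: "hausdorff_outer n s (\<Union>i. A i) \<le> (\<Sum>i. hausdorff_outer n s (A i))"
  unfolding hausdorff_outer_def[of n s "\<Union>i. A i"]
proof (rule SUP_least)
  fix \<delta> :: ennreal assume \<delta>: "\<delta> \<in> {0<..}"
  have "hausdorff_premeasure n s \<delta> (\<Union>i. A i) \<le> (\<Sum>i. hausdorff_premeasure n s \<delta> (A i))"
    by (rule hausdorff_premeasure_subadditive)
  also have "\<dots> \<le> (\<Sum>i. hausdorff_outer n s (A i))"
    using \<delta> by (intro suminf_le) (auto intro: hausdorff_premeasure_le_outer)
  finally show "hausdorff_premeasure n s \<delta> (\<Union>i. A i) \<le> (\<Sum>i. hausdorff_outer n s (A i))" .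
qed

lemma Un_from_subadditive:
  fixes f :: "'a set \<Rightarrow> ennreal"
  assumes "f {} = 0" "\<And>A :: nat \<Rightarrow> 'a set. f (\<Union>i. A i) \<le> (\<Sum>i. f (A i))"
  shows "f (A \<union> B) \<le> f A + f B"
  using assms(2)[of "binaryset A B"]
  unfolding UN_binaryset_eq suminf_binaryset_eq[where f=f, OF assms(1)] .

lemma hausdorff_premeasure_Un:
  "hausdorff_premeasure n s \<delta> (A \<union> B) \<le> hausdorff_premeasure n s \<delta> A + hausdorff_premeasure n s \<delta> B"
  by (rule Un_from_subadditive[of "hausdorff_premeasure n s \<delta>"])
     (simp_all add: hausdorff_premeasure_subadditive)

lemma hausdorff_outer_Un: "hausdorff_outer n s (A \<union> B) \<le> hausdorff_outer n s A + hausdorff_outer n s B"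
  by (rule Un_from_subadditive[of "hausdorff_outer n s"]) (simp_all add: hausdorff_outer_subadditive)

text \<open>No set of diameter at most \<open>\<delta>\<close> meets both \<open>A\<close> and
  \<open>B\<close>, so each cover of the union splits into a cover of \<open>A\<close> and one of
  \<open>B\<close> without counting any member twice.\<close>

lemma hausdorff_premeasure_separated:
  assumes sep: "\<And>x y. x \<in> A \<Longrightarrow> y \<in> B \<Longrightarrow> \<delta> < ennreal (euclid_dist n x y)"
  shows "hausdorff_premeasure n s \<delta> A + hausdorff_premeasure n s \<delta> B \<le> hausdorff_premeasure n s \<delta> (A \<union> B)"
  unfolding hausdorff_premeasure_eq[of n s \<delta> "A \<union> B"]
proof (rule INF_greatest)
  fix U assume U: "U \<in> covers n \<delta> (A \<union> B)"
  let ?V = "\<lambda>C i. if U i \<inter> C = {} then {} else U i"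
  have V: "?V C \<in> covers n \<delta> C" if "C \<subseteq> A \<union> B" for C
  proof -
    have "\<exists>i. x \<in> ?V C i" if x: "x \<in> C" for x
    proof -
      obtain i where i: "x \<in> U i" using U x \<open>C \<subseteq> A \<union> B\<close> unfolding covers_def by blast
      then show ?thesis using x by (intro exI[of _ i]) auto
    qed
    then have "C \<subseteq> (\<Union>i. ?V C i)" by blast
    then show ?thesis by (rule coversI) (use coversD[OF U] in auto)
  qed
  have *: "U i \<inter> A = {} \<or> U i \<inter> B = {}" for i
  proof (rule ccontr)
    assume "\<not> ?thesis"
    then obtain x y where xy: "x \<in> U i" "x \<in> A" "y \<in> U i" "y \<in> B" by auto
    have "euclid_ediam n (U i) \<le> \<delta>" using U by (auto simp: covers_def)
    then show False using sep[OF xy(2,4)] dist_le_euclid_ediam[OF xy(1,3), of n] by (meson leD order_trans)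
  qed
  have "hausdorff_premeasure n s \<delta> A + hausdorff_premeasure n s \<delta> B \<le>
      (\<Sum>i. hweight n s (?V A i)) + (\<Sum>i. hweight n s (?V B i))"
    by (intro add_mono hausdorff_premeasure_le_cover V) auto
  also have "\<dots> = (\<Sum>i. hweight n s (?V A i) + hweight n s (?V B i))"
    by (rule suminf_add) auto
  also have "\<dots> \<le> (\<Sum>i. hweight n s (U i))"
    using * by (intro suminf_le) auto
  finally show "hausdorff_premeasure n s \<delta> A + hausdorff_premeasure n s \<delta> B \<le> (\<Sum>i. hweight n s (U i))" .
qed

text \<open>A monotone sequence of scales, so that the supremum commutes with addition in
  \<open>hausdorff_outer_separated\<close>.\<close>

lemma hausdorff_outer_eq_SUP_nat:
  "hausdorff_outer n s A = (SUP k. hausdorff_premeasure n s (ennreal (d / Suc k)) A)" if "d > 0"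
proof (rule antisym)
  show "hausdorff_outer n s A \<le> (SUP k. hausdorff_premeasure n s (ennreal (d / Suc k)) A)"
    unfolding hausdorff_outer_def
  proof (rule SUP_least)
    fix \<delta> :: ennreal assume \<delta>: "\<delta> \<in> {0<..}"
    have "\<exists>k. ennreal (d / Suc k) \<le> \<delta>"
    proof (cases \<delta>)
      case (real r)
      then have "0 < r" using \<delta> by auto
      then obtain k where "d / r < real k" using reals_Archimedean2 by blast
      then have "d / Suc k \<le> r" using \<open>0 < r\<close> by (simp add: field_simps)
      then show ?thesis using real by (auto intro: ennreal_leI)
    qed auto
    then obtain k where "ennreal (d / Suc k) \<le> \<delta>" ..
    then show "hausdorff_premeasure n s \<delta> A \<le> (SUP k. hausdorff_premeasure n s (ennreal (d / Suc k)) A)"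
      by (intro SUP_upper2[of k] hausdorff_premeasure_antimono) auto
  qed
  show "(SUP k. hausdorff_premeasure n s (ennreal (d / Suc k)) A) \<le> hausdorff_outer n s A"
    using that by (intro SUP_least hausdorff_premeasure_le_outer) auto
qed

lemma hausdorff_outer_separated:
  assumes d: "0 < d" and sep: "\<And>x y. x \<in> A \<Longrightarrow> y \<in> B \<Longrightarrow> d \<le> euclid_dist n x y"
  shows "hausdorff_outer n s A + hausdorff_outer n s B \<le> hausdorff_outer n s (A \<union> B)"
proof -
  have mono: "incseq (\<lambda>k. hausdorff_premeasure n s (ennreal (d / 2 / Suc k)) C)" for C
    using d by (intro incseq_SucI hausdorff_premeasure_antimono ennreal_leI divide_left_mono) auto
  have "hausdorff_outer n s A + hausdorff_outer n s B =
     (SUP k. hausdorff_premeasure n s (ennreal (d / 2 / Suc k)) A + hausdorff_premeasure n s (ennreal (d / 2 / Suc k)) B)"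
    unfolding hausdorff_outer_eq_SUP_nat[OF half_gt_zero[OF d]]
    by (rule ennreal_SUP_add[OF mono mono, symmetric])
  also have "\<dots> \<le> hausdorff_outer n s (A \<union> B)"
  proof (rule SUP_least)
    fix k :: nat
    \<comment> \<open>Starting from \<open>d / 2\<close> keeps every scale strictly below the
      separation \<open>d\<close>.\<close>
    have lt: "d / 2 / Suc k < d" using d by (simp add: field_simps) (simp add: mult_pos_pos add_pos_nonneg)
    have "hausdorff_premeasure n s (ennreal (d / 2 / Suc k)) A + hausdorff_premeasure n s (ennreal (d / 2 / Suc k)) B
      \<le> hausdorff_premeasure n s (ennreal (d / 2 / Suc k)) (A \<union> B)"
      using lt sep d by (intro hausdorff_premeasure_separated) (auto simp: ennreal_less_iff intro: less_le_trans)
    also have "\<dots> \<le> hausdorff_outer n s (A \<union> B)" using d by (intro hausdorff_premeasure_le_outer) auto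
    finally show "hausdorff_premeasure n s (ennreal (d / 2 / Suc k)) A + hausdorff_premeasure n s (ennreal (d / 2 / Suc k)) B
      \<le> hausdorff_outer n s (A \<union> B)" .
  qed
  finally show ?thesis .
qed

lemma hausdorff_outer_separated_coord:
  assumes i: "i < n" and d: "0 < d" and sep: "\<And>x y. x \<in> A \<Longrightarrow> y \<in> B \<Longrightarrow> d \<le> \<bar>x i - y i\<bar>"
  shows "hausdorff_outer n s A + hausdorff_outer n s B \<le> hausdorff_outer n s (A \<union> B)"
proof (rule hausdorff_outer_separated[OF d])
  fix x y assume "x \<in> A" "y \<in> B"
  then have "d \<le> \<bar>x i - y i\<bar>" by (rule sep)
  also have "\<dots> \<le> nrm n (\<lambda>j. x j - y j)" using abs_coord_le_nrm[OF i, of "\<lambda>j. x j - y j"] by simp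
  finally show "d \<le> euclid_dist n x y" by (simp add: euclid_dist_def)
qed

lemma ennreal_tail_small:
  fixes f :: "nat \<Rightarrow> ennreal"
  assumes "(\<Sum>i. f i) \<noteq> top" "e > 0"
  shows "\<exists>k. (\<Sum>i. f (i + k)) < ennreal e"
proof -
  have fin: "f i \<noteq> top" for i
    using sum_le_suminf[of f "{i}"] assms(1) by (auto simp: top_unique)
  then have f: "f i = ennreal (enn2real (f i))" for i by (simp add: less_top)
  have sm: "summable (\<lambda>i. enn2real (f i))"
    using assms(1) by (intro summable_suminf_not_top) (auto simp flip: f)
  obtain k where k: "\<bar>\<Sum>i. enn2real (f (i + k))\<bar> < e"
    using suminf_exist_split[OF assms(2) sm] by auto
  have "(\<Sum>i. f (i + k)) = (\<Sum>i. ennreal (enn2real (f (i + k))))" using f by simp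
  also have "\<dots> = ennreal (\<Sum>i. enn2real (f (i + k)))"
    using sm summable_iff_shift[of "\<lambda>i. enn2real (f i)" k] by (intro suminf_ennreal2) auto
  also have "\<dots> < ennreal e" using k assms(2) by (intro ennreal_lessI) auto
  finally show ?thesis by blast
qed

lemma sum_even_odd: "(\<Sum>j<2 * N. f j :: ennreal) = (\<Sum>j<N. f (2 * j)) + (\<Sum>j<N. f (2 * j + 1))" for N :: nat
  by (induction N) (simp_all add: ac_simps)

text \<open>Consecutive slabs \<open>R j\<close> touch, but two of the same parity are separated by
  a slab in between. The measures within one parity class therefore add up to at most that of
  \<open>X\<close>, and both classes together to at most twice that.\<close>

lemma hausdorff_outer_annuli:
  fixes c :: real
  assumes i: "i < n" and fin: "hausdorff_outer n s X \<noteq> top"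
  defines "R \<equiv> \<lambda>j::nat. {x \<in> X. c + 1 / (real j + 2) \<le> x i \<and> x i < c + 1 / (real j + 1)}"
  shows "(\<Sum>j. hausdorff_outer n s (R j)) \<noteq> top"
proof -
  let ?H = "hausdorff_outer n s"
  have alt: "(\<Sum>j<N. ?H (R (2 * j + p))) \<le> ?H (\<Union>j<N. R (2 * j + p))" for N p :: nat
  proof (induction N)
    case (Suc N)
    define m where "m = real (2 * N + p)"
    \<comment> \<open>For \<open>N = 0\<close> the union is empty and any positive separation will
      do; otherwise \<open>d\<close> is the gap between the slabs with indices
      \<open>2 * (N - 1) + p\<close> and \<open>2 * N + p\<close>.\<close>
    define d where "d = (if N = 0 then 1 else 1 / m - 1 / (m + 1))"
    have m: "N \<noteq> 0 \<Longrightarrow> m > 0" by (simp add: m_def)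
    have "1 / (m + 1) < 1 / m" if "N \<noteq> 0"
      using m[OF that] by (intro divide_strict_left_mono) auto
    then have d: "0 < d" by (simp add: d_def)
    have "(\<Sum>j<Suc N. ?H (R (2 * j + p))) \<le> ?H (\<Union>j<N. R (2 * j + p)) + ?H (R (2 * N + p))"
      using Suc by (simp add: add_mono)
    also have "\<dots> \<le> ?H ((\<Union>j<N. R (2 * j + p)) \<union> R (2 * N + p))"
    proof (rule hausdorff_outer_separated_coord[OF i d])
      fix x y assume x: "x \<in> (\<Union>j<N. R (2 * j + p))" and y: "y \<in> R (2 * N + p)"
      from x obtain j where j: "j < N" "x \<in> R (2 * j + p)" by auto
      have "real (2 * j + p) + 2 \<le> m" using j by (simp add: m_def)
      then have "1 / m \<le> 1 / (real (2 * j + p) + 2)" by (intro divide_left_mono) auto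
      then have "c + 1 / m \<le> x i" using j by (auto simp: R_def)
      moreover have "y i < c + 1 / (m + 1)" using y by (simp add: R_def m_def)
      ultimately show "d \<le> \<bar>x i - y i\<bar>" using j(1) by (simp add: d_def)
    qed
    also have "(\<Union>j<N. R (2 * j + p)) \<union> R (2 * N + p) = (\<Union>j<Suc N. R (2 * j + p))"
      by (auto simp: less_Suc_eq)
    finally show ?case .
  qed simp
  have sub: "(\<Union>j<N. R (2 * j + p)) \<subseteq> X" for N p by (auto simp: R_def)
  have alt': "(\<Sum>j<N. ?H (R (2 * j + p))) \<le> ?H X" for N p
    using alt[where N=N and p=p] hausdorff_outer_mono[OF sub[where N=N and p=p], of n s] by (rule order_trans)
  have "(\<Sum>j. ?H (R j)) \<le> ?H X + ?H X"
    unfolding suminf_eq_SUP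
  proof (rule SUP_least)
    fix N
    have "(\<Sum>j<N. ?H (R j)) \<le> (\<Sum>j<2 * N. ?H (R j))" by (intro sum_mono2) auto
    also have "\<dots> \<le> ?H X + ?H X"
      unfolding sum_even_odd using alt'[where N=N and p=0] alt'[where N=N and p=1] by (intro add_mono) auto
    finally show "(\<Sum>j<N. ?H (R j)) \<le> ?H X + ?H X" .
  qed
  also have "\<dots> < top" using fin by (simp add: less_top)
  finally show ?thesis by simp
qed

text \<open>Caratheodory's argument: apart from the slabs \<open>R j\<close> with
  \<open>j \<ge> k\<close>, whose total measure is small, the part with \<open>c < x i\<close> keeps
  the distance \<open>1 / (k + 1)\<close> from the half-space \<open>x i \<le> c\<close>, and for
  separated sets additivity is known.\<close>

lemma hausdorff_outer_halfspace:
  assumes i: "i < n"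
  shows "hausdorff_outer n s {x \<in> X. x i \<le> c} + hausdorff_outer n s {x \<in> X. c < x i} \<le> hausdorff_outer n s X"
proof (cases "hausdorff_outer n s X = top")
  case False
  let ?H = "hausdorff_outer n s"
  define R where "R j = {x \<in> X. c + 1 / (real j + 2) \<le> x i \<and> x i < c + 1 / (real j + 1)}" for j
  show ?thesis
  proof (rule ennreal_le_epsilon)
    fix e :: real assume "0 < e"
    then obtain k where k: "(\<Sum>j. ?H (R (j + k))) < ennreal e"
      using ennreal_tail_small[OF hausdorff_outer_annuli[OF i False]] unfolding R_def by blast
    define A where "A = {x \<in> X. c + 1 / (real k + 1) \<le> x i}"
    have "{x \<in> X. c < x i} \<subseteq> A \<union> (\<Union>j. R (j + k))"
    proof
      fix x assume x: "x \<in> {x \<in> X. c < x i}"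
      show "x \<in> A \<union> (\<Union>j. R (j + k))"
      proof (cases "x \<in> A")
        case False
        then have lt: "x i < c + 1 / (real k + 1)" using x by (auto simp: A_def)
        have "\<exists>j::nat. c + 1 / (real j + 2) \<le> x i"
        proof -
          have pos: "0 < x i - c" using x by auto
          obtain j :: nat where "1 / (x i - c) < real j" using reals_Archimedean2 by blast
          then have "1 / (real j + 2) \<le> x i - c" using pos by (simp add: field_simps)
          then show ?thesis by (auto simp: algebra_simps)
        qed
        \<comment> \<open>The least admissible \<open>j\<close> also satisfies the upper end of its
          slab, and \<open>x \<notin> A\<close> forces \<open>k \<le> j\<close>.\<close>
        define j where "j = (LEAST j::nat. c + 1 / (real j + 2) \<le> x i)"
        have j: "c + 1 / (real j + 2) \<le> x i"
          unfolding j_def using LeastI_ex[OF \<open>\<exists>j::nat. c + 1 / (real j + 2) \<le> x i\<close>] .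
        have jk: "k \<le> j"
        proof (rule ccontr)
          assume "\<not> k \<le> j"
          then have "real j + 2 \<le> real k + 1" by linarith
          then have "1 / (real k + 1) \<le> 1 / (real j + 2)" by (intro divide_left_mono) auto
          then show False using j lt by linarith
        qed
        have "x i < c + 1 / (real j + 1)"
        proof (cases j)
          case 0
          then show ?thesis using lt jk by simp
        next
          case (Suc m)
          then have "\<not> c + 1 / (real m + 2) \<le> x i" using not_less_Least[of m "\<lambda>j. c + 1 / (real j + 2) \<le> x i"] by (simp add: j_def)
          then show ?thesis using Suc by (simp add: add.commute)
        qed
        then have "x \<in> R j" using j x by (auto simp: R_def)
        then show ?thesis using jk by (metis UN_iff UnI2 UNIV_I le_add_diff_inverse2)
      qed simp
    qed
    then have "?H {x \<in> X. c < x i} \<le> ?H (A \<union> (\<Union>j. R (j + k)))" by (rule hausdorff_outer_mono)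
    also have "\<dots> \<le> ?H A + ?H (\<Union>j. R (j + k))" by (rule hausdorff_outer_Un)
    also have "\<dots> \<le> ?H A + (\<Sum>j. ?H (R (j + k)))" by (intro add_left_mono hausdorff_outer_subadditive)
    also have "\<dots> \<le> ?H A + ennreal e" using k by (intro add_left_mono) auto
    finally have "?H {x \<in> X. x i \<le> c} + ?H {x \<in> X. c < x i} \<le> (?H {x \<in> X. x i \<le> c} + ?H A) + ennreal e"
      by (simp add: add.assoc add_left_mono)
    also have "?H {x \<in> X. x i \<le> c} + ?H A \<le> ?H ({x \<in> X. x i \<le> c} \<union> A)"
      by (rule hausdorff_outer_separated_coord[OF i, of "1 / (real k + 1)"]) (auto simp: A_def)
    also have "\<dots> \<le> ?H X" by (rule hausdorff_outer_mono) (auto simp: A_def)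
    finally show "?H {x \<in> X. x i \<le> c} + ?H {x \<in> X. c < x i} \<le> ?H X + ennreal e"
      by (simp add: add_right_mono)
  qed
qed simp

lemma space_PiM_euclid: "space (\<Pi>\<^sub>M i\<in>{..<n}. (borel :: real measure)) = euclid n"
  by (simp add: space_PiM euclid_def)

text \<open>\<open>measure_of\<close> falls back to the zero measure unless the set function is
  countably additive, so \<open>hausdorff_measure\<close> has content only through this fact. The
  Caratheodory-measurable sets contain all coordinate half-spaces, hence the product
  sigma-algebra.\<close>

lemma measure_space_hausdorff_outer:
  "measure_space (euclid n) (sets (\<Pi>\<^sub>M i\<in>{..<n}. borel)) (hausdorff_outer n s)"
proof -
  let ?H = "hausdorff_outer n s" and ?E = "euclid n"
  define L where "L = lambda_system ?E (Pow ?E) ?H"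
  have "outer_measure_space (Pow ?E) ?H"
    unfolding outer_measure_space_def positive_def increasing_def countably_subadditive_def
    using hausdorff_outer_mono hausdorff_outer_subadditive by auto
  then have L: "measure_space ?E L ?H"
    unfolding L_def by (rule sigma_algebra.caratheodory_lemma[OF sigma_algebra_Pow])
  have alg: "sigma_algebra ?E L" using L by (simp add: measure_space_def)
  define M where "M = measure_of ?E L ?H"
  have M: "space M = ?E" "sets M = L"
    using sigma_algebra.sets_measure_of_eq[OF alg] sigma_algebra.space_measure_of_eq[OF alg] by (simp_all add: M_def)
  have half: "{x \<in> ?E. x i \<le> c} \<in> L" if i: "i < n" for i c
    unfolding L_def lambda_system_def
  proof (safe)
    fix X assume X: "X \<subseteq> ?E"
    have *: "{x \<in> ?E. x i \<le> c} \<inter> X = {x \<in> X. x i \<le> c}" "(?E - {x \<in> ?E. x i \<le> c}) \<inter> X = {x \<in> X. c < x i}"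
      using X by auto
    have "X = {x \<in> X. x i \<le> c} \<union> {x \<in> X. c < x i}" by auto
    then have "?H X = ?H ({x \<in> X. x i \<le> c} \<union> {x \<in> X. c < x i})" by (rule arg_cong)
    also have "\<dots> \<le> ?H {x \<in> X. x i \<le> c} + ?H {x \<in> X. c < x i}"
      by (rule hausdorff_outer_Un)
    finally have "?H X \<le> ?H {x \<in> X. x i \<le> c} + ?H {x \<in> X. c < x i}" .
    then show "?H ({x \<in> ?E. x i \<le> c} \<inter> X) + ?H ((?E - {x \<in> ?E. x i \<le> c}) \<inter> X) = ?H X"
      unfolding * by (intro antisym hausdorff_outer_halfspace i)
  qed
  have coord: "(\<lambda>x. x i) \<in> borel_measurable M" if "i < n" for i
    by (rule borel_measurableI_le) (use half[OF that] M in simp)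
  have "sets (\<Pi>\<^sub>M i\<in>{..<n}. (borel :: real measure)) \<subseteq> L"
    unfolding sets_PiM_single space_borel euclid_def[symmetric]
  proof (rule sigma_algebra.sigma_sets_subset[OF alg])
    show "{{f \<in> ?E. f i \<in> A} |i A. i \<in> {..<n} \<and> A \<in> sets (borel :: real measure)} \<subseteq> L"
    proof safe
      fix i and A :: "real set" assume "i < n" "A \<in> sets borel"
      from measurable_sets[OF coord[OF this(1)] this(2)] show "{f \<in> ?E. f i \<in> A} \<in> L"
        by (simp add: M vimage_def Int_def conj_commute)
    qed
  qed
  then show ?thesis
    using measure_down[OF L] sets.sigma_algebra_axioms[of "\<Pi>\<^sub>M i\<in>{..<n}. (borel :: real measure)"]
    by (simp add: space_PiM_euclid)
qed

lemma space_hausdorff_measure [simp]: "space (hausdorff_measure n s) = euclid n"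
  and sets_hausdorff_measure [measurable_cong]: "sets (hausdorff_measure n s) = sets (\<Pi>\<^sub>M i\<in>{..<n}. borel)"
proof -
  interpret sigma_algebra "euclid n" "sets (\<Pi>\<^sub>M i\<in>{..<n}. (borel :: real measure))"
    using measure_space_hausdorff_outer[of n s] by (simp add: measure_space_def)
  show "space (hausdorff_measure n s) = euclid n" "sets (hausdorff_measure n s) = sets (\<Pi>\<^sub>M i\<in>{..<n}. borel)"
    by (simp_all add: hausdorff_measure_def sets_measure_of_eq space_measure_of_eq)
qed

lemma emeasure_hausdorff_measure:
  "A \<in> sets (\<Pi>\<^sub>M i\<in>{..<n}. borel) \<Longrightarrow> emeasure (hausdorff_measure n s) A = hausdorff_outer n s A"
  using measure_space_hausdorff_outer[of n s] unfolding hausdorff_measure_def measure_space_def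
  by (intro emeasure_measure_of_sigma) auto

lemma hausdorff_outer_refl_le:
  assumes "A \<subseteq> euclid n"
  shows "hausdorff_outer n s (hrefl n w ` A) \<le> hausdorff_outer n s A"
  unfolding hausdorff_outer_def
proof (rule SUP_mono, rule bexI)
  fix \<delta>
  show "hausdorff_premeasure n s \<delta> (hrefl n w ` A) \<le> hausdorff_premeasure n s \<delta> A"
    unfolding hausdorff_premeasure_eq[of n s \<delta> A]
  proof (rule INF_greatest)
    fix U assume U: "U \<in> covers n \<delta> A"
    have ed: "euclid_ediam n (hrefl n w ` V) = euclid_ediam n V" for V
      unfolding euclid_ediam_def by (simp add: image_image euclid_dist_def nrm_refl_diff)
    have hw: "hweight n s (hrefl n w ` V) = hweight n s V" for V
      by (cases "V = {}") (simp_all add: hweight_def ed)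
    have "(\<lambda>i. hrefl n w ` U i) \<in> covers n \<delta> (hrefl n w ` A)"
      using U by (auto simp: covers_def ed) (metis UN_iff subsetD imageI)
    then have "hausdorff_premeasure n s \<delta> (hrefl n w ` A) \<le> (\<Sum>i. hweight n s (hrefl n w ` U i))"
      by (rule hausdorff_premeasure_le_cover)
    also have "\<dots> = (\<Sum>i. hweight n s (U i))" by (simp add: hw)
    finally show "hausdorff_premeasure n s \<delta> (hrefl n w ` A) \<le> (\<Sum>i. hweight n s (U i))" .
  qed
qed

lemma refl_vimage: "hrefl n w -` A \<inter> euclid n = hrefl n w ` A" if "A \<subseteq> euclid n"
proof safe
  fix x assume "hrefl n w x \<in> A" "x \<in> euclid n"
  then show "x \<in> hrefl n w ` A" by (intro image_eqI[of _ _ "hrefl n w x"]) (simp_all add: refl_refl)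
qed (use that in \<open>auto simp: refl_refl\<close>)

lemma hausdorff_outer_refl:
  assumes A: "A \<subseteq> euclid n"
  shows "hausdorff_outer n s (hrefl n w ` A) = hausdorff_outer n s A"
proof (rule antisym[OF hausdorff_outer_refl_le[OF A]])
  have "hrefl n w ` hrefl n w ` A = A"
    using A by (auto simp: image_image refl_refl subset_eq)
  then show "hausdorff_outer n s A \<le> hausdorff_outer n s (hrefl n w ` A)"
    using hausdorff_outer_refl_le[where A="hrefl n w ` A" and n=n and s=s and w=w] by (auto simp: image_subset_iff)
qed

lemma measurable_hausdorff_measure:
  "measurable (hausdorff_measure n s) N = measurable (euclid_lborel n) N"
  "measurable N (hausdorff_measure n s) = measurable N (euclid_lborel n)"
  by (intro measurable_cong_sets; simp add: sets_hausdorff_measure sets_euclid_lborel)+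

lemma distr_hausdorff_refl:
  "distr (hausdorff_measure n s) (hausdorff_measure n s) (hrefl n w) = hausdorff_measure n s"
proof (rule measure_eqI)
  fix A assume "A \<in> sets (distr (hausdorff_measure n s) (hausdorff_measure n s) (hrefl n w))"
  then have A: "A \<in> sets (hausdorff_measure n s)" by simp
  then have AE: "A \<subseteq> euclid n" using sets.sets_into_space by fastforce
  have T: "hrefl n w \<in> measurable (hausdorff_measure n s) (hausdorff_measure n s)"
    by (simp add: measurable_hausdorff_measure)
  have "emeasure (distr (hausdorff_measure n s) (hausdorff_measure n s) (hrefl n w)) A =
     emeasure (hausdorff_measure n s) (hrefl n w ` A)"
    using emeasure_distr[OF T A] refl_vimage[OF AE] by simp
  also have "\<dots> = hausdorff_outer n s (hrefl n w ` A)"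
    using measurable_sets[OF T A] refl_vimage[OF AE] by (intro emeasure_hausdorff_measure) (simp add: sets_hausdorff_measure)
  also have "\<dots> = emeasure (hausdorff_measure n s) A"
    using A by (simp add: hausdorff_outer_refl[OF AE] emeasure_hausdorff_measure sets_hausdorff_measure)
  finally show "emeasure (distr (hausdorff_measure n s) (hausdorff_measure n s) (hrefl n w)) A =
    emeasure (hausdorff_measure n s) A" .
qed simp

subsection \<open>The Hausdorff measure of the unit sphere\<close>

lemma unit_ball_vol_nonzero [simp]: "unit_ball_vol (real n) \<noteq> 0"
  using unit_ball_vol_pos[of "real n"] by (metis less_irrefl of_nat_0_le_iff)

section \<open>Volumes of cones over subsets of the sphere\<close>

definition edir :: "nat \<Rightarrow> (nat \<Rightarrow> real) \<Rightarrow> nat \<Rightarrow> real" where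
  "edir n x = (\<lambda>i\<in>{..<n}. x i / nrm n x)"

text \<open>The apex is left out because \<open>edir\<close> is the zero vector there and not a
  direction.\<close>

definition econe :: "nat \<Rightarrow> (nat \<Rightarrow> real) set \<Rightarrow> real \<Rightarrow> (nat \<Rightarrow> real) set" where
  "econe n C t = {x \<in> euclid n. 0 < nrm n x \<and> nrm n x \<le> t \<and> edir n x \<in> C}"

lemma edir_eq_scale: "edir n x = (\<lambda>i\<in>{..<n}. (1 / nrm n x) * x i)"
  by (simp add: edir_def)

lemma nrm_edir: "0 < nrm n x \<Longrightarrow> nrm n (edir n x) = 1"
  unfolding edir_eq_scale nrm_restrict nrm_scale by simp

lemma edir_in_euclid [simp]: "edir n x \<in> euclid n"
  by (simp add: edir_def)

lemma edir_sphere: "0 < nrm n x \<Longrightarrow> edir n x \<in> euclid_sphere n"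
  by (simp add: euclid_sphere_def nrm_edir)

lemma measurable_edir [measurable]: "edir n \<in> measurable (euclid_lborel n) (euclid_lborel n)"
  unfolding edir_def by measurable

lemma sets_euclid_sphere [measurable]: "euclid_sphere n \<in> sets (euclid_lborel n)"
proof -
  have "{x \<in> space (euclid_lborel n). nrm n x = 1} \<in> sets (euclid_lborel n)" by measurable
  then show ?thesis by (simp add: euclid_sphere_def)
qed

lemma sets_econe [measurable]:
  assumes [measurable]: "C \<in> sets (euclid_lborel n)"
  shows "econe n C t \<in> sets (euclid_lborel n)"
proof -
  have "{x \<in> space (euclid_lborel n). 0 < nrm n x \<and> nrm n x \<le> t \<and> edir n x \<in> C} \<in> sets (euclid_lborel n)"
    by measurable
  then show ?thesis by (simp add: econe_def)
qed

lemma edir_scale: "c > 0 \<Longrightarrow> edir n (\<lambda>i\<in>{..<n}. c * x i) = edir n x"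
  unfolding edir_def nrm_restrict nrm_scale by (auto simp: fun_eq_iff)

lemma emeasure_econe_scale:
  assumes t: "t > 0" and C [measurable]: "C \<in> sets (euclid_lborel n)"
  shows "emeasure (euclid_lborel n) (econe n C t) = ennreal (t ^ n) * emeasure (euclid_lborel n) (econe n C 1)"
proof -
  have "emeasure (euclid_lborel n) (econe n C t) = (\<integral>\<^sup>+x. indicator (econe n C t) x \<partial>euclid_lborel n)"
    by simp
  also have "\<dots> = ennreal (\<bar>t\<bar> ^ n) * (\<integral>\<^sup>+x. indicator (econe n C t) (\<lambda>i\<in>{..<n}. 0 + t * x i) \<partial>euclid_lborel n)"
    using t by (intro nn_integral_euclid_affine) auto
  also have "(\<integral>\<^sup>+x. indicator (econe n C t) (\<lambda>i\<in>{..<n}. 0 + t * x i) \<partial>euclid_lborel n) =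
      (\<integral>\<^sup>+x. indicator (econe n C 1) x \<partial>euclid_lborel n)"
  proof (rule nn_integral_cong)
    fix x assume "x \<in> space (euclid_lborel n)"
    then have "(\<lambda>i\<in>{..<n}. t * x i) \<in> econe n C t \<longleftrightarrow> x \<in> econe n C 1"
      using t unfolding econe_def by (simp add: edir_scale nrm_scale zero_less_mult_iff)
    then show "indicator (econe n C t) (\<lambda>i\<in>{..<n}. 0 + t * x i) = (indicator (econe n C 1) x :: ennreal)"
      by (simp add: indicator_def)
  qed
  finally show ?thesis using t by simp
qed

lemma emeasure_punctured_ball:
  "emeasure (euclid_lborel n) (econe n (euclid n) 1) = ennreal (unit_ball_vol (real n))" if "n > 0"
proof -
  have "emeasure (euclid_lborel n) {x \<in> euclid n. nrm n x \<le> 0} = 0"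
    using that by (simp add: emeasure_euclid_ball)
  moreover have "econe n (euclid n) 1 = {x \<in> euclid n. nrm n x \<le> 1} - {x \<in> euclid n. nrm n x \<le> 0}"
    by (auto simp: econe_def)
  ultimately have "emeasure (euclid_lborel n) (econe n (euclid n) 1) = emeasure (euclid_lborel n) {x \<in> euclid n. nrm n x \<le> 1}"
    using emeasure_Diff_null_set[of "{x \<in> euclid n. nrm n x \<le> 0}" "euclid_lborel n" "{x \<in> euclid n. nrm n x \<le> 1}"]
    by (simp add: null_setsI sets_euclid_ball)
  then show ?thesis by (simp add: emeasure_euclid_ball)
qed

lemma sets_euclid [measurable]: "euclid n \<in> sets (euclid_lborel n)"
  using sets.top[of "euclid_lborel n"] by simp

lemma emeasure_econe_le:
  assumes "n > 0"
  shows "emeasure (euclid_lborel n) (econe n C 1) \<le> ennreal (unit_ball_vol (real n))"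
  unfolding emeasure_punctured_ball[OF assms, symmetric]
  by (intro emeasure_mono sets_econe sets_euclid) (auto simp: econe_def)

lemma emeasure_econe_eq:
  assumes "n > 0"
  shows "emeasure (euclid_lborel n) (econe n C 1) = ennreal (measure (euclid_lborel n) (econe n C 1))"
  using le_less_trans[OF emeasure_econe_le[OF assms] ennreal_less_top]
  by (intro emeasure_eq_ennreal_measure) (simp only: less_top)

lemma measurable_embed [measurable]: "(\<lambda>x. x) \<in> borel_measurable (euclid_lborel n)"
proof -
  have "(\<lambda>x. x) \<in> measurable (euclid_lborel n) (\<Pi>\<^sub>M i\<in>UNIV. borel :: real measure)"
    by (rule measurable_PiM_single') auto
  then show ?thesis by (simp cong: measurable_cong_sets add: sets_PiM_equal_borel)
qed

lemma sets_closure: "closure U \<inter> euclid n \<in> sets (euclid_lborel n)"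
  using measurable_sets[OF measurable_embed[of n], of "closure U"] by simp

lemma continuous_nrm_diff: "continuous_on UNIV (\<lambda>z. nrm n (\<lambda>i. fst z i - snd z i))"
  unfolding L2_set_def
  by (intro continuous_intros continuous_on_compose2[OF continuous_on_product_coordinates]) auto

text \<open>Covering sets in the Hausdorff premeasure are arbitrary subsets of
  \<open>euclid n\<close>. Their closures are measurable and obey the same diameter bound, so the
  cones over them have volumes to compare.\<close>

lemma diam_closure:
  assumes "\<And>x y. x \<in> U \<Longrightarrow> y \<in> U \<Longrightarrow> nrm n (\<lambda>i. x i - y i) \<le> d" "x \<in> closure U" "y \<in> closure U"
  shows "nrm n (\<lambda>i. x i - y i) \<le> d"
proof -
  have "closure (U \<times> U) \<subseteq> {z. nrm n (\<lambda>i. fst z i - snd z i) \<le> d}"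
    using assms(1) by (intro closure_minimal closed_Collect_le continuous_nrm_diff continuous_on_const) auto
  then show ?thesis using assms(2,3) by (auto simp: closure_Times)
qed

text \<open>The law of cosines with the radial and the angular part separated.\<close>

lemma nrm_edir_diff:
  assumes "0 < nrm n x" "0 < nrm n y"
  shows "(nrm n (\<lambda>i. x i - y i))\<^sup>2 = (nrm n x - nrm n y)\<^sup>2 + nrm n x * nrm n y * (nrm n (\<lambda>i. edir n x i - edir n y i))\<^sup>2"
proof -
  have "ip n (edir n x) (edir n y) = ip n x y / (nrm n x * nrm n y)"
    unfolding edir_eq_scale ip_restrict ip_scale by simp
  then show ?thesis
    using assms unfolding nrm_diff_power2 by (simp add: nrm_edir field_simps power2_eq_square)
qed

text \<open>A thin shell suits a set \<open>C\<close> of small diameter, whereas the diameter of the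
  full cone is of order 1. The shell \<open>1 < nrm n x \<le> 1 + t\<close> over \<open>C\<close>
  has squared diameter at most \<open>t\<^sup>2 + (1 + t)\<^sup>2 * d\<^sup>2\<close> and, by
  Bernoulli's inequality, at least \<open>n * t\<close> times the volume of the unit cone.\<close>

lemma cone_isodiametric:
  assumes C [measurable]: "C \<in> sets (euclid_lborel n)" and d: "d \<ge> 0" and t: "t > 0" and n: "n > 0"
    and diam: "\<And>u v. u \<in> C \<Longrightarrow> v \<in> C \<Longrightarrow> nrm n (\<lambda>i. u i - v i) \<le> d"
  shows "ennreal (real n * t) * emeasure (euclid_lborel n) (econe n C 1) \<le>
    ennreal (unit_ball_vol (real n) * (sqrt (t\<^sup>2 + (1 + t)\<^sup>2 * d\<^sup>2) / 2) ^ n)"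
proof -
  let ?L = "euclid_lborel n"
  define w where "w = measure ?L (econe n C 1)"
  have w: "emeasure ?L (econe n C 1) = ennreal w" "w \<ge> 0"
    using emeasure_econe_eq[OF n, of C] by (auto simp: w_def)
  define W where "W = econe n C (1 + t) - econe n C 1"
  have "emeasure ?L W \<le> ennreal (unit_ball_vol (real n) * (sqrt (t\<^sup>2 + (1 + t)\<^sup>2 * d\<^sup>2) / 2) ^ n)"
  proof (rule isodiametric)
    fix x y assume x: "x \<in> W" and y: "y \<in> W"
    have xy: "1 < nrm n x" "nrm n x \<le> 1 + t" "1 < nrm n y" "nrm n y \<le> 1 + t" "edir n x \<in> C" "edir n y \<in> C"
      using x y by (auto simp: W_def econe_def)
    have "(nrm n (\<lambda>i. x i - y i))\<^sup>2 = (nrm n x - nrm n y)\<^sup>2 + nrm n x * nrm n y * (nrm n (\<lambda>i. edir n x i - edir n y i))\<^sup>2"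
      using xy by (intro nrm_edir_diff) auto
    also have "\<dots> \<le> t\<^sup>2 + (1 + t) * (1 + t) * d\<^sup>2"
      using xy diam[OF xy(5,6)] t d
      by (intro add_mono mult_mono power_mono abs_le_square_iff[THEN iffD1]) auto
    finally show "nrm n (\<lambda>i. x i - y i) \<le> sqrt (t\<^sup>2 + (1 + t)\<^sup>2 * d\<^sup>2)"
      by (intro real_le_rsqrt) (simp add: power2_eq_square)
  qed (auto simp: W_def)
  moreover have "emeasure ?L W = ennreal (((1 + t) ^ n - 1) * w)"
  proof -
    have "emeasure ?L W = emeasure ?L (econe n C (1 + t)) - emeasure ?L (econe n C 1)"
      unfolding W_def
    proof (intro emeasure_Diff sets_econe C)
      show "econe n C 1 \<subseteq> econe n C (1 + t)" using t by (auto simp: econe_def)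
      show "emeasure ?L (econe n C 1) \<noteq> \<infinity>" by (simp add: w)
    qed
    also have "\<dots> = ennreal ((1 + t) ^ n) * ennreal w - ennreal w"
      using t by (subst emeasure_econe_scale) (auto simp: w)
    also have "\<dots> = ennreal ((1 + t) ^ n * w - w)"
      using t w(2) by (simp add: ennreal_mult[symmetric] ennreal_minus)
    finally show ?thesis by (simp add: algebra_simps)
  qed
  moreover have "real n * t * w \<le> ((1 + t) ^ n - 1) * w"
    using Bernoulli_inequality[of t n] t w(2) by (intro mult_right_mono) auto
  ultimately show ?thesis
    using t w by (simp add: ennreal_mult[symmetric])
qed

text \<open>The choice \<open>t = d / sqrt n\<close> balances two effects of the thickness. It adds
  \<open>d\<^sup>2 / n\<close> to the squared diameter, and a factor \<open>1 + 2 / n\<close> under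
  the square root costs at most \<open>exp 1\<close> after the \<open>n\<close>-th power; the shell
  volume in turn gains \<open>n * t = sqrt n * d\<close>. The restriction
  \<open>d \<le> 1 / (3 * n)\<close> keeps \<open>(1 + t)\<^sup>2 \<le> 1 + 1 / n\<close>.\<close>

lemma cone_isodiametric_small:
  assumes C: "C \<in> sets (euclid_lborel n)" and n: "n > 0" and d: "0 < d" "d \<le> 1 / (3 * real n)"
    and diam: "\<And>u v. u \<in> C \<Longrightarrow> v \<in> C \<Longrightarrow> nrm n (\<lambda>i. u i - v i) \<le> d"
  shows "emeasure (euclid_lborel n) (econe n C 1) \<le>
    ennreal (unit_ball_vol (real n) * exp 1 / (2 * sqrt (real n)) * (d / 2) ^ (n - 1))"
proof -
  define w where "w = measure (euclid_lborel n) (econe n C 1)"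
  have w: "emeasure (euclid_lborel n) (econe n C 1) = ennreal w" "w \<ge> 0"
    using emeasure_econe_eq[OF n, of C] by (auto simp: w_def)
  define \<kappa> where "\<kappa> = unit_ball_vol (real n)"
  have \<kappa>: "\<kappa> > 0" by (simp add: \<kappa>_def)
  define s where "s = sqrt (real n)"
  have s: "s \<ge> 1" "s * s = real n" using n by (auto simp: s_def)
  define t where "t = d / s"
  have t: "t > 0" "t \<le> d" using d s by (auto simp: t_def field_simps)
  have "1 / (3 * real n) \<le> 1" using n by simp
  then have d1: "d \<le> 1" using d by linarith
  have "t * t \<le> t * 1" using t d1 by (intro mult_left_mono) auto
  then have "(1 + t)\<^sup>2 \<le> 1 + 3 * t" by (simp add: power2_eq_square algebra_simps)
  also have "\<dots> \<le> 1 + 1 / real n"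
  proof -
    have "3 * d \<le> 1 / real n" using d n by (simp add: field_simps)
    then show ?thesis using t by linarith
  qed
  finally have t1: "(1 + t)\<^sup>2 \<le> 1 + 1 / real n" .
  have t2: "t\<^sup>2 = d\<^sup>2 / real n" using s by (simp add: t_def power2_eq_square)
  have "t\<^sup>2 + (1 + t)\<^sup>2 * d\<^sup>2 \<le> d\<^sup>2 / real n + (1 + 1 / real n) * d\<^sup>2"
    using t1 t2 by (intro add_mono mult_right_mono) auto
  also have "\<dots> = d\<^sup>2 * (1 + 2 / real n)" by (simp add: algebra_simps)
  also have "\<dots> \<le> d\<^sup>2 * exp (2 / real n)" by (intro mult_left_mono exp_ge_add_one_self) auto
  also have "\<dots> = (d * exp (1 / real n))\<^sup>2"
    by (simp add: power_mult_distrib exp_double[symmetric])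
  finally have "sqrt (t\<^sup>2 + (1 + t)\<^sup>2 * d\<^sup>2) \<le> d * exp (1 / real n)"
    using d by (intro real_le_lsqrt) auto
  then have "(sqrt (t\<^sup>2 + (1 + t)\<^sup>2 * d\<^sup>2) / 2) ^ n \<le> (d * exp (1 / real n) / 2) ^ n"
    by (intro power_mono) auto
  also have "\<dots> = (d / 2) ^ n * exp 1"
    using n by (simp add: power_mult_distrib power_divide exp_of_nat_mult[symmetric])
  finally have le: "\<kappa> * (sqrt (t\<^sup>2 + (1 + t)\<^sup>2 * d\<^sup>2) / 2) ^ n \<le> \<kappa> * ((d / 2) ^ n * exp 1)"
    using \<kappa> by (intro mult_left_mono) auto
  have "ennreal (real n * t * w) \<le> ennreal (\<kappa> * (sqrt (t\<^sup>2 + (1 + t)\<^sup>2 * d\<^sup>2) / 2) ^ n)"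
  proof -
    have "ennreal (real n * t * w) = ennreal (real n * t) * emeasure (euclid_lborel n) (econe n C 1)"
      unfolding w(1) using t w(2) by (intro ennreal_mult) auto
    then show ?thesis
      unfolding \<kappa>_def by (simp only:) (rule cone_isodiametric[OF C less_imp_le[OF d(1)] t(1) n diam])
  qed
  then have "real n * t * w \<le> \<kappa> * (sqrt (t\<^sup>2 + (1 + t)\<^sup>2 * d\<^sup>2) / 2) ^ n"
    using \<kappa> by (subst (asm) ennreal_le_iff) auto
  with le have "real n * t * w \<le> \<kappa> * ((d / 2) ^ n * exp 1)" by linarith
  also have "real n * t = s * d" using s by (simp add: t_def field_simps flip: s(2))
  also have "(d / 2) ^ n = (d / 2) * (d / 2) ^ (n - 1)" using n by (cases n) auto
  finally have "d * (s * w) \<le> d * (\<kappa> * exp 1 / 2 * (d / 2) ^ (n - 1))" by (simp add: algebra_simps)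
  then have "s * w \<le> \<kappa> * exp 1 / 2 * (d / 2) ^ (n - 1)" using d by simp
  then have "w \<le> \<kappa> * exp 1 / (2 * s) * (d / 2) ^ (n - 1)" using s by (simp add: field_simps)
  then show ?thesis unfolding w \<kappa>_def s_def by (rule ennreal_leI)
qed

lemma cone_le_hweight:
  assumes n: "n \<ge> 2" and U: "U \<subseteq> euclid n" "euclid_ediam n U \<le> ennreal (1 / (3 * real n))"
  shows "emeasure (euclid_lborel n) (econe n (closure U \<inter> euclid n) 1) \<le>
    ennreal (unit_ball_vol (real n) * exp 1 / (2 * sqrt (real n) * unit_ball_vol (real (n - 1)))) * hweight n (n - 1) U"
proof (cases "U = {}")
  case True
  then show ?thesis by (simp add: econe_def)
next
  case False
  let ?C = "closure U \<inter> euclid n"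
  define K where "K = unit_ball_vol (real n) * exp 1 / (2 * sqrt (real n))"
  have K: "K > 0" using n by (simp add: K_def)
  define \<kappa>' where "\<kappa>' = unit_ball_vol (real (n - 1))"
  have \<kappa>': "\<kappa>' > 0" unfolding \<kappa>'_def by (rule unit_ball_vol_pos) simp
  obtain d where d: "euclid_ediam n U = ennreal d" "0 \<le> d"
    using U(2) by (cases "euclid_ediam n U") (auto simp: top_unique)
  have d1: "d \<le> 1 / (3 * real n)" using U(2) d n by (simp add: ennreal_le_iff2)
  have "nrm n (\<lambda>i. x i - y i) \<le> d" if "x \<in> U" "y \<in> U" for x y
    using dist_le_euclid_ediam[OF that, of n] d by (simp add: euclid_dist_def)
  then have diam: "nrm n (\<lambda>i. x i - y i) \<le> d" if "x \<in> ?C" "y \<in> ?C" for x y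
    using that diam_closure by blast
  have le: "emeasure (euclid_lborel n) (econe n ?C 1) \<le> ennreal (K * (d' / 2) ^ (n - 1))"
    if "d \<le> d'" "0 < d'" "d' \<le> 1 / (3 * real n)" for d'
    unfolding K_def using n that diam
    by (intro cone_isodiametric_small sets_closure) (auto intro: order_trans)
  have "emeasure (euclid_lborel n) (econe n ?C 1) \<le> ennreal (K * (d / 2) ^ (n - 1))"
  proof (cases "d = 0")
    case True
    define w where "w = measure (euclid_lborel n) (econe n ?C 1)"
    have w: "emeasure (euclid_lborel n) (econe n ?C 1) = ennreal w" "w \<ge> 0"
      using emeasure_econe_eq[of n ?C] n by (auto simp: w_def)
    have "w \<le> 0"
    proof (rule ccontr)
      assume "\<not> w \<le> 0"
      \<comment> \<open>For a set of diameter 0 the estimate holds at every small positive scale.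
        Since \<open>n \<ge> 2\<close>, \<open>K * (d' / 2) ^ (n - 1)\<close> is at most
        \<open>K * d' / 2\<close>, so a scale up to \<open>w / K\<close> gives
        \<open>w \<le> w / 2\<close>.\<close>
      define d' where "d' = min (1 / (3 * real n)) (w / K)"
      have d': "0 < d'" "d' \<le> 1 / (3 * real n)" "d' \<le> w / K" using \<open>\<not> w \<le> 0\<close> K n by (auto simp: d'_def)
      have "1 / (3 * real n) \<le> 1" using n by simp
      then have "d' / 2 \<le> 1" using d' by linarith
      then have "(d' / 2) ^ (n - 1) \<le> (d' / 2) ^ 1" using d' n by (intro power_decreasing) auto
      then have "K * (d' / 2) ^ (n - 1) \<le> K * (d' / 2)" using K by simp
      also have "\<dots> \<le> w / 2" using d' K by (simp add: field_simps)
      finally have "K * (d' / 2) ^ (n - 1) \<le> w / 2" .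
      moreover have "w \<le> K * (d' / 2) ^ (n - 1)"
      proof -
        have "ennreal w \<le> ennreal (K * (d' / 2) ^ (n - 1))" using le[of d'] d' True w by simp
        then show ?thesis using d' K by (subst (asm) ennreal_le_iff) auto
      qed
      ultimately show False using \<open>\<not> w \<le> 0\<close> by linarith
    qed
    then show ?thesis using w by simp
  qed (use le[of d] d d1 in auto)
  also have "ennreal (K * (d / 2) ^ (n - 1)) = ennreal (K / \<kappa>' * (\<kappa>' / 2 ^ (n - 1) * d ^ (n - 1)))"
    using \<kappa>' by (simp add: power_divide)
  also have "\<dots> = ennreal (K / \<kappa>') * ennreal (\<kappa>' / 2 ^ (n - 1) * d ^ (n - 1))"
    using \<kappa>' K d by (intro ennreal_mult) auto
  also have "ennreal (\<kappa>' / 2 ^ (n - 1) * d ^ (n - 1)) = hweight n (n - 1) U"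
  proof -
    have "ennreal (\<kappa>' / 2 ^ (n - 1) * d ^ (n - 1)) = ennreal (\<kappa>' / 2 ^ (n - 1)) * ennreal (d ^ (n - 1))"
      using \<kappa>' d by (intro ennreal_mult) auto
    also have "\<dots> = hweight n (n - 1) U"
      unfolding hweight_def d(1) \<kappa>'_def using False d(2) by (simp only: ennreal_power if_False)
    finally show ?thesis .
  qed
  finally show ?thesis by (simp add: K_def \<kappa>'_def)
qed

text \<open>The cones over a cover of the sphere cover the punctured unit ball, so their volumes add
  up to at least \<open>unit_ball_vol n\<close>; \<open>cone_le_hweight\<close> compares each with
  its Hausdorff weight, which dictates the scale \<open>1 / (3 * n)\<close>.\<close>

lemma hausdorff_sphere_lower_aux:
  assumes n: "n \<ge> 2"
  shows "ennreal (2 * sqrt (real n) * unit_ball_vol (real (n - 1)) / exp 1) \<le> hausdorff_outer n (n - 1) (euclid_sphere n)"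
proof -
  let ?L = "euclid_lborel n"
  define K where "K = unit_ball_vol (real n) * exp 1 / (2 * sqrt (real n) * unit_ball_vol (real (n - 1)))"
  have K: "K > 0" using n by (simp add: K_def)
  define \<delta> where "\<delta> = ennreal (1 / (3 * real n))"
  have "ennreal (2 * sqrt (real n) * unit_ball_vol (real (n - 1)) / exp 1) \<le> hausdorff_premeasure n (n - 1) \<delta> (euclid_sphere n)"
    unfolding hausdorff_premeasure_eq
  proof (rule INF_greatest)
    fix U assume U: "U \<in> covers n \<delta> (euclid_sphere n)"
    have "econe n (euclid n) 1 \<subseteq> (\<Union>i. econe n (closure (U i) \<inter> euclid n) 1)"
    proof
      fix x assume x: "x \<in> econe n (euclid n) 1"
      then have "edir n x \<in> euclid_sphere n" by (auto simp: econe_def intro: edir_sphere)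
      then obtain i where "edir n x \<in> U i" using coversD(1)[OF U] by blast
      then have "x \<in> econe n (closure (U i) \<inter> euclid n) 1" using x closure_subset by (auto simp: econe_def)
      then show "x \<in> (\<Union>i. econe n (closure (U i) \<inter> euclid n) 1)" by blast
    qed
    then have "emeasure ?L (econe n (euclid n) 1) \<le> emeasure ?L (\<Union>i. econe n (closure (U i) \<inter> euclid n) 1)"
      by (intro emeasure_mono sets.countable_UN) (auto intro: sets_econe sets_closure)
    also have "\<dots> \<le> (\<Sum>i. emeasure ?L (econe n (closure (U i) \<inter> euclid n) 1))"
      by (intro emeasure_subadditive_countably) (auto intro: sets_econe sets_closure)
    also have "\<dots> \<le> (\<Sum>i. ennreal K * hweight n (n - 1) (U i))"
      unfolding K_def using n coversD[OF U] by (intro suminf_le cone_le_hweight) (auto simp: \<delta>_def)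
    finally have "ennreal (unit_ball_vol (real n)) \<le> ennreal K * (\<Sum>i. hweight n (n - 1) (U i))"
      using n by (simp add: emeasure_punctured_ball)
    then have "ennreal (1 / K) * ennreal (unit_ball_vol (real n)) \<le> ennreal (1 / K) * (ennreal K * (\<Sum>i. hweight n (n - 1) (U i)))"
      by (rule mult_left_mono) simp
    also have "\<dots> = (\<Sum>i. hweight n (n - 1) (U i))"
      using K by (simp add: mult.assoc[symmetric] ennreal_mult[symmetric])
    also have "ennreal (1 / K) * ennreal (unit_ball_vol (real n)) = ennreal (2 * sqrt (real n) * unit_ball_vol (real (n - 1)) / exp 1)"
      using K n unit_ball_vol_nonzero[of "n - 1"] by (simp add: ennreal_mult[symmetric] K_def del: of_nat_diff)
    finally show "ennreal (2 * sqrt (real n) * unit_ball_vol (real (n - 1)) / exp 1) \<le> (\<Sum>i. hweight n (n - 1) (U i))" .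
  qed
  also have "\<dots> \<le> hausdorff_outer n (n - 1) (euclid_sphere n)"
    using n by (intro hausdorff_premeasure_le_outer) (simp add: \<delta>_def)
  finally show ?thesis .
qed

text \<open>Log-convexity at the midpoint of \<open>x\<close> and \<open>x + 1\<close>, combined
  with \<open>Gamma (x + 1) = x * Gamma x\<close>.\<close>

lemma Gamma_half_step:
  assumes x: "x > (0::real)"
  shows "sqrt x * Gamma (x + 1 / 2) \<le> Gamma (x + 1)"
proof -
  have pos: "Gamma x > 0" "Gamma (x + 1) > 0" "Gamma (x + 1 / 2) > 0" using x by (auto intro!: Gamma_real_pos)
  have "(ln \<circ> Gamma) ((1 - 1 / 2) *\<^sub>R x + (1 / 2) *\<^sub>R (x + 1)) \<le> (1 - 1 / 2) * (ln \<circ> Gamma) x + (1 / 2) * (ln \<circ> Gamma) (x + 1)"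
    by (rule convex_onD[OF log_convex_Gamma_real]) (use x in auto)
  moreover have "(1 - 1 / 2) *\<^sub>R x + (1 / 2) *\<^sub>R (x + 1) = x + 1 / 2" by (simp add: field_simps)
  ultimately have "2 * ln (Gamma (x + 1 / 2)) \<le> ln (Gamma x) + ln (Gamma (x + 1))" by simp
  then have "ln ((Gamma (x + 1 / 2))\<^sup>2) \<le> ln (Gamma x * Gamma (x + 1))"
    using pos by (simp add: ln_mult ln_realpow)
  then have "(Gamma (x + 1 / 2))\<^sup>2 \<le> Gamma x * Gamma (x + 1)"
    using pos by (subst (asm) ln_le_cancel_iff) auto
  then have "x * (Gamma (x + 1 / 2))\<^sup>2 \<le> (x * Gamma x) * Gamma (x + 1)"
    using x by (simp add: mult.assoc mult_left_mono)
  also have "x * Gamma x = Gamma (x + 1)"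
    using x by (subst Gamma_plus1) (auto simp: nonpos_Ints_def)
  finally have "x * (Gamma (x + 1 / 2))\<^sup>2 \<le> (Gamma (x + 1))\<^sup>2" by (simp add: power2_eq_square)
  then have "sqrt (x * (Gamma (x + 1 / 2))\<^sup>2) \<le> sqrt ((Gamma (x + 1))\<^sup>2)" by (rule real_sqrt_le_mono)
  then show ?thesis using x Gamma_real_pos[of "x + 1 / 2"] Gamma_real_pos[of "x + 1"] by (simp add: real_sqrt_mult)
qed

text \<open>This is \<open>Gamma_half_step\<close> at \<open>x = n / 2\<close>. It turns the factor
  \<open>sqrt n * unit_ball_vol (n - 1)\<close> of the cone estimate into a multiple of
  \<open>n * unit_ball_vol n\<close>.\<close>

lemma unit_ball_vol_ratio:
  assumes "n \<ge> 1"
  shows "sqrt (real n / (2 * pi)) * unit_ball_vol (real n) \<le> unit_ball_vol (real (n - 1))"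
proof -
  have g: "Gamma (real n / 2 + 1) > 0" "Gamma (real n / 2 + 1 / 2) > 0" by (auto intro!: Gamma_real_pos)
  have p: "pi powr (real n / 2) = pi powr (real (n - 1) / 2) * sqrt pi"
    using assms by (simp add: powr_half_sqrt[symmetric] powr_add[symmetric] of_nat_diff field_simps)
  have "sqrt (real n / 2) * Gamma (real n / 2 + 1 / 2) \<le> Gamma (real n / 2 + 1)"
    using assms by (intro Gamma_half_step) auto
  then have "sqrt (real n / 2) / Gamma (real n / 2 + 1) \<le> 1 / Gamma (real n / 2 + 1 / 2)"
    using g by (simp add: field_simps)
  then have "pi powr (real (n - 1) / 2) * (sqrt (real n / 2) / Gamma (real n / 2 + 1)) \<le>
      pi powr (real (n - 1) / 2) * (1 / Gamma (real n / 2 + 1 / 2))"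
    by (intro mult_left_mono) auto
  moreover have "sqrt (real n / 2) = sqrt (real n / (2 * pi)) * sqrt pi"
    by (simp add: real_sqrt_mult[symmetric])
  moreover have "real (n - 1) / 2 + 1 = real n / 2 + 1 / 2" using assms by (simp add: of_nat_diff field_simps)
  ultimately show ?thesis
    unfolding unit_ball_vol_def p by (simp only: mult_ac times_divide_eq_left times_divide_eq_right mult_1_left)
qed

lemma hausdorff_sphere_lower:
  assumes n: "n \<ge> 2"
  shows "ennreal (2 / (exp 1 * sqrt (2 * pi)) * (real n * unit_ball_vol (real n))) \<le>
    emeasure (hausdorff_measure n (n - 1)) (euclid_sphere n)"
proof -
  have "real n / sqrt (2 * pi) = sqrt (real n) * sqrt (real n / (2 * pi))"
    by (simp add: real_sqrt_mult real_sqrt_divide)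
  then have "2 / (exp 1 * sqrt (2 * pi)) * (real n * unit_ball_vol (real n)) =
      2 * sqrt (real n) * (sqrt (real n / (2 * pi)) * unit_ball_vol (real n)) / exp 1"
    by (simp add: field_simps)
  also have "\<dots> \<le> 2 * sqrt (real n) * unit_ball_vol (real (n - 1)) / exp 1"
    using unit_ball_vol_ratio[of n] n by (intro divide_right_mono mult_left_mono) auto
  finally show ?thesis
    using hausdorff_sphere_lower_aux[OF n] sets_euclid_sphere[of n]
    by (subst emeasure_hausdorff_measure) (auto simp: sets_euclid_lborel intro: order_trans ennreal_leI)
qed

section \<open>Covering the sphere by caps\<close>

definition cap :: "nat \<Rightarrow> real \<Rightarrow> (nat \<Rightarrow> real) \<Rightarrow> (nat \<Rightarrow> real) set" where
  "cap n \<rho> v = {u \<in> euclid_sphere n. nrm n (\<lambda>i. u i - v i) \<le> \<rho>}"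

lemma sphere_subset: "u \<in> euclid_sphere n \<Longrightarrow> u \<in> euclid n" "u \<in> euclid_sphere n \<Longrightarrow> nrm n u = 1"
  by (auto simp: euclid_sphere_def)

lemma sets_cap [measurable]: "cap n \<rho> v \<in> sets (euclid_lborel n)"
proof -
  have "{u \<in> space (euclid_lborel n). nrm n u = 1 \<and> nrm n (\<lambda>i. u i - v i) \<le> \<rho>} \<in> sets (euclid_lborel n)"
    by measurable
  then show ?thesis by (simp add: cap_def euclid_sphere_def conj_assoc)
qed

text \<open>The last basis vector, so that inner products with it read off the coordinate split off
  by \<open>nn_integral_euclid_Suc\<close>.\<close>

definition pole :: "nat \<Rightarrow> nat \<Rightarrow> real" where
  "pole n = (\<lambda>i\<in>{..<n}. if Suc i = n then 1 else 0)"

lemma ip_pole: "ip (Suc m) x (pole (Suc m)) = x m"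
  by (simp add: euclid_inner_def pole_def lessThan_Suc)

lemma pole_sphere: "n > 0 \<Longrightarrow> pole n \<in> euclid_sphere n"
proof (cases n)
  case (Suc m)
  have "(nrm n (pole n))\<^sup>2 = 1" unfolding nrm_power2 Suc ip_pole by (simp add: pole_def)
  then have "nrm n (pole n) = 1"
    using L2_set_nonneg[of "pole n" "{..<n}"] unfolding power2_eq_1_iff by linarith
  then show ?thesis unfolding euclid_sphere_def by (simp add: pole_def)
qed simp

lemma hrefl_scale: "hrefl n w (\<lambda>i\<in>{..<n}. c * x i) = (\<lambda>i\<in>{..<n}. c * hrefl n w x i)"
  by (auto simp: hrefl_def algebra_simps fun_eq_iff)

lemma edir_refl: "edir n (hrefl n w x) = hrefl n w (edir n x)"
  unfolding edir_eq_scale nrm_refl hrefl_scale ..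

lemma emeasure_econe_cap:
  assumes u: "u \<in> euclid_sphere n" and v: "v \<in> euclid_sphere n"
  shows "emeasure (euclid_lborel n) (econe n (cap n \<rho> u) 1) = emeasure (euclid_lborel n) (econe n (cap n \<rho> v) 1)"
proof -
  let ?R = "hrefl n (\<lambda>i. v i - u i)"
  have R: "?R v = u" by (rule refl_maps[OF v u])
  have "emeasure (euclid_lborel n) (econe n (cap n \<rho> u) 1) = (\<integral>\<^sup>+x. indicator (econe n (cap n \<rho> u) 1) x \<partial>euclid_lborel n)"
    by simp
  also have "\<dots> = (\<integral>\<^sup>+x. indicator (econe n (cap n \<rho> u) 1) (?R x) \<partial>euclid_lborel n)"
    by (rule nn_integral_refl[symmetric]) measurable
  also have "\<dots> = (\<integral>\<^sup>+x. indicator (econe n (cap n \<rho> v) 1) x \<partial>euclid_lborel n)"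
  proof (rule nn_integral_cong)
    fix x assume x: "x \<in> space (euclid_lborel n)"
    have "nrm n (\<lambda>i. ?R (edir n x) i - u i) = nrm n (\<lambda>i. edir n x i - v i)"
      using nrm_refl_diff[of n "\<lambda>i. v i - u i" "edir n x" v] by (simp only: R)
    then have "?R x \<in> econe n (cap n \<rho> u) 1 \<longleftrightarrow> x \<in> econe n (cap n \<rho> v) 1"
      using x by (auto simp: econe_def cap_def edir_refl nrm_edir intro: edir_sphere)
    then show "indicator (econe n (cap n \<rho> u) 1) (?R x) = (indicator (econe n (cap n \<rho> v) 1) x :: ennreal)"
      by (simp add: indicator_def)
  qed
  finally show ?thesis by simp
qed

lemma emeasure_lborel_box_cone:
  assumes m: "m \<ge> 1" and h: "h > 0" and \<rho>: "\<rho> > 0"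
  shows "emeasure (euclid_lborel (Suc m)) {x \<in> euclid (Suc m). 0 < x m \<and> x m \<le> h \<and> nrm m x \<le> \<rho> * x m} =
    ennreal (unit_ball_vol (real m) * \<rho> ^ m * h ^ Suc m / real (Suc m))"
proof -
  define Q where "Q = {x \<in> euclid (Suc m). 0 < x m \<and> x m \<le> h \<and> nrm m x \<le> \<rho> * x m}"
  have Q [measurable]: "Q \<in> sets (euclid_lborel (Suc m))"
  proof -
    let ?L = "euclid_lborel (Suc m)"
    have "{x \<in> space ?L. nrm m x \<le> \<rho> * x m} \<in> sets ?L"
      by (intro borel_measurable_le borel_measurable_times borel_measurable_const measurable_nrm measurable_coordinate)
    moreover have "{x \<in> space ?L. 0 < x m \<and> x m \<le> h} \<in> sets ?L" by measurable
    moreover have "Q = {x \<in> space ?L. nrm m x \<le> \<rho> * x m} \<inter> {x \<in> space ?L. 0 < x m \<and> x m \<le> h}"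
      by (auto simp: Q_def)
    ultimately show ?thesis by auto
  qed
  have "emeasure (euclid_lborel (Suc m)) Q = (\<integral>\<^sup>+x. indicator Q x \<partial>euclid_lborel (Suc m))"
    using Q by simp
  also have "\<dots> = (\<integral>\<^sup>+y. \<integral>\<^sup>+x. indicator Q (x(m := y)) \<partial>euclid_lborel m \<partial>lborel)"
    by (intro nn_integral_euclid_Suc) measurable
  also have "\<dots> = (\<integral>\<^sup>+y. ennreal (unit_ball_vol (real m) * \<rho> ^ m * y ^ m) * indicator {0..h} y \<partial>lborel)"
  proof (rule nn_integral_cong)
    fix y :: real
    have upd: "x(m := y) \<in> euclid (Suc m)" "nrm m (x(m := y)) = nrm m x" if "x \<in> euclid m" for x
      using that by (auto simp: euclid_def PiE_iff extensional_def L2_set_def)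
    show "(\<integral>\<^sup>+x. indicator Q (x(m := y)) \<partial>euclid_lborel m) = ennreal (unit_ball_vol (real m) * \<rho> ^ m * y ^ m) * indicator {0..h} y"
    proof (cases "0 < y \<and> y \<le> h")
      case True
      have "(\<integral>\<^sup>+x. indicator Q (x(m := y)) \<partial>euclid_lborel m) = (\<integral>\<^sup>+x. indicator {x \<in> euclid m. nrm m x \<le> \<rho> * y} x \<partial>euclid_lborel m)"
        using True upd by (intro nn_integral_cong) (auto simp: Q_def indicator_def)
      also have "\<dots> = ennreal (unit_ball_vol (real m) * (\<rho> * y) ^ m)"
        using True \<rho> by (simp add: sets_euclid_ball emeasure_euclid_ball)
      finally show ?thesis using True by (simp add: power_mult_distrib mult.assoc)
    next
      case False
      then have "(\<integral>\<^sup>+x. indicator Q (x(m := y)) \<partial>euclid_lborel m) = (\<integral>\<^sup>+x. 0 \<partial>euclid_lborel m)"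
        by (intro nn_integral_cong) (auto simp: Q_def indicator_def)
      \<comment> \<open>At \<open>y = 0\<close> both integrands vanish because
        \<open>m \<ge> 1\<close>.\<close>
      moreover have "y ^ m = 0 \<or> y \<notin> {0..h}" using False m by auto
      ultimately show ?thesis by (auto simp del: power_eq_0_iff)
    qed
  qed
  also have "\<dots> = ennreal (unit_ball_vol (real m) * \<rho> ^ m * h ^ Suc m / real (Suc m) - unit_ball_vol (real m) * \<rho> ^ m * 0 ^ Suc m / real (Suc m))"
  proof (rule nn_integral_FTC_Icc)
    fix y assume "y \<in> {0..h}"
    show "((\<lambda>y. unit_ball_vol (real m) * \<rho> ^ m * y ^ Suc m / real (Suc m)) has_real_derivative unit_ball_vol (real m) * \<rho> ^ m * y ^ m) (at y)"
      by (rule derivative_eq_intros refl | simp)+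
    show "0 \<le> unit_ball_vol (real m) * \<rho> ^ m * y ^ m" using \<open>y \<in> {0..h}\<close> \<rho> by auto
  qed (use h in auto)
  finally show ?thesis unfolding Q_def by simp
qed

text \<open>The right circular cone of slope \<open>\<rho>\<close> about the pole with height
  \<open>1 / sqrt (1 + \<rho>\<^sup>2)\<close> has slant height 1, hence fits into the unit ball.
  Its directions have inner product at least
  \<open>1 / sqrt (1 + \<rho>\<^sup>2) \<ge> 1 - \<rho>\<^sup>2 / 2\<close> with the pole, that is,
  chord length at most \<open>\<rho>\<close>.\<close>

lemma cone_cap_ge:
  assumes n: "n \<ge> 2" and \<rho>: "\<rho> > 0" and u: "u \<in> euclid_sphere n"
  shows "ennreal (unit_ball_vol (real (n - 1)) * \<rho> ^ (n - 1) * (1 / sqrt (1 + \<rho>\<^sup>2)) ^ n / real n) \<le>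
    emeasure (euclid_lborel n) (econe n (cap n \<rho> u) 1)"
proof -
  define m where "m = n - 1"
  have nm: "n = Suc m" "m \<ge> 1" using n by (auto simp: m_def)
  define h where "h = 1 / sqrt (1 + \<rho>\<^sup>2)"
  have h: "h > 0" by (simp add: h_def add_pos_nonneg)
  let ?Q = "{x \<in> euclid n. 0 < x m \<and> x m \<le> h \<and> nrm m x \<le> \<rho> * x m}"
  have "?Q \<subseteq> econe n (cap n \<rho> (pole n)) 1"
  proof safe
    fix x assume x: "x \<in> euclid n" "0 < x m" "x m \<le> h" "nrm m x \<le> \<rho> * x m"
    have sq: "(nrm n x)\<^sup>2 = (nrm m x)\<^sup>2 + (x m)\<^sup>2"
      by (simp add: nm L2_set_def lessThan_Suc sum_nonneg)
    have "(nrm m x)\<^sup>2 \<le> (\<rho> * x m)\<^sup>2" using x by (intro power_mono) auto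
    then have "(nrm n x)\<^sup>2 \<le> (x m / h)\<^sup>2"
      unfolding sq h_def by (simp add: power_mult_distrib algebra_simps)
    then have le: "nrm n x \<le> x m / h" using x h by (intro power2_le_imp_le[of "nrm n x"]) auto
    also have "\<dots> \<le> 1" using x h by simp
    finally have le1: "nrm n x \<le> 1" .
    have pos: "0 < nrm n x" using x abs_coord_le_nrm[of m n x] nm by auto
    have "h \<le> x m / nrm n x" using le pos h by (simp add: field_simps)
    moreover have "1 - \<rho>\<^sup>2 / 2 \<le> h"
    proof -
      have "sqrt (1 + \<rho>\<^sup>2) \<le> 1 + \<rho>\<^sup>2 / 2"
      proof (rule real_le_lsqrt)
        show "1 + \<rho>\<^sup>2 \<le> (1 + \<rho>\<^sup>2 / 2)\<^sup>2"
          using zero_le_power2[of "\<rho>\<^sup>2"] by (simp add: power2_sum power_divide)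
      qed auto
      then have "1 / (1 + \<rho>\<^sup>2 / 2) \<le> h"
        unfolding h_def by (intro divide_left_mono mult_pos_pos) (auto intro: add_pos_nonneg)
      moreover have "1 - \<rho>\<^sup>2 / 2 \<le> 1 / (1 + \<rho>\<^sup>2 / 2)"
      proof -
        have "(1 - \<rho>\<^sup>2 / 2) * (1 + \<rho>\<^sup>2 / 2) \<le> 1" using zero_le_power2[of "\<rho>\<^sup>2"] by (simp add: power2_eq_square algebra_simps)
        then show ?thesis by (subst pos_le_divide_eq) (auto intro: add_pos_nonneg)
      qed
      ultimately show ?thesis by linarith
    qed
    moreover have "(nrm n (\<lambda>i. edir n x i - pole n i))\<^sup>2 = 2 - 2 * (x m / nrm n x)"
    proof -
      have "ip n (edir n x) (pole n) = x m / nrm n x"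
        unfolding nm ip_pole by (simp add: edir_def)
      moreover have "nrm n (pole n) = 1" using pole_sphere[of n] n by (simp add: sphere_subset)
      ultimately show ?thesis unfolding nrm_diff_power2 by (simp add: nrm_edir[OF pos])
    qed
    ultimately have "(nrm n (\<lambda>i. edir n x i - pole n i))\<^sup>2 \<le> \<rho>\<^sup>2" by linarith
    then have "nrm n (\<lambda>i. edir n x i - pole n i) \<le> \<rho>" by (rule power2_le_imp_le[OF _ less_imp_le[OF \<rho>]])
    then show "x \<in> econe n (cap n \<rho> (pole n)) 1"
      using x(1) pos le1 edir_sphere[OF pos] by (simp add: econe_def cap_def)
  qed
  then have "emeasure (euclid_lborel n) ?Q \<le> emeasure (euclid_lborel n) (econe n (cap n \<rho> (pole n)) 1)"
    by (intro emeasure_mono sets_econe sets_cap)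
  also have "\<dots> = emeasure (euclid_lborel n) (econe n (cap n \<rho> u) 1)"
    using n by (intro emeasure_econe_cap u pole_sphere) auto
  finally show ?thesis
    using emeasure_lborel_box_cone[OF nm(2) h \<rho>] nm(1) by (simp add: h_def)
qed

lemma hausdorff_premeasure_cap:
  assumes \<rho>: "\<rho> \<ge> 0"
  shows "hausdorff_premeasure n s (ennreal (2 * \<rho>)) (cap n \<rho> v) \<le> ennreal (unit_ball_vol (real s) * \<rho> ^ s)"
proof -
  have ed: "euclid_ediam n (cap n \<rho> v) \<le> ennreal (2 * \<rho>)"
  proof (rule euclid_ediam_le)
    fix x y assume "x \<in> cap n \<rho> v" "y \<in> cap n \<rho> v"
    then have "nrm n (\<lambda>i. x i - v i) \<le> \<rho>" "nrm n (\<lambda>i. v i - y i) \<le> \<rho>"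
      by (auto simp: cap_def nrm_minus_commute[of v y])
    then show "euclid_dist n x y \<le> 2 * \<rho>"
      using nrm_triangle[where x=x and y=v and z=y and n=n] by (simp add: euclid_dist_def)
  qed
  have "hausdorff_premeasure n s (ennreal (2 * \<rho>)) (cap n \<rho> v) \<le> hweight n s (cap n \<rho> v)"
    using ed by (intro hausdorff_premeasure_single) (auto simp: cap_def sphere_subset)
  also have "\<dots> \<le> ennreal (unit_ball_vol (real s) / 2 ^ s) * ennreal (2 * \<rho>) ^ s"
    unfolding hweight_def by (auto intro!: mult_left_mono power_mono ed)
  also have "\<dots> = ennreal (unit_ball_vol (real s) * \<rho> ^ s)"
    using \<rho> by (simp add: ennreal_power ennreal_mult[symmetric] power_mult_distrib)
  finally show ?thesis .
qed

lemma hausdorff_premeasure_UN_finite: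
  "finite F \<Longrightarrow> hausdorff_premeasure n s \<delta> (\<Union>v\<in>F. A v) \<le> (\<Sum>v\<in>F. hausdorff_premeasure n s \<delta> (A v))"
proof (induction F rule: finite_induct)
  case (insert v F)
  have "hausdorff_premeasure n s \<delta> (A v \<union> (\<Union>v\<in>F. A v)) \<le> hausdorff_premeasure n s \<delta> (A v) + hausdorff_premeasure n s \<delta> (\<Union>v\<in>F. A v)"
    by (rule hausdorff_premeasure_Un)
  also have "\<dots> \<le> hausdorff_premeasure n s \<delta> (A v) + (\<Sum>v\<in>F. hausdorff_premeasure n s \<delta> (A v))"
    by (intro add_left_mono insert.IH)
  finally show ?case using insert by simp
qed simp

lemma hausdorff_premeasure_caps:
  assumes "finite F" "\<rho> \<ge> 0" "real (card F) \<le> N"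
  shows "hausdorff_premeasure n s (ennreal (2 * \<rho>)) (\<Union>v\<in>F. cap n \<rho> v) \<le> ennreal (N * (unit_ball_vol (real s) * \<rho> ^ s))"
proof -
  have "hausdorff_premeasure n s (ennreal (2 * \<rho>)) (\<Union>v\<in>F. cap n \<rho> v) \<le> (\<Sum>v\<in>F. hausdorff_premeasure n s (ennreal (2 * \<rho>)) (cap n \<rho> v))"
    by (rule hausdorff_premeasure_UN_finite[OF assms(1)])
  also have "\<dots> \<le> (\<Sum>v\<in>F. ennreal (unit_ball_vol (real s) * \<rho> ^ s))"
    by (intro sum_mono hausdorff_premeasure_cap assms)
  also have "\<dots> = ennreal (real (card F) * (unit_ball_vol (real s) * \<rho> ^ s))"
    using assms by (simp add: ennreal_of_nat_eq_real_of_nat ennreal_mult)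
  also have "\<dots> \<le> ennreal (N * (unit_ball_vol (real s) * \<rho> ^ s))"
    using assms by (intro ennreal_leI mult_right_mono) auto
  finally show ?thesis .
qed

text \<open>The lower bound of \<open>cone_cap_ge\<close> for the volume of the cone over a cap.
  Divided by \<open>unit_ball_vol n\<close> it bounds from below the proportion of directions in the
  cap.\<close>

definition cap_bound :: "nat \<Rightarrow> real \<Rightarrow> real" where
  "cap_bound n \<rho> = unit_ball_vol (real (n - 1)) * \<rho> ^ (n - 1) * (1 / sqrt (1 + \<rho>\<^sup>2)) ^ n / real n"

lemma cap_bound_pos: "n \<ge> 2 \<Longrightarrow> \<rho> > 0 \<Longrightarrow> cap_bound n \<rho> > 0"
  unfolding cap_bound_def by (intro divide_pos_pos mult_pos_pos zero_less_power) (auto intro: add_pos_nonneg)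

lemma cap_bound_le:
  assumes "n \<ge> 2" "\<rho> > 0"
  shows "cap_bound n \<rho> \<le> unit_ball_vol (real n)"
proof -
  have "ennreal (cap_bound n \<rho>) \<le> ennreal (unit_ball_vol (real n))"
    using cone_cap_ge[OF assms pole_sphere] emeasure_econe_le[of n "cap n \<rho> (pole n)"] assms
    unfolding cap_bound_def by (meson less_le_trans order_trans pos2)
  then show ?thesis by (subst (asm) ennreal_le_iff) auto
qed

text \<open>Up to radius \<open>1 / sqrt n\<close> the curvature factor in \<open>cap_bound\<close>
  stays bounded in the dimension, because \<open>1 + 1 / n \<le> exp (1 / n)\<close> is raised only
  to the power \<open>n / 2\<close>.\<close>

lemma sqrt_power_le_2:
  assumes "n \<ge> 2" "0 < \<rho>" "\<rho> \<le> 1 / sqrt (real n)"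
  shows "sqrt (1 + \<rho>\<^sup>2) ^ n \<le> 2"
proof -
  have "\<rho>\<^sup>2 \<le> (1 / sqrt (real n))\<^sup>2" using assms by (intro power_mono) auto
  then have "1 + \<rho>\<^sup>2 \<le> 1 + 1 / real n" by (simp add: power_divide)
  also have "\<dots> \<le> exp (1 / real n)" by (rule exp_ge_add_one_self)
  also have "\<dots> = (exp (1 / (2 * real n)))\<^sup>2" by (simp add: exp_double[symmetric])
  finally have "sqrt (1 + \<rho>\<^sup>2) \<le> exp (1 / (2 * real n))" by (intro real_le_lsqrt) auto
  then have "sqrt (1 + \<rho>\<^sup>2) ^ n \<le> exp (1 / (2 * real n)) ^ n" by (intro power_mono) auto
  also have "\<dots> = exp (1 / 2)" using assms by (simp add: exp_of_nat_mult[symmetric])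
  also have "\<dots> \<le> 2"
  proof -
    have "exp (1 / 2 :: real) \<le> 1 + 1 / 2 + (1 / 2)\<^sup>2" by (rule exp_bound) auto
    then show ?thesis by (simp add: power2_eq_square)
  qed
  finally show ?thesis .
qed

text \<open>The flat factors \<open>unit_ball_vol (n - 1) * \<rho> ^ (n - 1)\<close> cancel. Caps in
  the number suggested by volume, \<open>unit_ball_vol n / cap_bound n \<rho>\<close>, thus have a
  total weight that depends on \<open>\<rho>\<close> only through the curvature factor.\<close>

lemma cap_weight_le:
  assumes n: "n \<ge> 2" and \<rho>: "0 < \<rho>" "\<rho> \<le> 1 / sqrt (real n)"
  shows "unit_ball_vol (real n) / cap_bound n \<rho> * (unit_ball_vol (real (n - 1)) * \<rho> ^ (n - 1)) \<le> 2 * (real n * unit_ball_vol (real n))"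
proof -
  have "unit_ball_vol (real n) / cap_bound n \<rho> * (unit_ball_vol (real (n - 1)) * \<rho> ^ (n - 1)) =
    real n * unit_ball_vol (real n) * sqrt (1 + \<rho>\<^sup>2) ^ n"
  proof -
    have *: "k / (k' * p * (1 / s) ^ n / real n) * (k' * p) = real n * k * s ^ n"
      if "k' \<noteq> 0" "p \<noteq> 0" "s \<noteq> 0" for k k' p s :: real
      using that n by (simp add: power_divide field_simps)
    have "1 + \<rho>\<^sup>2 > 0" by (simp add: add_pos_nonneg)
    then show ?thesis unfolding cap_bound_def using \<rho> by (intro *) auto
  qed
  also have "\<dots> \<le> real n * unit_ball_vol (real n) * 2"
    using sqrt_power_le_2[OF assms] by (intro mult_left_mono) auto
  finally show ?thesis by simp
qed

text \<open>Caps of half the radius about the points are disjoint, and so are the cones over them,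
  which all lie in the unit ball.\<close>

lemma separated_card_le:
  assumes n: "n \<ge> 2" and \<rho>: "\<rho> > 0" and F: "finite F" "F \<subseteq> euclid_sphere n"
    and sep: "\<And>u v. u \<in> F \<Longrightarrow> v \<in> F \<Longrightarrow> u \<noteq> v \<Longrightarrow> \<rho> < nrm n (\<lambda>i. u i - v i)"
  shows "real (card F) \<le> unit_ball_vol (real n) / cap_bound n (\<rho> / 2)"
proof -
  let ?L = "euclid_lborel n" and ?A = "\<lambda>u. econe n (cap n (\<rho> / 2) u) 1"
  have disj: "disjoint_family_on ?A F"
  proof (unfold disjoint_family_on_def, intro ballI impI equals0I)
    fix u v x assume uv: "u \<in> F" "v \<in> F" "u \<noteq> v" and x: "x \<in> ?A u \<inter> ?A v"
    then have "nrm n (\<lambda>i. u i - edir n x i) \<le> \<rho> / 2" "nrm n (\<lambda>i. edir n x i - v i) \<le> \<rho> / 2"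
      by (auto simp: econe_def cap_def nrm_minus_commute[of u "edir n x"])
    then show False using sep[OF uv] nrm_triangle[where x=u and y="edir n x" and z=v and n=n] by linarith
  qed
  have "ennreal (real (card F) * cap_bound n (\<rho> / 2)) = (\<Sum>u\<in>F. ennreal (cap_bound n (\<rho> / 2)))"
    using cap_bound_pos[of n "\<rho> / 2"] n \<rho> by (simp add: ennreal_mult ennreal_of_nat_eq_real_of_nat)
  also have "\<dots> \<le> (\<Sum>u\<in>F. emeasure ?L (?A u))"
    using cone_cap_ge[of n "\<rho> / 2"] n \<rho> F unfolding cap_bound_def by (intro sum_mono) auto
  also have "\<dots> = emeasure ?L (\<Union>u\<in>F. ?A u)"
    by (rule sum_emeasure[OF _ disj F(1)]) (auto intro: sets_econe sets_cap)
  also have "\<dots> \<le> emeasure ?L (econe n (euclid n) 1)"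
    by (intro emeasure_mono sets_econe sets_euclid) (auto simp: econe_def)
  also have "\<dots> = ennreal (unit_ball_vol (real n))" using n by (simp add: emeasure_punctured_ball)
  finally have "real (card F) * cap_bound n (\<rho> / 2) \<le> unit_ball_vol (real n)"
    by (subst (asm) ennreal_le_iff) auto
  then show ?thesis using cap_bound_pos[of n "\<rho> / 2"] n \<rho> by (simp add: pos_le_divide_eq)
qed

text \<open>A separated set of maximal size is a net; the packing bound guarantees that one
  exists.\<close>

lemma sphere_cover_caps:
  assumes n: "n \<ge> 2" and \<rho>: "\<rho> > 0"
  shows "\<exists>F. finite F \<and> real (card F) \<le> unit_ball_vol (real n) / cap_bound n (\<rho> / 2) \<and> euclid_sphere n \<subseteq> (\<Union>v\<in>F. cap n \<rho> v)"
proof -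
  define S where "S F \<longleftrightarrow> finite F \<and> F \<subseteq> euclid_sphere n \<and> (\<forall>u\<in>F. \<forall>v\<in>F. u \<noteq> v \<longrightarrow> \<rho> < nrm n (\<lambda>i. u i - v i))" for F
  define b where "b = nat \<lfloor>unit_ball_vol (real n) / cap_bound n (\<rho> / 2)\<rfloor>"
  have le: "real (card F) \<le> unit_ball_vol (real n) / cap_bound n (\<rho> / 2)" if "S F" for F
    using that by (intro separated_card_le n \<rho>) (auto simp: S_def)
  have "S {}" by (simp add: S_def)
  moreover have "\<forall>F. S F \<longrightarrow> card F < Suc b"
    using le by (auto simp: b_def le_nat_floor less_Suc_eq_le)
  ultimately obtain F where F: "S F" "\<And>G. S G \<Longrightarrow> card G \<le> card F"
    using ex_has_greatest_nat[of S "{}" card "Suc b"] by blast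
  have "euclid_sphere n \<subseteq> (\<Union>v\<in>F. cap n \<rho> v)"
  proof (rule ccontr)
    assume "\<not> ?thesis"
    then obtain u where u': "u \<in> euclid_sphere n" "u \<notin> (\<Union>v\<in>F. cap n \<rho> v)" by blast
    then have u: "u \<in> euclid_sphere n" "\<And>v. v \<in> F \<Longrightarrow> \<rho> < nrm n (\<lambda>i. u i - v i)"
      by (auto simp: cap_def not_le)
    have "u \<notin> F" using \<rho> u(2)[of u] by (auto simp: L2_set_constant)
    have "S (insert u F)"
      using F(1) u by (auto simp: S_def nrm_minus_commute[of _ u])
    then show False using F(2)[of "insert u F"] \<open>u \<notin> F\<close> F(1) by (simp add: S_def)
  qed
  then show ?thesis using F(1) le[OF F(1)] by (auto simp: S_def)
qed

lemma hausdorff_outer_le_small: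
  assumes r: "r > 0" and le: "\<And>\<rho>. 0 < \<rho> \<Longrightarrow> \<rho> \<le> r \<Longrightarrow> hausdorff_premeasure n s (ennreal (2 * \<rho>)) A \<le> b"
  shows "hausdorff_outer n s A \<le> b"
proof -
  have r2: "2 * r > 0" using r by simp
  have "hausdorff_premeasure n s (ennreal (2 * r / Suc k)) A \<le> b" for k
  proof -
    have "r / Suc k \<le> r / 1" using r by (intro divide_left_mono) auto
    then show ?thesis using le[of "r / Suc k"] r by simp
  qed
  then show ?thesis unfolding hausdorff_outer_eq_SUP_nat[OF r2] by (intro SUP_least)
qed

text \<open>Packing at radius \<open>\<rho> / 2\<close> but covering at radius \<open>\<rho>\<close>
  loses \<open>2 ^ (n - 1)\<close>. The crude bound serves for finiteness only, without which the
  uncovered remainder could not be absorbed in \<open>hausdorff_sphere_upper\<close>.\<close>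

lemma hausdorff_sphere_finite:
  assumes n: "n \<ge> 2"
  shows "hausdorff_outer n (n - 1) (euclid_sphere n) < top"
proof -
  have "hausdorff_outer n (n - 1) (euclid_sphere n) \<le> ennreal (2 ^ (n - 1) * (2 * (real n * unit_ball_vol (real n))))"
  proof (rule hausdorff_outer_le_small)
    show "0 < 1 / sqrt (real n)" using n by simp
    fix \<rho> assume \<rho>: "0 < \<rho>" "\<rho> \<le> 1 / sqrt (real n)"
    obtain F where F: "finite F" "real (card F) \<le> unit_ball_vol (real n) / cap_bound n (\<rho> / 2)" "euclid_sphere n \<subseteq> (\<Union>v\<in>F. cap n \<rho> v)"
      using sphere_cover_caps[OF n \<rho>(1)] by blast
    let ?k = "unit_ball_vol (real n)" and ?k' = "unit_ball_vol (real (n - 1))"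
    have "hausdorff_premeasure n (n - 1) (ennreal (2 * \<rho>)) (euclid_sphere n) \<le> hausdorff_premeasure n (n - 1) (ennreal (2 * \<rho>)) (\<Union>v\<in>F. cap n \<rho> v)"
      by (rule hausdorff_premeasure_mono[OF F(3)])
    also have "\<dots> \<le> ennreal (?k / cap_bound n (\<rho> / 2) * (?k' * \<rho> ^ (n - 1)))"
      using \<rho> by (intro hausdorff_premeasure_caps F(1,2)) auto
    also have "?k / cap_bound n (\<rho> / 2) * (?k' * \<rho> ^ (n - 1)) = 2 ^ (n - 1) * (?k / cap_bound n (\<rho> / 2) * (?k' * (\<rho> / 2) ^ (n - 1)))"
      by (simp add: power_divide)
    also have "ennreal \<dots> \<le> ennreal (2 ^ (n - 1) * (2 * (real n * ?k)))"
      using \<rho> n by (intro ennreal_leI mult_left_mono cap_weight_le) auto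
    finally show "hausdorff_premeasure n (n - 1) (ennreal (2 * \<rho>)) (euclid_sphere n) \<le> ennreal (2 ^ (n - 1) * (2 * (real n * ?k)))" .
  qed
  then show ?thesis by (meson ennreal_less_top le_less_trans)
qed

text \<open>The centre is averaged over the directions of the points of the unit ball: by Fubini every point of the
  sphere is covered by the cap with the same probability, so some cap covers at least that proportion of \<open>R\<close>.\<close>

lemma exists_good_cap:
  assumes n: "n \<ge> 2" and \<rho>: "\<rho> > 0" and R: "R \<in> sets (euclid_lborel n)" "R \<subseteq> euclid_sphere n"
    and h: "emeasure (hausdorff_measure n s) R = ennreal h" "h \<ge> 0"
  defines "q \<equiv> cap_bound n \<rho> / (2 * unit_ball_vol (real n))"
  shows "\<exists>v\<in>euclid_sphere n. ennreal (q * h) \<le> emeasure (hausdorff_measure n s) (R \<inter> cap n \<rho> v)"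
proof (rule ccontr)
  assume "\<not> ?thesis"
  then have less: "emeasure (hausdorff_measure n s) (R \<inter> cap n \<rho> v) < ennreal (q * h)" if "v \<in> euclid_sphere n" for v
    using that by (auto simp: not_le)
  let ?L = "euclid_lborel n" and ?H = "hausdorff_measure n s"
  have [measurable_cong]: "sets ?H = sets ?L" by (simp add: sets_hausdorff_measure sets_euclid_lborel)
  note [measurable] = R(1)
  \<comment> \<open>Restricted to \<open>R\<close> the measure is finite, as Fubini requires;
    Hausdorff measure of lower dimension is not sigma-finite on the whole space.\<close>
  define N where "N = density ?H (indicator R)"
  have [measurable_cong]: "sets N = sets ?L" by (simp add: N_def sets_hausdorff_measure sets_euclid_lborel)
  have N: "emeasure N A = emeasure ?H (R \<inter> A)" if "A \<in> sets ?L" for A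
  proof -
    have A: "A \<in> sets ?H" "R \<inter> A \<in> sets ?H" "R \<in> sets ?H"
      using that R(1) by (auto simp: sets_hausdorff_measure sets_euclid_lborel)
    have "emeasure N A = (\<integral>\<^sup>+u. indicator R u * indicator A u \<partial>?H)"
      unfolding N_def using A by (intro emeasure_density) auto
    also have "\<dots> = (\<integral>\<^sup>+u. indicator (R \<inter> A) u \<partial>?H)" by (simp add: indicator_inter_arith)
    finally show ?thesis using A by simp
  qed
  have space_N: "space N = euclid n" by (simp add: N_def)
  have "emeasure N (space N) = ennreal h"
    using N[of "euclid n"] R(2) h sphere_subset by (simp add: space_N Int_absorb2 subset_eq sets_euclid)
  interpret N: finite_measure N
    by (rule finite_measureI) (simp add: \<open>emeasure N (space N) = ennreal h\<close>)
  interpret P: pair_sigma_finite N ?L ..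
  define f where "f u x = (if 0 < nrm n x \<and> nrm n x \<le> 1 \<and> nrm n u = 1 \<and> nrm n (\<lambda>i. edir n x i - u i) \<le> \<rho> then 1 else 0 :: ennreal)" for u x
  have f [measurable]: "(\<lambda>(u, x). f u x) \<in> borel_measurable (N \<Otimes>\<^sub>M ?L)"
    unfolding f_def case_prod_beta by measurable
  have "ennreal (cap_bound n \<rho> * h) = (\<integral>\<^sup>+u. ennreal (cap_bound n \<rho>) \<partial>N)"
    using \<open>emeasure N (space N) = ennreal h\<close> h(2) cap_bound_pos[OF n \<rho>] by (simp add: ennreal_mult)
  also have "\<dots> \<le> (\<integral>\<^sup>+u. \<integral>\<^sup>+x. f u x \<partial>?L \<partial>N)"
  proof (rule nn_integral_mono_AE)
    have "AE u in N. u \<in> R" unfolding N_def by (subst AE_density) (auto simp: indicator_def)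
    then show "AE u in N. ennreal (cap_bound n \<rho>) \<le> (\<integral>\<^sup>+x. f u x \<partial>?L)"
    proof eventually_elim
      case (elim u)
      then have u: "u \<in> euclid_sphere n" using R by auto
      have "ennreal (cap_bound n \<rho>) \<le> emeasure ?L (econe n (cap n \<rho> u) 1)"
        using cone_cap_ge[OF n \<rho> u] by (simp add: cap_bound_def)
      also have "\<dots> = (\<integral>\<^sup>+x. indicator (econe n (cap n \<rho> u) 1) x \<partial>?L)" by simp
      also have "\<dots> = (\<integral>\<^sup>+x. f u x \<partial>?L)"
        using u by (intro nn_integral_cong) (auto simp: f_def econe_def cap_def indicator_def sphere_subset edir_sphere)
      finally show ?case .
    qed
  qed
  also have "\<dots> = (\<integral>\<^sup>+x. \<integral>\<^sup>+u. f u x \<partial>N \<partial>?L)"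
    by (rule P.Fubini'[symmetric]) (rule f)
  also have "\<dots> \<le> (\<integral>\<^sup>+x. ennreal (q * h) * indicator (econe n (euclid n) 1) x \<partial>?L)"
  proof (rule nn_integral_mono)
    fix x assume x: "x \<in> space ?L"
    show "(\<integral>\<^sup>+u. f u x \<partial>N) \<le> ennreal (q * h) * indicator (econe n (euclid n) 1) x"
    proof (cases "0 < nrm n x \<and> nrm n x \<le> 1")
      case True
      have "(\<integral>\<^sup>+u. f u x \<partial>N) = (\<integral>\<^sup>+u. indicator (cap n \<rho> (edir n x)) u \<partial>N)"
        using True by (intro nn_integral_cong)
          (auto simp: f_def cap_def indicator_def space_N euclid_sphere_def nrm_minus_commute[of "edir n x"])
      also have "\<dots> = emeasure ?H (R \<inter> cap n \<rho> (edir n x))" by (simp add: N)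
      also have "\<dots> \<le> ennreal (q * h)" using less[OF edir_sphere] True by (simp add: less_imp_le)
      finally show ?thesis using True x by (simp add: econe_def indicator_def)
    qed (auto simp: f_def)
  qed
  also have "\<dots> = ennreal (q * h) * ennreal (unit_ball_vol (real n))"
    using n by (subst nn_integral_cmult_indicator) (auto simp: emeasure_punctured_ball)
  also have "\<dots> = ennreal (cap_bound n \<rho> * h / 2)"
  proof -
    have "ennreal (q * h) * ennreal (unit_ball_vol (real n)) = ennreal (q * h * unit_ball_vol (real n))"
      using cap_bound_pos[OF n \<rho>] h(2) by (intro ennreal_mult[symmetric]) (auto simp: q_def)
    then show ?thesis by (simp add: q_def)
  qed
  \<comment> \<open>The factor 2 in \<open>q\<close> leaves room for the contradiction: the averages
    force \<open>h = 0\<close>, and then the assumed strict inequality at the pole has right-hand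
    side 0.\<close>
  finally have "cap_bound n \<rho> * h \<le> cap_bound n \<rho> * h / 2"
    using cap_bound_pos[OF n \<rho>] h(2) by (subst (asm) ennreal_le_iff) auto
  then have "cap_bound n \<rho> * h \<le> 0" by linarith
  then have "h = 0" using cap_bound_pos[OF n \<rho>] h(2) by (simp add: mult_le_0_iff)
  then show False using less[OF pole_sphere[of n]] n by simp
qed

text \<open>Greedy choice: each further cap removes at least the proportion \<open>q\<close> of what
  is still uncovered.\<close>

lemma exists_caps:
  assumes n: "n \<ge> 2" and \<rho>: "\<rho> > 0"
    and h: "emeasure (hausdorff_measure n s) (euclid_sphere n) = ennreal h" "h \<ge> 0"
  defines "q \<equiv> cap_bound n \<rho> / (2 * unit_ball_vol (real n))"
  shows "\<exists>F. finite F \<and> card F \<le> N \<and>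
    emeasure (hausdorff_measure n s) (euclid_sphere n - (\<Union>v\<in>F. cap n \<rho> v)) \<le> ennreal ((1 - q) ^ N * h)"
proof (induction N)
  case 0
  show ?case using h by (intro exI[of _ "{}"]) simp
next
  case (Suc N)
  let ?H = "hausdorff_measure n s"
  have sets_H: "sets ?H = sets (euclid_lborel n)" by (simp add: sets_hausdorff_measure sets_euclid_lborel)
  obtain F where F: "finite F" "card F \<le> N"
    "emeasure ?H (euclid_sphere n - (\<Union>v\<in>F. cap n \<rho> v)) \<le> ennreal ((1 - q) ^ N * h)" using Suc by blast
  define R where "R = euclid_sphere n - (\<Union>v\<in>F. cap n \<rho> v)"
  have R: "R \<in> sets (euclid_lborel n)" "R \<subseteq> euclid_sphere n"
    unfolding R_def using F(1) by (auto intro!: sets.Diff sets.finite_UN sets_euclid_sphere sets_cap)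
  have le_top: "emeasure ?H A < top" if "A \<subseteq> R" for A
  proof -
    have "emeasure ?H A \<le> emeasure ?H R" using R that by (intro emeasure_mono) (auto simp: sets_H)
    also have "\<dots> < top" using F(3) unfolding R_def by (meson ennreal_less_top le_less_trans)
    finally show ?thesis .
  qed
  define g where "g = measure ?H R"
  have g: "emeasure ?H R = ennreal g" "g \<ge> 0" using le_top[of R] by (auto simp: g_def emeasure_eq_ennreal_measure less_top)
  have q: "0 < q" "q \<le> 1" using cap_bound_pos[OF n \<rho>] cap_bound_le[OF n \<rho>] unit_ball_vol_pos[of "real n"]
    by (auto simp: q_def field_simps)
  have gle: "g \<le> (1 - q) ^ N * h"
    using F(3) g h(2) q unfolding R_def[symmetric] by (subst (asm) g(1), subst (asm) ennreal_le_iff) auto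
  obtain v where v: "v \<in> euclid_sphere n" "ennreal (q * g) \<le> emeasure ?H (R \<inter> cap n \<rho> v)"
    using exists_good_cap[OF n \<rho> R g] unfolding q_def by blast
  have "emeasure ?H (R - cap n \<rho> v) \<le> ennreal ((1 - q) ^ Suc N * h)"
  proof -
    define y z where "y = measure ?H (R \<inter> cap n \<rho> v)" and "z = measure ?H (R - cap n \<rho> v)"
    have y: "emeasure ?H (R \<inter> cap n \<rho> v) = ennreal y" "y \<ge> 0" and z: "emeasure ?H (R - cap n \<rho> v) = ennreal z" "z \<ge> 0"
      using le_top[of "R \<inter> cap n \<rho> v"] le_top[of "R - cap n \<rho> v"] by (auto simp: y_def z_def emeasure_eq_ennreal_measure less_top)
    have "ennreal (y + z) = emeasure ?H (R \<inter> cap n \<rho> v) + emeasure ?H (R - cap n \<rho> v)"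
      using y z by simp
    also have "\<dots> = emeasure ?H ((R \<inter> cap n \<rho> v) \<union> (R - cap n \<rho> v))"
      by (rule plus_emeasure) (auto simp: sets_H R sets_cap)
    also have "(R \<inter> cap n \<rho> v) \<union> (R - cap n \<rho> v) = R" by auto
    finally have "ennreal (y + z) = ennreal g" unfolding g(1) .
    then have "y + z = g" using g y z by (subst (asm) ennreal_inj) auto
    moreover have "q * g \<le> y" using v(2) y by (simp add: ennreal_le_iff)
    ultimately have "z \<le> (1 - q) * g" by (simp add: algebra_simps)
    also have "\<dots> \<le> (1 - q) * ((1 - q) ^ N * h)" using gle q by (intro mult_left_mono) auto
    finally show ?thesis unfolding z(1) by (intro ennreal_leI) (simp add: mult.assoc)
  qed
  moreover have "R - cap n \<rho> v = euclid_sphere n - (\<Union>v\<in>insert v F. cap n \<rho> v)" by (auto simp: R_def)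
  moreover have "card (insert v F) \<le> Suc N" using F card_insert_le_m1[of "Suc N" F v] by simp
  ultimately show ?case using F(1) by (intro exI[of _ "insert v F"]) simp
qed

text \<open>About \<open>1 / q\<close> greedy caps leave at most the proportion
  \<open>exp (- 1) \<le> 1 / 2\<close> of the sphere, and this remainder is charged at its own
  Hausdorff measure instead of being covered explicitly. The caps number at most
  \<open>4 * unit_ball_vol n / cap_bound n \<rho>\<close>, so \<open>cap_weight_le\<close> gives
  \<open>h \<le> 8 * (n * unit_ball_vol n) + h / 2\<close>, and \<open>h\<close> is finite.\<close>

lemma hausdorff_sphere_upper:
  assumes n: "n \<ge> 2"
  shows "emeasure (hausdorff_measure n (n - 1)) (euclid_sphere n) \<le> ennreal (16 * (real n * unit_ball_vol (real n)))"
proof -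
  let ?H = "hausdorff_measure n (n - 1)" and ?k = "unit_ball_vol (real n)" and ?k' = "unit_ball_vol (real (n - 1))"
  define h where "h = measure ?H (euclid_sphere n)"
  have outer: "emeasure ?H A = hausdorff_outer n (n - 1) A" if "A \<in> sets (euclid_lborel n)" for A
    using that by (intro emeasure_hausdorff_measure) (simp add: sets_euclid_lborel)
  have h: "emeasure ?H (euclid_sphere n) = ennreal h" "h \<ge> 0"
  proof -
    have "emeasure ?H (euclid_sphere n) \<noteq> \<top>"
      unfolding outer[OF sets_euclid_sphere] using hausdorff_sphere_finite[OF n] by simp
    then show "emeasure ?H (euclid_sphere n) = ennreal h" unfolding h_def by (rule emeasure_eq_ennreal_measure)
  qed (simp add: h_def)
  have "hausdorff_outer n (n - 1) (euclid_sphere n) \<le> ennreal (8 * (real n * ?k) + h / 2)"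
  proof (rule hausdorff_outer_le_small)
    show "0 < 1 / sqrt (real n)" using n by simp
    fix \<rho> assume \<rho>: "0 < \<rho>" "\<rho> \<le> 1 / sqrt (real n)"
    define q where "q = cap_bound n \<rho> / (2 * ?k)"
    have q: "0 < q" "q \<le> 1" using cap_bound_pos[OF n \<rho>(1)] cap_bound_le[OF n \<rho>(1)] unit_ball_vol_pos[of "real n"]
      by (auto simp: q_def field_simps)
    define N where "N = nat \<lceil>1 / q\<rceil>"
    have N: "1 / q \<le> real N" "real N \<le> 1 / q + 1" using q by (auto simp: N_def)
    have "1 / q \<ge> 1" using q by simp
    then have N2: "real N \<le> 2 * (1 / q)" using N by linarith
    obtain F where F: "finite F" "card F \<le> N"
      "emeasure ?H (euclid_sphere n - (\<Union>v\<in>F. cap n \<rho> v)) \<le> ennreal ((1 - q) ^ N * h)"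
      using exists_caps[OF n \<rho>(1) h, of N] unfolding q_def by blast
    have "1 - q \<le> exp (- q)" using exp_ge_add_one_self[of "- q"] by simp
    then have "(1 - q) ^ N \<le> exp (- q) ^ N" using q by (intro power_mono) auto
    also have "\<dots> = exp (- (real N * q))" by (simp add: exp_of_nat_mult[symmetric])
    also have "\<dots> \<le> exp (- 1)" using N(1) q by (simp add: field_simps)
    also have "\<dots> \<le> 1 / 2" using exp_ge_add_one_self[of 1] by (simp add: exp_minus field_simps)
    finally have half: "(1 - q) ^ N \<le> 1 / 2" .
    have fin: "card F \<le> 4 * (?k / cap_bound n \<rho>)"
      using F(2) N2 by (simp add: q_def)
    let ?P = "hausdorff_premeasure n (n - 1) (ennreal (2 * \<rho>))"
    have "?P (euclid_sphere n) \<le> ?P ((\<Union>v\<in>F. cap n \<rho> v) \<union> (euclid_sphere n - (\<Union>v\<in>F. cap n \<rho> v)))"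
      by (rule hausdorff_premeasure_mono) auto
    also have "\<dots> \<le> ?P (\<Union>v\<in>F. cap n \<rho> v) + ?P (euclid_sphere n - (\<Union>v\<in>F. cap n \<rho> v))"
      by (rule hausdorff_premeasure_Un)
    also have "\<dots> \<le> ennreal (4 * (?k / cap_bound n \<rho>) * (?k' * \<rho> ^ (n - 1))) + ennreal (h / 2)"
    proof (rule add_mono)
      show "?P (\<Union>v\<in>F. cap n \<rho> v) \<le> ennreal (4 * (?k / cap_bound n \<rho>) * (?k' * \<rho> ^ (n - 1)))"
        using \<rho> F(1) fin by (intro hausdorff_premeasure_caps) auto
      have "?P (euclid_sphere n - (\<Union>v\<in>F. cap n \<rho> v)) \<le> hausdorff_outer n (n - 1) (euclid_sphere n - (\<Union>v\<in>F. cap n \<rho> v))"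
        using \<rho> by (intro hausdorff_premeasure_le_outer) auto
      also have "\<dots> \<le> ennreal ((1 - q) ^ N * h)"
        using F by (subst outer[symmetric]) (auto intro!: sets.Diff sets.finite_UN sets_euclid_sphere sets_cap)
      also have "\<dots> \<le> ennreal (h / 2)" using half h(2) mult_right_mono[OF half h(2)] by (intro ennreal_leI) simp
      finally show "?P (euclid_sphere n - (\<Union>v\<in>F. cap n \<rho> v)) \<le> ennreal (h / 2)" .
    qed
    also have "\<dots> \<le> ennreal (8 * (real n * ?k)) + ennreal (h / 2)"
      using cap_weight_le[OF n \<rho>] by (intro add_right_mono ennreal_leI) simp
    also have "\<dots> = ennreal (8 * (real n * ?k) + h / 2)" using h(2) by (intro ennreal_plus[symmetric]) auto
    finally show "?P (euclid_sphere n) \<le> ennreal (8 * (real n * ?k) + h / 2)" .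
  qed
  then have "ennreal h \<le> ennreal (8 * (real n * ?k) + h / 2)"
    using h(1) outer[OF sets_euclid_sphere] by simp
  then have "h \<le> 8 * (real n * ?k) + h / 2" using h(2) by (subst (asm) ennreal_le_iff) auto
  then have "h \<le> 16 * (real n * ?k)" by linarith
  then show ?thesis unfolding h(1) by (rule ennreal_leI)
qed

subsection \<open>The space of hyperplanes\<close>

abbreviation hparam :: "nat \<Rightarrow> ((nat \<Rightarrow> real) \<times> real) topology" where
  "hparam n \<equiv> prod_topology (subtopology (euclid_topology n) (euclid_sphere n)) euclideanreal"

abbreviation hborel :: "nat \<Rightarrow> (nat \<Rightarrow> real) set measure" where
  "hborel n \<equiv> topology_borel (hyperplane_topology n)"

lemma topspace_hparam: "topspace (hparam n) = euclid_sphere n \<times> UNIV"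
  by (auto simp: euclid_topology_def euclid_sphere_def euclid_def)

lemma topspace_hyperplane_topology: "topspace (hyperplane_topology n) = hyperplanes n"
proof -
  have "{(u, t). u \<in> euclid_sphere n \<and> hyperplane n u t \<in> hyperplanes n} = topspace (hparam n)"
    unfolding topspace_hparam by (auto simp: hyperplanes_def)
  then have "openin (hyperplane_topology n) (hyperplanes n)"
    unfolding openin_hyperplane_topology by (metis openin_topspace order_refl)
  then show ?thesis
    by (metis openin_hyperplane_topology openin_subset openin_topspace subset_antisym)
qed

lemma space_hborel: "space (hborel n) = hyperplanes n"
  by (simp add: topology_borel_def space_measure_of_conv topspace_hyperplane_topology)

lemma sets_hborel: "sets (hborel n) = sigma_sets (hyperplanes n) {U. openin (hyperplane_topology n) U}"
  unfolding topology_borel_def topspace_hyperplane_topology[symmetric]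
  by (intro sets_measure_of) (auto dest: openin_subset)

lemma continuous_hparam_id: "continuous_map (top_of_set (euclid_sphere n \<times> UNIV)) (hparam n) (\<lambda>z. z)"
proof (rule continuous_map_pairwise[THEN iffD2, OF conjI])
  let ?A = "euclid_sphere n \<times> (UNIV :: real set)"
  have "continuous_on ?A (\<lambda>z. fst z i)" for i :: nat
    by (rule continuous_on_product_then_coordinatewise[OF continuous_on_fst[OF continuous_on_id]])
  then have c: "continuous_map (top_of_set ?A) euclideanreal (\<lambda>z. fst z i)" for i :: nat by simp
  have "(\<lambda>z. fst z) ` topspace (top_of_set ?A) \<subseteq> extensional {..<n}"
    by (auto simp: euclid_sphere_def euclid_def PiE_def)
  then have "continuous_map (top_of_set ?A) (euclid_topology n) (\<lambda>z. fst z)"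
    unfolding euclid_topology_def continuous_map_componentwise using c by blast
  moreover have "(\<lambda>z. fst z) \<in> topspace (top_of_set ?A) \<rightarrow> euclid_sphere n" by auto
  ultimately show "continuous_map (top_of_set ?A) (subtopology (euclid_topology n) (euclid_sphere n)) (fst \<circ> (\<lambda>z. z))"
    unfolding comp_def continuous_map_in_subtopology by blast
  have "continuous_on ?A (\<lambda>z. snd z)" by (intro continuous_on_snd continuous_on_id)
  then show "continuous_map (top_of_set ?A) euclideanreal (snd \<circ> (\<lambda>z. z))" unfolding comp_def by simp
qed

text \<open>The topology of the parameter space is compared with the one induced from functions on
  all of \<open>nat\<close>, where Borel sets and product-measurable sets agree.\<close>

lemma openin_hparam_sets:
  assumes "openin (hparam n) W"
  shows "W \<in> sets (euclid_lborel n \<Otimes>\<^sub>M borel)"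
proof -
  have "W \<subseteq> euclid_sphere n \<times> UNIV" using openin_subset[OF assms] topspace_hparam by auto
  then have "openin (top_of_set (euclid_sphere n \<times> UNIV)) W"
    using openin_continuous_map_preimage[OF continuous_hparam_id assms] by (simp add: Collect_conj_eq Int_absorb2 Int_commute)
  then obtain V where V: "open V" "W = (euclid_sphere n \<times> UNIV) \<inter> V" by (auto simp: openin_open)
  have "(\<lambda>z. (fst z, snd z)) \<in> measurable (euclid_lborel n \<Otimes>\<^sub>M borel) ((borel :: (nat \<Rightarrow> real) measure) \<Otimes>\<^sub>M (borel :: real measure))"
    by (intro measurable_Pair measurable_compose[OF measurable_fst measurable_embed] measurable_snd)
  then have "(\<lambda>z. z) \<in> borel_measurable (euclid_lborel n \<Otimes>\<^sub>M (borel :: real measure))" by (simp add: borel_prod)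
  from measurable_sets[OF this, of V] have "V \<inter> space (euclid_lborel n \<Otimes>\<^sub>M (borel :: real measure)) \<in> sets (euclid_lborel n \<Otimes>\<^sub>M borel)"
    using V(1) by simp
  moreover have "euclid_sphere n \<times> UNIV \<in> sets (euclid_lborel n \<Otimes>\<^sub>M (borel :: real measure))"
    by (intro pair_measureI sets_euclid_sphere) auto
  moreover have "W = (euclid_sphere n \<times> UNIV) \<inter> (V \<inter> space (euclid_lborel n \<Otimes>\<^sub>M (borel :: real measure)))"
    unfolding V(2) by (auto simp: space_pair_measure euclid_sphere_def)
  ultimately show ?thesis by auto
qed

lemma hborel_preimage:
  assumes "A \<in> sets (hborel n)"
  shows "{(u, t). u \<in> euclid_sphere n \<and> hyperplane n u t \<in> A} \<in> sets (euclid_lborel n \<Otimes>\<^sub>M borel)"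
  using assms unfolding sets_hborel
proof (induction A rule: sigma_sets.induct)
  case (Basic U)
  then show ?case by (intro openin_hparam_sets) (simp add: openin_hyperplane_topology)
next
  case Empty
  then show ?case by simp
next
  case (Compl A)
  have "euclid_sphere n \<times> UNIV \<in> sets (euclid_lborel n \<Otimes>\<^sub>M (borel :: real measure))"
    by (intro pair_measureI sets_euclid_sphere) auto
  moreover have "{(u, t). u \<in> euclid_sphere n \<and> hyperplane n u t \<in> hyperplanes n - A} =
      euclid_sphere n \<times> UNIV - {(u, t). u \<in> euclid_sphere n \<and> hyperplane n u t \<in> A}"
    by (auto simp: hyperplanes_def)
  ultimately show ?case using Compl by auto
next
  case (Union A)
  have "{(u, t). u \<in> euclid_sphere n \<and> hyperplane n u t \<in> \<Union> (range A)} =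
     (\<Union>i. {(u, t). u \<in> euclid_sphere n \<and> hyperplane n u t \<in> A i})" by auto
  then show ?case using Union by auto
qed

text \<open>Two test points of the first hyperplane suffice. With \<open>c = ip n u v\<close>, the
  foot point \<open>t * u\<close> gives \<open>s = t * c\<close>, and \<open>(t - c) * u + v\<close>
  gives \<open>(t - c) * c + 1 = s\<close>. Hence \<open>c\<^sup>2 = 1\<close>, and the unit vectors
  are equal or opposite.\<close>

lemma hyperplane_eqD:
  assumes u: "u \<in> euclid_sphere n" and v: "v \<in> euclid_sphere n" and eq: "hyperplane n u t = hyperplane n v s"
  shows "v = u \<and> s = t \<or> v = (\<lambda>i\<in>{..<n}. - u i) \<and> s = - t"
proof -
  have uu: "ip n u u = 1" and vv: "ip n v v = 1"
    using u v by (auto simp: euclid_sphere_def nrm_power2[symmetric])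
  define c where "c = ip n u v"
  have mem: "x \<in> euclid n \<Longrightarrow> ip n x u = t \<longleftrightarrow> ip n x v = s" for x
    using eq by (auto simp: hyperplane_def)
  have "ip n (\<lambda>i\<in>{..<n}. t * u i) u = t" by (simp add: uu)
  then have 1: "t * c = s" using mem[of "\<lambda>i\<in>{..<n}. t * u i"] by (simp add: c_def)
  have lin: "ip n (\<lambda>i. (t - c) * u i + 1 * v i) w = (t - c) * ip n u w + 1 * ip n v w" for w
    by (rule ip_linear)
  have "ip n (\<lambda>i\<in>{..<n}. (t - c) * u i + 1 * v i) u = t"
    unfolding ip_restrict lin by (simp add: uu c_def ip_commute)
  then have "ip n (\<lambda>i\<in>{..<n}. (t - c) * u i + 1 * v i) v = s"
    using mem[of "\<lambda>i\<in>{..<n}. (t - c) * u i + 1 * v i"] by simp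
  then have "(t - c) * c + 1 = s" unfolding ip_restrict lin by (simp add: vv c_def)
  then have "c\<^sup>2 = 1" using 1 by (simp add: power2_eq_square algebra_simps)
  then consider "c = 1" | "c = - 1" by (auto simp: power2_eq_1_iff)
  then show ?thesis
  proof cases
    case 1
    have "(nrm n (\<lambda>i. u i - v i))\<^sup>2 = 0"
      unfolding nrm_power2 ip_diff ip_commute[of n v u] using 1 by (simp add: uu vv c_def)
    then have "\<forall>i<n. u i = v i" by (simp add: nrm_power2 ip_self_eq_0)
    then have "u = v" using u v by (intro euclid_eqI[where n=n]) (auto simp: sphere_subset)
    then show ?thesis using \<open>t * c = s\<close> 1 by simp
  next
    case 2
    have "(nrm n (\<lambda>i. u i + v i))\<^sup>2 = 0"
      using ip_linear(1)[of n 1 u 1 v "\<lambda>i. u i + v i"] ip_linear(2)[of n u 1 u 1 v] ip_linear(2)[of n v 1 u 1 v] 2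
      unfolding nrm_power2 by (simp add: uu vv c_def ip_commute[of n v u])
    then have "\<forall>i<n. u i + v i = 0" by (simp add: nrm_power2 ip_self_eq_0)
    then have "\<forall>i<n. v i = - u i" by (simp add: add_eq_0_iff)
    then have "v = (\<lambda>i\<in>{..<n}. - u i)" using v by (intro euclid_eqI[where n=n]) (auto simp: sphere_subset)
    then show ?thesis using \<open>t * c = s\<close> 2 by auto
  qed
qed

lemma hyperplane_neg: "hyperplane n (\<lambda>i\<in>{..<n}. - u i) (- t) = hyperplane n u t"
proof -
  have "ip n x (\<lambda>i. - u i) = - ip n x u" for x
    using ip_scale(2)[of n x "-1" u] by simp
  then show ?thesis by (auto simp: hyperplane_def)
qed

lemma neg_sphere: "u \<in> euclid_sphere n \<Longrightarrow> (\<lambda>i\<in>{..<n}. - u i) \<in> euclid_sphere n"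
  using nrm_scale[where n=n and c="-1" and x=u] by (simp add: euclid_sphere_def)

lemma continuous_hparam_scale:
  "continuous_map (hparam n) euclidean (\<lambda>z. ((\<lambda>i\<in>{..<n}. c * fst z i), c * snd z))"
proof -
  have coord: "continuous_map (hparam n) euclideanreal (\<lambda>z. fst z i)" if "i < n" for i
  proof -
    have "continuous_map (subtopology (euclid_topology n) (euclid_sphere n)) euclideanreal (\<lambda>x. x i)"
      unfolding euclid_topology_def using that by (intro continuous_map_from_subtopology continuous_map_product_projection) auto
    from continuous_map_compose[OF continuous_map_fst this] show ?thesis by (simp add: comp_def)
  qed
  have "continuous_map (hparam n) euclideanreal (\<lambda>z. (\<lambda>i\<in>{..<n}. c * fst z i) i)" for i
    using coord[of i] by (cases "i < n") (auto intro: continuous_intros)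
  then have 1: "continuous_map (hparam n) euclidean (\<lambda>z. \<lambda>i\<in>{..<n}. c * fst z i)"
    unfolding euclidean_product_topology[symmetric] continuous_map_componentwise_UNIV by blast
  have "continuous_map (hparam n) euclideanreal snd" by (rule continuous_map_snd)
  then have 2: "continuous_map (hparam n) euclideanreal (\<lambda>z. c * snd z)"
    by (intro continuous_map_real_mult continuous_map_const[THEN iffD2]) auto
  show ?thesis
    unfolding prod_topology_euclidean[symmetric] continuous_map_pairwise using 1 2 by (simp add: comp_def)
qed

text \<open>A hyperplane has exactly the parameters \<open>(u, t)\<close> and
  \<open>(- u, - t)\<close>. The parameters mapped into the image of \<open>P\<close> are therefore
  those in \<open>P\<close> or in its antipodal copy; both conditions are open, as the quotient
  topology asks.\<close>

lemma openin_hyperplane_image: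
  assumes "open P"
  shows "openin (hyperplane_topology n) {hyperplane n u t | u t. u \<in> euclid_sphere n \<and> (u, t) \<in> P}"
  unfolding openin_hyperplane_topology
proof
  let ?O = "{hyperplane n u t | u t. u \<in> euclid_sphere n \<and> (u, t) \<in> P}"
  let ?W = "\<lambda>c. {z \<in> topspace (hparam n). ((\<lambda>i\<in>{..<n}. c * fst z i), c * snd z) \<in> P}"
  show "?O \<subseteq> hyperplanes n" by (auto simp: hyperplanes_def)
  have "openin (hparam n) (?W 1 \<union> ?W (- 1))"
    using assms by (intro openin_Un openin_continuous_map_preimage[OF continuous_hparam_scale]) auto
  also have "?W 1 \<union> ?W (- 1) = {(u, t). u \<in> euclid_sphere n \<and> hyperplane n u t \<in> ?O}"
  proof (intro set_eqI iffI)
    fix z assume z: "z \<in> ?W 1 \<union> ?W (- 1)"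
    obtain u t where ut: "z = (u, t)" by (cases z)
    have u: "u \<in> euclid_sphere n" using z unfolding topspace_hparam ut by auto
    then have u1: "(\<lambda>i\<in>{..<n}. u i) = u" by (intro euclid_eqI[where n=n]) (auto simp: sphere_subset)
    have "(u, t) \<in> P \<or> ((\<lambda>i\<in>{..<n}. - u i), - t) \<in> P" using z ut u1 by auto
    then have "hyperplane n u t \<in> ?O"
    proof
      assume "((\<lambda>i\<in>{..<n}. - u i), - t) \<in> P"
      then have "hyperplane n (\<lambda>i\<in>{..<n}. - u i) (- t) \<in> ?O" using neg_sphere[OF u] by blast
      then show ?thesis by (simp only: hyperplane_neg)
    qed (use u in blast)
    then show "z \<in> {(u, t). u \<in> euclid_sphere n \<and> hyperplane n u t \<in> ?O}" using u ut by simp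
  next
    fix z assume "z \<in> {(u, t). u \<in> euclid_sphere n \<and> hyperplane n u t \<in> ?O}"
    then obtain u t v s where z: "z = (u, t)" "u \<in> euclid_sphere n" "v \<in> euclid_sphere n" "(v, s) \<in> P"
      "hyperplane n u t = hyperplane n v s" by auto
    have u1: "(\<lambda>i\<in>{..<n}. u i) = u" using z(2) by (intro euclid_eqI[where n=n]) (auto simp: sphere_subset)
    from hyperplane_eqD[OF z(2,3,5)] z u1 show "z \<in> ?W 1 \<union> ?W (- 1)"
      unfolding topspace_hparam by auto
  qed
  finally show "openin (hparam n) {(u, t). u \<in> euclid_sphere n \<and> hyperplane n u t \<in> ?O}" .
qed

text \<open>These hyperplanes separate the ball of radius \<open>\<epsilon>\<close> about \<open>q\<close> from the origin or, for \<open>t = 0\<close>, pass through the origin.\<close>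

definition separating :: "nat \<Rightarrow> (nat \<Rightarrow> real) \<Rightarrow> real \<Rightarrow> (nat \<Rightarrow> real) set set" where
  "separating n q \<epsilon> = {hyperplane n u t | u t. u \<in> euclid_sphere n \<and> 0 \<le> t \<and> t < ip n q u - \<epsilon>}"

text \<open>The condition \<open>0 \<le> t\<close> is not open, so it is approached by
  \<open>- 1 / (k + 1) < t\<close> and the open sets \<open>Q k\<close> are intersected. Each
  \<open>Q k\<close> might be witnessed by a different one of the two parametrizations of a
  hyperplane; as the \<open>P k\<close> decrease, one of the two works for all
  \<open>k\<close>.\<close>

lemma sets_separating: "separating n q \<epsilon> \<in> sets (hborel n)"
proof -
  define P where "P k = {(u, t). - 1 / (real k + 1) < t \<and> t < ip n q u - \<epsilon>}" for k :: nat
  define Q where "Q k = {hyperplane n u t | u t. u \<in> euclid_sphere n \<and> (u, t) \<in> P k}" for k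
  have cip: "continuous_on UNIV (\<lambda>z :: (nat \<Rightarrow> real) \<times> real. ip n q (fst z) - \<epsilon>)"
    unfolding euclid_inner_def
    by (intro continuous_on_diff continuous_on_sum continuous_on_mult continuous_on_const
        continuous_on_product_then_coordinatewise[OF continuous_on_fst[OF continuous_on_id]])
  have "open (P k)" for k
  proof -
    have "P k = {z. - 1 / (real k + 1) < snd z} \<inter> {z. snd z < ip n q (fst z) - \<epsilon>}" by (auto simp: P_def)
    also have "open \<dots>"
      by (intro open_Int open_Collect_less cip continuous_on_const continuous_on_snd continuous_on_id)
    finally show ?thesis .
  qed
  then have "Q k \<in> sets (hborel n)" for k
    unfolding sets_hborel Q_def using openin_hyperplane_image by blast
  moreover have "separating n q \<epsilon> = (\<Inter>k. Q k)"
  proof (intro set_eqI iffI)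
    fix H assume "H \<in> separating n q \<epsilon>"
    then obtain u t where H: "H = hyperplane n u t" "u \<in> euclid_sphere n" "0 \<le> t" "t < ip n q u - \<epsilon>"
      by (auto simp: separating_def)
    have "(u, t) \<in> P k" for k using H(3,4) by (auto simp: P_def intro: less_le_trans[of _ 0])
    then show "H \<in> (\<Inter>k. Q k)" using H unfolding Q_def by blast
  next
    fix H assume H: "H \<in> (\<Inter>k. Q k)"
    then have "H \<in> Q 0" by blast
    then obtain u t where u: "H = hyperplane n u t" "u \<in> euclid_sphere n" by (auto simp: Q_def)
    define v where "v = (\<lambda>i\<in>{..<n}. - u i)"
    have v: "v \<in> euclid_sphere n" "H = hyperplane n v (- t)"
      using u neg_sphere by (auto simp: v_def hyperplane_neg)
    have or: "(u, t) \<in> P k \<or> (v, - t) \<in> P k" for k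
    proof -
      have "H \<in> Q k" using H by blast
      then obtain u' t' where *: "H = hyperplane n u' t'" "u' \<in> euclid_sphere n" "(u', t') \<in> P k" by (auto simp: Q_def)
      show ?thesis using hyperplane_eqD[OF u(2) *(2)] u(1) *(1,3) by (auto simp: v_def)
    qed
    have mono: "P k \<subseteq> P l" if "l \<le> k" for k l
    proof -
      have "1 / (real k + 1) \<le> 1 / (real l + 1)" using that by (intro divide_left_mono) auto
      then show ?thesis by (auto simp: P_def)
    qed
    have mem: "H \<in> separating n q \<epsilon>" if w: "H = hyperplane n w s" "w \<in> euclid_sphere n" and all: "\<And>k. (w, s) \<in> P k" for w s
    proof -
      have "0 \<le> s"
      proof (rule ccontr)
        assume "\<not> 0 \<le> s"
        then have "0 < - s" by simp
        then obtain k where "1 / real (Suc k) < - s" using nat_approx_posE by blast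
        then show False using all[of k] by (simp add: P_def add.commute)
      qed
      then show ?thesis using w all[of 0] by (auto simp: separating_def P_def)
    qed
    show "H \<in> separating n q \<epsilon>"
    proof (cases "\<forall>k. (u, t) \<in> P k")
      case True
      then show ?thesis using mem u by blast
    next
      case False
      then obtain k0 where "(u, t) \<notin> P k0" by blast
      then have "(v, - t) \<in> P (max k k0)" for k using or[of "max k k0"] mono[of k0 "max k k0"] by auto
      then have "(v, - t) \<in> P k" for k using mono[of k "max k k0"] by (meson max.cobounded1 subsetD)
      then show ?thesis using mem v by blast
    qed
  qed
  ultimately show ?thesis by auto
qed

subsection \<open>The intensity measure\<close>

definition intensity_const :: "nat \<Rightarrow> real \<Rightarrow> real" where
  "intensity_const n \<gamma> = 2 * \<gamma> / (real n * unit_ball_vol (real n))"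

text \<open>As for the Hausdorff measure, the defining formula takes effect only once it is shown to
  be countably additive, which is monotone convergence in both integrals.\<close>

lemma emeasure_hyperplane_intensity:
  assumes A: "A \<in> sets (hborel n)"
  shows "emeasure (hyperplane_intensity n \<gamma> r) A = ennreal (intensity_const n \<gamma>) *
    (\<integral>\<^sup>+u\<in>euclid_sphere n. (\<integral>\<^sup>+t\<in>{0..}. indicator A (hyperplane n u t) * ennreal (t powr (r - 1)) \<partial>lborel)
      \<partial>hausdorff_measure n (n - 1))"
proof -
  let ?H = "hausdorff_measure n (n - 1)"
  define g where "g A u = (\<integral>\<^sup>+t\<in>{0..}. indicator A (hyperplane n u t) * ennreal (t powr (r - 1)) \<partial>lborel) * indicator (euclid_sphere n) u" for A u
  define \<mu> where "\<mu> A = ennreal (intensity_const n \<gamma>) * (\<integral>\<^sup>+u. g A u \<partial>?H)" for A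
  have meas: "(\<lambda>(u, t). indicator A (hyperplane n u t) * ennreal (t powr (r - 1)) * indicator {0..} t * indicator (euclid_sphere n) u)
     \<in> borel_measurable (euclid_lborel n \<Otimes>\<^sub>M lborel)" if "A \<in> sets (hborel n)" for A
  proof -
    let ?B = "{(u, t). u \<in> euclid_sphere n \<and> hyperplane n u t \<in> A}"
    have s: "sets (euclid_lborel n \<Otimes>\<^sub>M lborel) = sets (euclid_lborel n \<Otimes>\<^sub>M (borel :: real measure))"
      by (intro sets_pair_measure_cong) auto
    have [measurable]: "?B \<in> sets (euclid_lborel n \<Otimes>\<^sub>M lborel)" unfolding s by (rule hborel_preimage[OF that])
    have "(\<lambda>z. indicator ?B z * (ennreal (snd z powr (r - 1)) * indicator {0..} (snd z))) \<in> borel_measurable (euclid_lborel n \<Otimes>\<^sub>M lborel)"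
      by measurable
    also have "?this \<longleftrightarrow> ?thesis"
      by (intro measurable_cong) (auto simp: indicator_def)
    finally show ?thesis .
  qed
  have g_alt: "g A u = (\<integral>\<^sup>+t. indicator A (hyperplane n u t) * ennreal (t powr (r - 1)) * indicator {0..} t * indicator (euclid_sphere n) u \<partial>lborel)" for A u
    by (cases "u \<in> euclid_sphere n") (auto simp: g_def)
  have g_meas: "g A \<in> borel_measurable ?H" if "A \<in> sets (hborel n)" for A
    unfolding g_alt[abs_def] measurable_hausdorff_measure
    by (rule lborel.borel_measurable_nn_integral) (rule meas[OF that])
  have line: "(\<lambda>t. indicator A (hyperplane n u t) * ennreal (t powr (r - 1)) * indicator {0..} t * indicator (euclid_sphere n) u) \<in> borel_measurable lborel"
    if "A \<in> sets (hborel n)" "u \<in> euclid n" for A u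
    using measurable_compose[OF measurable_Pair1' meas[OF that(1)], of u] that(2) by simp
  have "emeasure (hyperplane_intensity n \<gamma> r) A = \<mu> A"
  proof (rule emeasure_measure_of[where \<Omega>="hyperplanes n" and A="sets (hborel n)"])
    show "hyperplane_intensity n \<gamma> r = measure_of (hyperplanes n) (sets (hborel n)) \<mu>"
      by (simp add: hyperplane_intensity_def \<mu>_def[abs_def] g_def[abs_def] intensity_const_def)
    show "sets (hborel n) \<subseteq> Pow (hyperplanes n)" using sets.sets_into_space space_hborel by blast
    have sI: "sets (hyperplane_intensity n \<gamma> r) = sets (hborel n)"
      unfolding hyperplane_intensity_def space_hborel[symmetric] by (rule sets.sets_measure_of_eq)
    show "A \<in> sets (hyperplane_intensity n \<gamma> r)" using A sI by simp
    show "positive (sets (hyperplane_intensity n \<gamma> r)) \<mu>"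
      by (simp add: positive_def \<mu>_def g_def)
    show "countably_additive (sets (hyperplane_intensity n \<gamma> r)) \<mu>"
      unfolding sI
    proof (rule countably_additiveI)
      fix F :: "nat \<Rightarrow> (nat \<Rightarrow> real) set set"
      assume F: "range F \<subseteq> sets (hborel n)" "disjoint_family F"
      have "(\<Sum>i. \<mu> (F i)) = ennreal (intensity_const n \<gamma>) * (\<Sum>i. \<integral>\<^sup>+u. g (F i) u \<partial>?H)"
        unfolding \<mu>_def by (rule ennreal_suminf_cmult)
      also have "(\<Sum>i. \<integral>\<^sup>+u. g (F i) u \<partial>?H) = (\<integral>\<^sup>+u. (\<Sum>i. g (F i) u) \<partial>?H)"
        using F(1) by (intro nn_integral_suminf[symmetric] g_meas) auto
      also have "\<dots> = (\<integral>\<^sup>+u. g (\<Union>i. F i) u \<partial>?H)"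
      proof (rule nn_integral_cong)
        fix u assume u: "u \<in> space ?H"
        have "(\<Sum>i. g (F i) u) = (\<integral>\<^sup>+t. (\<Sum>i. indicator (F i) (hyperplane n u t) * ennreal (t powr (r - 1)) * indicator {0..} t * indicator (euclid_sphere n) u) \<partial>lborel)"
          unfolding g_alt using F(1) u by (intro nn_integral_suminf[symmetric] line) auto
        also have "\<dots> = g (\<Union>i. F i) u"
          unfolding g_alt
          by (intro nn_integral_cong) (simp add: mult.assoc ennreal_suminf_multc suminf_indicator[OF F(2)])
        finally show "(\<Sum>i. g (F i) u) = g (\<Union>i. F i) u" .
      qed
      finally show "(\<Sum>i. \<mu> (F i)) = \<mu> (\<Union>i. F i)" by (simp add: \<mu>_def)
    qed
  qed
  then show ?thesis by (simp add: \<mu>_def g_def)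
qed

lemma nn_integral_powr_0:
  assumes "r > 0" "c \<ge> 0"
  shows "(\<integral>\<^sup>+t. ennreal (t powr (r - 1)) * indicator {0..c} t \<partial>lborel) = ennreal (c powr r / r)"
proof -
  have "((\<lambda>t. t powr (r - 1)) has_integral (c powr (r - 1 + 1) / (r - 1 + 1))) {0..c}"
    using assms by (intro has_integral_powr_from_0) auto
  then have "((\<lambda>t. t powr (r - 1)) has_integral (c powr r / r)) {0..c}" by simp
  from nn_integral_has_integral_lebesgue[OF _ this] show ?thesis
    by (simp add: ennreal_mult' ennreal_indicator mult.commute)
qed

text \<open>For \<open>t > 0\<close> the other parametrization \<open>(- u, - t)\<close> is excluded
  by its negative offset.\<close>

lemma separating_0_iff:
  assumes "u \<in> euclid_sphere n" "t > 0"
  shows "hyperplane n u t \<in> separating n x 0 \<longleftrightarrow> t < ip n x u"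
proof
  assume "hyperplane n u t \<in> separating n x 0"
  then obtain v s where v: "v \<in> euclid_sphere n" "hyperplane n u t = hyperplane n v s" "0 \<le> s" "s < ip n x v"
    by (auto simp: separating_def)
  then show "t < ip n x u" using hyperplane_eqD[OF assms(1) v(1,2)] assms(2) by auto
next
  assume "t < ip n x u"
  then show "hyperplane n u t \<in> separating n x 0"
    unfolding separating_def using assms by (intro CollectI exI[of _ u] exI[of _ t]) simp
qed

text \<open>As a function of \<open>u\<close>, the support function of the segment from the origin
  to \<open>x\<close>.\<close>

definition pos_ip :: "nat \<Rightarrow> (nat \<Rightarrow> real) \<Rightarrow> (nat \<Rightarrow> real) \<Rightarrow> real" where
  "pos_ip n x u = max 0 (ip n x u)"

text \<open>For fixed \<open>u\<close> the relevant offsets fill \<open>{0..m}\<close>, up to the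
  endpoints, where \<open>m\<close> is the larger of the two support functions; integrating
  \<open>t powr (r - 1)\<close> gives \<open>m powr r / r\<close>.\<close>

lemma emeasure_separating_Un:
  assumes r: "r > 0"
  shows "emeasure (hyperplane_intensity n \<gamma> r) (separating n x 0 \<union> separating n y 0) =
    ennreal (intensity_const n \<gamma>) * (\<integral>\<^sup>+u. ennreal (max (pos_ip n x u) (pos_ip n y u) powr r / r) * indicator (euclid_sphere n) u \<partial>hausdorff_measure n (n - 1))"
proof -
  have line: "(\<integral>\<^sup>+t\<in>{0..}. indicator (separating n x 0 \<union> separating n y 0) (hyperplane n u t) * ennreal (t powr (r - 1)) \<partial>lborel) =
    ennreal (max (pos_ip n x u) (pos_ip n y u) powr r / r)" if u: "u \<in> euclid_sphere n" for u
  proof -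
    let ?m = "max (pos_ip n x u) (pos_ip n y u)"
    have ae: "AE t in lborel. t \<noteq> 0 \<and> t \<noteq> ?m"
      using AE_lborel_singleton[of 0] AE_lborel_singleton[of ?m] by eventually_elim auto
    have "(\<integral>\<^sup>+t\<in>{0..}. indicator (separating n x 0 \<union> separating n y 0) (hyperplane n u t) * ennreal (t powr (r - 1)) \<partial>lborel) =
      (\<integral>\<^sup>+t. ennreal (t powr (r - 1)) * indicator {0..?m} t \<partial>lborel)"
    proof (rule nn_integral_cong_AE)
      show "AE t in lborel. indicator (separating n x 0 \<union> separating n y 0) (hyperplane n u t) * ennreal (t powr (r - 1)) * indicator {0..} t =
         ennreal (t powr (r - 1)) * indicator {0..?m} t"
        using ae
      proof eventually_elim
        case (elim t)
        show ?case
        proof (cases "t > 0")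
          case True
          have iff: "hyperplane n u t \<in> separating n x 0 \<union> separating n y 0 \<longleftrightarrow> t < ?m"
            unfolding Un_iff separating_0_iff[OF u True] pos_ip_def using True by (simp add: less_max_iff_disj)
          have t: "t \<in> {0..}" "t \<in> {0..?m} \<longleftrightarrow> t < ?m" using True elim by auto
          show ?thesis unfolding indicator_def iff t(2) using t(1) by simp
        next
          case False
          then have "t \<notin> {0..}" "t \<notin> {0..?m}" using elim by auto
          then have "indicator {0..} t = (0 :: ennreal)" "indicator {0..?m} t = (0 :: ennreal)"
            unfolding indicator_def by (simp_all only: of_bool_eq)
          then show ?thesis by (simp only: mult_zero_right)
        qed
      qed
    qed
    also have "\<dots> = ennreal (?m powr r / r)" by (rule nn_integral_powr_0[OF r]) (simp add: pos_ip_def)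
    finally show ?thesis .
  qed
  have "separating n x 0 \<union> separating n y 0 \<in> sets (hborel n)"
    by (intro sets.Un sets_separating)
  note emeasure_hyperplane_intensity[OF this, of \<gamma> r]
  also have "(\<integral>\<^sup>+u\<in>euclid_sphere n. (\<integral>\<^sup>+t\<in>{0..}. indicator (separating n x 0 \<union> separating n y 0) (hyperplane n u t) *
        ennreal (t powr (r - 1)) \<partial>lborel) \<partial>hausdorff_measure n (n - 1)) =
    (\<integral>\<^sup>+u. ennreal (max (pos_ip n x u) (pos_ip n y u) powr r / r) * indicator (euclid_sphere n) u \<partial>hausdorff_measure n (n - 1))"
  proof (rule nn_integral_cong)
    fix u
    show "(\<integral>\<^sup>+t\<in>{0..}. indicator (separating n x 0 \<union> separating n y 0) (hyperplane n u t) *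
        ennreal (t powr (r - 1)) \<partial>lborel) * indicator (euclid_sphere n) u =
      ennreal (max (pos_ip n x u) (pos_ip n y u) powr r / r) * indicator (euclid_sphere n) u"
    proof (cases "u \<in> euclid_sphere n")
      case True
      then show ?thesis by (simp only: line)
    qed simp
  qed
  finally show ?thesis .
qed

subsection \<open>Void probabilities of the zero cell\<close>

text \<open>A hyperplane through the origin contributes both of its half-spaces to
  \<open>zero_cell\<close>. Correspondingly \<open>separating\<close> admits \<open>t = 0\<close>
  with either normal, so the equivalence has no exceptional hyperplanes.\<close>

lemma mem_zero_cell:
  assumes "x \<in> euclid n"
  shows "x \<in> zero_cell n \<H> \<longleftrightarrow> \<H> \<inter> separating n x 0 = {}"
proof -
  have o: "euclid_origin n \<in> euclid n" "ip n (euclid_origin n) u = 0" for u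
    by (auto simp: euclid_origin_def euclid_def euclid_inner_def)
  show ?thesis
  proof
    assume x: "x \<in> zero_cell n \<H>"
    show "\<H> \<inter> separating n x 0 = {}"
    proof (rule ccontr)
      assume "\<not> ?thesis"
      then obtain u t where H: "hyperplane n u t \<in> \<H>" "u \<in> euclid_sphere n" "0 \<le> t" "t < ip n x u"
        by (auto simp: separating_def)
      let ?h = "{y \<in> euclid n. ip n y u \<le> t}"
      have "?h \<in> closed_halfspaces n (hyperplane n u t)" using H(2) by (auto simp: closed_halfspaces_def)
      moreover have "euclid_origin n \<in> ?h" using o H(3) by simp
      ultimately have "x \<in> ?h" using x H(1) unfolding zero_cell_def by blast
      then show False using H(4) by simp
    qed
  next
    assume *: "\<H> \<inter> separating n x 0 = {}"
    show "x \<in> zero_cell n \<H>"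
      unfolding zero_cell_def
    proof (intro IntI assms InterI)
      fix h assume "h \<in> {h. \<exists>H\<in>\<H>. h \<in> closed_halfspaces n H \<and> euclid_origin n \<in> h}"
      then obtain u t where H: "hyperplane n u t \<in> \<H>" "u \<in> euclid_sphere n" "h = {y \<in> euclid n. ip n y u \<le> t}" "euclid_origin n \<in> h"
        by (auto simp: closed_halfspaces_def)
      have "0 \<le> t" using H(3,4) o by simp
      have "hyperplane n u t \<notin> separating n x 0" using * H(1) by blast
      then have "\<not> t < ip n x u" using H(2) \<open>0 \<le> t\<close> by (auto simp: separating_def)
      then show "x \<in> h" using H(3) assms by simp
    qed
  qed
qed

locale hyperplane_process =
  fixes M :: "'w measure" and n :: nat and \<gamma> r :: real and X :: "'w \<Rightarrow> (nat \<Rightarrow> real) set set"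
  assumes process: "poisson_hyperplane_process M n \<gamma> r X" and n2: "n \<ge> 2" and \<gamma>: "\<gamma> > 0" and r: "r > 0"
begin

sublocale prob_space M
  using process by (simp add: poisson_hyperplane_process_def poisson_process_def point_process_def)

lemma point_count_0_iff: "point_count X A \<omega> = 0 \<longleftrightarrow> X \<omega> \<inter> A = {}"
  unfolding point_count_def by (subst emeasure_count_space_eq_0) auto

lemma sets_hit: "A \<in> sets (hborel n) \<Longrightarrow> {\<omega> \<in> space M. X \<omega> \<inter> A = {}} \<in> sets M"
proof -
  assume "A \<in> sets (hborel n)"
  then have [measurable]: "point_count X A \<in> borel_measurable M"
    using process by (simp add: poisson_hyperplane_process_def poisson_process_def point_process_def)
  have "{\<omega> \<in> space M. point_count X A \<omega> = 0} \<in> sets M" by measurable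
  then show ?thesis by (simp add: point_count_0_iff)
qed

lemma prob_void:
  assumes "A \<in> sets (hborel n)" "emeasure (hyperplane_intensity n \<gamma> r) A < \<infinity>"
  shows "prob {\<omega> \<in> space M. X \<omega> \<inter> A = {}} = exp (- measure (hyperplane_intensity n \<gamma> r) A)"
proof -
  have "\<forall>k::nat. prob {\<omega> \<in> space M. point_count X A \<omega> = of_nat k} =
    exp (- measure (hyperplane_intensity n \<gamma> r) A) * measure (hyperplane_intensity n \<gamma> r) A ^ k / fact k"
    using process assms unfolding poisson_hyperplane_process_def poisson_process_def by blast
  from spec[OF this, of 0] show ?thesis by (simp add: point_count_0_iff)
qed

text \<open>Reduces measurability to countably many conditions. A hyperplane strictly separating
  \<open>x\<close> also separates a rational point \<open>q\<close> near \<open>x\<close> with a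
  rational margin; conversely, a margin exceeding the distance from \<open>q\<close> to
  \<open>x\<close> carries the separation over to \<open>x\<close>.\<close>

lemma rational_separation:
  assumes x: "x \<in> euclid n"
  shows "x \<notin> zero_cell n \<H> \<longleftrightarrow>
    (\<exists>q\<in>{..<n} \<rightarrow>\<^sub>E \<rat>. \<exists>\<epsilon>\<in>\<rat>. nrm n (\<lambda>i. x i - q i) < \<epsilon> \<and> \<H> \<inter> separating n q \<epsilon> \<noteq> {})"
proof
  assume "x \<notin> zero_cell n \<H>"
  then obtain u t where H: "hyperplane n u t \<in> \<H>" "u \<in> euclid_sphere n" "0 \<le> t" "t < ip n x u"
    using mem_zero_cell[OF x] by (auto simp: separating_def)
  \<comment> \<open>One third of the gap: the move from \<open>x\<close> to \<open>q\<close> uses at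
    most \<open>\<delta>\<close>, the margin \<open>\<epsilon>\<close> less than
    \<open>2 * \<delta>\<close>.\<close>
  define \<delta> where "\<delta> = (ip n x u - t) / 3"
  have \<delta>: "\<delta> > 0" using H by (simp add: \<delta>_def)
  have n0: "real n > 0" using n2 by simp
  have "\<exists>p\<in>\<rat>. x i - \<delta> / n < p \<and> p < x i" for i
    using Rats_dense_in_real[of "x i - \<delta> / n" "x i"] \<delta> n0 by auto
  then obtain p where p: "\<And>i. p i \<in> \<rat>" "\<And>i. x i - \<delta> / n < p i" "\<And>i. p i < x i" by metis
  define q where "q = restrict p {..<n}"
  have "nrm n (\<lambda>i. x i - q i) \<le> (\<Sum>i<n. \<bar>x i - q i\<bar>)" by (rule L2_set_le_sum_abs)
  also have "\<dots> \<le> (\<Sum>i<n. \<delta> / n)"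
  proof (rule sum_mono)
    fix i assume "i \<in> {..<n}"
    then show "\<bar>x i - q i\<bar> \<le> \<delta> / n" using p(2)[of i] p(3)[of i] by (simp add: q_def)
  qed
  also have "\<dots> = \<delta>" using n0 by simp
  finally have dist: "nrm n (\<lambda>i. x i - q i) \<le> \<delta>" .
  obtain \<epsilon> where \<epsilon>: "\<epsilon> \<in> \<rat>" "\<delta> < \<epsilon>" "\<epsilon> < 2 * \<delta>" using Rats_dense_in_real[of \<delta> "2 * \<delta>"] \<delta> by auto
  have "ip n x u - ip n q u \<le> \<bar>ip n (\<lambda>i. x i - q i) u\<bar>" by (simp add: ip_diff)
  also have "\<dots> \<le> nrm n (\<lambda>i. x i - q i) * nrm n u" by (rule abs_ip_le)
  also have "\<dots> \<le> \<delta>" using dist H(2) by (simp add: sphere_subset)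
  finally have "t < ip n q u - \<epsilon>" using \<epsilon> by (simp add: \<delta>_def)
  then have "\<H> \<inter> separating n q \<epsilon> \<noteq> {}" using H by (auto simp: separating_def)
  then show "\<exists>q\<in>{..<n} \<rightarrow>\<^sub>E \<rat>. \<exists>\<epsilon>\<in>\<rat>. nrm n (\<lambda>i. x i - q i) < \<epsilon> \<and> \<H> \<inter> separating n q \<epsilon> \<noteq> {}"
    using p(1) dist \<epsilon> by (intro bexI[of _ q] bexI[of _ \<epsilon>]) (auto simp: q_def)
next
  assume "\<exists>q\<in>{..<n} \<rightarrow>\<^sub>E \<rat>. \<exists>\<epsilon>\<in>\<rat>. nrm n (\<lambda>i. x i - q i) < \<epsilon> \<and> \<H> \<inter> separating n q \<epsilon> \<noteq> {}"
  then obtain q \<epsilon> u t where H: "nrm n (\<lambda>i. x i - q i) < \<epsilon>" "hyperplane n u t \<in> \<H>" "u \<in> euclid_sphere n" "0 \<le> t" "t < ip n q u - \<epsilon>"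
    by (auto simp: separating_def)
  have "ip n q u - ip n x u \<le> \<bar>ip n (\<lambda>i. x i - q i) u\<bar>" by (simp add: ip_diff)
  also have "\<dots> \<le> nrm n (\<lambda>i. x i - q i) * nrm n u" by (rule abs_ip_le)
  also have "\<dots> < \<epsilon>" using H by (simp add: sphere_subset)
  finally have "t < ip n x u" using H(5) by linarith
  then show "x \<notin> zero_cell n \<H>" using H mem_zero_cell[OF x] by (auto simp: separating_def)
qed

text \<open>Joint measurability in outcome and point, as needed for Fubini. By
  \<open>rational_separation\<close> the complement is a countable union of measurable
  rectangles.\<close>

lemma sets_zero_cell_pairs:
  "{(\<omega>, x). \<omega> \<in> space M \<and> x \<in> zero_cell n (X \<omega>)} \<in> sets (M \<Otimes>\<^sub>M euclid_lborel n)"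
proof -
  let ?L = "euclid_lborel n"
  define I where "I = ({..<n} \<rightarrow>\<^sub>E (\<rat> :: real set)) \<times> (\<rat> :: real set)"
  define B where "B p = {\<omega> \<in> space M. X \<omega> \<inter> separating n (fst p) (snd p) \<noteq> {}} \<times> {x \<in> euclid n. nrm n (\<lambda>i. x i - fst p i) < snd p}" for p
  have "countable I"
    unfolding I_def by (intro countable_SIGMA countable_PiE countable_rat) auto
  moreover have "B p \<in> sets (M \<Otimes>\<^sub>M ?L)" for p
  proof -
    have "{\<omega> \<in> space M. X \<omega> \<inter> separating n (fst p) (snd p) \<noteq> {}} = space M - {\<omega> \<in> space M. X \<omega> \<inter> separating n (fst p) (snd p) = {}}"
      by auto
    then have 1: "{\<omega> \<in> space M. X \<omega> \<inter> separating n (fst p) (snd p) \<noteq> {}} \<in> sets M"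
      using sets_hit[OF sets_separating] by auto
    have "{x \<in> space ?L. nrm n (\<lambda>i. x i - fst p i) < snd p} \<in> sets ?L" by measurable
    then show ?thesis unfolding B_def using 1 by auto
  qed
  ultimately have "(\<Union>p\<in>I. B p) \<in> sets (M \<Otimes>\<^sub>M ?L)" by (intro sets.countable_UN') auto
  then have "space (M \<Otimes>\<^sub>M ?L) - (\<Union>p\<in>I. B p) \<in> sets (M \<Otimes>\<^sub>M ?L)" by auto
  also have "space (M \<Otimes>\<^sub>M ?L) - (\<Union>p\<in>I. B p) = {(\<omega>, x). \<omega> \<in> space M \<and> x \<in> zero_cell n (X \<omega>)}"
  proof (intro set_eqI)
    fix z :: "'w \<times> (nat \<Rightarrow> real)"
    obtain \<omega> x where z: "z = (\<omega>, x)" by (cases z)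
    have "x \<in> zero_cell n (X \<omega>) \<Longrightarrow> x \<in> euclid n" by (simp add: zero_cell_def)
    then show "z \<in> space (M \<Otimes>\<^sub>M ?L) - (\<Union>p\<in>I. B p) \<longleftrightarrow> z \<in> {(\<omega>, x). \<omega> \<in> space M \<and> x \<in> zero_cell n (X \<omega>)}"
      using rational_separation[of x "X \<omega>"] unfolding z I_def B_def space_pair_measure by auto
  qed
  finally show ?thesis .
qed

end

subsection \<open>Integration over the sphere\<close>

text \<open>Placed on all of \<open>euclid n\<close> to share the sigma-algebra of
  \<open>euclid_lborel n\<close>; the area bound makes it finite for \<open>n \<ge> 2\<close>, so
  that Fubini applies.\<close>

definition sphere_measure :: "nat \<Rightarrow> (nat \<Rightarrow> real) measure" where
  "sphere_measure n = density (hausdorff_measure n (n - 1)) (indicator (euclid_sphere n))"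

definition sphere_area :: "nat \<Rightarrow> real" where
  "sphere_area n = measure (hausdorff_measure n (n - 1)) (euclid_sphere n)"

lemma space_sphere_measure [simp]: "space (sphere_measure n) = euclid n"
  by (simp add: sphere_measure_def)

lemma sets_sphere_measure [measurable_cong]: "sets (sphere_measure n) = sets (\<Pi>\<^sub>M i\<in>{..<n}. borel)"
  by (simp add: sphere_measure_def sets_hausdorff_measure)

lemma sphere_in_sets: "euclid_sphere n \<in> sets (hausdorff_measure n s)"
  using sets_euclid_sphere[of n] by (simp add: sets_hausdorff_measure sets_euclid_lborel)

lemma borel_measurable_sphere_measure:
  "borel_measurable (sphere_measure n) = borel_measurable (euclid_lborel n)"
  by (intro measurable_cong_sets) (simp_all add: sets_sphere_measure sets_euclid_lborel)

lemma nn_integral_sphere_measure: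
  assumes "f \<in> borel_measurable (euclid_lborel n)"
  shows "(\<integral>\<^sup>+u. f u \<partial>sphere_measure n) = (\<integral>\<^sup>+u. f u * indicator (euclid_sphere n) u \<partial>hausdorff_measure n (n - 1))"
  unfolding sphere_measure_def using assms sphere_in_sets
  by (subst nn_integral_density) (auto simp: measurable_hausdorff_measure mult.commute)

lemma AE_sphere_measure: "AE u in sphere_measure n. u \<in> euclid_sphere n"
  unfolding sphere_measure_def using sphere_in_sets by (subst AE_density) (auto simp: indicator_def)

lemma emeasure_sphere: "n \<ge> 2 \<Longrightarrow> emeasure (hausdorff_measure n (n - 1)) (euclid_sphere n) = ennreal (sphere_area n)"
  unfolding sphere_area_def
  using le_less_trans[OF hausdorff_sphere_upper ennreal_less_top]
  by (intro emeasure_eq_ennreal_measure) (simp only: less_top)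

lemma sphere_area_bounds:
  assumes "n \<ge> 2"
  shows "2 / (exp 1 * sqrt (2 * pi)) * (real n * unit_ball_vol (real n)) \<le> sphere_area n"
    "sphere_area n \<le> 16 * (real n * unit_ball_vol (real n))" "sphere_area n > 0"
proof -
  show 1: "2 / (exp 1 * sqrt (2 * pi)) * (real n * unit_ball_vol (real n)) \<le> sphere_area n"
    using hausdorff_sphere_lower[OF assms] unfolding emeasure_sphere[OF assms]
    by (subst (asm) ennreal_le_iff) (auto simp: sphere_area_def)
  show "sphere_area n \<le> 16 * (real n * unit_ball_vol (real n))"
    using hausdorff_sphere_upper[OF assms] unfolding emeasure_sphere[OF assms]
    by (subst (asm) ennreal_le_iff) auto
  have "0 < 2 / (exp 1 * sqrt (2 * pi)) * (real n * unit_ball_vol (real n))"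
    using assms unit_ball_vol_pos[of "real n"] by (intro mult_pos_pos divide_pos_pos) auto
  then show "sphere_area n > 0" using 1 by linarith
qed

lemma emeasure_sphere_measure_space: "n \<ge> 2 \<Longrightarrow> emeasure (sphere_measure n) (euclid n) = ennreal (sphere_area n)"
proof -
  assume n: "n \<ge> 2"
  have "emeasure (sphere_measure n) (euclid n) = (\<integral>\<^sup>+u. 1 \<partial>sphere_measure n)" by simp
  also have "\<dots> = (\<integral>\<^sup>+u. 1 * indicator (euclid_sphere n) u \<partial>hausdorff_measure n (n - 1))"
    by (rule nn_integral_sphere_measure) simp
  also have "\<dots> = ennreal (sphere_area n)" using sphere_in_sets emeasure_sphere[OF n] by simp
  finally show ?thesis .
qed

lemma finite_sphere_measure: "n \<ge> 2 \<Longrightarrow> finite_measure (sphere_measure n)"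
  by (rule finite_measureI) (simp add: emeasure_sphere_measure_space)

lemma nn_integral_sphere_refl:
  assumes f: "f \<in> borel_measurable (euclid_lborel n)"
  shows "(\<integral>\<^sup>+u. f (hrefl n w u) \<partial>sphere_measure n) = (\<integral>\<^sup>+u. f u \<partial>sphere_measure n)"
proof -
  let ?H = "hausdorff_measure n (n - 1)"
  note [measurable] = f
  have "(\<integral>\<^sup>+u. f (hrefl n w u) \<partial>sphere_measure n) = (\<integral>\<^sup>+u. f (hrefl n w u) * indicator (euclid_sphere n) u \<partial>?H)"
    by (rule nn_integral_sphere_measure) measurable
  also have "\<dots> = (\<integral>\<^sup>+u. f (hrefl n w u) * indicator (euclid_sphere n) (hrefl n w u) \<partial>?H)"
    by (intro nn_integral_cong) (simp add: indicator_def euclid_sphere_def)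
  also have "\<dots> = (\<integral>\<^sup>+u. f u * indicator (euclid_sphere n) u \<partial>distr ?H ?H (hrefl n w))"
    by (rule nn_integral_distr[symmetric]) (auto simp: measurable_hausdorff_measure)
  also have "\<dots> = (\<integral>\<^sup>+u. f u * indicator (euclid_sphere n) u \<partial>?H)" by (simp only: distr_hausdorff_refl)
  also have "\<dots> = (\<integral>\<^sup>+u. f u \<partial>sphere_measure n)" by (rule nn_integral_sphere_measure[symmetric, OF f])
  finally show ?thesis .
qed

section \<open>Integrals of support functions over the sphere\<close>

lemma pos_ip_nonneg [simp]: "0 \<le> pos_ip n x u"
  by (simp add: pos_ip_def)

lemma measurable_pos_ip [measurable (raw)]:
  assumes "f \<in> measurable M (euclid_lborel n)" "g \<in> measurable M (euclid_lborel n)"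
  shows "(\<lambda>x. pos_ip n (f x) (g x)) \<in> borel_measurable M"
  unfolding pos_ip_def
  by (intro borel_measurable_max measurable_ip borel_measurable_const measurable_compose[OF assms(1) measurable_coordinate]
      measurable_compose[OF assms(2) measurable_coordinate])

lemma pos_ip_refl: "pos_ip n (hrefl n w x) (hrefl n w u) = pos_ip n x u"
  by (simp add: pos_ip_def ip_refl_refl)

lemma pos_ip_refl_swap: "pos_ip n (hrefl n w x) u = pos_ip n x (hrefl n w u)"
  by (simp add: pos_ip_def ip_refl_swap)

lemma pos_ip_le: "pos_ip n x u \<le> nrm n x * nrm n u"
  using abs_ip_le[of n x u] by (auto simp: pos_ip_def)

definition support_int :: "nat \<Rightarrow> real \<Rightarrow> (nat \<Rightarrow> real) \<Rightarrow> ennreal" where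
  "support_int n r x = (\<integral>\<^sup>+u. ennreal (pos_ip n x u powr r) \<partial>sphere_measure n)"

definition meet_int :: "nat \<Rightarrow> real \<Rightarrow> (nat \<Rightarrow> real) \<Rightarrow> (nat \<Rightarrow> real) \<Rightarrow> ennreal" where
  "meet_int n r x y = (\<integral>\<^sup>+u. ennreal (min (pos_ip n x u) (pos_ip n y u) powr r) \<partial>sphere_measure n)"

text \<open>Homogeneity of degree \<open>r\<close> extracts the norm, and a reflection carrying the
  direction of \<open>x\<close> to the pole leaves the sphere measure unchanged.\<close>

lemma support_int_scale:
  assumes n: "n \<ge> 2" and r: "r > 0" and x: "x \<in> euclid n"
  shows "support_int n r x = ennreal (nrm n x powr r) * support_int n r (pole n)"
proof (cases "nrm n x = 0")
  case True
  then have "pos_ip n x u = 0" for u using pos_ip_le[of n x u] pos_ip_nonneg[of n x u] by simp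
  then show ?thesis using True by (simp add: support_int_def)
next
  case False
  then have pos: "0 < nrm n x" using L2_set_nonneg[of x "{..<n}"] by linarith
  define w where "w = (\<lambda>i. edir n x i - pole n i)"
  have R: "hrefl n w (edir n x) = pole n"
    unfolding w_def using n by (intro refl_maps edir_sphere pos pole_sphere) auto
  have scale: "pos_ip n x u = nrm n x * pos_ip n (pole n) (hrefl n w u)" for u
  proof -
    have "ip n (edir n x) u = ip n x u / nrm n x"
      unfolding edir_eq_scale ip_restrict ip_scale by simp
    then have "pos_ip n x u = nrm n x * pos_ip n (edir n x) u"
      using pos by (simp add: pos_ip_def max_mult_distrib_left)
    also have "pos_ip n (edir n x) u = pos_ip n (pole n) (hrefl n w u)"
      using pos_ip_refl[of n w "edir n x" u] R by simp
    finally show ?thesis .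
  qed
  have pole: "(\<lambda>_. pole n) \<in> measurable (euclid_lborel n) (euclid_lborel n)"
    using n by (intro measurable_const) (simp add: sphere_subset pole_sphere)
  have m: "(\<lambda>u. ennreal (pos_ip n (pole n) u powr r)) \<in> borel_measurable (euclid_lborel n)"
    using measurable_pos_ip[OF pole measurable_ident_sets[OF refl]] by measurable
  have "support_int n r x = (\<integral>\<^sup>+u. ennreal (nrm n x powr r) * ennreal (pos_ip n (pole n) (hrefl n w u) powr r) \<partial>sphere_measure n)"
    unfolding support_int_def using pos by (intro nn_integral_cong) (simp add: scale powr_mult ennreal_mult)
  also have "\<dots> = ennreal (nrm n x powr r) * (\<integral>\<^sup>+u. ennreal (pos_ip n (pole n) (hrefl n w u) powr r) \<partial>sphere_measure n)"
    using measurable_compose[OF measurable_refl m] by (intro nn_integral_cmult) (simp add: borel_measurable_sphere_measure)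
  also have "(\<integral>\<^sup>+u. ennreal (pos_ip n (pole n) (hrefl n w u) powr r) \<partial>sphere_measure n) = support_int n r (pole n)"
    unfolding support_int_def by (rule nn_integral_sphere_refl[OF m])
  finally show ?thesis .
qed

lemma support_int_pole_finite:
  assumes n: "n \<ge> 2" and r: "r > 0"
  shows "support_int n r (pole n) < top"
proof -
  have "support_int n r (pole n) \<le> (\<integral>\<^sup>+u. 1 \<partial>sphere_measure n)"
    unfolding support_int_def
  proof (rule nn_integral_mono_AE)
    show "AE u in sphere_measure n. ennreal (pos_ip n (pole n) u powr r) \<le> 1"
      using AE_sphere_measure
    proof eventually_elim
      case (elim u)
      have "pos_ip n (pole n) u \<le> 1"
        using pos_ip_le[of n "pole n" u] elim pole_sphere[of n] n by (simp add: sphere_subset)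
      then show ?case using r by (simp add: powr_le1)
    qed
  qed
  also have "\<dots> = ennreal (sphere_area n)" using n by (simp add: emeasure_sphere_measure_space)
  finally show ?thesis by (meson ennreal_less_top le_less_trans)
qed

abbreviation eball :: "nat \<Rightarrow> real \<Rightarrow> (nat \<Rightarrow> real) set" where
  "eball n \<rho> \<equiv> {x \<in> euclid n. nrm n x \<le> \<rho>}"

definition ball_moment :: "nat \<Rightarrow> real \<Rightarrow> ennreal" where
  "ball_moment n r = (\<integral>\<^sup>+x. ennreal (pos_ip n x (pole n) powr r) * indicator (eball n 1) x \<partial>euclid_lborel n)"

definition ball_min_moment :: "nat \<Rightarrow> real \<Rightarrow> ennreal" where
  "ball_min_moment n r = (\<integral>\<^sup>+x. \<integral>\<^sup>+y. ennreal (min (pos_ip n x (pole n)) (pos_ip n y (pole n)) powr r) *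
     (indicator (eball n 1) x * indicator (eball n 1) y) \<partial>euclid_lborel n \<partial>euclid_lborel n)"

lemma measurable_ident_euclid: "(\<lambda>x. x) \<in> measurable (euclid_lborel n) (euclid_lborel n)"
  by (rule measurable_ident_sets) simp

lemma pole_eq_refl:
  assumes "n \<ge> 2" "u \<in> euclid_sphere n"
  obtains w where "hrefl n w u = pole n" "hrefl n w (pole n) = u"
proof -
  let ?w = "\<lambda>i. u i - pole n i"
  have 1: "hrefl n ?w u = pole n" using assms by (intro refl_maps pole_sphere) auto
  then have "hrefl n ?w (pole n) = u" using refl_refl[of u n ?w] assms by (simp add: sphere_subset)
  with 1 show ?thesis using that by blast
qed

lemma indicator_eball_refl: "indicator (eball n \<rho>) (hrefl n w x) = (indicator (eball n \<rho>) x :: ennreal)" if "x \<in> euclid n"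
  using that by (simp add: indicator_def)

text \<open>After Fubini, a reflection taking \<open>u\<close> to the pole shows that the inner
  integral over the ball does not depend on \<open>u\<close>; the sphere remains through its total
  mass alone.\<close>

lemma nn_integral_support_int_ball:
  assumes n: "n \<ge> 2"
  shows "(\<integral>\<^sup>+x. support_int n r x * indicator (eball n 1) x \<partial>euclid_lborel n) = ennreal (sphere_area n) * ball_moment n r"
proof -
  let ?L = "euclid_lborel n" and ?U = "sphere_measure n"
  interpret U: finite_measure ?U by (rule finite_sphere_measure[OF n])
  interpret P: pair_sigma_finite ?U ?L ..
  note [measurable] = sets_euclid_ball
  have fstm: "fst \<in> measurable (?U \<Otimes>\<^sub>M ?L) ?L"
    using measurable_fst[of ?U ?L] by (simp cong: measurable_cong_sets add: sets_sphere_measure sets_euclid_lborel)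
  have m: "(\<lambda>z. pos_ip n (snd z) (fst z)) \<in> borel_measurable (?U \<Otimes>\<^sub>M ?L)"
    by (rule measurable_pos_ip[OF measurable_snd fstm])
  have mf: "(\<lambda>(u, x). ennreal (pos_ip n x u powr r) * indicator (eball n 1) x) \<in> borel_measurable (?U \<Otimes>\<^sub>M ?L)"
    using m unfolding case_prod_beta by measurable
  have line: "(\<lambda>u. ennreal (pos_ip n x u powr r)) \<in> borel_measurable ?U" if "x \<in> euclid n" for x
  proof -
    have "(\<lambda>u. pos_ip n x u) \<in> borel_measurable ?L"
      by (rule measurable_pos_ip[OF measurable_const measurable_ident_euclid]) (use that in simp)
    then show ?thesis unfolding borel_measurable_sphere_measure by measurable
  qed
  have linex: "(\<lambda>x. ennreal (pos_ip n x u powr r) * indicator (eball n 1) x) \<in> borel_measurable ?L" if "u \<in> euclid n" for u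
  proof -
    have [measurable]: "(\<lambda>x. pos_ip n x u) \<in> borel_measurable ?L"
      by (rule measurable_pos_ip[OF measurable_ident_euclid measurable_const]) (use that in simp)
    show ?thesis by measurable
  qed
  have "(\<integral>\<^sup>+x. support_int n r x * indicator (eball n 1) x \<partial>?L) =
      (\<integral>\<^sup>+x. \<integral>\<^sup>+u. ennreal (pos_ip n x u powr r) * indicator (eball n 1) x \<partial>?U \<partial>?L)"
    unfolding support_int_def by (intro nn_integral_cong nn_integral_multc[symmetric] line) simp
  also have "\<dots> = (\<integral>\<^sup>+u. \<integral>\<^sup>+x. ennreal (pos_ip n x u powr r) * indicator (eball n 1) x \<partial>?L \<partial>?U)"
    by (rule P.Fubini') (rule mf)
  also have "\<dots> = (\<integral>\<^sup>+u. ball_moment n r \<partial>?U)"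
  proof (rule nn_integral_cong_AE)
    show "AE u in ?U. (\<integral>\<^sup>+x. ennreal (pos_ip n x u powr r) * indicator (eball n 1) x \<partial>?L) = ball_moment n r"
      using AE_sphere_measure
    proof eventually_elim
      case (elim u)
      obtain w where w: "hrefl n w u = pole n" "hrefl n w (pole n) = u" using pole_eq_refl[OF n elim] .
      have "(\<integral>\<^sup>+x. ennreal (pos_ip n x u powr r) * indicator (eball n 1) x \<partial>?L) =
        (\<integral>\<^sup>+x. ennreal (pos_ip n (hrefl n w x) u powr r) * indicator (eball n 1) (hrefl n w x) \<partial>?L)"
        by (rule nn_integral_refl[symmetric]) (rule linex, use elim in \<open>simp add: sphere_subset\<close>)
      also have "\<dots> = ball_moment n r"
        unfolding ball_moment_def pos_ip_refl_swap w(1)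
        by (intro nn_integral_cong arg_cong2[where f="(*)"] refl indicator_eball_refl) simp
      finally show ?case .
    qed
  qed
  also have "\<dots> = ennreal (sphere_area n) * ball_moment n r"
    using n by (simp add: emeasure_sphere_measure_space mult.commute)
  finally show ?thesis .
qed

lemma measurable_min_pos_ip:
  assumes "f \<in> measurable M (euclid_lborel n)" "g \<in> measurable M (euclid_lborel n)" "h \<in> measurable M (euclid_lborel n)"
  shows "(\<lambda>z. ennreal (min (pos_ip n (f z) (h z)) (pos_ip n (g z) (h z)) powr r)) \<in> borel_measurable M"
  using measurable_pos_ip[OF assms(1,3)] measurable_pos_ip[OF assms(2,3)] by measurable

lemma measurable_meet_int:
  assumes n: "n \<ge> 2"
  shows "(\<lambda>(x, y). meet_int n r x y) \<in> borel_measurable (euclid_lborel n \<Otimes>\<^sub>M euclid_lborel n)"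
proof -
  let ?L = "euclid_lborel n" and ?U = "sphere_measure n"
  interpret U: finite_measure ?U by (rule finite_sphere_measure[OF n])
  have s: "snd \<in> measurable ((?L \<Otimes>\<^sub>M ?L) \<Otimes>\<^sub>M ?U) ?L"
    using measurable_snd[of "?L \<Otimes>\<^sub>M ?L" ?U] by (simp cong: measurable_cong_sets add: sets_sphere_measure sets_euclid_lborel)
  have "(\<lambda>z. ennreal (min (pos_ip n (fst (fst z)) (snd z)) (pos_ip n (snd (fst z)) (snd z)) powr r)) \<in> borel_measurable ((?L \<Otimes>\<^sub>M ?L) \<Otimes>\<^sub>M ?U)"
    by (intro measurable_min_pos_ip s measurable_compose[OF measurable_fst measurable_fst] measurable_compose[OF measurable_fst measurable_snd])
  then show ?thesis
    unfolding meet_int_def case_prod_beta by (intro U.borel_measurable_nn_integral) (simp add: case_prod_beta')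
qed

text \<open>The same exchange for two points. The dilation by \<open>\<rho>\<close> contributes
  \<open>\<rho> ^ n\<close> for each point and \<open>\<rho> powr r\<close> by homogeneity of the
  integrand.\<close>

lemma nn_integral_meet_int_ball:
  assumes n: "n \<ge> 2" and \<rho>: "\<rho> > 0"
  shows "(\<integral>\<^sup>+x. \<integral>\<^sup>+y. meet_int n r x y * (indicator (eball n \<rho>) x * indicator (eball n \<rho>) y) \<partial>euclid_lborel n \<partial>euclid_lborel n) =
    ennreal (sphere_area n) * (ennreal (\<rho> ^ n * \<rho> ^ n * \<rho> powr r) * ball_min_moment n r)"
proof -
  let ?L = "euclid_lborel n" and ?U = "sphere_measure n"
  interpret U: finite_measure ?U by (rule finite_sphere_measure[OF n])
  interpret P: pair_sigma_finite ?U ?L ..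
  note [measurable] = sets_euclid_ball
  define F where "F x y u = ennreal (min (pos_ip n x u) (pos_ip n y u) powr r) * (indicator (eball n \<rho>) x * indicator (eball n \<rho>) y)" for x y u
  have UL: "measurable N ?U = measurable N ?L" for N :: "'z measure"
    by (intro measurable_cong_sets) (simp_all add: sets_sphere_measure sets_euclid_lborel)
  have F_meas: "(\<lambda>z. F (f z) (g z) (h z)) \<in> borel_measurable N"
    if "f \<in> measurable N ?L" "g \<in> measurable N ?L" "h \<in> measurable N ?L" for f g h and N :: "'z measure"
    unfolding F_def using measurable_min_pos_ip[OF that] that(1,2) by measurable
  have id: "(\<lambda>x. x) \<in> measurable ?L ?L" by (rule measurable_ident_euclid)
  have sndU: "snd \<in> measurable (N \<Otimes>\<^sub>M ?U) ?L" for N :: "'z measure"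
    using measurable_snd[of N ?U] unfolding UL .
  have fstU: "fst \<in> measurable (?U \<Otimes>\<^sub>M N) ?L" for N :: "'z measure"
    using measurable_fst[of ?U N] unfolding UL .
  have idU: "(\<lambda>u. u) \<in> measurable ?U ?L"
    by (rule measurable_ident_sets) (simp add: sets_sphere_measure sets_euclid_lborel)
  have cst: "(\<lambda>_. x) \<in> measurable N ?L" if "x \<in> euclid n" for x and N :: "'z measure"
    using that by simp
  have "(\<integral>\<^sup>+x. \<integral>\<^sup>+y. meet_int n r x y * (indicator (eball n \<rho>) x * indicator (eball n \<rho>) y) \<partial>?L \<partial>?L) =
    (\<integral>\<^sup>+x. \<integral>\<^sup>+y. \<integral>\<^sup>+u. F x y u \<partial>?U \<partial>?L \<partial>?L)"
    unfolding meet_int_def F_def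
    by (intro nn_integral_cong nn_integral_multc[symmetric] measurable_min_pos_ip cst idU) auto
  also have "\<dots> = (\<integral>\<^sup>+x. \<integral>\<^sup>+u. \<integral>\<^sup>+y. F x y u \<partial>?L \<partial>?U \<partial>?L)"
  proof (rule nn_integral_cong)
    fix x assume x: "x \<in> space ?L"
    show "(\<integral>\<^sup>+y. \<integral>\<^sup>+u. F x y u \<partial>?U \<partial>?L) = (\<integral>\<^sup>+u. \<integral>\<^sup>+y. F x y u \<partial>?L \<partial>?U)"
    proof (rule P.Fubini')
      show "(\<lambda>(u, y). F x y u) \<in> borel_measurable (?U \<Otimes>\<^sub>M ?L)"
        unfolding case_prod_beta using x by (intro F_meas cst measurable_snd fstU) simp
    qed
  qed
  also have "\<dots> = (\<integral>\<^sup>+u. \<integral>\<^sup>+x. \<integral>\<^sup>+y. F x y u \<partial>?L \<partial>?L \<partial>?U)"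
  proof (rule P.Fubini')
    have "(\<lambda>z. F (snd (fst z)) (snd z) (fst (fst z))) \<in> borel_measurable ((?U \<Otimes>\<^sub>M ?L) \<Otimes>\<^sub>M ?L)"
      by (intro F_meas measurable_snd measurable_compose[OF measurable_fst measurable_snd] measurable_compose[OF measurable_fst fstU])
    then show "(\<lambda>(u, x). \<integral>\<^sup>+y. F x y u \<partial>?L) \<in> borel_measurable (?U \<Otimes>\<^sub>M ?L)"
      unfolding case_prod_beta by (intro euclid_lborel.borel_measurable_nn_integral) (simp add: case_prod_beta')
  qed
  also have "\<dots> = (\<integral>\<^sup>+u. ennreal (\<rho> ^ n * \<rho> ^ n * \<rho> powr r) * ball_min_moment n r \<partial>?U)"
  proof (rule nn_integral_cong_AE)
    show "AE u in ?U. (\<integral>\<^sup>+x. \<integral>\<^sup>+y. F x y u \<partial>?L \<partial>?L) = ennreal (\<rho> ^ n * \<rho> ^ n * \<rho> powr r) * ball_min_moment n r"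
      using AE_sphere_measure
    proof eventually_elim
      case (elim u)
      then have uE: "u \<in> euclid n" by (simp add: sphere_subset)
      have pE: "pole n \<in> euclid n" using n pole_sphere[of n] by (simp add: sphere_subset)
      obtain w where w: "hrefl n w u = pole n" "hrefl n w (pole n) = u" using pole_eq_refl[OF n elim] .
      have inner: "(\<lambda>x. \<integral>\<^sup>+y. F x y v \<partial>?L) \<in> borel_measurable ?L" if "v \<in> euclid n" for v
      proof -
        have "(\<lambda>z. F (fst z) (snd z) v) \<in> borel_measurable (?L \<Otimes>\<^sub>M ?L)"
          using that by (intro F_meas measurable_fst measurable_snd cst)
        then show ?thesis by (intro euclid_lborel.borel_measurable_nn_integral) (simp add: case_prod_beta')
      qed
      have FR: "F (hrefl n w x) (hrefl n w y) u = F x y (pole n)" if "x \<in> euclid n" "y \<in> euclid n" for x y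
        unfolding F_def pos_ip_refl_swap w(1) using that by (simp only: indicator_eball_refl)
      have "(\<integral>\<^sup>+x. \<integral>\<^sup>+y. F x y u \<partial>?L \<partial>?L) = (\<integral>\<^sup>+x. \<integral>\<^sup>+y. F (hrefl n w x) y u \<partial>?L \<partial>?L)"
        by (rule nn_integral_refl[symmetric]) (rule inner[OF uE])
      also have "\<dots> = (\<integral>\<^sup>+x. \<integral>\<^sup>+y. F (hrefl n w x) (hrefl n w y) u \<partial>?L \<partial>?L)"
        by (intro nn_integral_cong nn_integral_refl[symmetric] F_meas cst id uE) auto
      also have "\<dots> = (\<integral>\<^sup>+x. \<integral>\<^sup>+y. F x y (pole n) \<partial>?L \<partial>?L)"
        by (intro nn_integral_cong FR) auto
      also have "\<dots> = ennreal (\<bar>\<rho>\<bar> ^ n) * (\<integral>\<^sup>+x. \<integral>\<^sup>+y. F (\<lambda>i\<in>{..<n}. 0 + \<rho> * x i) y (pole n) \<partial>?L \<partial>?L)"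
        using \<rho> by (intro nn_integral_euclid_affine inner pE) auto
      also have "(\<integral>\<^sup>+x. \<integral>\<^sup>+y. F (\<lambda>i\<in>{..<n}. 0 + \<rho> * x i) y (pole n) \<partial>?L \<partial>?L) =
         (\<integral>\<^sup>+x. ennreal (\<bar>\<rho>\<bar> ^ n) * (\<integral>\<^sup>+y. F (\<lambda>i\<in>{..<n}. 0 + \<rho> * x i) (\<lambda>i\<in>{..<n}. 0 + \<rho> * y i) (pole n) \<partial>?L) \<partial>?L)"
        using \<rho> by (intro nn_integral_cong nn_integral_euclid_affine F_meas cst pE id) auto
      also have "\<dots> = (\<integral>\<^sup>+x. ennreal (\<bar>\<rho>\<bar> ^ n) * (ennreal (\<rho> powr r) * (\<integral>\<^sup>+y. ennreal (min (pos_ip n x (pole n)) (pos_ip n y (pole n)) powr r) *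
          (indicator (eball n 1) x * indicator (eball n 1) y) \<partial>?L)) \<partial>?L)"
      proof (intro nn_integral_cong arg_cong2[where f="(*)"] refl)
        fix x assume x: "x \<in> space ?L"
        have sc: "F (\<lambda>i\<in>{..<n}. 0 + \<rho> * x i) (\<lambda>i\<in>{..<n}. 0 + \<rho> * y i) (pole n) =
          ennreal (\<rho> powr r) * (ennreal (min (pos_ip n x (pole n)) (pos_ip n y (pole n)) powr r) * (indicator (eball n 1) x * indicator (eball n 1) y))"
          if y: "y \<in> euclid n" for y
        proof -
          have p: "pos_ip n (\<lambda>i\<in>{..<n}. 0 + \<rho> * z i) (pole n) = \<rho> * pos_ip n z (pole n)" for z
            using \<rho> by (simp add: pos_ip_def max_mult_distrib_left)
          have b: "indicator (eball n \<rho>) (\<lambda>i\<in>{..<n}. 0 + \<rho> * z i) = (indicator (eball n 1) z :: ennreal)" if "z \<in> euclid n" for z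
            using that \<rho> by (simp add: indicator_def nrm_scale)
          have "min (\<rho> * a) (\<rho> * b) powr r = \<rho> powr r * min a b powr r" if "0 \<le> a" "0 \<le> b" for a b
          proof -
            have "min (\<rho> * a) (\<rho> * b) = \<rho> * min a b" using \<rho> by (simp add: min_mult_distrib_left)
            then show ?thesis using \<rho> that by (simp add: powr_mult)
          qed
          then show ?thesis
            unfolding F_def p using b x y by (simp add: ennreal_mult mult.assoc)
        qed
        have "(\<integral>\<^sup>+y. F (\<lambda>i\<in>{..<n}. 0 + \<rho> * x i) (\<lambda>i\<in>{..<n}. 0 + \<rho> * y i) (pole n) \<partial>?L) =
          (\<integral>\<^sup>+y. ennreal (\<rho> powr r) * (ennreal (min (pos_ip n x (pole n)) (pos_ip n y (pole n)) powr r) * (indicator (eball n 1) x * indicator (eball n 1) y)) \<partial>?L)"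
          by (intro nn_integral_cong sc) simp
        also have "\<dots> = ennreal (\<rho> powr r) * (\<integral>\<^sup>+y. ennreal (min (pos_ip n x (pole n)) (pos_ip n y (pole n)) powr r) * (indicator (eball n 1) x * indicator (eball n 1) y) \<partial>?L)"
          using x pE measurable_min_pos_ip[OF cst[of x ?L] id cst[of "pole n" ?L]] by (intro nn_integral_cmult borel_measurable_times) auto
        finally show "(\<integral>\<^sup>+y. F (\<lambda>i\<in>{..<n}. 0 + \<rho> * x i) (\<lambda>i\<in>{..<n}. 0 + \<rho> * y i) (pole n) \<partial>?L) =
          ennreal (\<rho> powr r) * (\<integral>\<^sup>+y. ennreal (min (pos_ip n x (pole n)) (pos_ip n y (pole n)) powr r) *
          (indicator (eball n 1) x * indicator (eball n 1) y) \<partial>?L)" .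
      qed
      also have "\<dots> = ennreal (\<rho> ^ n) * (ennreal (\<rho> powr r) * ball_min_moment n r)"
      proof -
        have "(\<lambda>z. ennreal (min (pos_ip n (fst z) (pole n)) (pos_ip n (snd z) (pole n)) powr r) *
            (indicator (eball n 1) (fst z) * indicator (eball n 1) (snd z))) \<in> borel_measurable (?L \<Otimes>\<^sub>M ?L)"
          using measurable_min_pos_ip[OF measurable_fst measurable_snd cst[OF pE, of "?L \<Otimes>\<^sub>M ?L"]] by measurable
        then have "(\<lambda>x. \<integral>\<^sup>+y. ennreal (min (pos_ip n x (pole n)) (pos_ip n y (pole n)) powr r) *
            (indicator (eball n 1) x * indicator (eball n 1) y) \<partial>?L) \<in> borel_measurable ?L"
          by (intro euclid_lborel.borel_measurable_nn_integral) (simp add: case_prod_beta')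
        then show ?thesis
          unfolding ball_min_moment_def using \<rho> by (simp add: nn_integral_cmult)
      qed
      finally show ?case using \<rho> by (simp add: ennreal_mult mult.assoc)
    qed
  qed
  also have "\<dots> = ennreal (sphere_area n) * (ennreal (\<rho> ^ n * \<rho> ^ n * \<rho> powr r) * ball_min_moment n r)"
    using n by (simp add: emeasure_sphere_measure_space mult.commute)
  finally show ?thesis .
qed

subsection \<open>Moments of the volume of the zero cell\<close>

text \<open>Chebyshev's inequality in integrated form:
  \<open>a * b ^ k + a ^ k * b \<le> a ^ Suc k + b ^ Suc k\<close> with \<open>a = f x\<close> and
  \<open>b = f y\<close> is integrated over both variables. This works for values in
  [0, infinity].\<close>

lemma nn_integral_power_mean_step:
  fixes f :: "'a \<Rightarrow> ennreal"
  assumes f [measurable]: "f \<in> borel_measurable N"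
  shows "(\<integral>\<^sup>+x. f x \<partial>N) * (\<integral>\<^sup>+x. f x ^ k \<partial>N) \<le> emeasure N (space N) * (\<integral>\<^sup>+x. f x ^ Suc k \<partial>N)"
proof -
  let ?W = "emeasure N (space N)" and ?I = "\<lambda>j. \<integral>\<^sup>+x. f x ^ j \<partial>N"
  have cheb: "a * b ^ k + a ^ k * b \<le> a ^ Suc k + b ^ Suc k" for a b :: ennreal
  proof -
    have *: "a * b ^ k + a ^ k * b \<le> a ^ Suc k + b ^ Suc k" if "a \<le> b" for a b :: ennreal
    proof -
      \<comment> \<open>The inequality \<open>0 \<le> (b - a) * (b ^ k - a ^ k)\<close> is written
        additively, since subtraction on \<open>ennreal\<close> does not cancel.\<close>
      obtain c where c: "b = a + c" using \<open>a \<le> b\<close> by (auto simp: le_iff_add)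
      obtain d where d: "b ^ k = a ^ k + d" using power_mono[OF \<open>a \<le> b\<close>, of k] by (auto simp: le_iff_add)
      have "a * b ^ k + a ^ k * b = a * a ^ k + a * d + a ^ k * a + a ^ k * c"
        unfolding d by (simp add: c algebra_simps)
      also have "\<dots> \<le> a * a ^ k + (a * a ^ k + a * d + c * a ^ k + c * d)"
        by (simp add: algebra_simps add_increasing2)
      also have "a * a ^ k + a * d + c * a ^ k + c * d = b * b ^ k"
        unfolding d by (simp add: c algebra_simps)
      finally show ?thesis by simp
    qed
    show ?thesis using *[of a b] *[of b a] by (cases "a \<le> b") (auto simp: ac_simps)
  qed
  have "2 * (?I 1 * ?I k) = (\<integral>\<^sup>+x. (\<integral>\<^sup>+y. f x * f y ^ k + f x ^ k * f y \<partial>N) \<partial>N)"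
    by (simp add: nn_integral_add nn_integral_cmult nn_integral_multc mult_2 mult.commute)
  also have "\<dots> \<le> (\<integral>\<^sup>+x. (\<integral>\<^sup>+y. f x ^ Suc k + f y ^ Suc k \<partial>N) \<partial>N)"
    by (intro nn_integral_mono cheb)
  also have "\<dots> = 2 * (?W * ?I (Suc k))"
    by (simp add: nn_integral_add nn_integral_cmult nn_integral_multc mult_2 mult.commute del: power_Suc)
  finally show ?thesis
    by (subst (asm) ennreal_mult_le_mult_iff) auto
qed

lemma nn_integral_power_mean:
  fixes f :: "'a \<Rightarrow> ennreal"
  assumes f: "f \<in> borel_measurable N"
  shows "(\<integral>\<^sup>+x. f x \<partial>N) ^ Suc k \<le> emeasure N (space N) ^ k * (\<integral>\<^sup>+x. f x ^ Suc k \<partial>N)"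
proof (induction k)
  case (Suc k)
  let ?W = "emeasure N (space N)"
  have "(\<integral>\<^sup>+x. f x \<partial>N) ^ Suc (Suc k) \<le> (\<integral>\<^sup>+x. f x \<partial>N) * (?W ^ k * (\<integral>\<^sup>+x. f x ^ Suc k \<partial>N))"
    unfolding power_Suc[of _ "Suc k"] by (intro mult_left_mono Suc) simp
  also have "\<dots> = ?W ^ k * ((\<integral>\<^sup>+x. f x \<partial>N) * (\<integral>\<^sup>+x. f x ^ Suc k \<partial>N))" by (simp add: mult_ac)
  also have "\<dots> \<le> ?W ^ k * (?W * (\<integral>\<^sup>+x. f x ^ Suc (Suc k) \<partial>N))"
    by (intro mult_left_mono nn_integral_power_mean_step f) simp
  finally show ?case by (simp add: mult_ac)
qed simp

text \<open>The layer-cake weight: an integral of \<open>exp (- (q * nrm n x powr r))\<close>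
  becomes an integral over levels \<open>v\<close> of the volumes of sublevel sets, which are
  balls.\<close>

lemma nn_integral_exp_layer: "(\<integral>\<^sup>+v. ennreal (exp (- v)) * indicator {s..} v \<partial>lborel) = ennreal (exp (- s))" for s :: real
proof -
  have "(\<integral>\<^sup>+v. ennreal (exp (- v)) * indicator {s..} v \<partial>lborel) = ennreal (0 - (- exp (- s)))"
  proof (rule nn_integral_FTC_atLeast)
    show "((\<lambda>v. - exp (- v)) \<longlongrightarrow> (0 :: real)) at_top"
      using tendsto_minus[OF filterlim_compose[OF exp_at_bot filterlim_uminus_at_bot_at_top]] by simp
  qed (auto intro!: derivative_eq_intros)
  then show ?thesis by simp
qed

lemma nn_integral_Gamma:
  assumes "s \<ge> 0"
  shows "(\<integral>\<^sup>+v. ennreal (exp (- v)) * ennreal (v powr s) * indicator {0..} v \<partial>lborel) = ennreal (Gamma (s + 1))"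
proof -
  have "((\<lambda>t. t powr (s + 1 - 1) / exp t) has_integral Gamma (s + 1)) {0..}"
    using assms by (intro Gamma_integral_real) auto
  from nn_integral_has_integral_lebesgue[OF _ this]
  have "(\<integral>\<^sup>+v. ennreal (indicator {0..} v * (v powr s / exp v)) \<partial>lborel) = ennreal (Gamma (s + 1))" by simp
  also have "(\<integral>\<^sup>+v. ennreal (indicator {0..} v * (v powr s / exp v)) \<partial>lborel) =
    (\<integral>\<^sup>+v. ennreal (exp (- v)) * ennreal (v powr s) * indicator {0..} v \<partial>lborel)"
    by (intro nn_integral_cong) (auto simp: indicator_def ennreal_mult[symmetric] exp_minus divide_inverse mult.commute)
  finally show ?thesis .
qed

lemma indicator_powr_ball:
  assumes "q > 0" "r > 0" "v \<ge> 0" "x \<in> euclid n"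
  shows "q * nrm n x powr r \<le> v \<longleftrightarrow> x \<in> eball n ((v / q) powr (1 / r))"
proof -
  have "q * nrm n x powr r \<le> v \<longleftrightarrow> nrm n x powr r \<le> v / q" using assms by (simp add: field_simps)
  also have "\<dots> \<longleftrightarrow> nrm n x \<le> (v / q) powr (1 / r)"
  proof
    assume "nrm n x powr r \<le> v / q"
    then have "(nrm n x powr r) powr (1 / r) \<le> (v / q) powr (1 / r)" using assms by (intro powr_mono2) auto
    then show "nrm n x \<le> (v / q) powr (1 / r)" using assms by (simp add: powr_powr)
  next
    assume "nrm n x \<le> (v / q) powr (1 / r)"
    then have "nrm n x powr r \<le> ((v / q) powr (1 / r)) powr r" using assms by (intro powr_mono2) auto
    then show "nrm n x powr r \<le> v / q" using assms by (simp add: powr_powr)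
  qed
  finally show ?thesis using assms by simp
qed

text \<open>The sublevel set at \<open>v\<close> is the ball of radius
  \<open>(v / q) powr (1 / r)\<close>, with volume proportional to \<open>v powr (n / r)\<close>;
  integration against \<open>exp (- v)\<close> produces the Gamma value.\<close>

lemma nn_integral_exp_powr_nrm:
  assumes q: "q > 0" and r: "r > 0" and n: "n > 0"
  shows "(\<integral>\<^sup>+x. ennreal (exp (- (q * nrm n x powr r))) \<partial>euclid_lborel n) =
    ennreal (unit_ball_vol (real n) * q powr (- (real n / r)) * Gamma (real n / r + 1))"
proof -
  let ?L = "euclid_lborel n"
  interpret P: pair_sigma_finite lborel ?L ..
  have [measurable]: "(\<lambda>z. nrm n (snd z)) \<in> borel_measurable ((lborel :: real measure) \<Otimes>\<^sub>M ?L)"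
    by (rule measurable_nrm) (rule measurable_compose[OF measurable_snd measurable_coordinate])
  have set: "{z \<in> space (lborel \<Otimes>\<^sub>M ?L). q * nrm n (snd z) powr r \<le> fst z} \<in> sets (lborel \<Otimes>\<^sub>M ?L)"
    by measurable
  have "(\<integral>\<^sup>+x. ennreal (exp (- (q * nrm n x powr r))) \<partial>?L) =
    (\<integral>\<^sup>+x. \<integral>\<^sup>+v. ennreal (exp (- v)) * indicator {q * nrm n x powr r..} v \<partial>lborel \<partial>?L)"
    by (simp only: nn_integral_exp_layer)
  also have "\<dots> = (\<integral>\<^sup>+v. \<integral>\<^sup>+x. ennreal (exp (- v)) * indicator {q * nrm n x powr r..} v \<partial>?L \<partial>lborel)"
  proof (rule P.Fubini')
    have "(\<lambda>z. ennreal (exp (- fst z)) * indicator {z \<in> space (lborel \<Otimes>\<^sub>M ?L). q * nrm n (snd z) powr r \<le> fst z} z) \<in> borel_measurable (lborel \<Otimes>\<^sub>M ?L)"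
      using set by measurable
    also have "?this \<longleftrightarrow> (\<lambda>(v, x). ennreal (exp (- v)) * indicator {q * nrm n x powr r..} v) \<in> borel_measurable (lborel \<Otimes>\<^sub>M ?L)"
      by (intro measurable_cong) (auto simp: indicator_def)
    finally show "(\<lambda>(v, x). ennreal (exp (- v)) * indicator {q * nrm n x powr r..} v) \<in> borel_measurable (lborel \<Otimes>\<^sub>M ?L)" .
  qed
  also have "\<dots> = (\<integral>\<^sup>+v. ennreal (unit_ball_vol (real n) * q powr (- (real n / r))) * (ennreal (exp (- v)) * ennreal (v powr (real n / r)) * indicator {0..} v) \<partial>lborel)"
  proof (rule nn_integral_cong)
    fix v :: real
    show "(\<integral>\<^sup>+x. ennreal (exp (- v)) * indicator {q * nrm n x powr r..} v \<partial>?L) =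
      ennreal (unit_ball_vol (real n) * q powr (- (real n / r))) * (ennreal (exp (- v)) * ennreal (v powr (real n / r)) * indicator {0..} v)"
    proof (cases "v \<ge> 0")
      case True
      have "(\<integral>\<^sup>+x. ennreal (exp (- v)) * indicator {q * nrm n x powr r..} v \<partial>?L) =
          (\<integral>\<^sup>+x. ennreal (exp (- v)) * indicator (eball n ((v / q) powr (1 / r))) x \<partial>?L)"
        using indicator_powr_ball[OF q r True] by (intro nn_integral_cong) (auto simp: indicator_def)
      also have "\<dots> = ennreal (exp (- v)) * ennreal (unit_ball_vol (real n) * ((v / q) powr (1 / r)) ^ n)"
        by (simp add: nn_integral_cmult_indicator sets_euclid_ball emeasure_euclid_ball)
      also have "((v / q) powr (1 / r)) ^ n = v powr (real n / r) * q powr (- (real n / r))"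
      proof (cases "v = 0")
        case False
        then show ?thesis using True q
          by (simp add: powr_realpow[symmetric] powr_powr powr_divide powr_minus_divide)
      qed (use n in \<open>simp add: power_0_left\<close>)
      finally show ?thesis using True q by (simp add: ennreal_mult mult_ac)
    next
      case False
      have "v \<notin> {q * nrm n x powr r..}" for x
      proof -
        have "0 \<le> q * nrm n x powr r" using q by simp
        then show ?thesis using False by auto
      qed
      then show ?thesis using False by simp
    qed
  qed
  also have "\<dots> = ennreal (unit_ball_vol (real n) * q powr (- (real n / r))) * ennreal (Gamma (real n / r + 1))"
    using r by (subst nn_integral_cmult) (auto simp: nn_integral_Gamma)
  also have "\<dots> = ennreal (unit_ball_vol (real n) * q powr (- (real n / r)) * Gamma (real n / r + 1))"
    using r by (intro ennreal_mult[symmetric]) (auto intro!: less_imp_le[OF Gamma_real_pos] add_nonneg_pos)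
  finally show ?thesis .
qed

text \<open>Half of the volume of the unit ball lies beyond radius \<open>2 powr (- 1 / n)\<close>,
  where \<open>nrm n x powr r\<close> is at least \<open>2 powr (- r / n)\<close>. For
  \<open>r = a * n\<close> this is the constant \<open>2 powr (- a)\<close>.\<close>

lemma nn_integral_nrm_powr_ball:
  assumes r: "r > 0" and n: "n > 0"
  shows "(\<integral>\<^sup>+x. ennreal (nrm n x powr r) * indicator (eball n 1) x \<partial>euclid_lborel n) \<le> ennreal (unit_ball_vol (real n))"
    "ennreal (unit_ball_vol (real n) / (2 * 2 powr (r / real n))) \<le> (\<integral>\<^sup>+x. ennreal (nrm n x powr r) * indicator (eball n 1) x \<partial>euclid_lborel n)"
proof -
  let ?L = "euclid_lborel n" and ?\<kappa> = "unit_ball_vol (real n)"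
  note [measurable] = sets_euclid_ball
  have "(\<integral>\<^sup>+x. ennreal (nrm n x powr r) * indicator (eball n 1) x \<partial>?L) \<le> (\<integral>\<^sup>+x. indicator (eball n 1) x \<partial>?L)"
    using r by (intro nn_integral_mono) (auto simp: indicator_def powr_le1)
  also have "\<dots> = ennreal ?\<kappa>" by (simp add: sets_euclid_ball emeasure_euclid_ball)
  finally show "(\<integral>\<^sup>+x. ennreal (nrm n x powr r) * indicator (eball n 1) x \<partial>?L) \<le> ennreal ?\<kappa>" .
  define \<rho> where "\<rho> = 2 powr (- 1 / real n)"
  have \<rho>: "\<rho> > 0" "\<rho> \<le> 1" "\<rho> ^ n = 1 / 2" "\<rho> powr r = 1 / 2 powr (r / real n)"
  proof -
    show "\<rho> \<le> 1" unfolding \<rho>_def using powr_mono[of "- 1 / real n" 0 2] by simp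
    show "\<rho> ^ n = 1 / 2"
    proof -
      have "\<rho> ^ n = \<rho> powr real n" by (simp add: powr_realpow \<rho>_def)
      also have "\<dots> = 2 powr (- 1 / real n * real n)" by (simp only: \<rho>_def powr_powr)
      also have "- 1 / real n * real n = - 1" using n by simp
      finally show ?thesis by (simp add: powr_minus_divide)
    qed
    show "\<rho> powr r = 1 / 2 powr (r / real n)"
    proof -
      have "- 1 / real n * r = - (r / real n)" by simp
      then show ?thesis by (simp only: \<rho>_def powr_powr) (simp add: powr_minus_divide)
    qed
  qed (simp add: \<rho>_def)
  let ?A = "eball n 1 - eball n \<rho>"
  have "emeasure ?L ?A = emeasure ?L (eball n 1) - emeasure ?L (eball n \<rho>)"
    using emeasure_euclid_ball_finite[of n \<rho>] \<rho> by (intro emeasure_Diff) (auto simp: sets_euclid_ball)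
  also have "\<dots> = ennreal (?\<kappa> / 2)" using \<rho> by (simp add: emeasure_euclid_ball ennreal_minus)
  finally have A: "emeasure ?L ?A = ennreal (?\<kappa> / 2)" .
  have "ennreal (?\<kappa> / (2 * 2 powr (r / real n))) = ennreal (\<rho> powr r) * emeasure ?L ?A"
    unfolding A \<rho>(4) by (simp add: ennreal_mult[symmetric])
  also have "\<dots> = (\<integral>\<^sup>+x. ennreal (\<rho> powr r) * indicator ?A x \<partial>?L)"
    by (simp add: nn_integral_cmult_indicator sets_euclid_ball sets.Diff)
  also have "\<dots> \<le> (\<integral>\<^sup>+x. ennreal (nrm n x powr r) * indicator (eball n 1) x \<partial>?L)"
    using r \<rho>(1,2) by (intro nn_integral_mono) (auto simp: indicator_def intro!: ennreal_leI powr_mono2)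
  finally show "ennreal (?\<kappa> / (2 * 2 powr (r / real n))) \<le> (\<integral>\<^sup>+x. ennreal (nrm n x powr r) * indicator (eball n 1) x \<partial>?L)" .
qed

section \<open>Void probabilities and moments of the volume\<close>

context hyperplane_process
begin

abbreviation L :: "(nat \<Rightarrow> real) measure" where "L \<equiv> euclid_lborel n"

text \<open>The prefactor of the intensity after integrating over \<open>t\<close>, which
  contributes \<open>1 / r\<close>.\<close>

definition cc :: real where "cc = intensity_const n \<gamma> / r"

definition k0 :: real where "k0 = enn2real (support_int n r (pole n))"

definition qq :: real where "qq = cc * k0"

definition \<Phi> :: "(nat \<Rightarrow> real) \<Rightarrow> real" where "\<Phi> x = qq * nrm n x powr r"

definition meet :: "(nat \<Rightarrow> real) \<Rightarrow> (nat \<Rightarrow> real) \<Rightarrow> real" where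
  "meet x y = enn2real (ennreal cc * meet_int n r x y)"

lemma cc_pos: "cc > 0"
  unfolding cc_def intensity_const_def using \<gamma> r n2 unit_ball_vol_pos[of "real n"] by (intro divide_pos_pos mult_pos_pos) auto

lemma k0_nonneg: "k0 \<ge> 0" and qq_nonneg: "qq \<ge> 0"
  using cc_pos by (simp_all add: k0_def qq_def)

lemma \<Phi>_nonneg: "\<Phi> x \<ge> 0"
  using qq_nonneg by (simp add: \<Phi>_def)

lemma support_int_pole: "support_int n r (pole n) = ennreal k0"
  using support_int_pole_finite[OF n2 r] by (simp add: k0_def)

lemma support_int_eq: "x \<in> euclid n \<Longrightarrow> ennreal cc * support_int n r x = ennreal (\<Phi> x)"
  using support_int_scale[OF n2 r, of x] cc_pos k0_nonneg
  by (simp add: support_int_pole \<Phi>_def qq_def ennreal_mult mult_ac)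

lemma line_meas: "x \<in> euclid n \<Longrightarrow> (\<lambda>u. pos_ip n x u) \<in> borel_measurable (sphere_measure n)"
  unfolding borel_measurable_sphere_measure
  by (rule measurable_pos_ip[OF measurable_const measurable_ident_euclid]) simp

lemma meet_int_le:
  assumes "x \<in> euclid n" "y \<in> euclid n"
  shows "meet_int n r x y \<le> support_int n r x" "meet_int n r x y \<le> support_int n r y"
  unfolding meet_int_def support_int_def using r
  by (intro nn_integral_mono ennreal_leI powr_mono2; simp)+

lemma ennreal_meet: "x \<in> euclid n \<Longrightarrow> y \<in> euclid n \<Longrightarrow> ennreal (meet x y) = ennreal cc * meet_int n r x y"
proof -
  assume xy: "x \<in> euclid n" "y \<in> euclid n"
  have "ennreal cc * meet_int n r x y \<le> ennreal (\<Phi> x)"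
    unfolding support_int_eq[OF xy(1), symmetric] by (intro mult_left_mono meet_int_le xy) simp
  then have "ennreal cc * meet_int n r x y < top" by (meson ennreal_less_top le_less_trans)
  then show ?thesis unfolding meet_def by simp
qed

lemma meet_bounds:
  assumes xy: "x \<in> euclid n" "y \<in> euclid n"
  shows "0 \<le> meet x y" "meet x y \<le> \<Phi> x" "meet x y \<le> \<Phi> y"
proof -
  show "0 \<le> meet x y" by (simp add: meet_def)
  have "ennreal (meet x y) \<le> ennreal (\<Phi> x)" "ennreal (meet x y) \<le> ennreal (\<Phi> y)"
    unfolding ennreal_meet[OF xy] support_int_eq[OF xy(1), symmetric] support_int_eq[OF xy(2), symmetric]
    by (intro mult_left_mono meet_int_le xy; simp)+
  then show "meet x y \<le> \<Phi> x" "meet x y \<le> \<Phi> y" using \<Phi>_nonneg by (auto simp: ennreal_le_iff)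
qed

lemma meet_self: "x \<in> euclid n \<Longrightarrow> meet x x = \<Phi> x"
proof -
  assume x: "x \<in> euclid n"
  have "meet_int n r x x = support_int n r x" by (simp add: meet_int_def support_int_def)
  then have "ennreal (meet x x) = ennreal (\<Phi> x)" using ennreal_meet[OF x x] support_int_eq[OF x] by simp
  then show ?thesis using \<Phi>_nonneg meet_bounds(1)[OF x x] by simp
qed

text \<open>Maximum and minimum of the two support functions add up to their sum, also after raising
  each to the power \<open>r\<close>. As \<open>meet\<close> is finite it can be moved to the other
  side.\<close>

lemma emeasure_hitting:
  assumes xy: "x \<in> euclid n" "y \<in> euclid n"
  shows "emeasure (hyperplane_intensity n \<gamma> r) (separating n x 0 \<union> separating n y 0) = ennreal (\<Phi> x + \<Phi> y - meet x y)"
proof -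
  let ?U = "sphere_measure n"
  define A where "A = (\<integral>\<^sup>+u. ennreal (max (pos_ip n x u) (pos_ip n y u) powr r) \<partial>?U)"
  note [measurable] = line_meas[OF xy(1)] line_meas[OF xy(2)]
  have mm: "(\<lambda>u. max (pos_ip n x u) (pos_ip n y u)) \<in> borel_measurable L"
    using line_meas[OF xy(1)] line_meas[OF xy(2)] unfolding borel_measurable_sphere_measure by measurable
  have ic: "intensity_const n \<gamma> \<ge> 0" using cc_pos r by (simp add: cc_def zero_less_divide_iff)
  have "emeasure (hyperplane_intensity n \<gamma> r) (separating n x 0 \<union> separating n y 0) =
      ennreal (intensity_const n \<gamma>) * (\<integral>\<^sup>+u. ennreal (max (pos_ip n x u) (pos_ip n y u) powr r / r) \<partial>?U)"
    using mm unfolding emeasure_separating_Un[OF r] by (subst nn_integral_sphere_measure) measurable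
  also have "(\<integral>\<^sup>+u. ennreal (max (pos_ip n x u) (pos_ip n y u) powr r / r) \<partial>?U) =
      (\<integral>\<^sup>+u. ennreal (1 / r) * ennreal (max (pos_ip n x u) (pos_ip n y u) powr r) \<partial>?U)"
    using r by (intro nn_integral_cong) (simp add: ennreal_mult[symmetric])
  also have "\<dots> = ennreal (1 / r) * A"
    unfolding A_def by (rule nn_integral_cmult) measurable
  also have "ennreal (intensity_const n \<gamma>) * (ennreal (1 / r) * A) = ennreal cc * A"
    using ic r by (simp add: cc_def ennreal_mult[symmetric] mult.assoc[symmetric])
  finally have 1: "emeasure (hyperplane_intensity n \<gamma> r) (separating n x 0 \<union> separating n y 0) = ennreal cc * A" .
  have "A + meet_int n r x y = support_int n r x + support_int n r y"
  proof -
    have "A + meet_int n r x y = (\<integral>\<^sup>+u. ennreal (max (pos_ip n x u) (pos_ip n y u) powr r) + ennreal (min (pos_ip n x u) (pos_ip n y u) powr r) \<partial>?U)"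
      unfolding A_def meet_int_def by (rule nn_integral_add[symmetric]) measurable
    also have "\<dots> = (\<integral>\<^sup>+u. ennreal (pos_ip n x u powr r) + ennreal (pos_ip n y u powr r) \<partial>?U)"
      by (intro nn_integral_cong) (simp add: max_def min_def add.commute)
    also have "\<dots> = support_int n r x + support_int n r y"
      unfolding support_int_def by (rule nn_integral_add) measurable
    finally show ?thesis .
  qed
  then have "ennreal cc * A + ennreal cc * meet_int n r x y = ennreal cc * support_int n r x + ennreal cc * support_int n r y"
    by (simp only: distrib_left[symmetric])
  then have "ennreal cc * A + ennreal (meet x y) = ennreal (\<Phi> x + \<Phi> y)"
    using xy by (simp only: support_int_eq ennreal_meet ennreal_plus \<Phi>_nonneg)
  then have "ennreal cc * A = ennreal (\<Phi> x + \<Phi> y) - ennreal (meet x y)"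
    by (metis ennreal_add_diff_cancel_right ennreal_neq_top infinity_ennreal_def)
  also have "\<dots> = ennreal (\<Phi> x + \<Phi> y - meet x y)"
    using meet_bounds[OF xy] by (intro ennreal_minus) auto
  finally show ?thesis using 1 by simp
qed

definition Z :: "'w \<Rightarrow> (nat \<Rightarrow> real) set" where "Z \<omega> = zero_cell n (X \<omega>)"

lemma emeasure_Z2:
  assumes xy: "x \<in> euclid n" "y \<in> euclid n"
  shows "emeasure M {\<omega> \<in> space M. x \<in> Z \<omega> \<and> y \<in> Z \<omega>} = ennreal (exp (- (\<Phi> x + \<Phi> y - meet x y)))"
proof -
  have "{\<omega> \<in> space M. x \<in> Z \<omega> \<and> y \<in> Z \<omega>} = {\<omega> \<in> space M. X \<omega> \<inter> (separating n x 0 \<union> separating n y 0) = {}}"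
    using xy by (auto simp: Z_def mem_zero_cell)
  moreover have "prob {\<omega> \<in> space M. X \<omega> \<inter> (separating n x 0 \<union> separating n y 0) = {}} = exp (- (\<Phi> x + \<Phi> y - meet x y))"
  proof -
    have m: "measure (hyperplane_intensity n \<gamma> r) (separating n x 0 \<union> separating n y 0) = \<Phi> x + \<Phi> y - meet x y"
      unfolding measure_def emeasure_hitting[OF xy] using meet_bounds[OF xy] \<Phi>_nonneg[of x] \<Phi>_nonneg[of y] by (intro enn2real_ennreal) linarith
    show ?thesis
      unfolding m[symmetric] by (intro prob_void sets.Un sets_separating) (simp add: emeasure_hitting[OF xy])
  qed
  ultimately show ?thesis by (simp add: emeasure_eq_measure)
qed

lemma emeasure_Z1: "x \<in> euclid n \<Longrightarrow> emeasure M {\<omega> \<in> space M. x \<in> Z \<omega>} = ennreal (exp (- \<Phi> x))"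
  using emeasure_Z2[of x x] by (simp add: meet_self)

definition zi :: "'w \<Rightarrow> (nat \<Rightarrow> real) \<Rightarrow> ennreal" where "zi \<omega> x = indicator (Z \<omega>) x"

lemma measurable_zi: "(\<lambda>(\<omega>, x). zi \<omega> x) \<in> borel_measurable (M \<Otimes>\<^sub>M L)"
proof -
  have "(\<lambda>z. indicator {(\<omega>, x). \<omega> \<in> space M \<and> x \<in> zero_cell n (X \<omega>)} z :: ennreal) \<in> borel_measurable (M \<Otimes>\<^sub>M L)"
    using sets_zero_cell_pairs by measurable
  also have "?this \<longleftrightarrow> ?thesis"
    by (intro measurable_cong) (auto simp: zi_def Z_def indicator_def space_pair_measure)
  finally show ?thesis .
qed

lemma measurable_zi_comp:
  "f \<in> measurable N M \<Longrightarrow> g \<in> measurable N L \<Longrightarrow> (\<lambda>z. zi (f z) (g z)) \<in> borel_measurable N"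
  using measurable_compose[OF measurable_Pair measurable_zi, of f N g] by simp

lemma sets_Z: "\<omega> \<in> space M \<Longrightarrow> Z \<omega> \<in> sets L"
proof -
  assume \<omega>: "\<omega> \<in> space M"
  have "Pair \<omega> -` {(\<omega>, x). \<omega> \<in> space M \<and> x \<in> zero_cell n (X \<omega>)} \<in> sets L"
    by (rule sets_Pair1[OF sets_zero_cell_pairs])
  then show ?thesis using \<omega> by (simp add: Z_def vimage_def)
qed

definition vol :: "'w \<Rightarrow> ennreal" where "vol \<omega> = emeasure L (Z \<omega>)"

lemma vol_eq: "\<omega> \<in> space M \<Longrightarrow> vol \<omega> = (\<integral>\<^sup>+x. zi \<omega> x \<partial>L)"
  using sets_Z by (simp add: vol_def zi_def)

lemma measurable_vol [measurable]: "vol \<in> borel_measurable M"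
proof -
  have "(\<lambda>\<omega>. \<integral>\<^sup>+x. zi \<omega> x \<partial>L) \<in> borel_measurable M"
    by (rule euclid_lborel.borel_measurable_nn_integral) (rule measurable_zi)
  also have "?this \<longleftrightarrow> ?thesis" by (intro measurable_cong) (simp add: vol_eq)
  finally show ?thesis .
qed

lemma zero_cell_moment_eq: "zero_cell_moment M n X k = (\<integral>\<^sup>+\<omega>. vol \<omega> ^ k \<partial>M)"
  by (simp add: zero_cell_moment_def vol_def Z_def)

sublocale LM: pair_sigma_finite L M ..

lemma nn_integral_zi: "x \<in> euclid n \<Longrightarrow> (\<integral>\<^sup>+\<omega>. zi \<omega> x \<partial>M) = ennreal (exp (- \<Phi> x))"
proof -
  assume x: "x \<in> euclid n"
  have "{\<omega> \<in> space M. x \<in> Z \<omega>} = {\<omega> \<in> space M. X \<omega> \<inter> separating n x 0 = {}}"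
    using x by (auto simp: Z_def mem_zero_cell)
  then have s: "{\<omega> \<in> space M. x \<in> Z \<omega>} \<in> sets M" using sets_hit[OF sets_separating] by simp
  have "(\<integral>\<^sup>+\<omega>. zi \<omega> x \<partial>M) = (\<integral>\<^sup>+\<omega>. indicator {\<omega> \<in> space M. x \<in> Z \<omega>} \<omega> \<partial>M)"
    by (intro nn_integral_cong) (simp add: zi_def indicator_def)
  also have "\<dots> = emeasure M {\<omega> \<in> space M. x \<in> Z \<omega>}" using s by simp
  also have "\<dots> = ennreal (exp (- \<Phi> x))" by (rule emeasure_Z1[OF x])
  finally show ?thesis .
qed

lemma nn_integral_zi2:
  assumes xy: "x \<in> euclid n" "y \<in> euclid n"
  shows "(\<integral>\<^sup>+\<omega>. zi \<omega> x * zi \<omega> y \<partial>M) = ennreal (exp (- (\<Phi> x + \<Phi> y - meet x y)))"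
proof -
  have "{\<omega> \<in> space M. x \<in> Z \<omega> \<and> y \<in> Z \<omega>} = {\<omega> \<in> space M. X \<omega> \<inter> (separating n x 0 \<union> separating n y 0) = {}}"
    using xy by (auto simp: Z_def mem_zero_cell)
  then have s: "{\<omega> \<in> space M. x \<in> Z \<omega> \<and> y \<in> Z \<omega>} \<in> sets M"
    using sets_hit[OF sets.Un[OF sets_separating sets_separating]] by simp
  have "(\<integral>\<^sup>+\<omega>. zi \<omega> x * zi \<omega> y \<partial>M) = (\<integral>\<^sup>+\<omega>. indicator {\<omega> \<in> space M. x \<in> Z \<omega> \<and> y \<in> Z \<omega>} \<omega> \<partial>M)"
    by (intro nn_integral_cong) (simp add: zi_def indicator_def)
  also have "\<dots> = emeasure M {\<omega> \<in> space M. x \<in> Z \<omega> \<and> y \<in> Z \<omega>}" using s by simp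
  also have "\<dots> = ennreal (exp (- (\<Phi> x + \<Phi> y - meet x y)))" by (rule emeasure_Z2[OF xy])
  finally show ?thesis .
qed

lemma measurable_\<Phi> [measurable]: "\<Phi> \<in> borel_measurable L"
proof -
  have [measurable]: "(\<lambda>x. nrm n x) \<in> borel_measurable L" by (rule measurable_nrm) (rule measurable_coordinate)
  show ?thesis unfolding \<Phi>_def[abs_def] by measurable
qed

lemma expectation_vol_weighted:
  assumes g: "g \<in> borel_measurable L"
  shows "(\<integral>\<^sup>+\<omega>. \<integral>\<^sup>+x. zi \<omega> x * g x \<partial>L \<partial>M) = (\<integral>\<^sup>+x. ennreal (exp (- \<Phi> x)) * g x \<partial>L)"
proof -
  have "(\<integral>\<^sup>+\<omega>. \<integral>\<^sup>+x. zi \<omega> x * g x \<partial>L \<partial>M) = (\<integral>\<^sup>+x. \<integral>\<^sup>+\<omega>. zi \<omega> x * g x \<partial>M \<partial>L)"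
  proof (rule LM.Fubini')
    show "(\<lambda>(x, \<omega>). zi \<omega> x * g x) \<in> borel_measurable (L \<Otimes>\<^sub>M M)"
      unfolding case_prod_beta
      by (intro borel_measurable_times_ennreal measurable_zi_comp measurable_snd measurable_fst measurable_compose[OF measurable_fst g])
  qed
  also have "\<dots> = (\<integral>\<^sup>+x. ennreal (exp (- \<Phi> x)) * g x \<partial>L)"
  proof (rule nn_integral_cong)
    fix x assume x: "x \<in> space L"
    have "(\<lambda>\<omega>. zi \<omega> x) \<in> borel_measurable M"
      using x by (intro measurable_zi_comp measurable_ident_sets) auto
    then show "(\<integral>\<^sup>+\<omega>. zi \<omega> x * g x \<partial>M) = ennreal (exp (- \<Phi> x)) * g x"
      using x by (simp add: nn_integral_multc nn_integral_zi)
  qed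
  finally show ?thesis .
qed

lemma first_moment: "(\<integral>\<^sup>+\<omega>. vol \<omega> \<partial>M) = (\<integral>\<^sup>+x. ennreal (exp (- \<Phi> x)) \<partial>L)"
proof -
  have "(\<integral>\<^sup>+\<omega>. vol \<omega> \<partial>M) = (\<integral>\<^sup>+\<omega>. \<integral>\<^sup>+x. zi \<omega> x * 1 \<partial>L \<partial>M)"
    by (intro nn_integral_cong) (simp add: vol_eq)
  then show ?thesis using expectation_vol_weighted[of "\<lambda>_. 1"] by simp
qed

lemma moment_lower: "(\<integral>\<^sup>+x. ennreal (exp (- \<Phi> x)) \<partial>L) ^ Suc k \<le> (\<integral>\<^sup>+\<omega>. vol \<omega> ^ Suc k \<partial>M)"
  using nn_integral_power_mean[OF measurable_vol, of k] by (simp add: first_moment emeasure_space_1)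

text \<open>Jensen's inequality for the weight \<open>exp (- \<Phi> / k)\<close>, which is the one that makes the resulting bound
  a \<open>k\<close>-th power.\<close>

lemma moment_upper:
  "(\<integral>\<^sup>+\<omega>. vol \<omega> ^ Suc k \<partial>M) \<le> (\<integral>\<^sup>+x. ennreal (exp (- (\<Phi> x / Suc k))) \<partial>L) ^ Suc k"
proof -
  define w where "w x = exp (- (\<Phi> x / Suc k))" for x
  define W where "W = (\<integral>\<^sup>+x. ennreal (w x) \<partial>L)"
  have w [measurable]: "w \<in> borel_measurable L" unfolding w_def[abs_def] by measurable
  have wpos: "w x > 0" for x by (simp add: w_def)
  define N where "N = density L (\<lambda>x. ennreal (w x))"
  have N_space: "emeasure N (space N) = W"
    unfolding N_def W_def by (subst emeasure_density) (auto intro!: nn_integral_cong)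
  have le: "vol \<omega> ^ Suc k \<le> W ^ k * (\<integral>\<^sup>+x. zi \<omega> x * ennreal (1 / w x ^ k) \<partial>L)" if \<omega>: "\<omega> \<in> space M" for \<omega>
  proof -
    have z [measurable]: "zi \<omega> \<in> borel_measurable L" unfolding zi_def[abs_def] using sets_Z[OF \<omega>] by measurable
    \<comment> \<open>Dividing by the weight makes \<open>vol\<close> the integral of
      \<open>f\<close> against \<open>N\<close>. Its power leaves \<open>1 / w x ^ k\<close>, and
      after taking expectations \<open>exp (- \<Phi> x) = w x ^ Suc k\<close> restores the weight,
      so the last factor is again \<open>W\<close>.\<close>
    define f where "f x = zi \<omega> x * ennreal (1 / w x)" for x
    have f: "f \<in> borel_measurable N" unfolding f_def[abs_def] N_def by measurable
    have dens: "(\<integral>\<^sup>+x. g x \<partial>N) = (\<integral>\<^sup>+x. ennreal (w x) * g x \<partial>L)" if "g \<in> borel_measurable N" for g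
      using that unfolding N_def by (subst nn_integral_density) auto
    have "ennreal (w x) * f x = zi \<omega> x" for x
      using wpos[of x] by (cases "x \<in> Z \<omega>") (simp_all add: f_def zi_def ennreal_mult[symmetric])
    then have 1: "(\<integral>\<^sup>+x. f x \<partial>N) = vol \<omega>" unfolding dens[OF f] using vol_eq[OF \<omega>] by simp
    have "ennreal (w x) * f x ^ Suc k = zi \<omega> x * ennreal (1 / w x ^ k)" for x
    proof (cases "x \<in> Z \<omega>")
      case True
      then have "ennreal (w x) * f x ^ Suc k = ennreal (w x * (1 / w x) ^ Suc k)"
        using wpos[of x] by (simp add: f_def zi_def ennreal_power ennreal_mult[symmetric] del: power_Suc)
      also have "w x * (1 / w x) ^ Suc k = 1 / w x ^ k" using wpos[of x] by (simp add: power_divide)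
      finally show ?thesis using True by (simp add: zi_def)
    qed (simp add: f_def zi_def)
    then have 2: "(\<integral>\<^sup>+x. f x ^ Suc k \<partial>N) = (\<integral>\<^sup>+x. zi \<omega> x * ennreal (1 / w x ^ k) \<partial>L)"
      using dens[OF borel_measurable_power_ennreal[OF f]] by (simp del: power_Suc)
    show ?thesis using nn_integral_power_mean[OF f, of k] unfolding 1 2 N_space .
  qed
  have "(\<integral>\<^sup>+\<omega>. vol \<omega> ^ Suc k \<partial>M) \<le> (\<integral>\<^sup>+\<omega>. W ^ k * (\<integral>\<^sup>+x. zi \<omega> x * ennreal (1 / w x ^ k) \<partial>L) \<partial>M)"
    by (intro nn_integral_mono le)
  also have "\<dots> = W ^ k * (\<integral>\<^sup>+\<omega>. \<integral>\<^sup>+x. zi \<omega> x * ennreal (1 / w x ^ k) \<partial>L \<partial>M)"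
  proof (rule nn_integral_cmult, rule euclid_lborel.borel_measurable_nn_integral)
    have "(\<lambda>x. ennreal (1 / w x ^ k)) \<in> borel_measurable L" by measurable
    then show "(\<lambda>(\<omega>, x). zi \<omega> x * ennreal (1 / w x ^ k)) \<in> borel_measurable (M \<Otimes>\<^sub>M L)"
      unfolding case_prod_beta
      by (intro borel_measurable_times_ennreal measurable_zi_comp measurable_snd measurable_fst measurable_compose[OF measurable_snd])
  qed
  also have "(\<integral>\<^sup>+\<omega>. \<integral>\<^sup>+x. zi \<omega> x * ennreal (1 / w x ^ k) \<partial>L \<partial>M) = (\<integral>\<^sup>+x. ennreal (exp (- \<Phi> x)) * ennreal (1 / w x ^ k) \<partial>L)"
    by (rule expectation_vol_weighted) measurable
  also have "\<dots> = W"
    unfolding W_def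
  proof (rule nn_integral_cong)
    fix x
    have "exp (- \<Phi> x) = w x ^ Suc k" unfolding w_def by (subst exp_of_nat_mult[symmetric]) simp
    then show "ennreal (exp (- \<Phi> x)) * ennreal (1 / w x ^ k) = ennreal (w x)"
      using wpos[of x] by (simp add: ennreal_mult[symmetric])
  qed
  finally show ?thesis by (simp add: W_def w_def mult.commute)
qed

end

declare measurable_coordinate [measurable del]

lemma measurable_exp_layer: "(\<lambda>v. ennreal (exp (- v)) * indicator {s..} v) \<in> borel_measurable lborel" for s :: real
proof (rule borel_measurable_times_ennreal)
  show "(\<lambda>v. ennreal (exp (- v))) \<in> borel_measurable (lborel :: real measure)" by measurable
  show "indicator {s..} \<in> borel_measurable lborel" by (rule borel_measurable_indicator) simp
qed

lemma ennreal_mult4: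
  "0 \<le> a \<Longrightarrow> 0 \<le> b \<Longrightarrow> 0 \<le> c \<Longrightarrow> 0 \<le> d \<Longrightarrow>
    ennreal a * (ennreal b * (ennreal c * ennreal d)) = ennreal (a * (b * (c * d)))"
  by (simp add: ennreal_mult)

section \<open>Bounds for moments and variance in terms of \<open>qq\<close>\<close>

context hyperplane_process
begin

text \<open>Integrating \<open>support_int\<close> over the unit ball in two ways, by homogeneity
  and by Fubini, gives \<open>k0 * T = sphere_area n * I\<close>, where \<open>T\<close> is
  controlled by \<open>nn_integral_nrm_powr_ball\<close>.\<close>

lemma qq_bounds:
  assumes I: "ball_moment n r = ennreal I" "I > 0"
  shows "cc * sphere_area n * I / unit_ball_vol (real n) \<le> qq"
    "qq \<le> 2 * 2 powr (r / real n) * (cc * sphere_area n * I / unit_ball_vol (real n))" "qq > 0"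
proof -
  let ?\<kappa> = "unit_ball_vol (real n)" and ?A = "sphere_area n"
  have \<kappa>: "?\<kappa> > 0" by (rule unit_ball_vol_pos) simp
  have A: "?A > 0" by (rule sphere_area_bounds[OF n2])
  have [measurable]: "(\<lambda>x. nrm n x) \<in> borel_measurable L" by (rule measurable_nrm) (rule measurable_coordinate)
  note [measurable] = sets_euclid_ball
  define T where "T = (\<integral>\<^sup>+x. ennreal (nrm n x powr r) * indicator (eball n 1) x \<partial>L)"
  have T: "T \<le> ennreal ?\<kappa>" "ennreal (?\<kappa> / (2 * 2 powr (r / real n))) \<le> T"
    unfolding T_def using n2 by (intro nn_integral_nrm_powr_ball r; simp)+
  then obtain t where t: "T = ennreal t" "t \<ge> 0" by (cases T) (auto simp: top_unique)
  have t_le: "t \<le> ?\<kappa>" "?\<kappa> / (2 * 2 powr (r / real n)) \<le> t"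
    using T \<kappa> t by (simp_all add: ennreal_le_iff)
  have "0 < ?\<kappa> / (2 * 2 powr (r / real n))" using \<kappa> by (intro divide_pos_pos) auto
  then have t_pos: "t > 0" using t_le(2) by linarith
  have "ennreal k0 * T = (\<integral>\<^sup>+x. support_int n r x * indicator (eball n 1) x \<partial>L)"
    unfolding T_def by (subst nn_integral_cmult[symmetric])
      (auto intro!: nn_integral_cong simp: support_int_scale[OF n2 r] support_int_pole mult_ac)
  also have "\<dots> = ennreal ?A * ennreal I" unfolding I(1)[symmetric] by (rule nn_integral_support_int_ball[OF n2])
  finally have "ennreal (k0 * t) = ennreal (?A * I)" using t A I k0_nonneg by (simp add: ennreal_mult)
  then have k0t: "k0 * t = ?A * I" using t A I k0_nonneg by (subst (asm) ennreal_inj) auto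
  then have k0: "k0 = ?A * I / t" using t_pos by (simp add: field_simps)
  then have q: "qq = cc * ?A * I / t" by (simp add: qq_def)
  have num: "cc * ?A * I > 0" using cc_pos A I by simp
  show "qq > 0" unfolding q using num t_pos by simp
  show "cc * ?A * I / ?\<kappa> \<le> qq" unfolding q using num t_pos t_le(1) by (intro divide_left_mono) (auto intro!: mult_pos_pos \<kappa>)
  have "qq \<le> cc * ?A * I / (?\<kappa> / (2 * 2 powr (r / real n)))"
    unfolding q using num t_pos t_le(2) \<kappa> by (intro divide_left_mono) auto
  then show "qq \<le> 2 * 2 powr (r / real n) * (cc * ?A * I / ?\<kappa>)" by (simp add: mult_ac)
qed

text \<open>Both Jensen bounds are powers of the same radial integral, once with \<open>qq\<close>
  and once with \<open>qq / Suc k\<close>; this accounts for the extra factor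
  \<open>Suc k powr (n / r)\<close>.\<close>

lemma moment_bounds:
  assumes q: "qq > 0"
  shows "ennreal ((unit_ball_vol (real n) * qq powr (- (real n / r)) * Gamma (real n / r + 1)) ^ Suc k) \<le> zero_cell_moment M n X (Suc k)"
    "zero_cell_moment M n X (Suc k) \<le>
      ennreal ((real (Suc k) powr (real n / r) * (unit_ball_vol (real n) * qq powr (- (real n / r)) * Gamma (real n / r + 1))) ^ Suc k)"
proof -
  have n0: "n > 0" using n2 by simp
  have G: "0 \<le> Gamma (real n / r + 1)" using r by (intro less_imp_le[OF Gamma_real_pos] add_nonneg_pos) auto
  show "ennreal ((unit_ball_vol (real n) * qq powr (- (real n / r)) * Gamma (real n / r + 1)) ^ Suc k) \<le> zero_cell_moment M n X (Suc k)"
    using moment_lower[of k] G unfolding zero_cell_moment_eq \<Phi>_def nn_integral_exp_powr_nrm[OF q r n0]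
    by (subst (asm) ennreal_power) auto
  have s: "\<Phi> x / Suc k = (qq / Suc k) * nrm n x powr r" for x by (simp add: \<Phi>_def)
  have q': "qq / Suc k > 0" using q by simp
  have p: "(qq / Suc k) powr (- (real n / r)) = real (Suc k) powr (real n / r) * qq powr (- (real n / r))"
    using q by (simp add: powr_divide powr_minus_divide)
  have "zero_cell_moment M n X (Suc k) \<le> ennreal (unit_ball_vol (real n) * (qq / Suc k) powr (- (real n / r)) * Gamma (real n / r + 1)) ^ Suc k"
    using moment_upper[of k] unfolding zero_cell_moment_eq s nn_integral_exp_powr_nrm[OF q' r n0] .
  also have "\<dots> = ennreal ((unit_ball_vol (real n) * (qq / Suc k) powr (- (real n / r)) * Gamma (real n / r + 1)) ^ Suc k)"
    using G by (intro ennreal_power) auto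
  finally show "zero_cell_moment M n X (Suc k) \<le>
      ennreal ((real (Suc k) powr (real n / r) * (unit_ball_vol (real n) * qq powr (- (real n / r)) * Gamma (real n / r + 1))) ^ Suc k)"
    unfolding p by (simp add: mult_ac)
qed

lemma measurable_meet: "(\<lambda>(x, y). meet x y) \<in> borel_measurable (L \<Otimes>\<^sub>M L)"
  using measurable_meet_int[OF n2, of r] unfolding meet_def case_prod_beta by measurable

lemma measurable_meet_comp:
  "f \<in> measurable N L \<Longrightarrow> g \<in> measurable N L \<Longrightarrow> (\<lambda>z. meet (f z) (g z)) \<in> borel_measurable N"
  using measurable_compose[OF measurable_Pair measurable_meet, of f N g] by simp

text \<open>The double integral of the covariances of the indicators \<open>zi\<close>, kept in
  [0, infinity] until finiteness is known.\<close>

definition excess :: "ennreal" where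
  "excess = (\<integral>\<^sup>+x. \<integral>\<^sup>+y. ennreal (exp (- (\<Phi> x + \<Phi> y)) * (exp (meet x y) - 1)) \<partial>L \<partial>L)"

lemma second_moment:
  "(\<integral>\<^sup>+\<omega>. vol \<omega> ^ 2 \<partial>M) = (\<integral>\<^sup>+\<omega>. vol \<omega> \<partial>M) ^ 2 + excess"
proof -
  have zm: "zi \<omega> \<in> borel_measurable L" if "\<omega> \<in> space M" for \<omega>
    unfolding zi_def[abs_def] using sets_Z[OF that] by measurable
  have "(\<integral>\<^sup>+\<omega>. vol \<omega> ^ 2 \<partial>M) = (\<integral>\<^sup>+\<omega>. \<integral>\<^sup>+x. zi \<omega> x * vol \<omega> \<partial>L \<partial>M)"
    by (intro nn_integral_cong) (simp add: nn_integral_multc zm vol_eq power2_eq_square)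
  also have "\<dots> = (\<integral>\<^sup>+x. \<integral>\<^sup>+\<omega>. zi \<omega> x * vol \<omega> \<partial>M \<partial>L)"
  proof (rule LM.Fubini')
    show "(\<lambda>(x, \<omega>). zi \<omega> x * vol \<omega>) \<in> borel_measurable (L \<Otimes>\<^sub>M M)"
      unfolding case_prod_beta
      by (intro borel_measurable_times_ennreal measurable_zi_comp measurable_snd measurable_fst measurable_compose[OF measurable_snd measurable_vol])
  qed
  also have "\<dots> = (\<integral>\<^sup>+x. \<integral>\<^sup>+\<omega>. \<integral>\<^sup>+y. zi \<omega> x * zi \<omega> y \<partial>L \<partial>M \<partial>L)"
    by (intro nn_integral_cong) (simp add: nn_integral_cmult zm vol_eq)
  also have "\<dots> = (\<integral>\<^sup>+x. \<integral>\<^sup>+y. \<integral>\<^sup>+\<omega>. zi \<omega> x * zi \<omega> y \<partial>M \<partial>L \<partial>L)"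
  proof (rule nn_integral_cong)
    fix x assume x: "x \<in> space L"
    show "(\<integral>\<^sup>+\<omega>. \<integral>\<^sup>+y. zi \<omega> x * zi \<omega> y \<partial>L \<partial>M) = (\<integral>\<^sup>+y. \<integral>\<^sup>+\<omega>. zi \<omega> x * zi \<omega> y \<partial>M \<partial>L)"
    proof (rule LM.Fubini')
      show "(\<lambda>(y, \<omega>). zi \<omega> x * zi \<omega> y) \<in> borel_measurable (L \<Otimes>\<^sub>M M)"
        unfolding case_prod_beta using x
        by (intro borel_measurable_times_ennreal measurable_zi_comp measurable_snd measurable_fst measurable_const)
    qed
  qed
  also have "\<dots> = (\<integral>\<^sup>+x. \<integral>\<^sup>+y. ennreal (exp (- \<Phi> x)) * ennreal (exp (- \<Phi> y)) + ennreal (exp (- (\<Phi> x + \<Phi> y)) * (exp (meet x y) - 1)) \<partial>L \<partial>L)"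
  proof (intro nn_integral_cong)
    fix x y assume xy: "x \<in> space L" "y \<in> space L"
    have e: "exp (- (\<Phi> x + \<Phi> y - meet x y)) = exp (- \<Phi> x) * exp (- \<Phi> y) + exp (- (\<Phi> x + \<Phi> y)) * (exp (meet x y) - 1)"
      by (simp add: exp_add[symmetric] algebra_simps)
    have "0 \<le> exp (- (\<Phi> x + \<Phi> y)) * (exp (meet x y) - 1)" using meet_bounds(1)[of x y] xy by simp
    then show "(\<integral>\<^sup>+\<omega>. zi \<omega> x * zi \<omega> y \<partial>M) = ennreal (exp (- \<Phi> x)) * ennreal (exp (- \<Phi> y)) + ennreal (exp (- (\<Phi> x + \<Phi> y)) * (exp (meet x y) - 1))"
      using xy unfolding nn_integral_zi2[OF xy[unfolded space_euclid_lborel]] e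
      by (subst ennreal_plus) (simp_all add: ennreal_mult)
  qed
  also have "\<dots> = (\<integral>\<^sup>+x. (\<integral>\<^sup>+y. ennreal (exp (- \<Phi> x)) * ennreal (exp (- \<Phi> y)) \<partial>L) +
      (\<integral>\<^sup>+y. ennreal (exp (- (\<Phi> x + \<Phi> y)) * (exp (meet x y) - 1)) \<partial>L) \<partial>L)"
  proof (intro nn_integral_cong nn_integral_add)
    fix x assume x: "x \<in> space L"
    have [measurable]: "(\<lambda>y. meet x y) \<in> borel_measurable L"
      using x by (intro measurable_meet_comp measurable_const measurable_ident_euclid)
    show "(\<lambda>y. ennreal (exp (- (\<Phi> x + \<Phi> y)) * (exp (meet x y) - 1))) \<in> borel_measurable L" by measurable
  qed measurable
  also have "\<dots> = (\<integral>\<^sup>+x. (\<integral>\<^sup>+y. ennreal (exp (- \<Phi> x)) * ennreal (exp (- \<Phi> y)) \<partial>L) \<partial>L) + excess"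
    unfolding excess_def
  proof (rule nn_integral_add)
    show "(\<lambda>x. \<integral>\<^sup>+y. ennreal (exp (- \<Phi> x)) * ennreal (exp (- \<Phi> y)) \<partial>L) \<in> borel_measurable L"
      by (subst nn_integral_cmult) measurable
    show "(\<lambda>x. \<integral>\<^sup>+y. ennreal (exp (- (\<Phi> x + \<Phi> y)) * (exp (meet x y) - 1)) \<partial>L) \<in> borel_measurable L"
    proof (rule euclid_lborel.borel_measurable_nn_integral)
      have [measurable]: "(\<lambda>z. meet (fst z) (snd z)) \<in> borel_measurable (L \<Otimes>\<^sub>M L)"
        by (intro measurable_meet_comp measurable_fst measurable_snd)
      show "(\<lambda>(x, y). ennreal (exp (- (\<Phi> x + \<Phi> y)) * (exp (meet x y) - 1))) \<in> borel_measurable (L \<Otimes>\<^sub>M L)"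
        unfolding case_prod_beta by measurable
    qed
  qed
  also have "(\<integral>\<^sup>+x. (\<integral>\<^sup>+y. ennreal (exp (- \<Phi> x)) * ennreal (exp (- \<Phi> y)) \<partial>L) \<partial>L) = (\<integral>\<^sup>+\<omega>. vol \<omega> \<partial>M) ^ 2"
    unfolding first_moment by (simp add: nn_integral_cmult nn_integral_multc power2_eq_square)
  finally show ?thesis .
qed

text \<open>The second moment is finite by \<open>moment_bounds\<close>. Hence the volume is square
  integrable, and the variance, a Bochner integral, is the difference of moments that
  \<open>second_moment\<close> computes.\<close>

lemma variance_eq_excess:
  assumes q: "qq > 0"
  shows "excess < top" "zero_cell_variance M n X = enn2real excess"
proof -
  have "(\<integral>\<^sup>+\<omega>. vol \<omega> ^ 2 \<partial>M) < top"
    using moment_bounds(2)[OF q, of 1] unfolding zero_cell_moment_eq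
    by (simp add: numeral_2_eq_2) (meson ennreal_less_top le_less_trans)
  then show fin: "excess < top" unfolding second_moment by (auto simp: less_top[symmetric])
  define e1 where "e1 = enn2real (\<integral>\<^sup>+\<omega>. vol \<omega> \<partial>M)"
  have "(\<integral>\<^sup>+\<omega>. vol \<omega> \<partial>M) ^ 1 < top"
    using moment_bounds(2)[OF q, of 0] unfolding zero_cell_moment_eq
    by simp (meson ennreal_less_top le_less_trans)
  then have e1: "(\<integral>\<^sup>+\<omega>. vol \<omega> \<partial>M) = ennreal e1" "e1 \<ge> 0" by (auto simp: e1_def)
  define V where "V \<omega> = measure L (zero_cell n (X \<omega>))" for \<omega>
  have Vv: "V \<omega> = enn2real (vol \<omega>)" for \<omega> by (simp add: V_def vol_def Z_def measure_def)
  have V_meas [measurable]: "V \<in> borel_measurable M" unfolding Vv[abs_def] by measurable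
  have "AE \<omega> in M. vol \<omega> \<noteq> \<infinity>"
    by (rule nn_integral_PInf_AE) (use e1 in auto)
  then have AE: "AE \<omega> in M. ennreal (V \<omega>) = vol \<omega>"
    by eventually_elim (simp add: Vv less_top)
  have n1: "(\<integral>\<^sup>+\<omega>. ennreal (V \<omega>) \<partial>M) = ennreal e1"
    unfolding e1(1)[symmetric] by (intro nn_integral_cong_AE AE)
  have n2: "(\<integral>\<^sup>+\<omega>. ennreal ((V \<omega>)\<^sup>2) \<partial>M) = ennreal (e1\<^sup>2 + enn2real excess)"
  proof -
    have "(\<integral>\<^sup>+\<omega>. ennreal ((V \<omega>)\<^sup>2) \<partial>M) = (\<integral>\<^sup>+\<omega>. vol \<omega> ^ 2 \<partial>M)"
    proof (rule nn_integral_cong_AE)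
      show "AE \<omega> in M. ennreal ((V \<omega>)\<^sup>2) = vol \<omega> ^ 2"
        using AE
      proof eventually_elim
        case (elim \<omega>)
        have "ennreal ((V \<omega>)\<^sup>2) = ennreal (V \<omega>) ^ 2" by (subst ennreal_power) (simp_all add: V_def)
        then show ?case by (simp only: elim)
      qed
    qed
    also have "\<dots> = ennreal e1 ^ 2 + ennreal (enn2real excess)"
      unfolding second_moment e1(1) using fin by simp
    also have "\<dots> = ennreal (e1\<^sup>2 + enn2real excess)" using e1(2) by (simp add: ennreal_power)
    finally show ?thesis .
  qed
  have V0: "V \<omega> \<ge> 0" for \<omega> by (simp add: V_def)
  have i1: "integrable M V" using n1 V0 by (intro integrableI_nonneg) auto
  have i2: "integrable M (\<lambda>\<omega>. (V \<omega>)\<^sup>2)" using n2 by (intro integrableI_nonneg) auto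
  have "expectation V = enn2real (\<integral>\<^sup>+\<omega>. ennreal (V \<omega>) \<partial>M)"
    using V0 by (intro integral_eq_nn_integral) auto
  also have "\<dots> = e1" unfolding n1 by (rule enn2real_ennreal[OF e1(2)])
  finally have x1: "expectation V = e1" .
  have "expectation (\<lambda>\<omega>. (V \<omega>)\<^sup>2) = enn2real (\<integral>\<^sup>+\<omega>. ennreal ((V \<omega>)\<^sup>2) \<partial>M)"
    by (intro integral_eq_nn_integral) auto
  also have "\<dots> = e1\<^sup>2 + enn2real excess" unfolding n2 by (rule enn2real_ennreal) simp
  finally have x2: "expectation (\<lambda>\<omega>. (V \<omega>)\<^sup>2) = e1\<^sup>2 + enn2real excess" .
  have "zero_cell_variance M n X = variance V" unfolding zero_cell_variance_def V_def ..
  also have "\<dots> = expectation (\<lambda>\<omega>. (V \<omega>)\<^sup>2) - (expectation V)\<^sup>2" by (rule variance_eq[OF i1 i2])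
  also have "\<dots> = enn2real excess" unfolding x1 x2 by simp
  finally show "zero_cell_variance M n X = enn2real excess" .
qed

text \<open>The sublevel sets are balls of radius \<open>\<rho> = (v / qq) powr (1 / r)\<close>, so
  the scaling factor \<open>\<rho> powr (2 * n + r)\<close> becomes \<open>v / qq\<close> to the
  power \<open>2 * (n / r) + 1\<close>.\<close>

lemma meet_ball_integral:
  assumes J: "ball_min_moment n r = ennreal J" "J \<ge> 0" and q: "qq > 0" and v: "v > 0"
  shows "(\<integral>\<^sup>+x. \<integral>\<^sup>+y. ennreal (meet x y) * (indicator {x. \<Phi> x \<le> v} x * indicator {y. \<Phi> y \<le> v} y) \<partial>L \<partial>L) =
    ennreal (cc * sphere_area n * J * qq powr (- (2 * (real n / r) + 1)) * v powr (2 * (real n / r) + 1))"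
proof -
  define \<rho> where "\<rho> = (v / qq) powr (1 / r)"
  have \<rho>: "\<rho> > 0" using v q by (simp add: \<rho>_def)
  have ball: "\<Phi> x \<le> v \<longleftrightarrow> x \<in> eball n \<rho>" if "x \<in> euclid n" for x
    unfolding \<Phi>_def \<rho>_def using indicator_powr_ball[OF q r _ that] v by simp
  note [measurable] = sets_euclid_ball
  have "(\<integral>\<^sup>+x. \<integral>\<^sup>+y. ennreal (meet x y) * (indicator {x. \<Phi> x \<le> v} x * indicator {y. \<Phi> y \<le> v} y) \<partial>L \<partial>L) =
    (\<integral>\<^sup>+x. \<integral>\<^sup>+y. ennreal cc * (meet_int n r x y * (indicator (eball n \<rho>) x * indicator (eball n \<rho>) y)) \<partial>L \<partial>L)"
  proof (intro nn_integral_cong)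
    fix x y assume xy: "x \<in> space L" "y \<in> space L"
    then have "indicator {x. \<Phi> x \<le> v} x = (indicator (eball n \<rho>) x :: ennreal)" "indicator {x. \<Phi> x \<le> v} y = (indicator (eball n \<rho>) y :: ennreal)"
      using ball by (auto simp: indicator_def)
    then show "ennreal (meet x y) * (indicator {x. \<Phi> x \<le> v} x * indicator {y. \<Phi> y \<le> v} y) =
      ennreal cc * (meet_int n r x y * (indicator (eball n \<rho>) x * indicator (eball n \<rho>) y))"
      using xy by (simp only: ennreal_meet space_euclid_lborel mult.assoc)
  qed
  also have "\<dots> = ennreal cc * (\<integral>\<^sup>+x. \<integral>\<^sup>+y. meet_int n r x y * (indicator (eball n \<rho>) x * indicator (eball n \<rho>) y) \<partial>L \<partial>L)"
  proof -
    have m [measurable]: "(\<lambda>z. meet_int n r (fst z) (snd z)) \<in> borel_measurable (L \<Otimes>\<^sub>M L)"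
      using measurable_meet_int[OF n2, of r] by (simp add: case_prod_beta')
    have line: "(\<lambda>y. meet_int n r x y * (indicator (eball n \<rho>) x * indicator (eball n \<rho>) y)) \<in> borel_measurable L" if "x \<in> space L" for x
    proof -
      have "(\<lambda>y. meet_int n r x y) \<in> borel_measurable L"
        using measurable_compose[OF measurable_Pair1'[OF that] m] by simp
      then show ?thesis by measurable
    qed
    have "(\<lambda>x. \<integral>\<^sup>+y. meet_int n r x y * (indicator (eball n \<rho>) x * indicator (eball n \<rho>) y) \<partial>L) \<in> borel_measurable L"
    proof (rule euclid_lborel.borel_measurable_nn_integral)
      show "(\<lambda>(x, y). meet_int n r x y * (indicator (eball n \<rho>) x * indicator (eball n \<rho>) y)) \<in> borel_measurable (L \<Otimes>\<^sub>M L)"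
        unfolding case_prod_beta by measurable
    qed
    then show ?thesis
      by (subst nn_integral_cmult[symmetric]) (auto intro!: nn_integral_cong nn_integral_cmult line)
  qed
  also have "\<dots> = ennreal cc * (ennreal (sphere_area n) * (ennreal (\<rho> ^ n * \<rho> ^ n * \<rho> powr r) * ennreal J))"
    unfolding nn_integral_meet_int_ball[OF n2 \<rho>] J(1) ..
  also have "\<dots> = ennreal (cc * (sphere_area n * ((\<rho> ^ n * \<rho> ^ n * \<rho> powr r) * J)))"
    by (rule ennreal_mult4) (use cc_pos sphere_area_bounds(3)[OF n2] \<rho> J(2) in auto)
  also have "\<rho> ^ n * \<rho> ^ n * \<rho> powr r = qq powr (- (2 * (real n / r) + 1)) * v powr (2 * (real n / r) + 1)"
  proof -
    have "\<rho> ^ n = \<rho> powr real n" using \<rho> by (simp add: powr_realpow)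
    then have "\<rho> ^ n * \<rho> ^ n * \<rho> powr r = \<rho> powr (2 * real n + r)"
      by (simp only: powr_add mult_2)
    also have "\<dots> = (v / qq) powr (1 / r * (2 * real n + r))" by (simp only: \<rho>_def powr_powr)
    also have "1 / r * (2 * real n + r) = 2 * (real n / r) + 1" using r by (simp add: field_simps)
    also have "(v / qq) powr s = qq powr (- s) * v powr s" for s
      using v q by (simp add: powr_divide powr_minus_divide)
    finally show ?thesis .
  qed
  finally show ?thesis by (simp add: mult_ac)
qed

text \<open>Only points with \<open>\<Phi> \<le> 1\<close> are kept, where the exponential weight is
  at least \<open>exp (- 2)\<close>, and \<open>exp m - 1 \<ge> m\<close> is applied to
  \<open>m = meet x y\<close>.\<close>

lemma variance_lower:
  assumes J: "ball_min_moment n r = ennreal J" "J \<ge> 0" and q: "qq > 0"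
  shows "exp (- 2) * (cc * sphere_area n * J * qq powr (- (2 * (real n / r) + 1))) \<le> zero_cell_variance M n X"
proof -
  let ?c = "cc * sphere_area n * J * qq powr (- (2 * (real n / r) + 1))"
  have line: "(\<lambda>y. ennreal (meet x y) * (indicator {x. \<Phi> x \<le> 1} x * indicator {y. \<Phi> y \<le> 1} y)) \<in> borel_measurable L" if x: "x \<in> space L" for x
  proof -
    have "{y \<in> space L. \<Phi> y \<le> 1} \<in> sets L" by measurable
    moreover have [measurable]: "(\<lambda>y. meet x y) \<in> borel_measurable L"
      using x by (intro measurable_meet_comp measurable_const measurable_ident_euclid)
    ultimately have "(\<lambda>y. ennreal (meet x y) * (indicator {x. \<Phi> x \<le> 1} x * indicator {y \<in> space L. \<Phi> y \<le> 1} y)) \<in> borel_measurable L"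
      by measurable
    also have "?this \<longleftrightarrow> ?thesis" by (intro measurable_cong) (simp add: indicator_def)
    finally show ?thesis .
  qed
  have "ennreal (exp (- 2)) * ennreal ?c =
    ennreal (exp (- 2)) * (\<integral>\<^sup>+x. \<integral>\<^sup>+y. ennreal (meet x y) * (indicator {x. \<Phi> x \<le> 1} x * indicator {y. \<Phi> y \<le> 1} y) \<partial>L \<partial>L)"
    using meet_ball_integral[OF J q, of 1] by simp
  also have "\<dots> = (\<integral>\<^sup>+x. \<integral>\<^sup>+y. ennreal (exp (- 2)) * (ennreal (meet x y) * (indicator {x. \<Phi> x \<le> 1} x * indicator {y. \<Phi> y \<le> 1} y)) \<partial>L \<partial>L)"
  proof -
    have "(\<lambda>x. \<integral>\<^sup>+y. ennreal (meet x y) * (indicator {x. \<Phi> x \<le> 1} x * indicator {y. \<Phi> y \<le> 1} y) \<partial>L) \<in> borel_measurable L"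
    proof (rule euclid_lborel.borel_measurable_nn_integral)
      have [measurable]: "(\<lambda>z. meet (fst z) (snd z)) \<in> borel_measurable (L \<Otimes>\<^sub>M L)"
        by (intro measurable_meet_comp measurable_fst measurable_snd)
      have "{z \<in> space (L \<Otimes>\<^sub>M L). \<Phi> (fst z) \<le> 1 \<and> \<Phi> (snd z) \<le> 1} \<in> sets (L \<Otimes>\<^sub>M L)" by measurable
      then have "(\<lambda>z. ennreal (meet (fst z) (snd z)) * indicator {z \<in> space (L \<Otimes>\<^sub>M L). \<Phi> (fst z) \<le> 1 \<and> \<Phi> (snd z) \<le> 1} z) \<in> borel_measurable (L \<Otimes>\<^sub>M L)"
        by measurable
      also have "?this \<longleftrightarrow> (\<lambda>(x, y). ennreal (meet x y) * (indicator {x. \<Phi> x \<le> 1} x * indicator {y. \<Phi> y \<le> 1} y)) \<in> borel_measurable (L \<Otimes>\<^sub>M L)"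
        by (intro measurable_cong) (auto simp: indicator_def)
      finally show "(\<lambda>(x, y). ennreal (meet x y) * (indicator {x. \<Phi> x \<le> 1} x * indicator {y. \<Phi> y \<le> 1} y)) \<in> borel_measurable (L \<Otimes>\<^sub>M L)" .
    qed
    then show ?thesis
      by (subst nn_integral_cmult[symmetric]) (auto intro!: nn_integral_cong nn_integral_cmult[symmetric] line)
  qed
  also have "\<dots> \<le> excess"
    unfolding excess_def
  proof (intro nn_integral_mono)
    fix x y assume xy: "x \<in> space L" "y \<in> space L"
    show "ennreal (exp (- 2)) * (ennreal (meet x y) * (indicator {x. \<Phi> x \<le> 1} x * indicator {y. \<Phi> y \<le> 1} y)) \<le>
       ennreal (exp (- (\<Phi> x + \<Phi> y)) * (exp (meet x y) - 1))"
    proof (cases "\<Phi> x \<le> 1 \<and> \<Phi> y \<le> 1")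
      case True
      have "meet x y \<le> exp (meet x y) - 1" using exp_ge_add_one_self[of "meet x y"] by linarith
      then have "exp (- 2) * meet x y \<le> exp (- (\<Phi> x + \<Phi> y)) * (exp (meet x y) - 1)"
        using True meet_bounds(1)[of x y] xy by (intro mult_mono) auto
      then have "ennreal (exp (- 2) * meet x y) \<le> ennreal (exp (- (\<Phi> x + \<Phi> y)) * (exp (meet x y) - 1))" by (rule ennreal_leI)
      then show ?thesis using True meet_bounds(1)[of x y] xy by (simp add: ennreal_mult)
    qed auto
  qed
  also have "excess = ennreal (zero_cell_variance M n X)"
    using variance_eq_excess[OF q] by simp
  finally have "ennreal (exp (- 2) * ?c) \<le> ennreal (zero_cell_variance M n X)"
    using cc_pos sphere_area_bounds(3)[OF n2] J by (simp add: ennreal_mult)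
  moreover have "zero_cell_variance M n X \<ge> 0" using variance_eq_excess[OF q] by simp
  ultimately show ?thesis by (simp add: ennreal_le_iff)
qed

text \<open>Use \<open>exp m - 1 \<le> m * exp m\<close> for \<open>m = meet x y\<close> and
  \<open>\<Phi> x + \<Phi> y - m \<ge> max (\<Phi> x) (\<Phi> y)\<close>. The layer representation
  of \<open>exp (- max (\<Phi> x) (\<Phi> y))\<close> confines both points to the same ball, so
  \<open>meet_ball_integral\<close> applies at every level.\<close>

lemma variance_upper:
  assumes J: "ball_min_moment n r = ennreal J" "J \<ge> 0" and q: "qq > 0"
  shows "zero_cell_variance M n X \<le> Gamma (2 * (real n / r) + 2) * (cc * sphere_area n * J * qq powr (- (2 * (real n / r) + 1)))"
proof -
  let ?c = "cc * sphere_area n * J * qq powr (- (2 * (real n / r) + 1))"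
  let ?s = "2 * (real n / r) + 1"
  define F where "F x y v = ennreal (exp (- v)) * (ennreal (meet x y) * (indicator {x. \<Phi> x \<le> v} x * indicator {y. \<Phi> y \<le> v} y))" for x y v
  interpret LB: pair_sigma_finite lborel L ..
  have "0 \<le> real n / r" using r by simp
  then have "0 < ?s + 1" by linarith
  then have G: "0 \<le> Gamma (?s + 1)" by (intro less_imp_le[OF Gamma_real_pos])
  have c: "0 \<le> ?c" using J(2) cc_pos sphere_area_bounds(3)[OF n2] by simp
  have F_meas: "(\<lambda>z. F (f z) (g z) (h z)) \<in> borel_measurable N"
    if [measurable]: "f \<in> measurable N L" "g \<in> measurable N L" "h \<in> borel_measurable N" for f g h and N :: "'z measure"
  proof -
    have [measurable]: "(\<lambda>z. meet (f z) (g z)) \<in> borel_measurable N" by (intro measurable_meet_comp that)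
    have "{z \<in> space N. \<Phi> (f z) \<le> h z \<and> \<Phi> (g z) \<le> h z} \<in> sets N" by measurable
    then have "(\<lambda>z. ennreal (exp (- h z)) * (ennreal (meet (f z) (g z)) * indicator {z \<in> space N. \<Phi> (f z) \<le> h z \<and> \<Phi> (g z) \<le> h z} z)) \<in> borel_measurable N"
      by measurable
    also have "?this \<longleftrightarrow> ?thesis" unfolding F_def by (intro measurable_cong) (auto simp: indicator_def)
    finally show ?thesis .
  qed
  have "excess \<le> (\<integral>\<^sup>+x. \<integral>\<^sup>+y. \<integral>\<^sup>+v. F x y v \<partial>lborel \<partial>L \<partial>L)"
    unfolding excess_def
  proof (intro nn_integral_mono)
    fix x y assume xy: "x \<in> space L" "y \<in> space L"
    note mb = meet_bounds[of x y, simplified, OF xy[simplified]]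
    have "exp (meet x y) - 1 \<le> meet x y * exp (meet x y)"
    proof -
      have "1 - meet x y \<le> exp (- meet x y)" using exp_ge_add_one_self[of "- meet x y"] by simp
      then have "(1 - meet x y) * exp (meet x y) \<le> exp (- meet x y) * exp (meet x y)" by (intro mult_right_mono) auto
      then show ?thesis by (simp add: exp_minus algebra_simps)
    qed
    then have "exp (- (\<Phi> x + \<Phi> y)) * (exp (meet x y) - 1) \<le> exp (- (\<Phi> x + \<Phi> y)) * (meet x y * exp (meet x y))"
      by (intro mult_left_mono) auto
    also have "\<dots> = meet x y * exp (- (\<Phi> x + \<Phi> y - meet x y))"
    proof -
      have "exp (- (\<Phi> x + \<Phi> y - meet x y)) = exp (- (\<Phi> x + \<Phi> y)) * exp (meet x y)" by (simp add: exp_add[symmetric])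
      then show ?thesis by (simp only: mult_ac)
    qed
    also have "\<dots> \<le> meet x y * exp (- max (\<Phi> x) (\<Phi> y))" using mb by (intro mult_left_mono) auto
    finally have "ennreal (exp (- (\<Phi> x + \<Phi> y)) * (exp (meet x y) - 1)) \<le> ennreal (meet x y) * ennreal (exp (- max (\<Phi> x) (\<Phi> y)))"
      using mb(1) by (subst ennreal_mult[symmetric]) (auto intro!: ennreal_leI)
    also have "\<dots> = ennreal (meet x y) * (\<integral>\<^sup>+v. ennreal (exp (- v)) * indicator {max (\<Phi> x) (\<Phi> y)..} v \<partial>lborel)"
      by (simp only: nn_integral_exp_layer)
    also have "\<dots> = (\<integral>\<^sup>+v. ennreal (meet x y) * (ennreal (exp (- v)) * indicator {max (\<Phi> x) (\<Phi> y)..} v) \<partial>lborel)"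
      by (rule nn_integral_cmult[symmetric]) (rule measurable_exp_layer)
    also have "\<dots> = (\<integral>\<^sup>+v. F x y v \<partial>lborel)"
      unfolding F_def by (intro nn_integral_cong) (auto simp: indicator_def mult_ac)
    finally show "ennreal (exp (- (\<Phi> x + \<Phi> y)) * (exp (meet x y) - 1)) \<le> (\<integral>\<^sup>+v. F x y v \<partial>lborel)" .
  qed
  also have "\<dots> = (\<integral>\<^sup>+x. \<integral>\<^sup>+v. \<integral>\<^sup>+y. F x y v \<partial>L \<partial>lborel \<partial>L)"
  proof (rule nn_integral_cong)
    fix x assume x: "x \<in> space L"
    show "(\<integral>\<^sup>+y. \<integral>\<^sup>+v. F x y v \<partial>lborel \<partial>L) = (\<integral>\<^sup>+v. \<integral>\<^sup>+y. F x y v \<partial>L \<partial>lborel)"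
    proof (rule LB.Fubini')
      show "(\<lambda>(v, y). F x y v) \<in> borel_measurable (lborel \<Otimes>\<^sub>M L)"
        unfolding case_prod_beta using x by (intro F_meas measurable_const measurable_snd) auto
    qed
  qed
  also have "\<dots> = (\<integral>\<^sup>+v. \<integral>\<^sup>+x. \<integral>\<^sup>+y. F x y v \<partial>L \<partial>L \<partial>lborel)"
  proof (rule LB.Fubini')
    have "(\<lambda>z. F (snd (fst z)) (snd z) (fst (fst z))) \<in> borel_measurable ((lborel \<Otimes>\<^sub>M L) \<Otimes>\<^sub>M L)"
      by (intro F_meas measurable_snd measurable_compose[OF measurable_fst measurable_snd]) measurable
    then show "(\<lambda>(v, x). \<integral>\<^sup>+y. F x y v \<partial>L) \<in> borel_measurable (lborel \<Otimes>\<^sub>M L)"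
      unfolding case_prod_beta by (intro euclid_lborel.borel_measurable_nn_integral) (simp add: case_prod_beta')
  qed
  also have "\<dots> = (\<integral>\<^sup>+v. ennreal ?c * (ennreal (exp (- v)) * ennreal (v powr ?s) * indicator {0..} v) \<partial>lborel)"
  proof (rule nn_integral_cong_AE)
    show "AE v in lborel. (\<integral>\<^sup>+x. \<integral>\<^sup>+y. F x y v \<partial>L \<partial>L) = ennreal ?c * (ennreal (exp (- v)) * ennreal (v powr ?s) * indicator {0..} v)"
      using AE_lborel_singleton[of 0]
    proof eventually_elim
      case (elim v)
      show ?case
      proof (cases "v > 0")
        case True
        have Fv: "(\<lambda>x. \<integral>\<^sup>+y. ennreal (meet x y) * (indicator {x. \<Phi> x \<le> v} x * indicator {y. \<Phi> y \<le> v} y) \<partial>L) \<in> borel_measurable L"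
          "x \<in> space L \<Longrightarrow> (\<lambda>y. ennreal (meet x y) * (indicator {x. \<Phi> x \<le> v} x * indicator {y. \<Phi> y \<le> v} y)) \<in> borel_measurable L" for x
        proof -
          have eq: "ennreal (meet x y) * (indicator {x. \<Phi> x \<le> v} x * indicator {y. \<Phi> y \<le> v} y) = ennreal (exp v) * F x y v" for x y
            unfolding F_def mult.assoc[symmetric, of "ennreal (exp v)" "ennreal (exp (- v))"] by (simp add: ennreal_mult[symmetric] exp_add[symmetric])
          have m: "(\<lambda>z. ennreal (exp v) * F (fst z) (snd z) v) \<in> borel_measurable (L \<Otimes>\<^sub>M L)"
            by (intro borel_measurable_times_ennreal F_meas measurable_fst measurable_snd measurable_const) auto
          then show "(\<lambda>x. \<integral>\<^sup>+y. ennreal (meet x y) * (indicator {x. \<Phi> x \<le> v} x * indicator {y. \<Phi> y \<le> v} y) \<partial>L) \<in> borel_measurable L"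
            unfolding eq by (intro euclid_lborel.borel_measurable_nn_integral) (simp add: case_prod_beta')
          show "(\<lambda>y. ennreal (meet x y) * (indicator {x. \<Phi> x \<le> v} x * indicator {y. \<Phi> y \<le> v} y)) \<in> borel_measurable L" if "x \<in> space L"
            unfolding eq using that by (intro borel_measurable_times_ennreal F_meas measurable_const measurable_ident_euclid) auto
        qed
        have "(\<integral>\<^sup>+x. \<integral>\<^sup>+y. F x y v \<partial>L \<partial>L) = (\<integral>\<^sup>+x. ennreal (exp (- v)) * (\<integral>\<^sup>+y. ennreal (meet x y) * (indicator {x. \<Phi> x \<le> v} x * indicator {y. \<Phi> y \<le> v} y) \<partial>L) \<partial>L)"
          unfolding F_def by (intro nn_integral_cong nn_integral_cmult Fv(2))
        also have "\<dots> = ennreal (exp (- v)) * (\<integral>\<^sup>+x. \<integral>\<^sup>+y. ennreal (meet x y) * (indicator {x. \<Phi> x \<le> v} x * indicator {y. \<Phi> y \<le> v} y) \<partial>L \<partial>L)"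
          by (intro nn_integral_cmult Fv(1))
        also have "\<dots> = ennreal (exp (- v)) * ennreal (?c * v powr ?s)"
          using meet_ball_integral[OF J q True] by simp
        finally show ?thesis
          using True cc_pos sphere_area_bounds(3)[OF n2] J(2) by (simp add: ennreal_mult mult_ac)
      next
        case False
        then have "v < 0" using elim by simp
        then have "\<not> \<Phi> x \<le> v" for x using \<Phi>_nonneg[of x] by linarith
        then show ?thesis using \<open>v < 0\<close> by (simp add: F_def)
      qed
    qed
  qed
  also have "\<dots> = ennreal ?c * ennreal (Gamma (?s + 1))"
    using r by (subst nn_integral_cmult) (auto simp: nn_integral_Gamma)
  also have "\<dots> = ennreal (Gamma (?s + 1) * ?c)"
    unfolding ennreal_mult[OF G c] by (rule mult.commute)
  finally have le: "excess \<le> ennreal (Gamma (?s + 1) * ?c)" .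
  have "excess = ennreal (zero_cell_variance M n X)" using variance_eq_excess[OF q] by simp
  from le[unfolded this] have "zero_cell_variance M n X \<le> Gamma (?s + 1) * ?c"
    using mult_nonneg_nonneg[OF G c] by (subst (asm) ennreal_le_iff) auto
  also have "?s + 1 = 2 * (real n / r) + 2" by simp
  finally show ?thesis .
qed

end

subsection \<open>Moments of the unit ball\<close>

lemma Beta_real_pos: "a > 0 \<Longrightarrow> b > 0 \<Longrightarrow> Beta a b > (0 :: real)"
  unfolding Beta_def by (intro divide_pos_pos mult_pos_pos Gamma_real_pos add_pos_pos)

lemma ennreal_mult3:
  "0 \<le> a \<Longrightarrow> 0 \<le> b \<Longrightarrow> 0 \<le> c \<Longrightarrow> ennreal a * (ennreal b * ennreal c) = ennreal (a * (b * c))"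
  by (simp add: ennreal_mult)

lemma nn_integral_Beta_square:
  assumes p: "p > -1" and b: "b \<ge> 0"
  shows "(\<integral>\<^sup>+t. ennreal (t powr p * (1 - t\<^sup>2) powr b) * indicator {0..1} t \<partial>lborel) = ennreal (Beta ((p + 1) / 2) (b + 1) / 2)"
proof -
  let ?f = "\<lambda>s::real. s powr ((p - 1) / 2) * (1 - s) powr b"
  have "(?f has_integral Beta ((p + 1) / 2) (b + 1)) {0..1}"
    using has_integral_Beta_real[of "(p + 1) / 2" "b + 1"] p b by (simp add: field_simps)
  from nn_integral_has_integral_lebesgue[OF _ this]
  have "ennreal (Beta ((p + 1) / 2) (b + 1)) = (\<integral>\<^sup>+s. ennreal (?f s * indicator {0\<^sup>2..1\<^sup>2} s) \<partial>lborel)"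
    by (simp add: mult.commute)
  also have "\<dots> = (\<integral>\<^sup>+t. ennreal (?f (t\<^sup>2) * (2 * t) * indicator {0..1} t) \<partial>lborel)"
    by (subst nn_integral_substitution[where g = "\<lambda>x. x ^ 2" and g' = "\<lambda>x. 2 * x"])
       (auto intro!: derivative_eq_intros continuous_intros simp: set_borel_measurable_def)
  also have "\<dots> = (\<integral>\<^sup>+t. 2 * (ennreal (t powr p * (1 - t\<^sup>2) powr b) * indicator {0..1} t) \<partial>lborel)"
  proof (rule nn_integral_cong)
    fix t :: real
    show "ennreal (?f (t\<^sup>2) * (2 * t) * indicator {0..1} t) = 2 * (ennreal (t powr p * (1 - t\<^sup>2) powr b) * indicator {0..1} t)"
    proof (cases "0 < t \<and> t \<le> 1")
      case True
      have "t\<^sup>2 = t powr 2" using True by simp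
      then have "(t\<^sup>2) powr ((p - 1) / 2) = t powr (2 * ((p - 1) / 2))" by (simp only: powr_powr)
      also have "2 * ((p - 1) / 2) = p - 1" by simp
      finally have "(t\<^sup>2) powr ((p - 1) / 2) = t powr (p - 1)" .
      then have "?f (t\<^sup>2) * (2 * t) = 2 * ((t powr (p - 1) * t) * (1 - t\<^sup>2) powr b)" by simp
      also have "t powr (p - 1) * t = t powr p" using True powr_add[of t "p - 1" 1] by simp
      finally have eq: "?f (t\<^sup>2) * (2 * t) = 2 * (t powr p * (1 - t\<^sup>2) powr b)" .
      have i: "indicator {0..1} t = (1 :: real)" "indicator {0..1} t = (1 :: ennreal)" using True by auto
      show ?thesis unfolding i mult_1_right eq by (simp add: ennreal_mult)
    next
      case False
      then show ?thesis by (cases "t = 0") (auto simp: indicator_def)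
    qed
  qed
  also have "\<dots> = 2 * (\<integral>\<^sup>+t. ennreal (t powr p * (1 - t\<^sup>2) powr b) * indicator {0..1} t \<partial>lborel)"
    by (rule nn_integral_cmult) measurable
  finally have "2 * (\<integral>\<^sup>+t. ennreal (t powr p * (1 - t\<^sup>2) powr b) * indicator {0..1} t \<partial>lborel) = 2 * ennreal (Beta ((p + 1) / 2) (b + 1) / 2)"
    using Beta_real_pos[of "(p + 1) / 2" "b + 1"] p b by (simp add: ennreal_mult[symmetric] flip: ennreal_numeral)
  then show ?thesis by (subst (asm) ennreal_mult_cancel_left) auto
qed

text \<open>Fubini along the last axis: the slice at height \<open>t\<close> is a ball of radius
  \<open>sqrt (1 - t\<^sup>2)\<close>.\<close>

lemma nn_integral_ball_slices:
  assumes f [measurable]: "f \<in> borel_measurable borel" and m: "m \<ge> 1"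
  shows "(\<integral>\<^sup>+x. f (x m) * indicator (eball (Suc m) 1) x \<partial>euclid_lborel (Suc m)) =
    (\<integral>\<^sup>+t. f t * (ennreal (unit_ball_vol (real m) * (1 - t\<^sup>2) powr (real m / 2)) * indicator {-1..1} t) \<partial>lborel)"
proof -
  have [measurable]: "(\<lambda>x. f (x m)) \<in> borel_measurable (euclid_lborel (Suc m))"
    by (rule measurable_compose[OF measurable_coordinate f])
  note [measurable] = sets_euclid_ball
  have "(\<integral>\<^sup>+x. f (x m) * indicator (eball (Suc m) 1) x \<partial>euclid_lborel (Suc m)) =
    (\<integral>\<^sup>+t. \<integral>\<^sup>+x. f ((x(m := t)) m) * indicator (eball (Suc m) 1) (x(m := t)) \<partial>euclid_lborel m \<partial>lborel)"
    by (rule nn_integral_euclid_Suc) measurable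
  also have "\<dots> = (\<integral>\<^sup>+t. f t * (ennreal (unit_ball_vol (real m) * (1 - t\<^sup>2) powr (real m / 2)) * indicator {-1..1} t) \<partial>lborel)"
  proof (rule nn_integral_cong)
    fix t :: real
    have mem: "x(m := t) \<in> eball (Suc m) 1 \<longleftrightarrow> t \<in> {-1..1} \<and> x \<in> eball m (sqrt (1 - t\<^sup>2))" if "x \<in> euclid m" for x
    proof -
      have "x(m := t) \<in> euclid (Suc m)" using that by (auto simp: euclid_def PiE_iff extensional_def)
      moreover have "nrm (Suc m) (x(m := t)) \<le> 1 \<longleftrightarrow> (nrm m x)\<^sup>2 + t\<^sup>2 \<le> 1"
        unfolding nrm_upd by simp
      moreover have "(nrm m x)\<^sup>2 + t\<^sup>2 \<le> 1 \<longleftrightarrow> t \<in> {-1..1} \<and> nrm m x \<le> sqrt (1 - t\<^sup>2)"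
      proof
        assume a: "(nrm m x)\<^sup>2 + t\<^sup>2 \<le> 1"
        then have "t\<^sup>2 \<le> 1" using zero_le_power2[of "nrm m x"] by linarith
        then have "\<bar>t\<bar> \<le> 1" by (simp add: abs_square_le_1)
        moreover have "nrm m x \<le> sqrt (1 - t\<^sup>2)" using a by (intro real_le_rsqrt) simp
        ultimately show "t \<in> {-1..1} \<and> nrm m x \<le> sqrt (1 - t\<^sup>2)" by auto
      next
        assume a: "t \<in> {-1..1} \<and> nrm m x \<le> sqrt (1 - t\<^sup>2)"
        then have "t\<^sup>2 \<le> 1" by (simp add: abs_square_le_1 abs_le_iff)
        moreover have "(nrm m x)\<^sup>2 \<le> (sqrt (1 - t\<^sup>2))\<^sup>2" using a by (intro power_mono) auto
        ultimately show "(nrm m x)\<^sup>2 + t\<^sup>2 \<le> 1" by simp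
      qed
      ultimately show ?thesis using that by simp
    qed
    have "(\<integral>\<^sup>+x. f ((x(m := t)) m) * indicator (eball (Suc m) 1) (x(m := t)) \<partial>euclid_lborel m) =
      (\<integral>\<^sup>+x. (f t * indicator {-1..1} t) * indicator (eball m (sqrt (1 - t\<^sup>2))) x \<partial>euclid_lborel m)"
      using mem by (intro nn_integral_cong) (auto simp: indicator_def)
    also have "\<dots> = (f t * indicator {-1..1} t) * emeasure (euclid_lborel m) (eball m (sqrt (1 - t\<^sup>2)))"
      by (rule nn_integral_cmult_indicator) (rule sets_euclid_ball)
    also have "\<dots> = f t * (ennreal (unit_ball_vol (real m) * (1 - t\<^sup>2) powr (real m / 2)) * indicator {-1..1} t)"
    proof (cases "t \<in> {-1..1}")
      case True
      then have t: "0 \<le> 1 - t\<^sup>2" by (simp add: abs_square_le_1 abs_le_iff)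
      have "sqrt (1 - t\<^sup>2) ^ m = (1 - t\<^sup>2) powr (real m / 2)"
      proof (cases "1 - t\<^sup>2 = 0")
        case False
        then have "sqrt (1 - t\<^sup>2) ^ m = ((1 - t\<^sup>2) powr (1 / 2)) powr real m"
          using t by (simp add: powr_half_sqrt powr_realpow)
        then show ?thesis by (simp add: powr_powr)
      qed (use m in \<open>simp add: power_0_left\<close>)
      then show ?thesis using True t by (simp add: emeasure_euclid_ball)
    qed simp
    finally show "(\<integral>\<^sup>+x. f ((x(m := t)) m) * indicator (eball (Suc m) 1) (x(m := t)) \<partial>euclid_lborel m) =
      f t * (ennreal (unit_ball_vol (real m) * (1 - t\<^sup>2) powr (real m / 2)) * indicator {-1..1} t)" .
  qed
  finally show ?thesis .
qed

lemma pos_ip_pole: "pos_ip (Suc m) x (pole (Suc m)) = max 0 (x m)"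
  by (simp add: pos_ip_def ip_pole)

lemma ball_moment_eq:
  assumes m: "m \<ge> 1" and r: "r > 0"
  shows "ball_moment (Suc m) r = ennreal (unit_ball_vol (real m) * Beta ((r + 1) / 2) (real m / 2 + 1) / 2)"
proof -
  have "ball_moment (Suc m) r = (\<integral>\<^sup>+t. ennreal (max 0 t powr r) * (ennreal (unit_ball_vol (real m) * (1 - t\<^sup>2) powr (real m / 2)) * indicator {-1..1} t) \<partial>lborel)"
    unfolding ball_moment_def pos_ip_pole using m by (intro nn_integral_ball_slices) measurable
  also have "\<dots> = (\<integral>\<^sup>+t. ennreal (unit_ball_vol (real m)) * (ennreal (t powr r * (1 - t\<^sup>2) powr (real m / 2)) * indicator {0..1} t) \<partial>lborel)"
  proof (rule nn_integral_cong)
    fix t :: real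
    show "ennreal (max 0 t powr r) * (ennreal (unit_ball_vol (real m) * (1 - t\<^sup>2) powr (real m / 2)) * indicator {-1..1} t) =
      ennreal (unit_ball_vol (real m)) * (ennreal (t powr r * (1 - t\<^sup>2) powr (real m / 2)) * indicator {0..1} t)"
    proof (cases "0 \<le> t \<and> t \<le> 1")
      case True
      then show ?thesis by (simp add: ennreal_mult max_def mult_ac)
    next
      case False
      then have "max 0 t powr r = 0 \<or> t \<notin> {-1..1}" "t \<notin> {0..1}" by auto
      then show ?thesis by auto
    qed
  qed
  also have "\<dots> = ennreal (unit_ball_vol (real m)) * (\<integral>\<^sup>+t. ennreal (t powr r * (1 - t\<^sup>2) powr (real m / 2)) * indicator {0..1} t \<partial>lborel)"
    by (rule nn_integral_cmult) measurable
  also have "\<dots> = ennreal (unit_ball_vol (real m)) * ennreal (Beta ((r + 1) / 2) (real m / 2 + 1) / 2)"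
    using r by (subst nn_integral_Beta_square) auto
  also have "\<dots> = ennreal (unit_ball_vol (real m) * Beta ((r + 1) / 2) (real m / 2 + 1) / 2)"
    using Beta_real_pos[of "(r + 1) / 2" "real m / 2 + 1"] r by (subst ennreal_mult[symmetric]) auto
  finally show ?thesis .
qed

text \<open>The factor \<open>s\<close> makes the integrand an exact derivative, namely of
  \<open>- ((1 - s\<^sup>2) powr (c + 1) / (2 * c + 2))\<close>.\<close>

lemma nn_integral_tail:
  assumes t: "0 \<le> t" "t \<le> 1" and c: "c \<ge> 0"
  shows "(\<integral>\<^sup>+s. ennreal (s * (1 - s\<^sup>2) powr c) * indicator {t..1} s \<partial>lborel) = ennreal ((1 - t\<^sup>2) powr (c + 1) / (2 * c + 2))"
proof -
  have "((\<lambda>s. s * (1 - s\<^sup>2) powr c) has_integral (- ((1 - 1\<^sup>2) powr (c + 1) / (2 * c + 2)) - - ((1 - t\<^sup>2) powr (c + 1) / (2 * c + 2)))) {t..1}"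
  proof (rule fundamental_theorem_of_calculus_interior[OF t(2)])
    show "continuous_on {t..1} (\<lambda>s. - ((1 - s\<^sup>2) powr (c + 1) / (2 * c + 2)))"
      using t c by (intro continuous_intros continuous_on_powr') (auto simp: abs_square_le_1 abs_le_iff)
    fix s assume s: "s \<in> {t<..<1}"
    then have pos: "0 < 1 - s\<^sup>2" using t by (simp add: abs_square_less_1)
    have "((\<lambda>s. - ((1 - s\<^sup>2) powr (c + 1) / (2 * c + 2))) has_real_derivative s * (1 - s\<^sup>2) powr c) (at s)"
    proof -
      have "((\<lambda>s. 1 - s\<^sup>2) has_real_derivative (- 2 * s)) (at s)"
        by (auto intro!: derivative_eq_intros)
      from DERIV_minus[OF DERIV_cdivide[OF DERIV_chain2[OF has_real_derivative_powr[OF pos] this], of "c + 1" "2 * c + 2"]]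
      have "((\<lambda>s. - ((1 - s\<^sup>2) powr (c + 1) / (2 * c + 2))) has_real_derivative
        - ((c + 1) * (1 - s\<^sup>2) powr (c + 1 - 1) * (- 2 * s) / (2 * c + 2))) (at s)" .
      moreover have "- ((c + 1) * (1 - s\<^sup>2) powr (c + 1 - 1) * (- 2 * s) / (2 * c + 2)) = s * (1 - s\<^sup>2) powr c"
        using c by (simp add: field_simps)
      ultimately show ?thesis by simp
    qed
    then show "((\<lambda>s. - ((1 - s\<^sup>2) powr (c + 1) / (2 * c + 2))) has_vector_derivative s * (1 - s\<^sup>2) powr c) (at s)"
      by (simp add: has_real_derivative_iff_has_vector_derivative)
  qed
  then have "((\<lambda>s. s * (1 - s\<^sup>2) powr c) has_integral ((1 - t\<^sup>2) powr (c + 1) / (2 * c + 2))) {t..1}"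
    by simp
  from nn_integral_has_integral_lebesgue[OF _ this] t
  have "(\<integral>\<^sup>+s. ennreal (indicator {t..1} s * (s * (1 - s\<^sup>2) powr c)) \<partial>lborel) = ennreal ((1 - t\<^sup>2) powr (c + 1) / (2 * c + 2))"
    by simp
  then show ?thesis
    by (simp add: ennreal_mult' ennreal_indicator mult.commute)
qed

text \<open>The volume of the segment that the height \<open>t\<close> cuts off from the unit
  ball.\<close>

definition ball_tail :: "nat \<Rightarrow> real \<Rightarrow> ennreal" where
  "ball_tail m t = (\<integral>\<^sup>+x. indicator {t..} (x m) * indicator (eball (Suc m) 1) x \<partial>euclid_lborel (Suc m))"

text \<open>On \<open>{t..1}\<close> one has \<open>s \<le> 1 \<le> s / t\<close>, so the factor
  \<open>s\<close> that makes the integral elementary can be inserted in both directions.\<close>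

lemma ball_tail_bounds:
  assumes m: "m \<ge> 1" and t: "0 < t" "t \<le> 1"
  defines "K \<equiv> unit_ball_vol (real m) / (real m + 2)"
  shows "ennreal (K * (1 - t\<^sup>2) powr (real m / 2 + 1)) \<le> ball_tail m t"
    "ball_tail m t \<le> ennreal (K * (1 - t\<^sup>2) powr (real m / 2 + 1) / t)"
proof -
  let ?k = "unit_ball_vol (real m)"
  have "ball_tail m t = (\<integral>\<^sup>+s. indicator {t..} s * (ennreal (?k * (1 - s\<^sup>2) powr (real m / 2)) * indicator {-1..1} s) \<partial>lborel)"
    unfolding ball_tail_def using m by (intro nn_integral_ball_slices) measurable
  also have "\<dots> = (\<integral>\<^sup>+s. ennreal ?k * (ennreal ((1 - s\<^sup>2) powr (real m / 2)) * indicator {t..1} s) \<partial>lborel)"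
    using t by (intro nn_integral_cong) (auto simp: indicator_def ennreal_mult)
  also have "\<dots> = ennreal ?k * (\<integral>\<^sup>+s. ennreal ((1 - s\<^sup>2) powr (real m / 2)) * indicator {t..1} s \<partial>lborel)"
    by (rule nn_integral_cmult) measurable
  finally have T: "ball_tail m t = ennreal ?k * (\<integral>\<^sup>+s. ennreal ((1 - s\<^sup>2) powr (real m / 2)) * indicator {t..1} s \<partial>lborel)" .
  have J: "(\<integral>\<^sup>+s. ennreal (s * (1 - s\<^sup>2) powr (real m / 2)) * indicator {t..1} s \<partial>lborel) = ennreal ((1 - t\<^sup>2) powr (real m / 2 + 1) / (real m + 2))"
    using nn_integral_tail[of t "real m / 2"] t by simp
  have "ennreal (K * (1 - t\<^sup>2) powr (real m / 2 + 1)) = ennreal ?k * ennreal ((1 - t\<^sup>2) powr (real m / 2 + 1) / (real m + 2))"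
    by (subst ennreal_mult[symmetric]) (auto simp: K_def)
  also have "\<dots> \<le> ball_tail m t"
    unfolding T J[symmetric] using t
    by (intro mult_left_mono nn_integral_mono) (auto simp: indicator_def intro!: ennreal_leI mult_left_le_one_le)
  finally show "ennreal (K * (1 - t\<^sup>2) powr (real m / 2 + 1)) \<le> ball_tail m t" .
  have "(\<integral>\<^sup>+s. ennreal ((1 - s\<^sup>2) powr (real m / 2)) * indicator {t..1} s \<partial>lborel) \<le>
      (\<integral>\<^sup>+s. ennreal (1 / t) * (ennreal (s * (1 - s\<^sup>2) powr (real m / 2)) * indicator {t..1} s) \<partial>lborel)"
  proof (intro nn_integral_mono)
    fix s :: real
    show "ennreal ((1 - s\<^sup>2) powr (real m / 2)) * indicator {t..1} s \<le> ennreal (1 / t) * (ennreal (s * (1 - s\<^sup>2) powr (real m / 2)) * indicator {t..1} s)"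
    proof (cases "s \<in> {t..1}")
      case True
      then have "1 * (1 - s\<^sup>2) powr (real m / 2) \<le> (s / t) * (1 - s\<^sup>2) powr (real m / 2)"
        using t by (intro mult_right_mono) auto
      then have "ennreal ((1 - s\<^sup>2) powr (real m / 2)) \<le> ennreal (1 / t * (s * (1 - s\<^sup>2) powr (real m / 2)))"
        by (intro ennreal_leI) simp
      also have "\<dots> = ennreal (1 / t) * ennreal (s * (1 - s\<^sup>2) powr (real m / 2))"
        using t True by (intro ennreal_mult) auto
      finally show ?thesis using True by simp
    qed simp
  qed
  also have "\<dots> = ennreal (1 / t) * ennreal ((1 - t\<^sup>2) powr (real m / 2 + 1) / (real m + 2))"
    unfolding J[symmetric] by (rule nn_integral_cmult) measurable
  finally have "ball_tail m t \<le> ennreal ?k * (ennreal (1 / t) * ennreal ((1 - t\<^sup>2) powr (real m / 2 + 1) / (real m + 2)))"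
    unfolding T by (rule mult_left_mono) simp
  also have "\<dots> = ennreal (?k * (1 / t * ((1 - t\<^sup>2) powr (real m / 2 + 1) / (real m + 2))))"
    using t by (intro ennreal_mult3) auto
  also have "?k * (1 / t * ((1 - t\<^sup>2) powr (real m / 2 + 1) / (real m + 2))) = K * (1 - t\<^sup>2) powr (real m / 2 + 1) / t"
    by (simp add: K_def)
  finally show "ball_tail m t \<le> ennreal (K * (1 - t\<^sup>2) powr (real m / 2 + 1) / t)" .
qed

lemma ball_tail_zero: "t > 1 \<Longrightarrow> ball_tail m t = 0"
proof -
  assume t: "t > 1"
  have *: "indicator {t..} (x m) * indicator (eball (Suc m) 1) x = (0 :: ennreal)" for x :: "nat \<Rightarrow> real"
    using abs_coord_le_nrm[of m "Suc m" x] t by (auto simp: indicator_def)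
  show ?thesis unfolding ball_tail_def * by simp
qed

text \<open>The minimum is at least \<open>t\<close> exactly when both numbers are, so the layer
  representation separates \<open>a\<close> from \<open>b\<close>.\<close>

lemma min_powr_layer:
  assumes r: "r > 0" and "a \<ge> 0" "b \<ge> 0"
  shows "ennreal (min a b powr r) = (\<integral>\<^sup>+t. ennreal (r * t powr (r - 1)) * indicator {0..} t * (indicator {t..} a * indicator {t..} b) \<partial>lborel)"
proof -
  have "ennreal (min a b powr r) = ennreal r * ennreal (min a b powr r / r)"
    using r by (subst ennreal_mult[symmetric]) auto
  also have "\<dots> = ennreal r * (\<integral>\<^sup>+t. ennreal (t powr (r - 1)) * indicator {0..min a b} t \<partial>lborel)"
    using assms by (subst nn_integral_powr_0) auto
  also have "\<dots> = (\<integral>\<^sup>+t. ennreal r * (ennreal (t powr (r - 1)) * indicator {0..min a b} t) \<partial>lborel)"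
    by (rule nn_integral_cmult[symmetric]) measurable
  also have "\<dots> = (\<integral>\<^sup>+t. ennreal (r * t powr (r - 1)) * indicator {0..} t * (indicator {t..} a * indicator {t..} b) \<partial>lborel)"
    using r by (intro nn_integral_cong) (auto simp: indicator_def ennreal_mult)
  finally show ?thesis .
qed

text \<open>At each level \<open>t\<close> the integrand of \<open>min_powr_layer\<close> is a
  product over the two points, and after Fubini each of them contributes a factor
  \<open>ball_tail m t\<close>.\<close>

lemma ball_min_moment_layer:
  assumes r: "r > 0"
  shows "ball_min_moment (Suc m) r = (\<integral>\<^sup>+t. ennreal (r * t powr (r - 1)) * indicator {0<..} t * (ball_tail m t)\<^sup>2 \<partial>lborel)"
proof -
  let ?L = "euclid_lborel (Suc m)"
  interpret LB: pair_sigma_finite lborel ?L ..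
  define G where "G x t = (indicator {t..} (max 0 (x m)) * indicator (eball (Suc m) 1) x :: ennreal)" for x t
  define c where "c t = ennreal (r * t powr (r - 1)) * indicator {0..} t" for t
  have c [measurable]: "c \<in> borel_measurable borel"
  proof -
    have "(\<lambda>t::real. ennreal (r * t powr (r - 1))) \<in> borel_measurable borel" by measurable
    moreover have "(indicator {0..} :: real \<Rightarrow> ennreal) \<in> borel_measurable borel" by (rule borel_measurable_indicator) simp
    ultimately show ?thesis unfolding c_def[abs_def] by (rule borel_measurable_times_ennreal)
  qed
  have G_meas: "(\<lambda>z. G (f z) (h z)) \<in> borel_measurable N"
    if f [measurable]: "f \<in> measurable N ?L" and h [measurable]: "h \<in> borel_measurable N" for f h and N :: "'z measure"
  proof -
    have [measurable]: "(\<lambda>z. f z m) \<in> borel_measurable N" by (rule measurable_compose[OF f measurable_coordinate])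
    note [measurable] = sets_euclid_ball
    have "{z \<in> space N. h z \<le> max 0 (f z m)} \<in> sets N" by measurable
    then have "(\<lambda>z. indicator {z \<in> space N. h z \<le> max 0 (f z m)} z * indicator (eball (Suc m) 1) (f z) :: ennreal) \<in> borel_measurable N"
      by measurable
    also have "?this \<longleftrightarrow> ?thesis" by (intro measurable_cong) (simp add: G_def indicator_def)
    finally show ?thesis .
  qed
  have "ball_min_moment (Suc m) r = (\<integral>\<^sup>+x. \<integral>\<^sup>+y. \<integral>\<^sup>+t. c t * (G x t * G y t) \<partial>lborel \<partial>?L \<partial>?L)"
    unfolding ball_min_moment_def
  proof (intro nn_integral_cong)
    fix x y :: "nat \<Rightarrow> real"
    let ?i = "indicator (eball (Suc m) 1) x * indicator (eball (Suc m) 1) y :: ennreal"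
    have "ennreal (min (pos_ip (Suc m) x (pole (Suc m))) (pos_ip (Suc m) y (pole (Suc m))) powr r) * ?i =
      (\<integral>\<^sup>+t. c t * (indicator {t..} (max 0 (x m)) * indicator {t..} (max 0 (y m))) \<partial>lborel) * ?i"
      unfolding pos_ip_pole c_def by (subst min_powr_layer[OF r]) auto
    also have "\<dots> = (\<integral>\<^sup>+t. c t * (indicator {t..} (max 0 (x m)) * indicator {t..} (max 0 (y m))) * ?i \<partial>lborel)"
    proof (rule nn_integral_multc[symmetric])
      have "(\<lambda>t. c t * (indicator {..max 0 (x m)} t * indicator {..max 0 (y m)} t)) \<in> borel_measurable lborel" by measurable
      also have "?this \<longleftrightarrow> (\<lambda>t. c t * (indicator {t..} (max 0 (x m)) * indicator {t..} (max 0 (y m)))) \<in> borel_measurable lborel"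
        by (intro measurable_cong) (simp add: indicator_def)
      finally show "(\<lambda>t. c t * (indicator {t..} (max 0 (x m)) * indicator {t..} (max 0 (y m)))) \<in> borel_measurable lborel" .
    qed
    also have "\<dots> = (\<integral>\<^sup>+t. c t * (G x t * G y t) \<partial>lborel)"
      unfolding G_def by (intro nn_integral_cong) (simp only: mult_ac)
    finally show "ennreal (min (pos_ip (Suc m) x (pole (Suc m))) (pos_ip (Suc m) y (pole (Suc m))) powr r) * ?i = (\<integral>\<^sup>+t. c t * (G x t * G y t) \<partial>lborel)" .
  qed
  also have "\<dots> = (\<integral>\<^sup>+x. \<integral>\<^sup>+t. \<integral>\<^sup>+y. c t * (G x t * G y t) \<partial>?L \<partial>lborel \<partial>?L)"
  proof (rule nn_integral_cong)
    fix x assume x: "x \<in> space ?L"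
    show "(\<integral>\<^sup>+y. \<integral>\<^sup>+t. c t * (G x t * G y t) \<partial>lborel \<partial>?L) = (\<integral>\<^sup>+t. \<integral>\<^sup>+y. c t * (G x t * G y t) \<partial>?L \<partial>lborel)"
    proof (rule LB.Fubini')
      show "(\<lambda>(t, y). c t * (G x t * G y t)) \<in> borel_measurable (lborel \<Otimes>\<^sub>M ?L)"
        unfolding case_prod_beta using x
        by (intro borel_measurable_times_ennreal G_meas measurable_const measurable_snd measurable_compose[OF measurable_fst c[unfolded measurable_lborel1[symmetric]]]) auto
    qed
  qed
  also have "\<dots> = (\<integral>\<^sup>+t. \<integral>\<^sup>+x. \<integral>\<^sup>+y. c t * (G x t * G y t) \<partial>?L \<partial>?L \<partial>lborel)"
  proof (rule LB.Fubini')
    have "(\<lambda>z. c (fst (fst z)) * (G (snd (fst z)) (fst (fst z)) * G (snd z) (fst (fst z)))) \<in> borel_measurable ((lborel \<Otimes>\<^sub>M ?L) \<Otimes>\<^sub>M ?L)"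
      by (intro borel_measurable_times_ennreal G_meas measurable_snd measurable_compose[OF measurable_fst measurable_snd]
          measurable_compose[OF _ c]) measurable
    then show "(\<lambda>(t, x). \<integral>\<^sup>+y. c t * (G x t * G y t) \<partial>?L) \<in> borel_measurable (lborel \<Otimes>\<^sub>M ?L)"
      unfolding case_prod_beta by (intro euclid_lborel.borel_measurable_nn_integral) (simp add: case_prod_beta')
  qed
  also have "\<dots> = (\<integral>\<^sup>+t. ennreal (r * t powr (r - 1)) * indicator {0<..} t * (ball_tail m t)\<^sup>2 \<partial>lborel)"
  proof (rule nn_integral_cong_AE)
    show "AE t in lborel. (\<integral>\<^sup>+x. \<integral>\<^sup>+y. c t * (G x t * G y t) \<partial>?L \<partial>?L) = ennreal (r * t powr (r - 1)) * indicator {0<..} t * (ball_tail m t)\<^sup>2"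
      using AE_lborel_singleton[of 0]
    proof eventually_elim
      case (elim t)
      show ?case
      proof (cases "t > 0")
        case True
        have Gt: "(\<lambda>x. G x t) \<in> borel_measurable ?L" by (intro G_meas measurable_ident_euclid measurable_const) auto
        have "(\<integral>\<^sup>+x. G x t \<partial>?L) = ball_tail m t"
          unfolding ball_tail_def G_def using True by (intro nn_integral_cong) (auto simp: indicator_def)
        moreover have "(\<integral>\<^sup>+x. \<integral>\<^sup>+y. c t * (G x t * G y t) \<partial>?L \<partial>?L) = c t * ((\<integral>\<^sup>+x. G x t \<partial>?L) * (\<integral>\<^sup>+x. G x t \<partial>?L))"
          using Gt by (simp add: nn_integral_cmult nn_integral_multc)
        ultimately show ?thesis using True by (simp add: c_def power2_eq_square)
      next
        case False
        then have "t < 0" using elim by simp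
        then show ?thesis by (simp add: c_def)
      qed
    qed
  qed
  finally show ?thesis .
qed

lemma ball_min_moment_lower:
  assumes m: "m \<ge> 1" and r: "r > 0"
  shows "ennreal ((unit_ball_vol (real m) / (real m + 2))\<^sup>2 * (r * Beta (r / 2) (real m + 3) / 2)) \<le> ball_min_moment (Suc m) r"
proof -
  define K where "K = unit_ball_vol (real m) / (real m + 2)"
  have K: "K \<ge> 0" by (simp add: K_def)
  have B: "Beta (r / 2) (real m + 3) > 0" using r by (intro Beta_real_pos) auto
  have "ennreal (K\<^sup>2 * (r * Beta (r / 2) (real m + 3) / 2)) = ennreal (K\<^sup>2 * r) * ennreal (Beta ((r - 1 + 1) / 2) (real m + 2 + 1) / 2)"
    using B r by (subst ennreal_mult[symmetric]) (auto simp: add.assoc)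
  also have "\<dots> = ennreal (K\<^sup>2 * r) * (\<integral>\<^sup>+t. ennreal (t powr (r - 1) * (1 - t\<^sup>2) powr (real m + 2)) * indicator {0..1} t \<partial>lborel)"
    using r by (subst nn_integral_Beta_square) auto
  also have "\<dots> = (\<integral>\<^sup>+t. ennreal (K\<^sup>2 * r) * (ennreal (t powr (r - 1) * (1 - t\<^sup>2) powr (real m + 2)) * indicator {0..1} t) \<partial>lborel)"
    by (rule nn_integral_cmult[symmetric]) measurable
  also have "\<dots> \<le> (\<integral>\<^sup>+t. ennreal (r * t powr (r - 1)) * indicator {0<..} t * (ball_tail m t)\<^sup>2 \<partial>lborel)"
  proof (intro nn_integral_mono)
    fix t :: real
    show "ennreal (K\<^sup>2 * r) * (ennreal (t powr (r - 1) * (1 - t\<^sup>2) powr (real m + 2)) * indicator {0..1} t) \<le>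
      ennreal (r * t powr (r - 1)) * indicator {0<..} t * (ball_tail m t)\<^sup>2"
    proof (cases "0 < t \<and> t \<le> 1")
      case True
      let ?p = "(1 - t\<^sup>2) powr (real m / 2 + 1)"
      have sq: "?p\<^sup>2 = (1 - t\<^sup>2) powr (real m + 2)"
      proof -
        have "real m / 2 + 1 + (real m / 2 + 1) = real m + 2" by simp
        then show ?thesis by (simp only: power2_eq_square[of ?p] powr_add[symmetric])
      qed
      have "ennreal (K\<^sup>2 * r) * ennreal (t powr (r - 1) * (1 - t\<^sup>2) powr (real m + 2)) = ennreal (r * t powr (r - 1)) * (ennreal (K * ?p))\<^sup>2"
        using K r by (simp add: ennreal_power ennreal_mult[symmetric] power_mult_distrib sq mult_ac)
      also have "\<dots> \<le> ennreal (r * t powr (r - 1)) * (ball_tail m t)\<^sup>2"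
        using ball_tail_bounds(1)[OF m, of t] True unfolding K_def by (intro mult_left_mono power_mono) auto
      finally show ?thesis using True by simp
    next
      case False
      then show ?thesis by (cases "t = 0") auto
    qed
  qed
  finally show ?thesis unfolding ball_min_moment_layer[OF r] K_def .
qed

text \<open>The loss \<open>1 / t\<close> in each of the two tails lowers the exponent of
  \<open>t\<close> by 2, that is, the first Beta parameter by 1; convergence at 0 then asks for
  \<open>r > 2\<close>.\<close>

lemma ball_min_moment_upper:
  assumes m: "m \<ge> 1" and r: "r > 2"
  shows "ball_min_moment (Suc m) r \<le> ennreal ((unit_ball_vol (real m) / (real m + 2))\<^sup>2 * (r * Beta (r / 2 - 1) (real m + 3) / 2))"
proof -
  define K where "K = unit_ball_vol (real m) / (real m + 2)"
  have K: "K \<ge> 0" by (simp add: K_def)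
  have r0: "r > 0" using r by simp
  have B: "Beta (r / 2 - 1) (real m + 3) > 0" using r by (intro Beta_real_pos) auto
  have e: "(r - 3 + 1) / 2 = r / 2 - 1" by (simp add: field_simps)
  have "(\<integral>\<^sup>+t. ennreal (r * t powr (r - 1)) * indicator {0<..} t * (ball_tail m t)\<^sup>2 \<partial>lborel) \<le>
    (\<integral>\<^sup>+t. ennreal (K\<^sup>2 * r) * (ennreal (t powr (r - 3) * (1 - t\<^sup>2) powr (real m + 2)) * indicator {0..1} t) \<partial>lborel)"
  proof (intro nn_integral_mono)
    fix t :: real
    show "ennreal (r * t powr (r - 1)) * indicator {0<..} t * (ball_tail m t)\<^sup>2 \<le>
      ennreal (K\<^sup>2 * r) * (ennreal (t powr (r - 3) * (1 - t\<^sup>2) powr (real m + 2)) * indicator {0..1} t)"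
    proof (cases "0 < t \<and> t \<le> 1")
      case True
      let ?p = "(1 - t\<^sup>2) powr (real m / 2 + 1)"
      have sq: "?p\<^sup>2 = (1 - t\<^sup>2) powr (real m + 2)"
      proof -
        have "real m / 2 + 1 + (real m / 2 + 1) = real m + 2" by simp
        then show ?thesis by (simp only: power2_eq_square[of ?p] powr_add[symmetric])
      qed
      have tp: "t powr (r - 1) / t\<^sup>2 = t powr (r - 3)"
        using True powr_diff[of t "r - 1" 2] by (simp add: powr_numeral)
      have "ennreal (r * t powr (r - 1)) * (ball_tail m t)\<^sup>2 \<le> ennreal (r * t powr (r - 1)) * (ennreal (K * ?p / t))\<^sup>2"
        using ball_tail_bounds(2)[OF m, of t] True unfolding K_def by (intro mult_left_mono power_mono) auto
      also have "\<dots> = ennreal (r * t powr (r - 1) * (K * ?p / t)\<^sup>2)"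
        using K r True by (simp add: ennreal_power ennreal_mult[symmetric])
      also have "r * t powr (r - 1) * (K * ?p / t)\<^sup>2 = K\<^sup>2 * r * ((t powr (r - 1) / t\<^sup>2) * ?p\<^sup>2)"
        by (simp add: power_mult_distrib power_divide)
      also have "\<dots> = K\<^sup>2 * r * (t powr (r - 3) * (1 - t\<^sup>2) powr (real m + 2))" unfolding sq tp ..
      also have "ennreal \<dots> = ennreal (K\<^sup>2 * r) * ennreal (t powr (r - 3) * (1 - t\<^sup>2) powr (real m + 2))"
        using r by (intro ennreal_mult) auto
      finally show ?thesis using True by simp
    next
      case False
      then show ?thesis using ball_tail_zero[of t m] by (cases "t > 1") auto
    qed
  qed
  also have "\<dots> = ennreal (K\<^sup>2 * r) * (\<integral>\<^sup>+t. ennreal (t powr (r - 3) * (1 - t\<^sup>2) powr (real m + 2)) * indicator {0..1} t \<partial>lborel)"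
    by (rule nn_integral_cmult) measurable
  also have "\<dots> = ennreal (K\<^sup>2 * r) * ennreal (Beta (r / 2 - 1) (real m + 3) / 2)"
  proof -
    have "(\<integral>\<^sup>+t. ennreal (t powr (r - 3) * (1 - t\<^sup>2) powr (real m + 2)) * indicator {0..1} t \<partial>lborel) =
      ennreal (Beta ((r - 3 + 1) / 2) (real m + 2 + 1) / 2)"
      by (rule nn_integral_Beta_square) (use r in auto)
    also have "real m + 2 + 1 = real m + 3" by simp
    finally show ?thesis unfolding e by simp
  qed
  also have "\<dots> = ennreal (K\<^sup>2 * (r * Beta (r / 2 - 1) (real m + 3) / 2))"
    using B r by (subst ennreal_mult[symmetric]) auto
  finally show ?thesis unfolding ball_min_moment_layer[OF r0] K_def .
qed

text \<open>Covers also \<open>r \<le> 2\<close>, which \<open>ball_min_moment_upper\<close> does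
  not reach but which can occur for \<open>r = a * n\<close> in small dimensions.\<close>

lemma ball_min_moment_finite: "n \<ge> 1 \<Longrightarrow> r > 0 \<Longrightarrow> ball_min_moment n r < top"
proof -
  assume n: "n \<ge> 1" and r: "r > 0"
  note [measurable] = sets_euclid_ball
  have "ball_min_moment n r \<le> (\<integral>\<^sup>+x. \<integral>\<^sup>+y. indicator (eball n 1) x * indicator (eball n 1) y \<partial>euclid_lborel n \<partial>euclid_lborel n)"
    unfolding ball_min_moment_def
  proof (intro nn_integral_mono)
    fix x y :: "nat \<Rightarrow> real"
    show "ennreal (min (pos_ip n x (pole n)) (pos_ip n y (pole n)) powr r) * (indicator (eball n 1) x * indicator (eball n 1) y) \<le>
      indicator (eball n 1) x * indicator (eball n 1) y"
    proof (cases "x \<in> eball n 1 \<and> y \<in> eball n 1")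
      case True
      then have "pos_ip n x (pole n) \<le> 1" using pos_ip_le[of n x "pole n"] pole_sphere[of n] n by (simp add: sphere_subset)
      then have "min (pos_ip n x (pole n)) (pos_ip n y (pole n)) powr r \<le> 1" using r by (intro powr_le1) auto
      then show ?thesis using True by simp
    qed auto
  qed
  also have "\<dots> = ennreal (unit_ball_vol (real n)) * ennreal (unit_ball_vol (real n))"
    by (simp add: nn_integral_cmult nn_integral_multc emeasure_euclid_ball sets_euclid_ball)
  also have "\<dots> < top" by (simp add: ennreal_mult_less_top)
  finally show ?thesis .
qed

subsection \<open>Asymptotic comparison\<close>

text \<open>The difference is \<open>(x + 1 / 2) * (ln (x + 1) - ln x) - 1\<close>. Midpoint and
  trapezoid bounds for the integral of the reciprocal over \<open>{x..x + 1}\<close> show that it is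
  nonnegative and at most a telescoping term.\<close>

lemma Stirling_step:
  fixes x :: real
  assumes x: "x > 0"
  defines "g \<equiv> \<lambda>x::real. ln (Gamma x) - (x - 1 / 2) * ln x + x"
  shows "g (x + 1) \<le> g x" "g x - g (x + 1) \<le> (1 / x - 1 / (x + 1)) / 4"
proof -
  have "Gamma (x + 1) = x * Gamma x" using x by (subst Gamma_plus1) (auto simp: nonpos_Ints_def)
  then have "ln (Gamma (x + 1)) = ln x + ln (Gamma x)"
  proof -
    have "Gamma x \<noteq> 0" using Gamma_real_pos[OF x] by linarith
    then show ?thesis using x \<open>Gamma (x + 1) = x * Gamma x\<close> by (simp add: ln_mult)
  qed
  then have d: "g x - g (x + 1) = (x + 1 / 2) * (ln (x + 1) - ln x) - 1" by (simp add: g_def algebra_simps)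
  have "ln (x + 1) - ln x \<ge> 2 * (x + 1 - x) / (x + (x + 1))" by (rule ln_inverse_approx_ge) (use x in auto)
  then have "(x + 1 / 2) * (2 / (2 * x + 1)) \<le> (x + 1 / 2) * (ln (x + 1) - ln x)" using x by (intro mult_left_mono) auto
  moreover have "(x + 1 / 2) * (2 / (2 * x + 1)) = 1" using x by (simp add: field_simps)
  ultimately show "g (x + 1) \<le> g x" using d by linarith
  have "ln (x + 1) - ln x \<le> 1 * (inverse x + inverse (x + 1)) / 2" by (rule ln_inverse_approx_le) (use x in auto)
  then have "(x + 1 / 2) * (ln (x + 1) - ln x) \<le> (x + 1 / 2) * ((inverse x + inverse (x + 1)) / 2)" using x by (intro mult_left_mono) auto
  moreover have "(x + 1 / 2) * ((inverse x + inverse (x + 1)) / 2) - 1 = (1 / x - 1 / (x + 1)) / 4"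
    using x by (simp add: divide_simps) (simp add: algebra_simps)
  ultimately show "g x - g (x + 1) \<le> (1 / x - 1 / (x + 1)) / 4" using d by linarith
qed

text \<open>Integer steps reduce \<open>x\<close> to \<open>{1..2}\<close>, where \<open>g\<close>
  is continuous; the total decrease along the steps telescopes to at most
  \<open>1 / 4\<close>.\<close>

lemma Stirling_bounded:
  "\<exists>b. \<forall>x::real. x \<ge> 1 \<longrightarrow> \<bar>ln (Gamma x) - (x - 1 / 2) * ln x + x\<bar> \<le> b"
proof -
  define g where "g = (\<lambda>x::real. ln (Gamma x) - (x - 1 / 2) * ln x + x)"
  have "continuous_on {1..2::real} Gamma"
    by (intro continuous_on_Gamma continuous_on_id) (auto elim!: nonpos_Ints_cases)
  moreover have "Gamma x \<noteq> 0" if "x \<in> {1..2}" for x :: real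
  proof -
    have "Gamma x > 0" using that by (intro Gamma_real_pos) auto
    then show ?thesis by linarith
  qed
  ultimately have "continuous_on {1..2} g"
    unfolding g_def by (intro continuous_intros) auto
  then have "compact (g ` {1..2})" by (intro compact_continuous_image) auto
  then obtain b where b: "\<And>x. x \<in> {1..2} \<Longrightarrow> \<bar>g x\<bar> \<le> b"
    using compact_imp_bounded bounded_iff by (metis imageI real_norm_def)
  have shift: "g (y + real N) \<le> g y \<and> g y - g (y + real N) \<le> (1 / y - 1 / (y + real N)) / 4" if "y \<ge> 1" for y N
  proof (induction N)
    case (Suc N)
    have pos: "y + real N > 0" using that by simp
    have "g (y + real N + 1) \<le> g (y + real N)" "g (y + real N) - g (y + real N + 1) \<le> (1 / (y + real N) - 1 / (y + real N + 1)) / 4"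
      unfolding g_def by (rule Stirling_step[OF pos])+
    moreover have "y + real (Suc N) = y + real N + 1" by simp
    ultimately show ?case using Suc by (simp only:) argo
  qed simp
  show ?thesis
  proof (intro exI[of _ "b + 1 / 4"] allI impI)
    fix x :: real assume x: "x \<ge> 1"
    \<comment> \<open>One step fewer than the integer part, so that \<open>y\<close> lies in
      \<open>{1..2}\<close> and not below 1.\<close>
    define N where "N = nat \<lfloor>x\<rfloor> - 1"
    define y where "y = x - real N"
    have fl: "real (nat \<lfloor>x\<rfloor>) \<le> x" "x < real (nat \<lfloor>x\<rfloor>) + 1" "nat \<lfloor>x\<rfloor> \<ge> 1" using x by (auto simp: le_nat_iff)
    have N: "real N = real (nat \<lfloor>x\<rfloor>) - 1" using fl(3) unfolding N_def by (simp only: of_nat_diff of_nat_1)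
    have y: "y \<ge> 1" "y \<le> 2" using fl(1,2) unfolding y_def N by linarith+
    have "g x \<le> g y \<and> g y - g x \<le> (1 / y - 1 / x) / 4" using shift[OF y(1), of N] by (simp add: y_def)
    moreover have "(1 / y - 1 / x) / 4 \<le> 1 / 4"
    proof -
      have "1 / y \<le> 1" "0 \<le> 1 / x" using y x by auto
      then have "1 / y - 1 / x \<le> 1 - 0" by (rule diff_mono)
      then show ?thesis by (intro divide_right_mono) (simp_all only: diff_0_right zero_le_numeral)
    qed
    moreover have "\<bar>g y\<bar> \<le> b" using b y by auto
    ultimately have "\<bar>g x\<bar> \<le> b + 1 / 4" by linarith
    then show "\<bar>ln (Gamma x) - (x - 1 / 2) * ln x + x\<bar> \<le> b + 1 / 4" by (simp add: g_def)
  qed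
qed

section \<open>Calculus of growth orders\<close>

definition scale :: "real \<Rightarrow> real \<Rightarrow> real \<Rightarrow> nat \<Rightarrow> real" where
  "scale s a b n = exp (s * ln (real n) + real n * (a + b * ln (real n)))"

text \<open>For positive \<open>n\<close> the comparison function is
  \<open>n powr s * exp (a * n) * n powr (b * n)\<close>, the shape shared by all quantities to be
  estimated. The three exponents add under products and are multiplied under powers, so orders are
  found by linear arithmetic.\<close>

definition grows :: "(nat \<Rightarrow> real) \<Rightarrow> real \<Rightarrow> real \<Rightarrow> real \<Rightarrow> bool" where
  "grows f s a b \<longleftrightarrow> (\<exists>c>0. \<exists>C>0. eventually (\<lambda>n. c * scale s a b n \<le> f n \<and> f n \<le> C * scale s a b n) sequentially)"

lemma scale_pos [simp]: "scale s a b n > 0"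
  by (simp add: scale_def)

lemma scale_mult: "scale s a b n * scale s' a' b' n = scale (s + s') (a + a') (b + b') n"
  by (simp add: scale_def exp_add[symmetric] algebra_simps)

lemma scale_powr: "scale s a b n powr p = scale (p * s) (p * a) (p * b) n"
  by (simp add: scale_def powr_def algebra_simps)

lemma growsI:
  assumes "c > 0" "C > 0" "eventually (\<lambda>n. c * scale s a b n \<le> f n \<and> f n \<le> C * scale s a b n) sequentially"
  shows "grows f s a b"
  using assms unfolding grows_def by blast

lemma growsE:
  assumes "grows f s a b"
  obtains c C where "c > 0" "C > 0" "eventually (\<lambda>n. c * scale s a b n \<le> f n \<and> f n \<le> C * scale s a b n) sequentially"
  using assms unfolding grows_def by blast

lemma grows_cong:
  assumes "grows f s a b" "eventually (\<lambda>n. f n = g n) sequentially" "s = s'" "a = a'" "b = b'"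
  shows "grows g s' a' b'"
proof -
  obtain c C where c: "c > 0" "C > 0" "eventually (\<lambda>n. c * scale s a b n \<le> f n \<and> f n \<le> C * scale s a b n) sequentially"
    by (rule growsE[OF assms(1)])
  have "eventually (\<lambda>n. c * scale s a b n \<le> g n \<and> g n \<le> C * scale s a b n) sequentially"
    using c(3) assms(2) by eventually_elim auto
  then show ?thesis using c(1,2) assms(3-) by (auto intro: growsI)
qed

lemma grows_mult:
  assumes "grows f s a b" "grows g s' a' b'"
  shows "grows (\<lambda>n. f n * g n) (s + s') (a + a') (b + b')"
proof -
  obtain c C where c: "c > 0" "C > 0" "eventually (\<lambda>n. c * scale s a b n \<le> f n \<and> f n \<le> C * scale s a b n) sequentially"
    by (rule growsE[OF assms(1)])
  obtain d D where d: "d > 0" "D > 0" "eventually (\<lambda>n. d * scale s' a' b' n \<le> g n \<and> g n \<le> D * scale s' a' b' n) sequentially"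
    by (rule growsE[OF assms(2)])
  show ?thesis
  proof (rule growsI[of "c * d" "C * D"])
    show "eventually (\<lambda>n. c * d * scale (s + s') (a + a') (b + b') n \<le> f n * g n \<and> f n * g n \<le> C * D * scale (s + s') (a + a') (b + b') n) sequentially"
      using c(3) d(3)
    proof eventually_elim
      case (elim n)
      have p: "0 \<le> c * scale s a b n" "0 \<le> d * scale s' a' b' n" using c d by (simp_all add: less_imp_le)
      have fg: "0 \<le> f n" "0 \<le> g n" using p elim by linarith+
      have "(c * scale s a b n) * (d * scale s' a' b' n) \<le> f n * g n" using elim p fg by (intro mult_mono) auto
      moreover have "f n * g n \<le> (C * scale s a b n) * (D * scale s' a' b' n)" using elim p c d fg by (intro mult_mono) (auto simp: less_imp_le)
      ultimately show ?case by (simp add: scale_mult[symmetric] mult_ac)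
    qed
  qed (use c d in auto)
qed

lemma grows_powr:
  assumes "grows f s a b"
  shows "grows (\<lambda>n. f n powr p) (p * s) (p * a) (p * b)"
proof -
  obtain c C where c: "c > 0" "C > 0" "eventually (\<lambda>n. c * scale s a b n \<le> f n \<and> f n \<le> C * scale s a b n) sequentially"
    by (rule growsE[OF assms])
  have pw: "(k * scale s a b n) powr p = k powr p * scale (p * s) (p * a) (p * b) n" if "k > 0" for k n
    using that by (simp add: powr_mult less_imp_le scale_powr)
  show ?thesis
  proof (cases "p \<ge> 0")
    case True
    show ?thesis
    proof (rule growsI[of "c powr p" "C powr p"])
      show "eventually (\<lambda>n. c powr p * scale (p * s) (p * a) (p * b) n \<le> f n powr p \<and> f n powr p \<le> C powr p * scale (p * s) (p * a) (p * b) n) sequentially"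
        using c(3)
      proof eventually_elim
        case (elim n)
        have "0 < c * scale s a b n" using c by simp
        then show ?case unfolding pw[OF c(1), symmetric] pw[OF c(2), symmetric] using elim True by (intro conjI powr_mono2) auto
      qed
    qed (use c in auto)
  next
    case False
    show ?thesis
    proof (rule growsI[of "C powr p" "c powr p"])
      show "eventually (\<lambda>n. C powr p * scale (p * s) (p * a) (p * b) n \<le> f n powr p \<and> f n powr p \<le> c powr p * scale (p * s) (p * a) (p * b) n) sequentially"
        using c(3)
      proof eventually_elim
        case (elim n)
        have "0 < c * scale s a b n" using c by simp
        then show ?case unfolding pw[OF c(1), symmetric] pw[OF c(2), symmetric] using elim False by (intro conjI powr_mono2') auto
      qed
    qed (use c in auto)
  qed
qed

lemma grows_sandwich:
  assumes "grows f s a b" "grows h s a b" "eventually (\<lambda>n. f n \<le> g n \<and> g n \<le> h n) sequentially"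
  shows "grows g s a b"
proof -
  obtain c C where c: "c > 0" "C > 0" "eventually (\<lambda>n. c * scale s a b n \<le> f n \<and> f n \<le> C * scale s a b n) sequentially"
    by (rule growsE[OF assms(1)])
  obtain d D where d: "d > 0" "D > 0" "eventually (\<lambda>n. d * scale s a b n \<le> h n \<and> h n \<le> D * scale s a b n) sequentially"
    by (rule growsE[OF assms(2)])
  show ?thesis
  proof (rule growsI[OF c(1) d(2)])
    show "eventually (\<lambda>n. c * scale s a b n \<le> g n \<and> g n \<le> D * scale s a b n) sequentially"
      using c(3) d(3) assms(3) by eventually_elim auto
  qed
qed

lemma grows_eventually_pos: "grows f s a b \<Longrightarrow> eventually (\<lambda>n. f n > 0) sequentially"
proof (erule growsE)
  fix c C assume c: "c > 0" "eventually (\<lambda>n. c * scale s a b n \<le> f n \<and> f n \<le> C * scale s a b n) sequentially"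
  show "eventually (\<lambda>n. f n > 0) sequentially"
    using c(2)
  proof eventually_elim
    case (elim n)
    have "0 < c * scale s a b n" using c by simp
    then show ?case using elim by linarith
  qed
qed

lemma grows_divide:
  assumes "grows f s a b" "grows g s' a' b'"
  shows "grows (\<lambda>n. f n / g n) (s - s') (a - a') (b - b')"
proof -
  have "grows (\<lambda>n. f n * g n powr (- 1)) (s + (- 1) * s') (a + (- 1) * a') (b + (- 1) * b')"
    by (intro grows_mult grows_powr assms)
  then show ?thesis
    by (rule grows_cong) (use grows_eventually_pos[OF assms(2)] in \<open>auto elim!: eventually_mono simp: powr_minus_divide\<close>)
qed

lemma grows_const: "k > 0 \<Longrightarrow> grows (\<lambda>_. k) 0 0 0"
  by (rule growsI[of k k]) (auto simp: scale_def)

lemma grows_exp: "grows (\<lambda>n. exp (real n * k)) 0 k 0"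
  by (rule growsI[of 1 1]) (auto simp: scale_def)

lemma grows_n: "grows real 1 0 0"
proof (rule growsI[of 1 1])
  show "eventually (\<lambda>n. 1 * scale 1 0 0 n \<le> real n \<and> real n \<le> 1 * scale 1 0 0 n) sequentially"
    using eventually_gt_at_top[of 0] by eventually_elim (simp add: scale_def)
qed auto

lemma grows_n_plus: "k \<ge> 0 \<Longrightarrow> grows (\<lambda>n. real n + k) 1 0 0"
proof (rule growsI[of 1 "1 + k"])
  assume k: "k \<ge> 0"
  show "eventually (\<lambda>n. 1 * scale 1 0 0 n \<le> real n + k \<and> real n + k \<le> (1 + k) * scale 1 0 0 n) sequentially"
    using eventually_gt_at_top[of 0]
  proof eventually_elim
    case (elim n)
    have "k * 1 \<le> k * real n" using k elim by (intro mult_left_mono) auto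
    then show ?case using elim k by (simp add: scale_def algebra_simps)
  qed
qed auto

text \<open>Stirling's formula at \<open>\<alpha> * n + \<beta>\<close>. The shift changes the
  logarithm of the main term by \<open>\<beta> * ln n\<close> up to a bounded error, because
  \<open>u * (ln (u + \<beta>) - ln u)\<close> stays bounded for
  \<open>u = \<alpha> * n\<close>.\<close>

lemma grows_Gamma:
  assumes \<alpha>: "\<alpha> > 0"
  shows "grows (\<lambda>n. Gamma (\<alpha> * real n + \<beta>)) (\<beta> - 1 / 2) (\<alpha> * (ln \<alpha> - 1)) \<alpha>"
proof -
  obtain b :: real where b: "\<And>x. x \<ge> 1 \<Longrightarrow> \<bar>ln (Gamma x) - (x - 1 / 2) * ln x + x\<bar> \<le> b"
    using Stirling_bounded by auto
  define K where "K = b + (2 * \<bar>\<beta>\<bar> + \<bar>\<beta> - 1 / 2\<bar> * (\<bar>ln \<alpha>\<bar> + 2 * \<bar>\<beta>\<bar>) + \<bar>\<beta>\<bar>)"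
  have lim: "filterlim (\<lambda>n. \<alpha> * real n) at_top sequentially"
    using \<alpha> by (intro filterlim_tendsto_pos_mult_at_top[OF tendsto_const] filterlim_real_sequentially)
  \<comment> \<open>The threshold ensures \<open>u \<ge> 1\<close>, \<open>x \<ge> 1\<close> and
    \<open>2 * x \<ge> u\<close> for \<open>u\<close> and \<open>x\<close> as defined below.\<close>
  have "eventually (\<lambda>n. \<alpha> * real n \<ge> 2 + 2 * \<bar>\<beta>\<bar>) sequentially"
    using lim by (simp add: filterlim_at_top)
  then have "eventually (\<lambda>n. exp (- K) * scale (\<beta> - 1 / 2) (\<alpha> * (ln \<alpha> - 1)) \<alpha> n \<le> Gamma (\<alpha> * real n + \<beta>) \<and>
      Gamma (\<alpha> * real n + \<beta>) \<le> exp K * scale (\<beta> - 1 / 2) (\<alpha> * (ln \<alpha> - 1)) \<alpha> n) sequentially"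
    using eventually_gt_at_top[of 0]
  proof eventually_elim
    case (elim n)
    define u x where "u = \<alpha> * real n" and "x = \<alpha> * real n + \<beta>"
    have x: "x = u + \<beta>" "x \<ge> 1" "u \<ge> 1" "2 * x \<ge> u" using elim by (auto simp: u_def x_def)
    have lnu: "ln u = ln \<alpha> + ln (real n)" using \<alpha> elim by (simp add: u_def ln_mult)
    define d where "d = ln x - ln u"
    have d1: "d \<le> \<beta> / u"
    proof -
      have "ln (x / u) \<le> x / u - 1" using x by (intro ln_le_minus_one) auto
      then show ?thesis using x by (simp add: d_def ln_div field_simps)
    qed
    have d2: "\<beta> / x \<le> d"
    proof -
      have "ln (u / x) \<le> u / x - 1" using x by (intro ln_le_minus_one) auto
      then show ?thesis using x by (simp add: d_def ln_div field_simps)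
    qed
    have ud: "\<bar>u * d\<bar> \<le> 2 * \<bar>\<beta>\<bar>"
    proof -
      have "u * d \<le> \<beta>" using d1 x by (simp add: field_simps)
      moreover have "u * (\<beta> / x) \<le> u * d" using d2 x by (intro mult_left_mono) auto
      moreover have "\<bar>u * (\<beta> / x)\<bar> \<le> 2 * \<bar>\<beta>\<bar>"
      proof -
        have "\<bar>u * (\<beta> / x)\<bar> = (u / x) * \<bar>\<beta>\<bar>" using x by (simp add: abs_mult)
        also have "\<dots> \<le> 2 * \<bar>\<beta>\<bar>" using x by (intro mult_right_mono) (auto simp: field_simps)
        finally show ?thesis .
      qed
      ultimately show ?thesis by linarith
    qed
    have "\<bar>d\<bar> \<le> \<bar>u * d\<bar>" using x by (simp add: abs_mult mult_le_cancel_right1)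
    then have dd: "\<bar>ln \<alpha> + d\<bar> \<le> \<bar>ln \<alpha>\<bar> + 2 * \<bar>\<beta>\<bar>" using ud by linarith
    define E where "E = (\<beta> - 1 / 2) * ln (real n) + real n * (\<alpha> * (ln \<alpha> - 1) + \<alpha> * ln (real n))"
    have "(x - 1 / 2) * ln x - x - E = u * d + (\<beta> - 1 / 2) * (ln \<alpha> + d) - \<beta>"
    proof -
      have lx: "ln x = ln \<alpha> + ln (real n) + d" using lnu by (simp add: d_def)
      have "E = (\<beta> - 1 / 2) * ln (real n) + u * (ln \<alpha> + ln (real n)) - u" by (simp add: E_def u_def algebra_simps)
      then show ?thesis by (simp only: lx) (simp add: x(1) algebra_simps)
    qed
    moreover have "\<bar>(\<beta> - 1 / 2) * (ln \<alpha> + d)\<bar> \<le> \<bar>\<beta> - 1 / 2\<bar> * (\<bar>ln \<alpha>\<bar> + 2 * \<bar>\<beta>\<bar>)"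
      unfolding abs_mult using dd by (intro mult_left_mono) auto
    ultimately have "\<bar>(x - 1 / 2) * ln x - x - E\<bar> \<le> 2 * \<bar>\<beta>\<bar> + \<bar>\<beta> - 1 / 2\<bar> * (\<bar>ln \<alpha>\<bar> + 2 * \<bar>\<beta>\<bar>) + \<bar>\<beta>\<bar>"
      using ud by linarith
    then have K: "\<bar>ln (Gamma x) - E\<bar> \<le> K" using b[OF x(2)] unfolding K_def by linarith
    have G: "Gamma x = exp (ln (Gamma x))" using Gamma_real_pos[of x] x by simp
    have "exp (- K + E) \<le> exp (ln (Gamma x))" "exp (ln (Gamma x)) \<le> exp (K + E)" using K by auto
    then show ?case unfolding G[symmetric] exp_add by (simp add: scale_def E_def x_def)
  qed
  then show ?thesis by (rule growsI[rotated 2]) auto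
qed

text \<open>The finitely many dimensions below the threshold are absorbed into the constants;
  positivity of \<open>f\<close> keeps the minimum of the quotients positive.\<close>

lemma grows_bounds:
  assumes f: "grows f s a b" and pos: "\<And>n. n \<ge> 2 \<Longrightarrow> f n > 0"
  shows "\<exists>c>0. \<exists>C>0. \<forall>n\<ge>2. c * scale s a b n \<le> f n \<and> f n \<le> C * scale s a b n"
proof -
  obtain c C where c: "c > 0" "C > 0" "eventually (\<lambda>n. c * scale s a b n \<le> f n \<and> f n \<le> C * scale s a b n) sequentially"
    by (rule growsE[OF f])
  then obtain N where N: "\<And>n. n \<ge> N \<Longrightarrow> c * scale s a b n \<le> f n \<and> f n \<le> C * scale s a b n"
    by (auto simp: eventually_at_top_linorder)
  define S where "S = (\<lambda>n. f n / scale s a b n) ` {2..<N}"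
  have S: "finite S" "\<And>x. x \<in> S \<Longrightarrow> x > 0" using pos by (auto simp: S_def)
  define c' C' where "c' = Min (insert c S)" and "C' = Max (insert C S)"
  have c': "c' > 0" "c' \<le> c" and C': "C' > 0" "C \<le> C'" using S c by (auto simp: c'_def C'_def Max_gr_iff)
  have "c' * scale s a b n \<le> f n \<and> f n \<le> C' * scale s a b n" if n: "n \<ge> 2" for n
  proof (cases "n \<ge> N")
    case True
    have "c' * scale s a b n \<le> c * scale s a b n" "C * scale s a b n \<le> C' * scale s a b n"
      using c' C' by (auto intro!: mult_right_mono simp: less_imp_le)
    then show ?thesis using N[OF True] by linarith
  next
    case False
    then have "f n / scale s a b n \<in> S" using n by (auto simp: S_def)
    then have "c' \<le> f n / scale s a b n" "f n / scale s a b n \<le> C'" using S(1) by (auto simp: c'_def C'_def)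
    then show ?thesis by (simp add: pos_le_divide_eq pos_divide_le_eq)
  qed
  then show ?thesis using c' C' by blast
qed

lemma scale_tendsto_0:
  assumes "b < 0"
  shows "(\<lambda>n. scale s a b n) \<longlonglongrightarrow> 0"
proof -
  have "filterlim (\<lambda>n. ln (real n)) at_top sequentially"
    by (rule filterlim_compose[OF ln_at_top filterlim_real_sequentially])
  \<comment> \<open>Beyond this threshold \<open>a + b * ln n \<le> - (1 + \<bar>s\<bar>)\<close>:
    the 1 yields \<open>exp (- n)\<close>, and \<open>\<bar>s\<bar>\<close> absorbs
    \<open>n powr s\<close> because \<open>ln n \<le> n\<close>.\<close>
  then have "eventually (\<lambda>n. ln (real n) \<ge> (1 + \<bar>s\<bar> + a) / (- b)) sequentially" by (simp add: filterlim_at_top)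
  then have ev: "eventually (\<lambda>n. scale s a b n \<le> exp (- real n)) sequentially"
    using eventually_gt_at_top[of 0]
  proof eventually_elim
    case (elim n)
    have "a + b * ln (real n) \<le> - (1 + \<bar>s\<bar>)" using elim(1) assms by (simp add: field_simps)
    then have "real n * (a + b * ln (real n)) \<le> real n * (- (1 + \<bar>s\<bar>))" by (intro mult_left_mono) auto
    moreover have "ln (real n) \<le> real n - 1" "0 \<le> ln (real n)" using elim(2) ln_le_minus_one[of "real n"] by auto
    then have "s * ln (real n) \<le> \<bar>s\<bar> * real n"
      by (intro order_trans[OF mult_right_mono[OF abs_ge_self] mult_left_mono]) auto
    ultimately show ?case by (simp add: scale_def algebra_simps)
  qed
  have lim: "(\<lambda>n. exp (- real n)) \<longlonglongrightarrow> 0"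
    by (intro filterlim_compose[OF exp_at_bot] filterlim_compose[OF filterlim_uminus_at_bot_at_top] filterlim_real_sequentially)
  show ?thesis
    by (rule tendsto_sandwich[OF _ ev tendsto_const lim]) (simp add: less_imp_le)
qed

lemma scale_power: "scale s a b n ^ k = scale (real k * s) (real k * a) (real k * b) n"
  by (simp add: scale_def exp_of_nat_mult[symmetric] algebra_simps)

lemma scale_eq_powr:
  assumes "n \<ge> 1" "B > 0"
  shows "scale s (l * ln B) (- l) n = real n powr s * (B / real n) powr (l * real n)"
  using assms by (simp add: scale_def powr_def ln_div exp_add[symmetric] algebra_simps)

subsection \<open>Growth of the moments in the dimension\<close>

lemma grows_unit_ball_vol:
  "grows (\<lambda>n. unit_ball_vol (real n)) (- 1 / 2) ((ln pi + ln 2 + 1) / 2) (- 1 / 2)"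
proof -
  have "grows (\<lambda>n. exp (real n * (ln pi / 2)) / Gamma (1 / 2 * real n + 1)) (0 - (1 - 1 / 2)) (ln pi / 2 - 1 / 2 * (ln (1 / 2) - 1)) (0 - 1 / 2)"
    by (intro grows_divide grows_exp grows_Gamma) auto
  then show ?thesis
    by (rule grows_cong) (auto simp: unit_ball_vol_def powr_def ln_div field_simps)
qed

lemma grows_unit_ball_vol_pred:
  "grows (\<lambda>n. unit_ball_vol (real (n - 1))) 0 ((ln pi + ln 2 + 1) / 2) (- 1 / 2)"
proof -
  have g: "grows (\<lambda>n. pi powr (- 1 / 2) * (exp (real n * (ln pi / 2)) / Gamma (1 / 2 * real n + 1 / 2)))
      (0 + (0 - (1 / 2 - 1 / 2))) (0 + (ln pi / 2 - 1 / 2 * (ln (1 / 2) - 1))) (0 + (0 - 1 / 2))"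
    by (intro grows_mult grows_const grows_divide grows_exp grows_Gamma) auto
  have "eventually (\<lambda>n. pi powr (- 1 / 2) * (exp (real n * (ln pi / 2)) / Gamma (1 / 2 * real n + 1 / 2)) =
      unit_ball_vol (real (n - 1))) sequentially"
    using eventually_ge_at_top[of 1]
  proof eventually_elim
    case (elim n)
    have "pi powr (- 1 / 2) * exp (real n * (ln pi / 2)) = pi powr (real (n - 1) / 2)"
      using elim by (simp add: powr_def exp_add[symmetric] of_nat_diff field_simps)
    moreover have "1 / 2 * real n + 1 / 2 = real (n - 1) / 2 + 1"
      using elim by (simp add: of_nat_diff field_simps)
    ultimately show ?case unfolding unit_ball_vol_def by simp
  qed
  from grows_cong[OF g this] show ?thesis by (auto simp: ln_div field_simps)
qed

text \<open>The contributions \<open>n * ln n\<close> of the three Gamma values cancel, and so do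
  the shifts in the power of \<open>n\<close>: the order does not depend on \<open>\<beta>\<close>
  and \<open>\<beta>'\<close>.\<close>

lemma grows_Beta:
  assumes "\<alpha> > 0" "\<alpha>' > 0"
  shows "grows (\<lambda>n. Beta (\<alpha> * real n + \<beta>) (\<alpha>' * real n + \<beta>')) (- 1 / 2)
    (\<alpha> * (ln \<alpha> - 1) + \<alpha>' * (ln \<alpha>' - 1) - (\<alpha> + \<alpha>') * (ln (\<alpha> + \<alpha>') - 1)) 0"
proof -
  have "grows (\<lambda>n. Gamma (\<alpha> * real n + \<beta>) * Gamma (\<alpha>' * real n + \<beta>') / Gamma ((\<alpha> + \<alpha>') * real n + (\<beta> + \<beta>')))
    ((\<beta> - 1 / 2) + (\<beta>' - 1 / 2) - (\<beta> + \<beta>' - 1 / 2))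
    (\<alpha> * (ln \<alpha> - 1) + \<alpha>' * (ln \<alpha>' - 1) - (\<alpha> + \<alpha>') * (ln (\<alpha> + \<alpha>') - 1)) (\<alpha> + \<alpha>' - (\<alpha> + \<alpha>'))"
    using assms by (intro grows_mult grows_divide grows_Gamma) auto
  then show ?thesis
    by (rule grows_cong) (auto simp: Beta_def algebra_simps)
qed

definition radial_integral :: "real \<Rightarrow> nat \<Rightarrow> real" where
  "radial_integral a n = unit_ball_vol (real (n - 1)) * Beta ((a * real n + 1) / 2) (real (n - 1) / 2 + 1) / 2"

definition min_integral :: "real \<Rightarrow> nat \<Rightarrow> real" where
  "min_integral a n = enn2real (ball_min_moment n (a * real n))"

text \<open>The order of \<open>qq / \<gamma>\<close>, see \<open>qq_bounds_rate\<close>.\<close>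

definition rate :: "real \<Rightarrow> nat \<Rightarrow> real" where
  "rate a n = radial_integral a n / (real n * unit_ball_vol (real n))"

lemma radial_integral:
  assumes "a > 0" "n \<ge> 2"
  shows "radial_integral a n > 0" "ball_moment n (a * real n) = ennreal (radial_integral a n)" "rate a n > 0"
proof -
  obtain m where m: "n = Suc m" "m \<ge> 1" using assms(2) by (cases n) auto
  have an: "a * real n > 0" using assms by simp
  show pos: "radial_integral a n > 0"
    unfolding radial_integral_def using an by (intro divide_pos_pos mult_pos_pos Beta_real_pos) (auto intro: unit_ball_vol_pos)
  show "ball_moment n (a * real n) = ennreal (radial_integral a n)"
    using ball_moment_eq[OF m(2) an] unfolding radial_integral_def m(1) by simp
  show "rate a n > 0" unfolding rate_def using pos assms(2) by (intro divide_pos_pos mult_pos_pos) (auto intro: unit_ball_vol_pos)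
qed

lemma min_integral:
  assumes "a > 0" "n \<ge> 2"
  shows "ball_min_moment n (a * real n) = ennreal (min_integral a n)"
    and "(unit_ball_vol (real (n - 1)) / (real n + 1))\<^sup>2 * (a * real n * Beta (a / 2 * real n + 0) (1 * real n + 2) / 2) \<le> min_integral a n"
    and "a * real n > 2 \<Longrightarrow> min_integral a n \<le> (unit_ball_vol (real (n - 1)) / (real n + 1))\<^sup>2 * (a * real n * Beta (a / 2 * real n + - 1) (1 * real n + 2) / 2)"
    and "min_integral a n > 0"
proof -
  obtain m where m: "n = Suc m" "m \<ge> 1" using assms(2) by (cases n) auto
  have an: "a * real n > 0" using assms by simp
  have n1: "n \<ge> 1" using assms(2) by simp
  show eq: "ball_min_moment n (a * real n) = ennreal (min_integral a n)"
    unfolding min_integral_def using ball_min_moment_finite[OF n1 an] by simp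
  have nn: "real m + 2 = real n + 1" "real m + 3 = 1 * real n + 2" "n - 1 = m" using m by auto
  have lo: "ennreal ((unit_ball_vol (real (n - 1)) / (real n + 1))\<^sup>2 * (a * real n * Beta (a / 2 * real n + 0) (1 * real n + 2) / 2)) \<le> ennreal (min_integral a n)"
    using ball_min_moment_lower[OF m(2) an] unfolding eq[symmetric] m(1)[symmetric] nn by (simp add: mult_ac)
  have pos: "0 < (unit_ball_vol (real (n - 1)) / (real n + 1))\<^sup>2 * (a * real n * Beta (a / 2 * real n + 0) (1 * real n + 2) / 2)"
    using an assms by (intro mult_pos_pos divide_pos_pos zero_less_power Beta_real_pos) (auto intro: unit_ball_vol_pos)
  have ge0: "min_integral a n \<ge> 0" unfolding min_integral_def by simp
  show lo': "(unit_ball_vol (real (n - 1)) / (real n + 1))\<^sup>2 * (a * real n * Beta (a / 2 * real n + 0) (1 * real n + 2) / 2) \<le> min_integral a n"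
    using lo ge0 by (simp only: ennreal_le_iff)
  then show "min_integral a n > 0" using pos by linarith
  assume a2: "a * real n > 2"
  have "0 < (unit_ball_vol (real (n - 1)) / (real n + 1))\<^sup>2 * (a * real n * Beta (a / 2 * real n + - 1) (1 * real n + 2) / 2)"
    using an a2 assms by (intro mult_pos_pos divide_pos_pos zero_less_power Beta_real_pos) (auto intro: unit_ball_vol_pos)
  moreover have "ennreal (min_integral a n) \<le> ennreal ((unit_ball_vol (real (n - 1)) / (real n + 1))\<^sup>2 * (a * real n * Beta (a / 2 * real n + - 1) (1 * real n + 2) / 2))"
    using ball_min_moment_upper[OF m(2) a2] unfolding eq[symmetric] m(1)[symmetric] nn by (simp add: mult_ac)
  ultimately show "min_integral a n \<le> (unit_ball_vol (real (n - 1)) / (real n + 1))\<^sup>2 * (a * real n * Beta (a / 2 * real n + - 1) (1 * real n + 2) / 2)"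
    by (simp only: ennreal_le_iff less_imp_le)
qed

lemma grows_radial_integral:
  assumes a: "a > 0"
  shows "grows (radial_integral a) (- 1 / 2)
    ((ln pi + ln 2 + 1) / 2 + (a / 2 * ln a - (a + 1) / 2 * ln (a + 1))) (- 1 / 2)"
proof -
  have g: "grows (\<lambda>n. unit_ball_vol (real (n - 1)) * (Beta (a / 2 * real n + 1 / 2) (1 / 2 * real n + 1 / 2) * (1 / 2)))
    (0 + (- 1 / 2 + 0)) ((ln pi + ln 2 + 1) / 2 + (a / 2 * (ln (a / 2) - 1) + 1 / 2 * (ln (1 / 2) - 1) - (a / 2 + 1 / 2) * (ln (a / 2 + 1 / 2) - 1) + 0)) (- 1 / 2 + (0 + 0))"
    using a by (intro grows_mult grows_unit_ball_vol_pred grows_Beta grows_const) auto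
  have ev: "eventually (\<lambda>n. unit_ball_vol (real (n - 1)) * (Beta (a / 2 * real n + 1 / 2) (1 / 2 * real n + 1 / 2) * (1 / 2)) = radial_integral a n) sequentially"
    using eventually_ge_at_top[of 1]
  proof eventually_elim
    case (elim n)
    have "a / 2 * real n + 1 / 2 = (a * real n + 1) / 2" "1 / 2 * real n + 1 / 2 = real (n - 1) / 2 + 1"
      using elim by (auto simp: of_nat_diff field_simps)
    then show ?case unfolding radial_integral_def by (simp only:)
  qed
  have "a / 2 + 1 / 2 = (a + 1) / 2" by (simp add: field_simps)
  then have "ln (a / 2 + 1 / 2) = ln (a + 1) - ln 2" using a by (simp only:) (subst ln_div, auto)
  moreover have "ln (a / 2) = ln a - ln 2" "ln (1 / 2 :: real) = - ln 2" using a by (auto simp: ln_div)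
  ultimately have l: "ln (a / 2 + 1 / 2) = ln (a + 1) - ln 2" "ln (a / 2) = ln a - ln 2" "ln (1 / 2 :: real) = - ln 2" by auto
  show ?thesis
    by (rule grows_cong[OF g ev]) (auto simp: l, simp add: field_simps)
qed

lemma grows_rate:
  assumes a: "a > 0"
  shows "grows (rate a) (- 1) (a / 2 * ln a - (a + 1) / 2 * ln (a + 1)) 0"
proof -
  have "grows (\<lambda>n. radial_integral a n / (real n * unit_ball_vol (real n))) (- 1 / 2 - (1 + (- 1 / 2)))
    ((ln pi + ln 2 + 1) / 2 + (a / 2 * ln a - (a + 1) / 2 * ln (a + 1)) - (0 + (ln pi + ln 2 + 1) / 2)) (- 1 / 2 - (0 + (- 1 / 2)))"
    by (intro grows_divide grows_mult grows_n grows_unit_ball_vol grows_radial_integral a)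
  then show ?thesis by (rule grows_cong) (auto simp: rate_def)
qed

lemma B_const_pos: "a > 0 \<Longrightarrow> B_const a > 0"
  unfolding B_const_def by simp

text \<open>The origin of \<open>B_const a\<close>: its logarithm is twice the exponential rate of
  \<open>unit_ball_vol n\<close> minus \<open>2 / a\<close> times that of \<open>rate a n\<close>,
  as it arises from the mean volume
  \<open>unit_ball_vol n * rate a n powr (- (1 / a))\<close>.\<close>

lemma ln_B_const:
  assumes "a > 0"
  shows "ln (B_const a) = ln pi + ln 2 + 1 - 2 / a * (a / 2 * ln a - (a + 1) / 2 * ln (a + 1))"
  using assms unfolding B_const_def by (simp add: ln_mult ln_div ln_powr field_simps)

lemma grows_mean:
  assumes a: "a > 0"
  shows "grows (\<lambda>n. unit_ball_vol (real n) * rate a n powr (- (1 / a))) (1 / a - 1 / 2) (1 / 2 * ln (B_const a)) (- (1 / 2))"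
proof -
  have "grows (\<lambda>n. unit_ball_vol (real n) * rate a n powr (- (1 / a))) (- 1 / 2 + (- (1 / a)) * (- 1))
    ((ln pi + ln 2 + 1) / 2 + (- (1 / a)) * (a / 2 * ln a - (a + 1) / 2 * ln (a + 1))) (- 1 / 2 + (- (1 / a)) * 0)"
    by (intro grows_mult grows_powr grows_unit_ball_vol grows_rate a)
  then show ?thesis by (rule grows_cong) (auto simp: ln_B_const[OF a] field_simps)
qed

text \<open>Lower and upper bound differ by the shift 0 or \<open>- 1\<close> in a Beta parameter,
  which by \<open>grows_Beta\<close> leaves the order unchanged.\<close>

lemma grows_min_integral:
  assumes a: "a > 0"
  shows "grows (min_integral a) (- 3 / 2)
    (ln pi + ln 2 + 1 + (a / 2 * ln a + ln 2 - (a + 2) / 2 * ln (a + 2))) (- 1)"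
proof -
  have g: "grows (\<lambda>n. (unit_ball_vol (real (n - 1)) / (real n + 1)) * (unit_ball_vol (real (n - 1)) / (real n + 1)) *
      (a * (real n * (Beta (a / 2 * real n + \<beta>) (1 * real n + 2) * (1 / 2)))))
    ((0 - 1) + (0 - 1) + (0 + (1 + (- 1 / 2 + 0))))
    (((ln pi + ln 2 + 1) / 2 - 0) + ((ln pi + ln 2 + 1) / 2 - 0) + (0 + (0 + ((a / 2 * (ln (a / 2) - 1) + 1 * (ln 1 - 1) - (a / 2 + 1) * (ln (a / 2 + 1) - 1)) + 0))))
    ((- 1 / 2 - 0) + (- 1 / 2 - 0) + (0 + (0 + (0 + 0))))" for \<beta>
    using a by (intro grows_mult grows_divide grows_unit_ball_vol_pred grows_Beta grows_const grows_n grows_n_plus) auto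
  have "a / 2 + 1 = (a + 2) / 2" by (simp add: field_simps)
  then have "ln (a / 2 + 1) = ln (a + 2) - ln 2" using a by (simp only:) (subst ln_div, auto)
  moreover have "ln (a / 2) = ln a - ln 2" using a by (simp add: ln_div)
  ultimately have l: "ln (a / 2 + 1) = ln (a + 2) - ln 2" "ln (a / 2) = ln a - ln 2" by auto
  have g': "grows (\<lambda>n. (unit_ball_vol (real (n - 1)) / (real n + 1))\<^sup>2 * (a * real n * Beta (a / 2 * real n + \<beta>) (1 * real n + 2) / 2)) (- 3 / 2)
    (ln pi + ln 2 + 1 + (a / 2 * ln a + ln 2 - (a + 2) / 2 * ln (a + 2))) (- 1)" for \<beta>
    by (rule grows_cong[OF g[of \<beta>]]) (auto simp: l power2_eq_square mult_ac, simp add: field_simps)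
  have "filterlim (\<lambda>n. a * real n) at_top sequentially"
    using a by (intro filterlim_tendsto_pos_mult_at_top[OF tendsto_const] filterlim_real_sequentially)
  then have "eventually (\<lambda>n. a * real n > 2) sequentially" by (simp add: filterlim_at_top_dense)
  then have "eventually (\<lambda>n. (unit_ball_vol (real (n - 1)) / (real n + 1))\<^sup>2 * (a * real n * Beta (a / 2 * real n + 0) (1 * real n + 2) / 2) \<le> min_integral a n \<and>
    min_integral a n \<le> (unit_ball_vol (real (n - 1)) / (real n + 1))\<^sup>2 * (a * real n * Beta (a / 2 * real n + - 1) (1 * real n + 2) / 2)) sequentially"
    using eventually_ge_at_top[of 2] by eventually_elim (intro conjI min_integral a)
  then show ?thesis by (rule grows_sandwich[OF g' g'])
qed

definition var_base :: "real \<Rightarrow> real" where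
  "var_base a = 4 * (a + 1) powr (a + 1) / (a + 2) powr (a + 2)"

lemma ln_var_base: "a > 0 \<Longrightarrow> ln (var_base a) = 2 * ln 2 + (a + 1) * ln (a + 1) - (a + 2) * ln (a + 2)"
proof -
  assume "a > 0"
  moreover have "ln (4::real) = 2 * ln 2" using ln_realpow[of 2 2] by simp
  ultimately show ?thesis unfolding var_base_def by (simp add: ln_mult ln_div ln_powr)
qed

text \<open>In the variance bounds \<open>cc * sphere_area n\<close> is of order
  \<open>qq * unit_ball_vol n / radial_integral a n\<close>; this cancels one power of
  \<open>qq\<close> and leads to the product considered here.\<close>

lemma grows_var:
  assumes a: "a > 0"
  shows "grows (\<lambda>n. unit_ball_vol (real n) * min_integral a n / radial_integral a n * rate a n powr (- (2 / a)))
    (2 / a - 3 / 2) (1 / 2 * ln (var_base a) + ln (B_const a)) (- 1)"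
proof -
  have "grows (\<lambda>n. unit_ball_vol (real n) * min_integral a n / radial_integral a n * rate a n powr (- (2 / a)))
    ((- 1 / 2 + - 3 / 2 - - 1 / 2) + (- (2 / a)) * (- 1))
    ((((ln pi + ln 2 + 1) / 2) + (ln pi + ln 2 + 1 + (a / 2 * ln a + ln 2 - (a + 2) / 2 * ln (a + 2)))
       - ((ln pi + ln 2 + 1) / 2 + (a / 2 * ln a - (a + 1) / 2 * ln (a + 1)))) + (- (2 / a)) * (a / 2 * ln a - (a + 1) / 2 * ln (a + 1)))
    ((- 1 / 2 + - 1 - - 1 / 2) + (- (2 / a)) * 0)"
    by (intro grows_mult grows_divide grows_powr grows_unit_ball_vol grows_rate grows_min_integral grows_radial_integral a)
  then show ?thesis
  proof (rule grows_cong)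
    show "(((ln pi + ln 2 + 1) / 2) + (ln pi + ln 2 + 1 + (a / 2 * ln a + ln 2 - (a + 2) / 2 * ln (a + 2)))
       - ((ln pi + ln 2 + 1) / 2 + (a / 2 * ln a - (a + 1) / 2 * ln (a + 1)))) + (- (2 / a)) * (a / 2 * ln a - (a + 1) / 2 * ln (a + 1))
      = 1 / 2 * ln (var_base a) + ln (B_const a)"
      unfolding ln_B_const[OF a] ln_var_base[OF a] by (simp add: field_simps)
  qed auto
qed

section \<open>Bounds with constants independent of the dimension for
  \<open>r = a * n\<close>\<close>

context hyperplane_process
begin

text \<open>The area relative to \<open>n * unit_ball_vol n\<close>, called \<open>\<sigma>\<close>,
  lies between \<open>2 / (exp 1 * sqrt (2 * pi))\<close> and 16 by
  \<open>sphere_area_bounds\<close>. Together with \<open>2 / a\<close> from \<open>cc\<close> and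
  \<open>2 * 2 powr a\<close> from \<open>qq_bounds\<close> this yields the constants.\<close>

lemma qq_bounds_rate:
  assumes a: "a > 0" and ra: "r = a * real n"
  shows "4 / (exp 1 * sqrt (2 * pi) * a) * (\<gamma> * rate a n) \<le> qq" (is "?c * _ \<le> _")
    and "qq \<le> 64 * 2 powr a / a * (\<gamma> * rate a n)" (is "_ \<le> ?C * _")
    and "qq > 0"
    and "cc * sphere_area n \<le> qq * unit_ball_vol (real n) / radial_integral a n"
    and "qq * unit_ball_vol (real n) / radial_integral a n / (2 * 2 powr a) \<le> cc * sphere_area n"
proof -
  let ?\<kappa> = "unit_ball_vol (real n)" and ?I = "radial_integral a n"
  note I = radial_integral[OF a n2]
  have \<kappa>: "?\<kappa> > 0" by (simp add: unit_ball_vol_pos)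
  have n0: "real n > 0" using n2 by simp
  have rn: "r / real n = a" using n0 by (simp add: ra)
  have q: "cc * sphere_area n * ?I / ?\<kappa> \<le> qq" "qq \<le> 2 * 2 powr a * (cc * sphere_area n * ?I / ?\<kappa>)" "qq > 0"
    using qq_bounds[OF I(2)[folded ra] I(1)] unfolding rn by auto
  show "qq > 0" by (rule q(3))
  define \<sigma> where "\<sigma> = sphere_area n / (real n * ?\<kappa>)"
  have \<sigma>: "2 / (exp 1 * sqrt (2 * pi)) \<le> \<sigma>" "\<sigma> \<le> 16"
    using sphere_area_bounds[OF n2] \<kappa> n0 unfolding \<sigma>_def by (auto simp: pos_le_divide_eq pos_divide_le_eq)
  have c: "cc = 2 * \<gamma> / (real n * ?\<kappa>) / (a * real n)" unfolding cc_def intensity_const_def by (simp only: ra)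
  have eq: "cc * sphere_area n * ?I / ?\<kappa> = 2 / a * \<sigma> * (\<gamma> * rate a n)"
    unfolding \<sigma>_def rate_def c using \<kappa> n0 a by (simp add: field_simps)
  have gr: "\<gamma> * rate a n > 0" using I(3) \<gamma> by simp
  have "?c * (\<gamma> * rate a n) = 2 / a * (2 / (exp 1 * sqrt (2 * pi))) * (\<gamma> * rate a n)" using a by simp
  also have "\<dots> \<le> 2 / a * \<sigma> * (\<gamma> * rate a n)" using \<sigma> gr a by (intro mult_right_mono mult_left_mono) auto
  finally show "?c * (\<gamma> * rate a n) \<le> qq" using q(1) eq by linarith
  have "2 / a * \<sigma> * (\<gamma> * rate a n) \<le> 2 / a * 16 * (\<gamma> * rate a n)" using \<sigma> gr a by (intro mult_right_mono mult_left_mono) auto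
  then have "2 * 2 powr a * (2 / a * \<sigma> * (\<gamma> * rate a n)) \<le> 2 * 2 powr a * (2 / a * 16 * (\<gamma> * rate a n))" by (intro mult_left_mono) auto
  also have "\<dots> = ?C * (\<gamma> * rate a n)" by simp
  finally show "qq \<le> ?C * (\<gamma> * rate a n)" using q(2) unfolding eq by (rule order_trans[rotated])
  show "cc * sphere_area n \<le> qq * ?\<kappa> / ?I"
    using q(1) \<kappa> I(1) by (simp add: field_simps)
  show "qq * ?\<kappa> / ?I / (2 * 2 powr a) \<le> cc * sphere_area n"
    using q(2) \<kappa> I(1) by (simp add: field_simps)
qed

lemma qq_powr_bounds:
  assumes a: "a > 0" and ra: "r = a * real n" and p: "p > 0"
  shows "(64 * 2 powr a / a) powr (- p) * (\<gamma> powr (- p) * rate a n powr (- p)) \<le> qq powr (- p)"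
    and "qq powr (- p) \<le> (4 / (exp 1 * sqrt (2 * pi) * a)) powr (- p) * (\<gamma> powr (- p) * rate a n powr (- p))"
proof -
  note q = qq_bounds_rate[OF a ra] and R = radial_integral(3)[OF a n2]
  have pw: "(c * (\<gamma> * rate a n)) powr (- p) = c powr (- p) * (\<gamma> powr (- p) * rate a n powr (- p))" if "c > 0" for c
    using that \<gamma> R by (simp add: powr_mult less_imp_le)
  have "(64 * 2 powr a / a * (\<gamma> * rate a n)) powr (- p) \<le> qq powr (- p)"
    using q(2,3) p by (intro powr_mono2') auto
  then show "(64 * 2 powr a / a) powr (- p) * (\<gamma> powr (- p) * rate a n powr (- p)) \<le> qq powr (- p)"
    using a by (subst (asm) pw) auto
  have "0 < 4 / (exp 1 * sqrt (2 * pi) * a) * (\<gamma> * rate a n)" using a \<gamma> R by (intro mult_pos_pos divide_pos_pos) auto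
  then have "qq powr (- p) \<le> (4 / (exp 1 * sqrt (2 * pi) * a) * (\<gamma> * rate a n)) powr (- p)"
    using q(1) p by (intro powr_mono2') auto
  then show "qq powr (- p) \<le> (4 / (exp 1 * sqrt (2 * pi) * a)) powr (- p) * (\<gamma> powr (- p) * rate a n powr (- p))"
    using a by (subst (asm) pw) auto
qed

lemma moment_bounds_rate:
  assumes a: "a > 0" and ra: "r = a * real n"
  defines "x \<equiv> \<gamma> powr (- (1 / a)) * (unit_ball_vol (real n) * rate a n powr (- (1 / a)))"
  shows "ennreal (((64 * 2 powr a / a) powr (- (1 / a)) * Gamma (1 / a + 1) * x) ^ Suc k) \<le> zero_cell_moment M n X (Suc k)"
    and "zero_cell_moment M n X (Suc k) \<le>
      ennreal ((real (Suc k) powr (1 / a) * (4 / (exp 1 * sqrt (2 * pi) * a)) powr (- (1 / a)) * Gamma (1 / a + 1) * x) ^ Suc k)"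
proof -
  let ?\<kappa> = "unit_ball_vol (real n)" and ?G = "Gamma (1 / a + 1)"
  have \<kappa>: "?\<kappa> > 0" by (simp add: unit_ball_vol_pos)
  have G: "?G > 0" using a by (intro Gamma_real_pos) (auto intro: add_pos_pos)
  have n0: "real n > 0" using n2 by simp
  have nr: "real n / r = 1 / a" using n0 a by (simp add: ra)
  have p: "1 / a > 0" using a by simp
  note q = qq_powr_bounds[OF a ra p]
  note mb = moment_bounds[OF qq_bounds_rate(3)[OF a ra], of k, unfolded nr]
  have x0: "x \<ge> 0" unfolding x_def using \<kappa> by simp
  have lo: "(64 * 2 powr a / a) powr (- (1 / a)) * ?G * x \<le> ?\<kappa> * qq powr (- (1 / a)) * ?G"
    using mult_left_mono[OF q(1), of "?\<kappa> * ?G"] \<kappa> G by (simp add: x_def mult_ac)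
  have hi: "?\<kappa> * qq powr (- (1 / a)) * ?G \<le> (4 / (exp 1 * sqrt (2 * pi) * a)) powr (- (1 / a)) * ?G * x"
    using mult_left_mono[OF q(2), of "?\<kappa> * ?G"] \<kappa> G by (simp add: x_def mult_ac)
  have "((64 * 2 powr a / a) powr (- (1 / a)) * ?G * x) ^ Suc k \<le> (?\<kappa> * qq powr (- (1 / a)) * ?G) ^ Suc k"
    using x0 G by (intro power_mono lo mult_nonneg_nonneg) (auto simp: less_imp_le)
  from order_trans[OF ennreal_leI[OF this] mb(1)]
  show "ennreal (((64 * 2 powr a / a) powr (- (1 / a)) * ?G * x) ^ Suc k) \<le> zero_cell_moment M n X (Suc k)" .
  have "(real (Suc k) powr (1 / a) * (?\<kappa> * qq powr (- (1 / a)) * ?G)) ^ Suc k \<le>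
      (real (Suc k) powr (1 / a) * ((4 / (exp 1 * sqrt (2 * pi) * a)) powr (- (1 / a)) * ?G * x)) ^ Suc k"
    using \<kappa> G by (intro power_mono mult_left_mono hi mult_nonneg_nonneg) (auto simp: less_imp_le)
  from order_trans[OF mb(2) ennreal_leI[OF this]]
  show "zero_cell_moment M n X (Suc k) \<le>
      ennreal ((real (Suc k) powr (1 / a) * (4 / (exp 1 * sqrt (2 * pi) * a)) powr (- (1 / a)) * ?G * x) ^ Suc k)"
    by (simp only: mult.assoc)
qed

lemma variance_bounds_rate:
  assumes a: "a > 0" and ra: "r = a * real n"
  defines "y \<equiv> \<gamma> powr (- (2 / a)) * (unit_ball_vol (real n) * min_integral a n / radial_integral a n * rate a n powr (- (2 / a)))"
  shows "exp (- 2) / (2 * 2 powr a) * (64 * 2 powr a / a) powr (- (2 / a)) * y \<le> zero_cell_variance M n X"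
    and "zero_cell_variance M n X \<le> Gamma (2 / a + 2) * (4 / (exp 1 * sqrt (2 * pi) * a)) powr (- (2 / a)) * y"
proof -
  let ?\<kappa> = "unit_ball_vol (real n)" and ?I = "radial_integral a n" and ?J = "min_integral a n"
  have \<kappa>: "?\<kappa> > 0" by (simp add: unit_ball_vol_pos)
  have n0: "real n > 0" using n2 by simp
  have nr: "2 * (real n / r) = 2 / a" using n0 a by (simp add: ra)
  have p: "2 / a > 0" using a by simp
  have G: "Gamma (2 / a + 2) > 0" using p by (intro Gamma_real_pos) linarith
  note I = radial_integral[OF a n2] and J = min_integral[OF a n2]
  note q = qq_powr_bounds[OF a ra p] and qb = qq_bounds_rate[OF a ra]
  note V = variance_lower[OF J(1)[folded ra] less_imp_le[OF J(4)] qb(3), unfolded nr]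
    variance_upper[OF J(1)[folded ra] less_imp_le[OF J(4)] qb(3), unfolded nr]
  \<comment> \<open>The surplus power of \<open>qq\<close> is consumed by
    \<open>cc * sphere_area n\<close>, which is comparable to
    \<open>qq * ?\<kappa> / ?I\<close>.\<close>
  have qp: "qq powr (- (2 / a + 1)) * qq = qq powr (- (2 / a))"
    using qb(3) powr_add[of qq "- (2 / a + 1)" 1] by simp
  let ?W = "cc * sphere_area n * ?J * qq powr (- (2 / a + 1))"
  define K where "K = ?\<kappa> * ?J / ?I"
  have K: "K > 0" unfolding K_def using \<kappa> I J by simp
  have y: "y = \<gamma> powr (- (2 / a)) * (K * rate a n powr (- (2 / a)))" unfolding y_def K_def ..
  have "?W = cc * sphere_area n * (?J * qq powr (- (2 / a + 1)))" by simp
  also have "\<dots> \<le> qq * ?\<kappa> / ?I * (?J * qq powr (- (2 / a + 1)))"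
    using qb J(4) by (intro mult_right_mono) auto
  also have "\<dots> = K * qq powr (- (2 / a))" unfolding qp[symmetric] K_def by simp
  also have "\<dots> \<le> K * ((4 / (exp 1 * sqrt (2 * pi) * a)) powr (- (2 / a)) * (\<gamma> powr (- (2 / a)) * rate a n powr (- (2 / a))))"
    using K q(2) by (intro mult_left_mono) auto
  finally have W1: "?W \<le> (4 / (exp 1 * sqrt (2 * pi) * a)) powr (- (2 / a)) * y" unfolding y by (simp only: mult_ac)
  have "1 / (2 * 2 powr a) * ((64 * 2 powr a / a) powr (- (2 / a)) * y) =
      1 / (2 * 2 powr a) * (K * ((64 * 2 powr a / a) powr (- (2 / a)) * (\<gamma> powr (- (2 / a)) * rate a n powr (- (2 / a)))))"
    unfolding y by (simp only: mult_ac)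
  also have "\<dots> \<le> 1 / (2 * 2 powr a) * (K * qq powr (- (2 / a)))"
    using K q(1) by (intro mult_left_mono) auto
  also have "\<dots> = qq * ?\<kappa> / ?I / (2 * 2 powr a) * (?J * qq powr (- (2 / a + 1)))"
    unfolding qp[symmetric] K_def by (simp add: mult_ac)
  also have "\<dots> \<le> cc * sphere_area n * (?J * qq powr (- (2 / a + 1)))"
    using qb J(4) by (intro mult_right_mono) auto
  also have "\<dots> = ?W" by simp
  finally have W2: "1 / (2 * 2 powr a) * ((64 * 2 powr a / a) powr (- (2 / a)) * y) \<le> ?W" .
  have "exp (- 2) / (2 * 2 powr a) * (64 * 2 powr a / a) powr (- (2 / a)) * y =
     exp (- 2) * (1 / (2 * 2 powr a) * ((64 * 2 powr a / a) powr (- (2 / a)) * y))" by simp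
  also have "\<dots> \<le> exp (- 2) * ?W" by (intro mult_left_mono W2) auto
  finally show "exp (- 2) / (2 * 2 powr a) * (64 * 2 powr a / a) powr (- (2 / a)) * y \<le> zero_cell_variance M n X"
    using V(1) by linarith
  have "Gamma (2 / a + 2) * ?W \<le> Gamma (2 / a + 2) * ((4 / (exp 1 * sqrt (2 * pi) * a)) powr (- (2 / a)) * y)"
    using G by (intro mult_left_mono W1) auto
  then show "zero_cell_variance M n X \<le> Gamma (2 / a + 2) * (4 / (exp 1 * sqrt (2 * pi) * a)) powr (- (2 / a)) * y"
    using V(2) by (simp only: mult.assoc)
qed

end

text \<open>All constants are fixed before the dimension and the process are chosen:
  \<open>c\<close> and \<open>C\<close> come from the growth of the mean, \<open>d\<close> and
  \<open>D\<close> from \<open>moment_bounds_rate\<close>, and their products are raised to the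
  power \<open>k\<close>.\<close>

lemma moment_asymptotics:
  fixes a :: real
  assumes a: "a > 0" and k: "k \<ge> 1"
  shows "\<exists>c>0. \<exists>C>0. \<forall>n \<gamma> (M :: 'w measure) X. n \<ge> 2 \<and> \<gamma> > 0 \<and> poisson_hyperplane_process M n \<gamma> (a * real n) X \<longrightarrow>
    ennreal (c * \<gamma> powr (- (real k / a)) * scale (real k / a - real k / 2) (real k / 2 * ln (B_const a)) (- (real k / 2)) n)
      \<le> zero_cell_moment M n X k \<and>
    zero_cell_moment M n X k \<le>
      ennreal (C * \<gamma> powr (- (real k / a)) * scale (real k / a - real k / 2) (real k / 2 * ln (B_const a)) (- (real k / 2)) n)"
proof -
  let ?S = "scale (1 / a - 1 / 2) (1 / 2 * ln (B_const a)) (- (1 / 2))"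
  let ?u = "\<lambda>n. unit_ball_vol (real n) * rate a n powr (- (1 / a))"
  have "?u n > 0" if "n \<ge> 2" for n using radial_integral(3)[OF a that] by (simp add: unit_ball_vol_pos)
  from grows_bounds[OF grows_mean[OF a] this]
  obtain c C where cC: "c > 0" "C > 0" and u: "\<And>n. n \<ge> 2 \<Longrightarrow> c * ?S n \<le> ?u n \<and> ?u n \<le> C * ?S n" by blast
  define d D where "d = (64 * 2 powr a / a) powr (- (1 / a)) * Gamma (1 / a + 1)"
    and "D = real k powr (1 / a) * (4 / (exp 1 * sqrt (2 * pi) * a)) powr (- (1 / a)) * Gamma (1 / a + 1)"
  have "Gamma (1 / a + 1) > 0" using a by (intro Gamma_real_pos) (auto intro: add_pos_pos)
  then have dD: "d > 0" "D > 0" unfolding d_def D_def using a k by (auto intro!: mult_pos_pos)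
  have power: "(e * (\<gamma> powr (- (1 / a)) * (b * ?S n))) ^ k =
      (e * b) ^ k * \<gamma> powr (- (real k / a)) * scale (real k / a - real k / 2) (real k / 2 * ln (B_const a)) (- (real k / 2)) n"
    if "\<gamma> > 0" for e b \<gamma> :: real and n
  proof -
    have "(\<gamma> powr (- (1 / a))) ^ k = \<gamma> powr (- (real k / a))" using that k by (simp add: powr_power)
    moreover have "?S n ^ k = scale (real k / a - real k / 2) (real k / 2 * ln (B_const a)) (- (real k / 2)) n"
      unfolding scale_power by (simp add: algebra_simps)
    ultimately show ?thesis by (simp add: power_mult_distrib mult_ac)
  qed
  show ?thesis
  proof (intro exI conjI allI impI)
    show "(d * c) ^ k > 0" "(D * C) ^ k > 0" using dD cC by auto
    fix n and \<gamma> :: real and M :: "'w measure" and X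
    assume H: "n \<ge> 2 \<and> \<gamma> > 0 \<and> poisson_hyperplane_process M n \<gamma> (a * real n) X"
    interpret hyperplane_process M n \<gamma> "a * real n" X
      by unfold_locales (use H a in auto)
    obtain k' where k': "k = Suc k'" using k by (cases k) auto
    note mb = moment_bounds_rate[OF a refl, of k', folded k', folded d_def D_def]
    have g: "\<gamma> powr (- (1 / a)) > 0" using H by simp
    have "(d * (\<gamma> powr (- (1 / a)) * (c * ?S n))) ^ k \<le> (d * (\<gamma> powr (- (1 / a)) * ?u n)) ^ k"
      using u[of n] H g dD cC by (intro power_mono mult_left_mono mult_nonneg_nonneg) (auto simp: less_imp_le)
    from order_trans[OF ennreal_leI[OF this] mb(1)]
    show "ennreal ((d * c) ^ k * \<gamma> powr (- (real k / a)) * scale (real k / a - real k / 2) (real k / 2 * ln (B_const a)) (- (real k / 2)) n)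
      \<le> zero_cell_moment M n X k" using H by (subst (asm) power) auto
    have "0 \<le> ?u n" by (simp add: unit_ball_vol_nonneg)
    then have "(D * (\<gamma> powr (- (1 / a)) * ?u n)) ^ k \<le> (D * (\<gamma> powr (- (1 / a)) * (C * ?S n))) ^ k"
      using u[of n] H g dD cC by (intro power_mono mult_left_mono mult_nonneg_nonneg) (auto simp: less_imp_le)
    from order_trans[OF mb(2) ennreal_leI[OF this]]
    show "zero_cell_moment M n X k \<le>
      ennreal ((D * C) ^ k * \<gamma> powr (- (real k / a)) * scale (real k / a - real k / 2) (real k / 2 * ln (B_const a)) (- (real k / 2)) n)"
      using H by (subst (asm) power) auto
  qed
qed

lemma variance_asymptotics:
  fixes a :: real
  assumes a: "a > 0"
  shows "\<exists>c>0. \<exists>C>0. \<forall>n \<gamma> (M :: 'w measure) X. n \<ge> 2 \<and> \<gamma> > 0 \<and> poisson_hyperplane_process M n \<gamma> (a * real n) X \<longrightarrow>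
    c * \<gamma> powr (- (2 / a)) * scale (2 / a - 3 / 2) (1 / 2 * ln (var_base a) + ln (B_const a)) (- 1) n \<le> zero_cell_variance M n X \<and>
    zero_cell_variance M n X \<le> C * \<gamma> powr (- (2 / a)) * scale (2 / a - 3 / 2) (1 / 2 * ln (var_base a) + ln (B_const a)) (- 1) n"
proof -
  let ?S = "scale (2 / a - 3 / 2) (1 / 2 * ln (var_base a) + ln (B_const a)) (- 1)"
  let ?v = "\<lambda>n. unit_ball_vol (real n) * min_integral a n / radial_integral a n * rate a n powr (- (2 / a))"
  have "?v n > 0" if "n \<ge> 2" for n
    using radial_integral(1,3)[OF a that] min_integral(4)[OF a that] by (simp add: unit_ball_vol_pos)
  from grows_bounds[OF grows_var[OF a] this]
  obtain c C where cC: "c > 0" "C > 0" and v: "\<And>n. n \<ge> 2 \<Longrightarrow> c * ?S n \<le> ?v n \<and> ?v n \<le> C * ?S n" by blast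
  define d D where "d = exp (- 2) / (2 * 2 powr a) * (64 * 2 powr a / a) powr (- (2 / a))"
    and "D = Gamma (2 / a + 2) * (4 / (exp 1 * sqrt (2 * pi) * a)) powr (- (2 / a))"
  have "2 / a > 0" using a by simp
  then have "Gamma (2 / a + 2) > 0" by (intro Gamma_real_pos) linarith
  then have dD: "d > 0" "D > 0" unfolding d_def D_def using a by (auto intro!: mult_pos_pos)
  show ?thesis
  proof (intro exI conjI allI impI)
    show "d * c > 0" "D * C > 0" using dD cC by auto
    fix n and \<gamma> :: real and M :: "'w measure" and X
    assume H: "n \<ge> 2 \<and> \<gamma> > 0 \<and> poisson_hyperplane_process M n \<gamma> (a * real n) X"
    interpret hyperplane_process M n \<gamma> "a * real n" X
      by unfold_locales (use H a in auto)
    note vb = variance_bounds_rate[OF a refl, folded d_def D_def]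
    have g: "\<gamma> powr (- (2 / a)) > 0" using H by simp
    have "d * (\<gamma> powr (- (2 / a)) * (c * ?S n)) \<le> d * (\<gamma> powr (- (2 / a)) * ?v n)"
      "D * (\<gamma> powr (- (2 / a)) * ?v n) \<le> D * (\<gamma> powr (- (2 / a)) * (C * ?S n))"
      using conjunct1[OF v] conjunct2[OF v] H by (intro mult_left_mono less_imp_le[OF g] less_imp_le[OF dD(1)] less_imp_le[OF dD(2)]; blast)+
    from order_trans[OF this(1) vb(1)] order_trans[OF vb(2) this(2)]
    show "d * c * \<gamma> powr (- (2 / a)) * ?S n \<le> zero_cell_variance M n X"
      "zero_cell_variance M n X \<le> D * C * \<gamma> powr (- (2 / a)) * ?S n"
      by (simp_all only: mult_ac)
  qed
qed

theorem corollary2: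
  fixes a :: real
  assumes "a > 0"
  shows
    "(\<forall>k::nat. k \<ge> 1 \<longrightarrow>
        (\<exists>c>0. \<exists>C>0. \<forall>n::nat. \<forall>\<gamma>::real. \<forall>(M :: 'w measure) X.
          n \<ge> 2 \<and> \<gamma> > 0 \<and> poisson_hyperplane_process M n \<gamma> (a * real n) X \<longrightarrow>
            ennreal (c * \<gamma> powr (- (real k / a)) * real n powr (real k / a - real k / 2) *
              (B_const a / real n) powr (real k * real n / 2))
              \<le> zero_cell_moment M n X k \<and>
            zero_cell_moment M n X k \<le>
            ennreal (C * \<gamma> powr (- (real k / a)) * real n powr (real k / a - real k / 2) *
              (B_const a / real n) powr (real k * real n / 2)))) \<and>
     (\<exists>c>0. \<exists>C>0. \<forall>n::nat. \<forall>\<gamma>::real. \<forall>(M :: 'w measure) X.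
        n \<ge> 2 \<and> \<gamma> > 0 \<and> poisson_hyperplane_process M n \<gamma> (a * real n) X \<longrightarrow>
          c * (4 * (a + 1) powr (a + 1) / (a + 2) powr (a + 2)) powr (real n / 2) *
            \<gamma> powr (- (2 / a)) * real n powr (2 / a - 3 / 2) * (B_const a / real n) ^ n
            \<le> zero_cell_variance M n X \<and>
          zero_cell_variance M n X \<le>
          C * (4 * (a + 1) powr (a + 1) / (a + 2) powr (a + 2)) powr (real n / 2) *
            \<gamma> powr (- (2 / a)) * real n powr (2 / a - 3 / 2) * (B_const a / real n) ^ n) \<and>
     (\<forall>(\<gamma>::real) (M :: nat \<Rightarrow> 'w measure) X.
        \<gamma> > 0 \<and> (\<forall>n\<ge>2. poisson_hyperplane_process (M n) n \<gamma> (a * real n) (X n)) \<longrightarrow>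
          (\<forall>k::nat. k \<ge> 1 \<longrightarrow> (\<lambda>n. zero_cell_moment (M n) n (X n) k) \<longlonglongrightarrow> 0) \<and>
          (\<lambda>n. zero_cell_variance (M n) n (X n)) \<longlonglongrightarrow> 0)"
proof (intro conjI allI impI)
  note a = assms
  have B: "B_const a > 0" by (rule B_const_pos[OF a])
  have D: "var_base a > 0" using a by (simp add: var_base_def)
  have moment_scale: "scale (real k / a - real k / 2) (real k / 2 * ln (B_const a)) (- (real k / 2)) n =
      real n powr (real k / a - real k / 2) * (B_const a / real n) powr (real k * real n / 2)" if "n \<ge> 2" for k n :: nat
    using scale_eq_powr[OF _ B, of n "real k / a - real k / 2" "real k / 2"] that by simp
  have variance_scale: "scale (2 / a - 3 / 2) (1 / 2 * ln (var_base a) + ln (B_const a)) (- 1) n =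
      var_base a powr (real n / 2) * (real n powr (2 / a - 3 / 2) * (B_const a / real n) ^ n)" if n: "n \<ge> 2" for n :: nat
  proof -
    have "scale (2 / a - 3 / 2) (1 / 2 * ln (var_base a) + ln (B_const a)) (- 1) n =
        var_base a powr (real n / 2) * scale (2 / a - 3 / 2) (1 * ln (B_const a)) (- 1) n"
      using D by (simp add: scale_def powr_def exp_add[symmetric] algebra_simps)
    also have "scale (2 / a - 3 / 2) (1 * ln (B_const a)) (- 1) n = real n powr (2 / a - 3 / 2) * (B_const a / real n) powr (1 * real n)"
      using n by (intro scale_eq_powr B) auto
    also have "(B_const a / real n) powr (1 * real n) = (B_const a / real n) ^ n"
      using n B by (simp add: powr_realpow)
    finally show ?thesis .
  qed
  have variance_scale': "c * x * scale (2 / a - 3 / 2) (1 / 2 * ln (var_base a) + ln (B_const a)) (- 1) n =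
      c * var_base a powr (real n / 2) * x * real n powr (2 / a - 3 / 2) * (B_const a / real n) ^ n" if "n \<ge> 2" for n :: nat and c x
    unfolding variance_scale[OF that] by (simp only: mult_ac)
  {
    fix k :: nat assume k: "k \<ge> 1"
    show "\<exists>c>0. \<exists>C>0. \<forall>n::nat. \<forall>\<gamma>::real. \<forall>(M :: 'w measure) X.
          n \<ge> 2 \<and> \<gamma> > 0 \<and> poisson_hyperplane_process M n \<gamma> (a * real n) X \<longrightarrow>
            ennreal (c * \<gamma> powr (- (real k / a)) * real n powr (real k / a - real k / 2) *
              (B_const a / real n) powr (real k * real n / 2))
              \<le> zero_cell_moment M n X k \<and>
            zero_cell_moment M n X k \<le>
            ennreal (C * \<gamma> powr (- (real k / a)) * real n powr (real k / a - real k / 2) *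
              (B_const a / real n) powr (real k * real n / 2))"
      using moment_asymptotics[OF a k, where 'w = 'w] by (simp only: moment_scale mult.assoc cong: conj_cong imp_cong)
  }
  show "\<exists>c>0. \<exists>C>0. \<forall>n::nat. \<forall>\<gamma>::real. \<forall>(M :: 'w measure) X.
        n \<ge> 2 \<and> \<gamma> > 0 \<and> poisson_hyperplane_process M n \<gamma> (a * real n) X \<longrightarrow>
          c * (4 * (a + 1) powr (a + 1) / (a + 2) powr (a + 2)) powr (real n / 2) *
            \<gamma> powr (- (2 / a)) * real n powr (2 / a - 3 / 2) * (B_const a / real n) ^ n
            \<le> zero_cell_variance M n X \<and>
          zero_cell_variance M n X \<le>
          C * (4 * (a + 1) powr (a + 1) / (a + 2) powr (a + 2)) powr (real n / 2) *
            \<gamma> powr (- (2 / a)) * real n powr (2 / a - 3 / 2) * (B_const a / real n) ^ n"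
    using variance_asymptotics[OF a, where 'w = 'w]
    by (simp only: variance_scale' var_base_def[symmetric] cong: conj_cong imp_cong)
next
  note a = assms
  fix \<gamma> :: real and M :: "nat \<Rightarrow> 'w measure" and X and k :: nat
  assume H: "\<gamma> > 0 \<and> (\<forall>n\<ge>2. poisson_hyperplane_process (M n) n \<gamma> (a * real n) (X n))" and k: "k \<ge> 1"
  let ?s = "scale (real k / a - real k / 2) (real k / 2 * ln (B_const a)) (- (real k / 2))"
  obtain C where C: "\<And>n (M :: 'w measure) X. n \<ge> 2 \<and> \<gamma> > 0 \<and> poisson_hyperplane_process M n \<gamma> (a * real n) X \<Longrightarrow>
      zero_cell_moment M n X k \<le> ennreal (C * \<gamma> powr (- (real k / a)) * ?s n)"
    using moment_asymptotics[OF a k, where 'w = 'w] by blast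
  \<comment> \<open>The coefficient \<open>- (real k / 2)\<close> of \<open>n * ln n\<close> is
    negative and outweighs all other terms in the exponent.\<close>
  have "(\<lambda>n. ?s n) \<longlonglongrightarrow> 0" using k by (intro scale_tendsto_0) auto
  then have "(\<lambda>n. C * \<gamma> powr (- (real k / a)) * ?s n) \<longlonglongrightarrow> 0" by (rule tendsto_mult_right_zero)
  then have lim: "(\<lambda>n. ennreal (C * \<gamma> powr (- (real k / a)) * ?s n)) \<longlonglongrightarrow> 0"
    using tendsto_ennrealI ennreal_0 by fastforce
  have ev: "eventually (\<lambda>n. zero_cell_moment (M n) n (X n) k \<le> ennreal (C * \<gamma> powr (- (real k / a)) * ?s n)) sequentially"
    using eventually_ge_at_top[of 2] by eventually_elim (use H in \<open>intro C, auto\<close>)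
  show "(\<lambda>n. zero_cell_moment (M n) n (X n) k) \<longlonglongrightarrow> 0"
    by (rule tendsto_sandwich[OF _ ev tendsto_const lim]) simp
next
  note a = assms
  fix \<gamma> :: real and M :: "nat \<Rightarrow> 'w measure" and X
  assume H: "\<gamma> > 0 \<and> (\<forall>n\<ge>2. poisson_hyperplane_process (M n) n \<gamma> (a * real n) (X n))"
  let ?s = "scale (2 / a - 3 / 2) (1 / 2 * ln (var_base a) + ln (B_const a)) (- 1)"
  obtain c C where C: "c > 0" "\<And>n (M :: 'w measure) X. n \<ge> 2 \<and> \<gamma> > 0 \<and> poisson_hyperplane_process M n \<gamma> (a * real n) X \<Longrightarrow>
      c * \<gamma> powr (- (2 / a)) * ?s n \<le> zero_cell_variance M n X \<and> zero_cell_variance M n X \<le> C * \<gamma> powr (- (2 / a)) * ?s n"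
    using variance_asymptotics[OF a, where 'w = 'w] by blast
  have s: "(\<lambda>n. ?s n) \<longlonglongrightarrow> 0" by (intro scale_tendsto_0) auto
  have b: "eventually (\<lambda>n. c * \<gamma> powr (- (2 / a)) * ?s n \<le> zero_cell_variance (M n) n (X n) \<and>
      zero_cell_variance (M n) n (X n) \<le> C * \<gamma> powr (- (2 / a)) * ?s n) sequentially"
    using eventually_ge_at_top[of 2] by eventually_elim (use H in \<open>intro C(2), auto\<close>)
  show "(\<lambda>n. zero_cell_variance (M n) n (X n)) \<longlonglongrightarrow> 0"
    by (rule tendsto_sandwich[OF eventually_mono[OF b] eventually_mono[OF b] tendsto_mult_right_zero[OF s] tendsto_mult_right_zero[OF s]]) auto
qed

end
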